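(* Let $n,J\ge 1$, let $\delta>0$, and let $g(z,c)=(g_j(z,c))_{j=1}^J$ be a $J$-vector of holomorphic functions on a polydisk $B^{(n)}\times B^{(1)}\subset\mathbb{C}^n\times\mathbb{C}$ centered at the origin. Assume that $$\int_{B^{(n)}} |g(z,0)|^{-\delta}\, dV_1\cdots dV_n<\infty .$$ Then there exists a smaller polydisk $B'^{(n)}\times B'^{(1)}$ centered at the origin such that the function $$c\longmapsto \int_{B'^{(n)}} |g(z,c)|^{-\delta}\, dV_1\cdots dV_n$$ is finite and continuous for $c\in B'^{(1)}$.
   Context: For a $J$-vector $g=(g_j)_{j=1}^J$ of complex numbers or functions, $|g|^2=\sum_{j=1}^J|g_j|^2$. $dV_k$ denotes Lebesgue (area) measure in the $k$-th complex coordinate $z_k$, so $dV_1\cdots dV_n$ is Lebesgue measure on $\mathbb{C}^n$. $B^{(n)}$ denotes an open polydisk in $\mathbb{C}^n$. *)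

theory Defs
  imports "HOL-Analysis.Analysis"
begin

definition polydisk :: "('n::finite \<Rightarrow> real) \<Rightarrow> (complex^'n) set" where
  "polydisk r = {z. \<forall>i. norm (z $ i) < r i}"

definition cmul :: "complex \<Rightarrow> (complex^'n::finite) \<times> complex \<Rightarrow> (complex^'n) \<times> complex" where
  "cmul a p = ((\<chi> i. a * fst p $ i), a * snd p)"

definition holomorphic_several ::
  "((complex^'n::finite) \<times> complex \<Rightarrow> complex) \<Rightarrow> ((complex^'n) \<times> complex) set \<Rightarrow> bool" where
  "holomorphic_several F S \<longleftrightarrow> open S \<and>
     (\<forall>p\<in>S. \<exists>L. (F has_derivative L) (at p) \<and> (\<forall>a v. L (cmul a v) = a * L v))"

definition negpow :: "real \<Rightarrow> real \<Rightarrow> ennreal" where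
  "negpow \<delta> t = (if t = 0 then \<infinity> else ennreal (t powr (-\<delta>)))"

end

theory Submission
 imports Defs "HOL-Complex_Analysis.Cauchy_Integral_Formula"
begin

text \<open>The integral of \<open>|p|\<^sup>-\<^sup>\<delta>\<close> is shown to be stable, with a slightly larger exponent, under uniform perturbation of a
 vector \<open>g\<close> by polynomial vectors \<open>p\<close>, by induction on the number of variables on which they depend (Hiep's argument).
 By Fubini there are slices \<open>z\<^sub>k = w\<close> arbitrarily near the origin on which the integral is at most \<open>\<kappa> / |w|\<^sup>2\<close>, because
 \<open>1 / |w|\<^sup>2\<close> is not integrable in the plane. The induction hypothesis transfers this bound to nearby \<open>p\<close>, and an
 Ohsawa--Takegoshi extension \<open>F\<close> of the constant \<open>1\<close> from that slice has \<open>L\<^sup>2\<close> norm of order \<open>\<surd>\<kappa> / |w|\<close> with respect to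
 the weight \<open>|p|\<^sup>-\<^sup>\<delta>\<close>; by Cauchy's estimate \<open>|F| \<ge> 1/2\<close> near the origin, so \<open>|p|\<^sup>-\<^sup>\<delta>\<close> is integrable there with a uniform
 bound. Approximating \<open>g(\<cdot>, c)\<close> by polynomials and using Fatou's lemma bounds the integrals for all small \<open>c\<close> with an
 exponent larger than \<open>\<delta>\<close>, hence they are uniform limits of integrals of truncated, continuous integrands.\<close>

text \<open>Polynomials are entire, so the weights exp (-2 |z|^2) Q powr (-\<delta>/2) live on all
  of C^n: test functions have compact support, and neither boundary terms nor pseudoconvex domains
  occur. Localisation to a polydisk is simulated by adding high powers of |z_i|/R to |p|^2. The
  obstacle in the induction is that the constant obtained for a slice depends on that slice and is
  uncontrolled, whereas the extension step works only if the slice integral B satisfies C B |w|^2 <=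
  1 with C fixed beforehand. This is why stability asserts a larger exponent: the spare exponent
  multiplies the uncontrolled constant by a small power of a truncation level, so a perturbation at
  most doubles the bound on the slice. The extension theorem uses no unbounded operators: it rests
  on a Riesz argument against \<open>Lop v\<close>, a twisted Bochner inequality for exact forms,
  and interior regularity of weak solutions. C^k classes of small order suffice, so cutoffs are
  powers of max 0 (1 - |x|^2/r^2).\<close>

unbundle no fps_syntax

section \<open>Lebesgue measure under translations, reflections and linear isometries\<close>

lemma nn_integral_lborel_shift:
 fixes f :: "'a::euclidean_space => ennreal"
 assumes [measurable]: "f \<in> borel_measurable borel"
 shows "(\<integral>\<^sup>+x. f (a + x) \<partial>lborel) = (\<integral>\<^sup>+x. f x \<partial>lborel)"
 by (subst (2) lborel_distr_plus[of a, symmetric]) (simp add: nn_integral_distr)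

lemma lborel_distr_uminus_euclidean:
 "distr lborel borel uminus = (lborel :: 'a::euclidean_space measure)"
 by (subst lborel_affine[of "-1" 0]) (auto simp: density_1 one_ennreal_def[symmetric])

lemma nn_integral_lborel_reflect:
 fixes f :: "'a::euclidean_space => ennreal"
 assumes [measurable]: "f \<in> borel_measurable borel"
 shows "(\<integral>\<^sup>+x. f (a - x) \<partial>lborel) = (\<integral>\<^sup>+x. f x \<partial>lborel)"
proof -
 have "(\<integral>\<^sup>+x. f (a - x) \<partial>lborel) = (\<integral>\<^sup>+x. f (a + x) \<partial>lborel)"
  by (subst (2) lborel_distr_uminus_euclidean[symmetric]) (simp add: nn_integral_distr)
 then show ?thesis by (simp add: nn_integral_lborel_shift)
qed

lemma integral_lborel_shift:
 fixes f :: "'a::euclidean_space => 'b::{banach,second_countable_topology}"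
 assumes [measurable]: "f \<in> borel_measurable borel"
 shows "(\<integral>x. f (a + x) \<partial>lborel) = (\<integral>x. f x \<partial>lborel)"
 by (subst (2) lborel_distr_plus[of a, symmetric]) (simp add: integral_distr)

lemma integral_lborel_reflect:
 fixes f :: "'a::euclidean_space => 'b::{banach,second_countable_topology}"
 assumes [measurable]: "f \<in> borel_measurable borel"
 shows "(\<integral>x. f (a - x) \<partial>lborel) = (\<integral>x. f x \<partial>lborel)"
proof -
 have "(\<integral>x. f (a - x) \<partial>lborel) = (\<integral>x. f (a + x) \<partial>lborel)"
  by (subst (2) lborel_distr_uminus_euclidean[symmetric]) (simp add: integral_distr)
 then show ?thesis by (simp add: integral_lborel_shift)
qed

text \<open>Uniqueness of translation-invariant measures, tested against the unit ball, which an
 isometry maps to itself.\<close>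

lemma nn_integral_lborel_isometry:
 fixes T :: "'a::euclidean_space => 'a" and f :: "'a => ennreal"
 assumes "linear T" and iso: "\<And>x. norm (T x) = norm x"
  and [measurable]: "f \<in> borel_measurable borel"
 shows "(\<integral>\<^sup>+x. f (T x) \<partial>lborel) = (\<integral>\<^sup>+x. f x \<partial>lborel)"
proof -
 interpret T: linear T by fact
 have contT: "continuous_on UNIV T"
  by (simp add: assms(1) linear_continuous_on linear_linear)
 then have [measurable]: "T \<in> borel_measurable borel"
  by (rule borel_measurable_continuous_onI)
 have "inj T"
  by (metis iso T.inj_iff_eq_0 norm_eq_zero)
 then have "surj T"
  using assms(1) linear_injective_imp_surjective by blast
 \<comment> \<open>A test set of positive finite measure that \<open>T\<close> preserves. In the
   chain below f (T y) is multiplied by the volume of B, written as an integral over x of the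
   indicator at T y + x; Fubini and the shift of y by a preimage of x then separate f from the
   indicator.\<close>
 define B :: "'a set" where "B = ball 0 1"
 have [measurable]: "B \<in> sets borel" by (simp add: B_def)
 have TB: "indicator B (T y) = (indicator B y :: ennreal)" for y
  by (simp add: B_def indicator_def iso)
 let ?b = "%x. indicator B x :: ennreal"
 have "(\<integral>\<^sup>+y. f (T y) \<partial>lborel) * emeasure lborel B = (\<integral>\<^sup>+y. f (T y) * (\<integral>\<^sup>+x. ?b x \<partial>lborel) \<partial>lborel)"
  by (simp add: nn_integral_multc)
 also have "... = (\<integral>\<^sup>+y. f (T y) * (\<integral>\<^sup>+x. ?b (T y + x) \<partial>lborel) \<partial>lborel)"
  by (subst nn_integral_lborel_shift) auto
 also have "... = (\<integral>\<^sup>+y. \<integral>\<^sup>+x. f (T y) * ?b (T y + x) \<partial>lborel \<partial>lborel)"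
  by (simp add: nn_integral_cmult)
 also have "... = (\<integral>\<^sup>+x. \<integral>\<^sup>+y. f (T y) * ?b (T y + x) \<partial>lborel \<partial>lborel)"
  by (subst lborel_pair.Fubini') auto
 also have "... = (\<integral>\<^sup>+x. \<integral>\<^sup>+y. f (T y - x) * ?b (T y) \<partial>lborel \<partial>lborel)"
 proof (rule nn_integral_cong)
  fix x
  obtain a where a: "T a = x" using \<open>surj T\<close> by (metis surjD)
  have "(\<integral>\<^sup>+y. f (T y) * ?b (T y + x) \<partial>lborel) = (\<integral>\<^sup>+y. f (T (-a + y)) * ?b (T (-a + y) + x) \<partial>lborel)"
   by (rule nn_integral_lborel_shift[symmetric]) auto
  then show "(\<integral>\<^sup>+y. f (T y) * ?b (T y + x) \<partial>lborel) = (\<integral>\<^sup>+y. f (T y - x) * ?b (T y) \<partial>lborel)"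
   by (simp add: T.diff a)
 qed
 also have "... = (\<integral>\<^sup>+y. \<integral>\<^sup>+x. f (T y - x) * ?b (T y) \<partial>lborel \<partial>lborel)"
  by (subst lborel_pair.Fubini') auto
 also have "... = (\<integral>\<^sup>+y. (\<integral>\<^sup>+x. f x \<partial>lborel) * ?b y \<partial>lborel)"
  by (simp add: nn_integral_multc nn_integral_lborel_reflect TB)
 also have "... = (\<integral>\<^sup>+x. f x \<partial>lborel) * emeasure lborel B"
  by (simp add: nn_integral_cmult)
 finally have *: "(\<integral>\<^sup>+y. f (T y) \<partial>lborel) * emeasure lborel B = (\<integral>\<^sup>+x. f x \<partial>lborel) * emeasure lborel B" .
 have "emeasure lborel B ~= 0" "emeasure lborel B ~= \<infinity>"
  unfolding B_def using emeasure_lborel_ball_finite[of "0::'a" 1] content_ball_pos[of 1 "0::'a"]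
  by (auto simp: measure_def)
 then show ?thesis using *
  by (metis ennreal_mult_divide_eq infinity_ennreal_def)
qed

section \<open>Replacing one coordinate, and Fubini in that coordinate\<close>

definition upd :: "complex^'n => 'n => complex => complex^'n" where
 "upd z k w = (\<chi> i. if i = k then w else z $ i)"

lemma upd_nth [simp]: "upd z k w $ i = (if i = k then w else z $ i)"
 by (simp add: upd_def)

lemma upd_upd [simp]: "upd (upd z k v) k w = upd z k w"
 by (simp add: vec_eq_iff)

lemma upd_same [simp]: "upd z k (z $ k) = z"
 by (simp add: vec_eq_iff)

lemma norm_sq_vec: "(norm (z::complex^'n))\<^sup>2 = (\<Sum>i\<in>UNIV. (norm (z $ i))\<^sup>2)"
 by (simp add: norm_vec_def L2_set_def sum_nonneg)

lemma continuous_on_upd [continuous_intros]: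
 fixes f :: "'a::topological_space => complex^'n::finite"
 assumes "continuous_on S f" "continuous_on S h"
 shows "continuous_on S (%x. upd (f x) k (h x))"
 unfolding upd_def
proof (rule continuous_on_vec_lambda)
 show "continuous_on S (%x. if i = k then h x else f x $ i)" for i
  by (cases "i = k") (auto intro!: continuous_intros assms)
qed

lemma borel_measurable_upd [measurable]:
 "(%(z, w). upd z k w) \<in> borel_measurable ((borel :: (complex^'n::finite) measure) \<Otimes>\<^sub>M borel)"
proof -
 have "continuous_on UNIV (%p. upd (fst p) k (snd p) :: complex^'n)"
  by (intro continuous_intros)
 then show ?thesis
  by (simp add: borel_prod borel_measurable_continuous_onI split_beta')
qed

lemma borel_measurable_vec_nth' [measurable]:
 "(%z. z $ k) \<in> borel_measurable (borel :: (complex^'n::finite) measure)"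
 by (intro borel_measurable_continuous_onI continuous_intros)

text \<open>The map (z, w) to (\<open>upd z k w\<close>, z_k) exchanges w with the k-th coordinate,
  so it is a linear isometry of C^n x C and preserves Lebesgue measure. This is Fubini in one
  coordinate without splitting the type \<open>complex^'n\<close>. In applications \<open>b\<close>
  is the indicator of a disk, which keeps the integral over the freed coordinate finite.\<close>

lemma nn_integral_upd:
 fixes f :: "complex^'n::finite => ennreal" and b :: "complex => ennreal"
 assumes [measurable]: "f \<in> borel_measurable borel" "b \<in> borel_measurable borel"
 shows "(\<integral>\<^sup>+z. f z \<partial>lborel) * (\<integral>\<^sup>+w. b w \<partial>lborel)
   = (\<integral>\<^sup>+z. \<integral>\<^sup>+w. f (upd z k w) * b (z $ k) \<partial>lborel \<partial>lborel)"
proof -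
 define T :: "(complex^'n) \<times> complex => (complex^'n) \<times> complex"
  where "T = (%(z, w). (upd z k w, z $ k))"
 have lin: "linear T"
  by (rule linearI) (auto simp: T_def vec_eq_iff split: prod.splits)
 have "(norm (T p))\<^sup>2 = (norm p)\<^sup>2" for p
 proof -
  obtain z w where p: "p = (z, w)" by force
  have "(norm (upd z k w))\<^sup>2 = (norm w)\<^sup>2 + (\<Sum>i\<in>UNIV - {k}. (norm (z $ i))\<^sup>2)"
   unfolding norm_sq_vec by (subst sum.remove[of _ k]) auto
  moreover have "(norm z)\<^sup>2 = (norm (z $ k))\<^sup>2 + (\<Sum>i\<in>UNIV - {k}. (norm (z $ i))\<^sup>2)"
   unfolding norm_sq_vec by (subst sum.remove[of _ k]) auto
  ultimately show ?thesis
   by (simp add: p T_def norm_Pair ac_simps)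
 qed
 then have iso: "norm (T p) = norm p" for p
  by (simp add: power2_eq_iff_nonneg)
 let ?f = "%p::(complex^'n) \<times> complex. f (fst p) * b (snd p)"
 have meas: "?f \<in> borel_measurable borel"
  by (simp add: borel_prod[symmetric])
 have "(\<integral>\<^sup>+z. f z \<partial>lborel) * (\<integral>\<^sup>+w. b w \<partial>lborel) = (\<integral>\<^sup>+z. \<integral>\<^sup>+w. f z * b w \<partial>lborel \<partial>lborel)"
  by (simp add: nn_integral_cmult nn_integral_multc)
 also have "... = (\<integral>\<^sup>+p. ?f p \<partial>(lborel \<Otimes>\<^sub>M lborel))"
  by (subst lborel.nn_integral_fst[symmetric]) auto
 also have "... = (\<integral>\<^sup>+p. ?f (T p) \<partial>(lborel \<Otimes>\<^sub>M lborel))"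
  unfolding lborel_prod by (rule nn_integral_lborel_isometry[OF lin iso meas, symmetric])
 also have "... = (\<integral>\<^sup>+z. \<integral>\<^sup>+w. f (upd z k w) * b (z $ k) \<partial>lborel \<partial>lborel)"
  by (subst lborel.nn_integral_fst[symmetric]) (auto simp: T_def split_beta')
 finally show ?thesis .
qed

section \<open>Partial derivatives and functions of class C^n\<close>

text \<open>Differentiability along e is demanded at every point of the space, so the derivative is
  again a total function and can be iterated; total derivatives never appear in this
  calculus.\<close>

definition has_pd :: "('a::euclidean_space => complex) => 'a => ('a => complex) => bool" where
 "has_pd f e f' \<longleftrightarrow> (\<forall>x. ((%t. f (x + t *\<^sub>R e)) has_vector_derivative f' x) (at 0))"

definition pd :: "'a::euclidean_space => ('a => complex) => 'a => complex" where
 "pd e f x = vector_derivative (%t. f (x + t *\<^sub>R e)) (at 0)"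

lemma pd_eq: "has_pd f e f' ==> pd e f = f'"
 by (auto simp: has_pd_def pd_def fun_eq_iff intro: vector_derivative_at)

lemma has_pd_pd: "has_pd f e f' ==> has_pd f e (pd e f)"
 using pd_eq by metis

lemma has_pd_at:
 assumes "has_pd f e f'"
 shows "((%t. f (x + t *\<^sub>R e)) has_vector_derivative f' (x + s *\<^sub>R e)) (at s)"
proof -
 have "((%t. f ((x + s *\<^sub>R e) + t *\<^sub>R e)) has_vector_derivative f' (x + s *\<^sub>R e)) (at (s - s))"
  using assms by (simp add: has_pd_def)
 moreover have "((%t. t - s) has_vector_derivative 1) (at s)"
  by (auto intro!: derivative_eq_intros)
 ultimately have "((%t. f ((x + s *\<^sub>R e) + t *\<^sub>R e)) \<circ> (%t. t - s) has_vector_derivative 1 *\<^sub>R f' (x + s *\<^sub>R e)) (at s)"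
  by (rule vector_diff_chain_at[rotated])
 then show ?thesis by (simp add: o_def algebra_simps)
qed

lemma has_pd_const: "has_pd (%_. c) e (%_. 0)"
 by (simp add: has_pd_def)

lemma has_pd_add: "has_pd f e f' ==> has_pd g e g' ==> has_pd (%x. f x + g x) e (%x. f' x + g' x)"
 by (auto simp: has_pd_def intro!: derivative_eq_intros)

lemma has_pd_minus: "has_pd f e f' ==> has_pd (%x. - f x) e (%x. - f' x)"
 by (auto simp: has_pd_def intro!: derivative_eq_intros)

lemma has_pd_mult: "has_pd f e f' ==> has_pd g e g' ==> has_pd (%x. f x * g x) e (%x. f' x * g x + f x * g' x)"
 unfolding has_pd_def
proof (intro allI)
 fix x
 assume *: "\<forall>x. ((%t. f (x + t *\<^sub>R e)) has_vector_derivative f' x) (at 0)"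
  "\<forall>x. ((%t. g (x + t *\<^sub>R e)) has_vector_derivative g' x) (at 0)"
 show "((%t. f (x + t *\<^sub>R e) * g (x + t *\<^sub>R e)) has_vector_derivative f' x * g x + f x * g' x) (at 0)"
  using has_vector_derivative_mult[OF *(1)[rule_format, of x] *(2)[rule_format, of x]]
  by (simp add: add.commute)
qed

lemma has_pd_cnj: "has_pd f e f' ==> has_pd (%x. cnj (f x)) e (%x. cnj (f' x))"
 unfolding has_pd_def using bounded_linear.has_vector_derivative[OF bounded_linear_cnj] by blast

lemma has_pd_inverse:
 assumes "has_pd f e f'" "\<And>x. f x ~= 0"
 shows "has_pd (%x. inverse (f x)) e (%x. - f' x * (inverse (f x) * inverse (f x)))"
 unfolding has_pd_def
proof
 fix x
 have "((%t. f (x + t *\<^sub>R e)) has_vector_derivative f' x) (at 0)"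
  using assms by (simp add: has_pd_def)
 moreover have "(inverse has_field_derivative - (inverse (f x) * inverse (f x))) (at (f (x + 0 *\<^sub>R e)))"
  using assms(2)[of x] DERIV_inverse[of "f x" UNIV] by (simp add: power2_eq_square)
 ultimately have "(inverse \<circ> (%t. f (x + t *\<^sub>R e)) has_vector_derivative f' x * - (inverse (f x) * inverse (f x))) (at 0)"
  by (rule field_vector_diff_chain_at)
 then show "((%t. inverse (f (x + t *\<^sub>R e))) has_vector_derivative - f' x * (inverse (f x) * inverse (f x))) (at 0)"
  by (simp add: o_def)
qed

lemma has_pd_reflect:
 assumes "has_pd f e f'"
 shows "has_pd (%x. f (a - x)) e (%x. - f' (a - x))"
 unfolding has_pd_def
proof
 fix x
 have "((%t. f ((a - x) + t *\<^sub>R e)) has_vector_derivative f' (a - x)) (at (- 0))"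
  using assms by (simp add: has_pd_def)
 moreover have "((%t::real. - t) has_vector_derivative - 1) (at 0)"
  by (auto intro!: derivative_eq_intros)
 ultimately have "((%t. f ((a - x) + t *\<^sub>R e)) \<circ> (%t. - t) has_vector_derivative (-1) *\<^sub>R f' (a - x)) (at 0)"
  by (rule vector_diff_chain_at[rotated])
 then show "((%t. f (a - (x + t *\<^sub>R e))) has_vector_derivative - f' (a - x)) (at 0)"
  by (simp add: o_def algebra_simps)
qed

text \<open>The class C^n, in terms of iterated partial derivatives along \<open>Basis\<close>. The
  recursive form turns closure under sums, products, inverses and convolution into inductions on n
  in which the function varies.\<close>

primrec ck :: "nat => ('a::euclidean_space => complex) => bool" where
 "ck 0 f = continuous_on UNIV f"
| "ck (Suc n) f = (continuous_on UNIV f \<and> (\<forall>e\<in>Basis. has_pd f e (pd e f) \<and> ck n (pd e f)))"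

lemma ck_cont: "ck n f ==> continuous_on UNIV f"
 by (cases n) auto

lemma ck_SucI:
 assumes "continuous_on UNIV f" "\<And>e. e \<in> Basis ==> has_pd f e (f' e)" "\<And>e. e \<in> Basis ==> ck n (f' e)"
 shows "ck (Suc n) f"
 using assms pd_eq[OF assms(2)] by simp

lemma ck_has_pd: "ck (Suc n) f ==> e \<in> Basis ==> has_pd f e (pd e f)"
 and ck_pd: "ck (Suc n) f ==> e \<in> Basis ==> ck n (pd e f)"
 by auto

lemma ck_Suc_imp: "ck (Suc n) f ==> ck n f"
proof (induction n arbitrary: f)
 case 0
 then show ?case by simp
next
 case (Suc n)
 then show ?case
  by (intro ck_SucI[where f' = "%e. pd e f"]) (auto simp: ck_cont)
qed

lemma ck_le: "ck n f ==> m <= n ==> ck m f"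
proof (induction n)
 case (Suc n)
 show ?case
 proof (cases "m = Suc n")
  case False
  with Suc show ?thesis by (meson ck_Suc_imp le_SucE)
 qed (use Suc in simp)
qed simp

lemma ck_const: "ck n (%_. c)"
proof (induction n arbitrary: c)
 case (Suc n)
 show ?case by (rule ck_SucI[OF _ has_pd_const]) (auto intro: Suc)
qed auto

lemma ck_add: "ck n f ==> ck n g ==> ck n (%x. f x + g x)"
proof (induction n arbitrary: f g)
 case 0
 then show ?case by (auto intro: continuous_intros)
next
 case (Suc n)
 show ?case
  by (rule ck_SucI[OF _ has_pd_add[OF ck_has_pd ck_has_pd]])
   (use Suc in \<open>auto intro!: continuous_intros simp: ck_cont\<close>)
qed

lemma ck_minus: "ck n f ==> ck n (%x. - f x)"
proof (induction n arbitrary: f)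
 case 0
 then show ?case by (auto intro: continuous_intros)
next
 case (Suc n)
 show ?case
  by (rule ck_SucI[OF _ has_pd_minus[OF ck_has_pd]])
   (use Suc in \<open>auto intro!: continuous_intros simp: ck_cont\<close>)
qed

lemma ck_diff: "ck n f ==> ck n g ==> ck n (%x. f x - g x)"
 using ck_add[OF _ ck_minus, of n f g] by simp

lemma ck_cnj: "ck n f ==> ck n (%x. cnj (f x))"
proof (induction n arbitrary: f)
 case 0
 then show ?case by (auto intro: continuous_intros)
next
 case (Suc n)
 show ?case
  by (rule ck_SucI[OF _ has_pd_cnj[OF ck_has_pd]])
   (use Suc in \<open>auto intro!: continuous_intros simp: ck_cont\<close>)
qed

lemma ck_mult: "ck n f ==> ck n g ==> ck n (%x. f x * g x)"
proof (induction n arbitrary: f g)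
 case 0
 then show ?case by (auto intro: continuous_intros)
next
 case (Suc n)
 have "ck n (%x. pd e f x * g x + f x * pd e g x)" if "e \<in> Basis" for e
  by (intro ck_add Suc.IH ck_pd[OF Suc.prems(1) that] ck_pd[OF Suc.prems(2) that]
    ck_Suc_imp[OF Suc.prems(1)] ck_Suc_imp[OF Suc.prems(2)])
 moreover have "continuous_on UNIV (%x. f x * g x)"
  using Suc.prems by (intro continuous_on_mult ck_cont)
 moreover have "has_pd (%x. f x * g x) e (%x. pd e f x * g x + f x * pd e g x)" if "e \<in> Basis" for e
  using Suc.prems that by (intro has_pd_mult ck_has_pd)
 ultimately show ?case by (intro ck_SucI)
qed

lemma ck_inverse:
 assumes nz: "\<And>x. f x ~= 0"
 shows "ck n f ==> ck n (%x. inverse (f x))"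
proof (induction n)
 case 0
 then show ?case using nz by (auto intro!: continuous_intros)
next
 case (Suc n)
 have "ck n (%x. - pd e f x * (inverse (f x) * inverse (f x)))" if "e \<in> Basis" for e
  using Suc.IH[OF ck_Suc_imp[OF Suc.prems]] ck_pd[OF Suc.prems that] by (intro ck_minus ck_mult)
 moreover have "continuous_on UNIV (%x. inverse (f x))"
  using ck_cont[OF Suc.prems] nz by (intro continuous_on_inverse) auto
 moreover have "has_pd (%x. inverse (f x)) e (%x. - pd e f x * (inverse (f x) * inverse (f x)))" if "e \<in> Basis" for e
  using Suc.prems that nz by (intro has_pd_inverse ck_has_pd)
 ultimately show ?case by (intro ck_SucI)
qed

lemma ck_divide: "ck n f ==> ck n g ==> (\<And>x. g x ~= 0) ==> ck n (%x. f x / g x)"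
 unfolding divide_inverse by (intro ck_mult ck_inverse)

lemma ck_sum: "(\<And>i. i \<in> A ==> ck n (f i)) ==> ck n (%x. \<Sum>i\<in>A. f i x)"
 by (induction A rule: infinite_finite_induct) (auto intro: ck_const ck_add)

lemma ck_power: "ck n f ==> ck n (%x. f x ^ m)"
 by (induction m) (auto intro: ck_const ck_mult)

lemma ck_reflect: "ck n f ==> ck n (%x. f (a - x))"
proof (induction n arbitrary: f)
 case 0
 then have "continuous_on UNIV f" by simp
 then have "continuous_on UNIV (%x. f (a - x))"
  by (rule continuous_on_compose2) (auto intro: continuous_intros)
 then show ?case by simp
next
 case (Suc n)
 then have "continuous_on UNIV f" by (rule_tac ck_cont)
 have "ck n (%x. - pd e f (a - x))" if "e \<in> Basis" for e
  by (intro ck_minus Suc.IH ck_pd[OF Suc.prems that])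
 moreover have "continuous_on UNIV (%x. f (a - x))"
  by (rule continuous_on_compose2[OF \<open>continuous_on UNIV f\<close>]) (auto intro: continuous_intros)
 moreover have "has_pd (%x. f (a - x)) e (%x. - pd e f (a - x))" if "e \<in> Basis" for e
  using Suc.prems that by (intro has_pd_reflect ck_has_pd)
 ultimately show ?case by (intro ck_SucI)
qed

text \<open>The second difference over a square of side t is symmetric in the two directions and
  equals t^2 times a mixed derivative at an intermediate point, for either order of differentiation;
  then t tends to 0. The mean value theorem is real, so real and imaginary parts are treated
  separately through a bounded linear map r.\<close>

lemma pd_commute:
 assumes f: "ck 2 f" and e: "e \<in> Basis" "d \<in> Basis"
 shows "pd e (pd d f) x = pd d (pd e f) x"
proof -
 have ck2: "ck (Suc (Suc 0)) f" using f by (simp add: numeral_2_eq_2)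
 have hf: "has_pd f a (pd a f)" if "a \<in> Basis" for a
  using ck_has_pd[OF ck2 that] .
 have hp: "has_pd (pd a f) b (pd b (pd a f))" if "a \<in> Basis" "b \<in> Basis" for a b
  using ck_has_pd[OF ck_pd[OF ck2]] that by blast
 have ct: "continuous_on UNIV (pd b (pd a f))" if "a \<in> Basis" "b \<in> Basis" for a b
  using ck_pd[OF ck_pd[OF ck2]] that ck_cont by blast
 have key: "\<exists>s1\<in>{0<..<t}. \<exists>t1\<in>{0<..<t}.
   r (f (x + t *\<^sub>R a + t *\<^sub>R b)) - r (f (x + t *\<^sub>R a)) - r (f (x + t *\<^sub>R b)) + r (f x)
    = t * t * r (pd b (pd a f) (x + s1 *\<^sub>R a + t1 *\<^sub>R b))"
  if ab: "a \<in> Basis" "b \<in> Basis" and t: "t > 0" and r: "bounded_linear r"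
  for a b t and r :: "complex => real"
 proof -
  interpret r: bounded_linear r by fact
  have d1: "((%s. r (f (y + s *\<^sub>R a))) has_field_derivative r (pd a f (y + s *\<^sub>R a))) (at s)" for y s
   using r.has_vector_derivative[OF has_pd_at[OF hf[OF ab(1)]]]
   by (simp add: has_real_derivative_iff_has_vector_derivative)
  have d2: "((%s. r (pd a f (y + s *\<^sub>R b))) has_field_derivative r (pd b (pd a f) (y + s *\<^sub>R b))) (at s)" for y s
   using r.has_vector_derivative[OF has_pd_at[OF hp[OF ab]]]
   by (simp add: has_real_derivative_iff_has_vector_derivative)
  have "((%s. r (f ((x + t *\<^sub>R b) + s *\<^sub>R a)) - r (f (x + s *\<^sub>R a))) has_field_derivative
    r (pd a f ((x + t *\<^sub>R b) + s *\<^sub>R a)) - r (pd a f (x + s *\<^sub>R a))) (at s)" for s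
   by (intro DERIV_diff d1)
  then obtain s1 where s1: "0 < s1" "s1 < t"
   "(r (f ((x + t *\<^sub>R b) + t *\<^sub>R a)) - r (f (x + t *\<^sub>R a))) - (r (f ((x + t *\<^sub>R b) + 0 *\<^sub>R a)) - r (f (x + 0 *\<^sub>R a)))
    = (t - 0) * (r (pd a f ((x + t *\<^sub>R b) + s1 *\<^sub>R a)) - r (pd a f (x + s1 *\<^sub>R a)))"
   using MVT2[of 0 t "%s. r (f ((x + t *\<^sub>R b) + s *\<^sub>R a)) - r (f (x + s *\<^sub>R a))"
    "%s. r (pd a f ((x + t *\<^sub>R b) + s *\<^sub>R a)) - r (pd a f (x + s *\<^sub>R a))"] t by blast
  obtain t1 where t1: "0 < t1" "t1 < t"
   "r (pd a f ((x + s1 *\<^sub>R a) + t *\<^sub>R b)) - r (pd a f ((x + s1 *\<^sub>R a) + 0 *\<^sub>R b))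
    = (t - 0) * r (pd b (pd a f) ((x + s1 *\<^sub>R a) + t1 *\<^sub>R b))"
   using MVT2[of 0 t "%s. r (pd a f ((x + s1 *\<^sub>R a) + s *\<^sub>R b))"
     "%s. r (pd b (pd a f) ((x + s1 *\<^sub>R a) + s *\<^sub>R b))"] d2 t by blast
  have "r (f (x + t *\<^sub>R a + t *\<^sub>R b)) - r (f (x + t *\<^sub>R a)) - r (f (x + t *\<^sub>R b)) + r (f x)
    = t * t * r (pd b (pd a f) (x + s1 *\<^sub>R a + t1 *\<^sub>R b))"
   using s1(3) t1(3) by (simp add: algebra_simps)
  with s1(1,2) t1(1,2) show ?thesis
   by (intro bexI[of _ s1] bexI[of _ t1]) auto
 qed
 define \<tau> where "\<tau> = (%m. 1 / real (Suc m))"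
 have \<tau>: "0 < \<tau> m" for m by (simp add: \<tau>_def)
 have \<tau>0: "\<tau> \<longlonglongrightarrow> 0"
  unfolding \<tau>_def using LIMSEQ_inverse_real_of_nat by (simp add: inverse_eq_divide)
 have lim: "(%m. r (pd b (pd a f) (x + s m *\<^sub>R c + t m *\<^sub>R c'))) \<longlonglongrightarrow> r (pd b (pd a f) x)"
  if "a \<in> Basis" "b \<in> Basis" "bounded_linear r" "\<And>m. s m \<in> {0<..<\<tau> m}"
    "\<And>m. t m \<in> {0<..<\<tau> m}" for a b c c' s t and r :: "complex => real"
 proof -
  have "s \<longlonglongrightarrow> 0"
   by (rule tendsto_sandwich[OF _ _ tendsto_const \<tau>0]) (use that(4) in \<open>auto intro!: always_eventually less_imp_le\<close>)
  moreover have "t \<longlonglongrightarrow> 0"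
   by (rule tendsto_sandwich[OF _ _ tendsto_const \<tau>0]) (use that(5) in \<open>auto intro!: always_eventually less_imp_le\<close>)
  ultimately have "(%m. x + s m *\<^sub>R c + t m *\<^sub>R c') \<longlonglongrightarrow> x + 0 *\<^sub>R c + 0 *\<^sub>R c'"
   by (intro tendsto_intros)
  moreover have "isCont (pd b (pd a f)) x"
   using ct[OF that(1,2)] by (simp add: continuous_on_eq_continuous_at)
  ultimately have "(%m. pd b (pd a f) (x + s m *\<^sub>R c + t m *\<^sub>R c')) \<longlonglongrightarrow> pd b (pd a f) x"
   using isCont_tendsto_compose by fastforce
  then show ?thesis
   using bounded_linear.tendsto[OF that(3)] by blast
 qed
 have eq: "r (pd e (pd d f) x) = r (pd d (pd e f) x)" if r: "bounded_linear r" for r :: "complex => real"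
 proof -
  obtain s1 t1 where s: "\<And>m. s1 m \<in> {0<..<\<tau> m}" "\<And>m. t1 m \<in> {0<..<\<tau> m}"
   "\<And>m. r (f (x + \<tau> m *\<^sub>R d + \<tau> m *\<^sub>R e)) - r (f (x + \<tau> m *\<^sub>R d)) - r (f (x + \<tau> m *\<^sub>R e)) + r (f x)
    = \<tau> m * \<tau> m * r (pd e (pd d f) (x + s1 m *\<^sub>R d + t1 m *\<^sub>R e))"
   using key[OF e(2,1) \<tau> r] by metis
  obtain s2 t2 where u: "\<And>m. s2 m \<in> {0<..<\<tau> m}" "\<And>m. t2 m \<in> {0<..<\<tau> m}"
   "\<And>m. r (f (x + \<tau> m *\<^sub>R e + \<tau> m *\<^sub>R d)) - r (f (x + \<tau> m *\<^sub>R e)) - r (f (x + \<tau> m *\<^sub>R d)) + r (f x)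
    = \<tau> m * \<tau> m * r (pd d (pd e f) (x + s2 m *\<^sub>R e + t2 m *\<^sub>R d))"
   using key[OF e \<tau> r] by metis
  have "r (pd e (pd d f) (x + s1 m *\<^sub>R d + t1 m *\<^sub>R e)) = r (pd d (pd e f) (x + s2 m *\<^sub>R e + t2 m *\<^sub>R d))" for m
  proof -
   have "x + \<tau> m *\<^sub>R e + \<tau> m *\<^sub>R d = x + \<tau> m *\<^sub>R d + \<tau> m *\<^sub>R e"
    by (simp add: algebra_simps)
   then have "\<tau> m * \<tau> m * r (pd e (pd d f) (x + s1 m *\<^sub>R d + t1 m *\<^sub>R e))
    = \<tau> m * \<tau> m * r (pd d (pd e f) (x + s2 m *\<^sub>R e + t2 m *\<^sub>R d))"
    using s(3)[of m] u(3)[of m] by (simp only:)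
   then show ?thesis using \<tau>[of m] by simp
  qed
  moreover have "(%m. r (pd e (pd d f) (x + s1 m *\<^sub>R d + t1 m *\<^sub>R e))) \<longlonglongrightarrow> r (pd e (pd d f) x)"
   by (rule lim[OF e(2,1) r s(1,2)])
  moreover have "(%m. r (pd d (pd e f) (x + s2 m *\<^sub>R e + t2 m *\<^sub>R d))) \<longlonglongrightarrow> r (pd d (pd e f) x)"
   by (rule lim[OF e r u(1,2)])
  ultimately show ?thesis using LIMSEQ_unique by auto
 qed
 show ?thesis
  using eq[OF bounded_linear_Re] eq[OF bounded_linear_Im] by (simp add: complex_eq_iff)
qed

section \<open>Compact support and vanishing integrals of derivatives\<close>

definition csupp :: "('a::euclidean_space => 'b::zero) => bool" where
 "csupp f \<longleftrightarrow> (\<exists>R. \<forall>x. R < norm x \<longrightarrow> f x = 0)"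

lemma csupp_mult1: "csupp f ==> csupp (%x. f x * (g x :: 'b::mult_zero))"
 and csupp_mult2: "csupp g ==> csupp (%x. (f x :: 'b::mult_zero) * g x)"
 by (force simp: csupp_def)+

lemma csupp_add: "csupp f ==> csupp g ==> csupp (%x. f x + (g x :: 'b::monoid_add))"
proof -
 assume "csupp f" "csupp g"
 then obtain R S where "\<forall>x. R < norm x \<longrightarrow> f x = 0" "\<forall>x. S < norm x \<longrightarrow> g x = 0"
  by (auto simp: csupp_def)
 then have "\<forall>x. max R S < norm x \<longrightarrow> f x + g x = 0" by auto
 then show ?thesis unfolding csupp_def by blast
qed

lemma csupp_comp: "csupp f ==> h 0 = 0 ==> csupp (%x. h (f x))"
 unfolding csupp_def by metis

lemma csupp_sum: "(\<And>i. i \<in> A ==> csupp (f i)) ==> csupp (%x. \<Sum>i\<in>A. (f i x :: 'b::comm_monoid_add))"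
proof (induction A rule: infinite_finite_induct)
 case (insert a A)
 then show ?case by (simp add: csupp_add)
qed (auto simp: csupp_def)

lemma csupp_reflect:
 assumes "csupp f" shows "csupp (%x. f (a - x))"
proof -
 obtain R where "\<forall>x. R < norm x \<longrightarrow> f x = 0" using assms by (auto simp: csupp_def)
 moreover have "norm x <= norm (a - x) + norm a" for x
  using norm_triangle_ineq[of "x - a" a] by (simp add: norm_minus_commute)
 ultimately have "\<forall>x. R + norm a < norm x \<longrightarrow> f (a - x) = 0"
  by (smt (verit))
 then show ?thesis unfolding csupp_def by blast
qed

lemma csupp_pd:
 assumes "csupp f" shows "csupp (pd e f)"
proof -
 obtain R where R: "\<forall>x. R < norm x \<longrightarrow> f x = 0" using assms by (auto simp: csupp_def)
 have "pd e f x = 0" if "R < norm x" for x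
 proof -
  have "((%t. norm (x + t *\<^sub>R e)) \<longlongrightarrow> norm (x + 0 *\<^sub>R e)) (at (0::real))"
   by (intro tendsto_intros)
  then have "\<forall>\<^sub>F t in at (0::real). R < norm (x + t *\<^sub>R e)"
   using that by (intro order_tendstoD(1)) auto
  then have "\<forall>\<^sub>F t in nhds (0::real). f (x + t *\<^sub>R e) = 0"
   using R that by (auto simp: eventually_nhds_conv_at elim: eventually_mono)
  then have "((%t. f (x + t *\<^sub>R e)) has_vector_derivative 0) (at 0)"
   by (subst has_vector_derivative_cong_ev[where g = "%_. 0"]) (use R that in \<open>auto elim: eventually_mono\<close>)
  then show ?thesis by (simp add: pd_def vector_derivative_at)
 qed
 then show ?thesis by (auto simp: csupp_def)
qed

lemma integrable_csupp:
 fixes f :: "'a::euclidean_space => 'b::{banach,second_countable_topology}"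
 assumes "continuous_on UNIV f" "csupp f"
 shows "integrable lborel f"
proof -
 obtain R where R: "\<And>x. R < norm x ==> f x = 0" using assms by (auto simp: csupp_def)
 have "integrable lborel (%x. indicator (cball 0 R) x *\<^sub>R f x)"
  by (intro borel_integrable_compact) (use assms continuous_on_subset in auto)
 moreover have "(%x. indicator (cball 0 R) x *\<^sub>R f x) = f"
  using R by (auto simp: fun_eq_iff indicator_def not_le)
 ultimately show ?thesis by simp
qed

lemma bounded_csupp:
 fixes f :: "'a::euclidean_space => 'b::real_normed_vector"
 assumes "continuous_on UNIV f" "csupp f"
 obtains M where "M \<ge> 0" "\<And>x. norm (f x) <= M"
proof -
 obtain R where R: "\<And>x. R < norm x ==> f x = 0" using assms by (auto simp: csupp_def)
 have "compact (f ` cball 0 R)"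
  by (intro compact_continuous_image) (use assms continuous_on_subset in auto)
 then obtain M where M: "\<And>x. x \<in> cball 0 R ==> norm (f x) <= M"
  using compact_imp_bounded bounded_iff by (metis imageI)
 then have "norm (f x) <= max M 0" for x
  using R[of x] by (cases "R < norm x") (auto simp: max.coboundedI1)
 then show ?thesis by (intro that[of "max M 0"]) auto
qed

text \<open>Difference quotients have integral 0 by translation invariance, and dominated
  convergence carries this over to the derivative. Every later integration by parts is this fact
  applied to a product.\<close>

lemma integral_pd_eq_0:
 fixes f :: "'a::euclidean_space => complex"
 assumes f: "ck 1 f" "csupp f" and e: "e \<in> Basis"
 shows "(\<integral>x. pd e f x \<partial>lborel) = 0"
proof -
 have h: "has_pd f e (pd e f)" and c: "continuous_on UNIV f" "continuous_on UNIV (pd e f)"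
  using f e by auto
 obtain M where M: "M \<ge> 0" "\<And>x. norm (pd e f x) <= M"
  using bounded_csupp[OF c(2) csupp_pd[OF f(2)]] by blast
 obtain R where R: "\<And>x. R < norm x ==> f x = 0" using f by (auto simp: csupp_def)
 \<comment> \<open>Step lengths at most 1 keep the supports of all quotients in the ball of radius R
   + |e|, which gives a single integrable majorant.\<close>
 define t where "t = (%m. 1 / real (Suc m))"
 have t: "0 < t m" "t m <= 1" for m by (auto simp: t_def)
 have tl: "t \<longlonglongrightarrow> 0"
  unfolding t_def using LIMSEQ_inverse_real_of_nat by (simp add: inverse_eq_divide)
 let ?g = "%m x. (f (x + t m *\<^sub>R e) - f x) /\<^sub>R t m"
 have [measurable]: "f \<in> borel_measurable borel" "pd e f \<in> borel_measurable borel"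
  using c by (auto intro: borel_measurable_continuous_onI)
 have "(%m. \<integral>x. ?g m x \<partial>lborel) \<longlonglongrightarrow> (\<integral>x. pd e f x \<partial>lborel)"
 proof (rule integral_dominated_convergence[where w = "%x. M * indicator (cball (0::'a) (R + norm e)) x"])
  show "AE x in lborel. (%m. ?g m x) \<longlonglongrightarrow> pd e f x"
  proof (rule AE_I2)
   fix x
   have "((%s. f (x + s *\<^sub>R e)) has_vector_derivative pd e f x) (at 0)"
    using h by (auto simp: has_pd_def)
   then have "((%h. norm (f (x + h *\<^sub>R e) - f x - h *\<^sub>R pd e f x) / norm h) \<longlongrightarrow> 0) (at 0)"
    by (simp add: has_vector_derivative_def has_derivative_at)
   moreover have "filterlim t (at 0) sequentially"
    by (rule filterlim_atI[OF tl]) (simp add: t_def)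
   ultimately have *: "(%m. norm (f (x + t m *\<^sub>R e) - f x - t m *\<^sub>R pd e f x) / norm (t m)) \<longlonglongrightarrow> 0"
    by (rule filterlim_compose)
   have "norm (f (x + t m *\<^sub>R e) - f x - t m *\<^sub>R pd e f x) / norm (t m) = norm (?g m x - pd e f x)" for m
   proof -
    have "?g m x - pd e f x = (f (x + t m *\<^sub>R e) - f x - t m *\<^sub>R pd e f x) /\<^sub>R t m"
     using t(1)[of m] by (simp add: scaleR_diff_right)
    then show ?thesis using t(1)[of m] by (simp add: divide_inverse mult.commute)
   qed
   then have "(%m. ?g m x - pd e f x) \<longlonglongrightarrow> 0"
    using * by (simp add: tendsto_norm_zero_iff)
   then show "(%m. ?g m x) \<longlonglongrightarrow> pd e f x"
    using LIM_zero_iff by blast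
  qed
  show "AE x in lborel. norm (?g m x) <= M * indicator (cball (0::'a) (R + norm e)) x" for m
  proof (rule AE_I2)
   fix x
   show "norm (?g m x) <= M * indicator (cball (0::'a) (R + norm e)) x"
   proof (cases "x \<in> cball 0 (R + norm e)")
    case True
    have "\<exists>s\<in>{0<..<t m}. norm (f (x + t m *\<^sub>R e) - f (x + 0 *\<^sub>R e)) <= norm ((t m - 0) *\<^sub>R pd e f (x + s *\<^sub>R e))"
    proof (rule mvt_general[where f = "%s. f (x + s *\<^sub>R e)" and f' = "%s h. h *\<^sub>R pd e f (x + s *\<^sub>R e)"])
     show "continuous_on {0..t m} (%s. f (x + s *\<^sub>R e))"
      using has_vector_derivative_continuous[OF has_pd_at[OF h, of x]]
      by (intro continuous_at_imp_continuous_on) auto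
     show "((%s. f (x + s *\<^sub>R e)) has_derivative (%h. h *\<^sub>R pd e f (x + s *\<^sub>R e))) (at s)" for s
      using has_pd_at[OF h, of x s] by (simp add: has_vector_derivative_def)
    qed (rule t)
    then have "norm (f (x + t m *\<^sub>R e) - f x) <= t m * M"
     using M t[of m] by (auto intro: order_trans mult_left_mono)
    then show ?thesis using True t[of m] by (simp add: divide_simps mult.commute)
   next
    case False
    then have "R + norm e < norm x" by simp
    moreover have "norm (t m *\<^sub>R e) <= norm e" using t[of m] by (simp add: mult_left_le_one_le)
    moreover have "norm x <= norm (x + t m *\<^sub>R e) + norm (t m *\<^sub>R e)"
     by (metis add_diff_cancel_right' norm_triangle_ineq4)
    ultimately have "R < norm (x + t m *\<^sub>R e)" "R < norm x"
     using norm_ge_zero[of e] by linarith+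
    then have "f (x + t m *\<^sub>R e) = 0" "f x = 0"
     by (auto intro: R)
    then show ?thesis using False by simp
   qed
  qed
  show "integrable lborel (%x. M * indicator (cball (0::'a) (R + norm e)) x)"
   using emeasure_lborel_cball_finite[of "0::'a" "R + norm e"]
   by (intro integrable_mult_right integrable_real_indicator) auto
  show "pd e f \<in> borel_measurable lborel" "?g m \<in> borel_measurable lborel" for m
   by measurable
 qed
 moreover have "(\<integral>x. ?g m x \<partial>lborel) = 0" for m
 proof -
  have "integrable lborel f" by (rule integrable_csupp) (use c f in auto)
  moreover have "integrable lborel (%x. f (x + t m *\<^sub>R e))"
  proof (rule integrable_csupp)
   show "continuous_on UNIV (%x. f (x + t m *\<^sub>R e))"
    using c by (auto intro!: continuous_on_compose2[of UNIV f] continuous_intros)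
   have "norm x <= norm (x + t m *\<^sub>R e) + norm (t m *\<^sub>R e)" for x
    by (metis add_diff_cancel_right' norm_triangle_ineq4)
   then have "\<forall>x. R + norm (t m *\<^sub>R e) < norm x \<longrightarrow> f (x + t m *\<^sub>R e) = 0"
    using R by (smt (verit))
   then show "csupp (%x. f (x + t m *\<^sub>R e))" unfolding csupp_def by blast
  qed
  moreover have "(\<integral>x. f (x + t m *\<^sub>R e) \<partial>lborel) = (\<integral>x. f x \<partial>lborel)"
   using integral_lborel_shift[of f "t m *\<^sub>R e"] by (simp add: add.commute)
  ultimately show ?thesis by simp
 qed
 ultimately have "(%m. 0) \<longlonglongrightarrow> (\<integral>x. pd e f x \<partial>lborel)" by (simp only:)
 then show ?thesis by (simp add: LIMSEQ_const_iff)
qed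

section \<open>Wirtinger derivatives\<close>

definition dz :: "'n::finite => (complex^'n => complex) => complex^'n => complex" where
 "dz k f x = (pd (axis k 1) f x - \<i> * pd (axis k \<i>) f x) / 2"

definition dzb :: "'n::finite => (complex^'n => complex) => complex^'n => complex" where
 "dzb k f x = (pd (axis k 1) f x + \<i> * pd (axis k \<i>) f x) / 2"

lemma axis_Basis [simp]: "axis k 1 \<in> (Basis :: (complex^'n::finite) set)" "axis k \<i> \<in> (Basis :: (complex^'n) set)"
 by (simp_all add: axis_in_Basis_iff Basis_complex_def)

lemma ck_dz: "ck (Suc n) f ==> ck n (dz k f)"
 unfolding dz_def[abs_def] by (intro ck_divide ck_diff ck_mult ck_const ck_pd) auto

lemma ck_dzb: "ck (Suc n) f ==> ck n (dzb k f)"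
 unfolding dzb_def[abs_def] by (intro ck_divide ck_add ck_mult ck_const ck_pd) auto

lemma csupp_dz: assumes "csupp f" shows "csupp (dz k f)"
proof -
 have "csupp (%x. pd (axis k 1) f x + (- \<i>) * pd (axis k \<i>) f x)"
  by (intro csupp_add csupp_mult2 csupp_pd assms)
 from csupp_comp[OF this, of "%x. x / 2"] show ?thesis by (simp add: dz_def[abs_def])
qed

lemma csupp_dzb: assumes "csupp f" shows "csupp (dzb k f)"
proof -
 have "csupp (%x. pd (axis k 1) f x + \<i> * pd (axis k \<i>) f x)"
  by (intro csupp_add csupp_mult2 csupp_pd assms)
 from csupp_comp[OF this, of "%x. x / 2"] show ?thesis by (simp add: dzb_def[abs_def])
qed

lemma ck1_has_pd: "ck 1 f ==> e \<in> Basis ==> has_pd f e (pd e f)"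
 by simp

lemma pd_add: "ck 1 f ==> ck 1 g ==> e \<in> Basis ==> pd e (%x. f x + g x) x = pd e f x + pd e g x"
 using pd_eq[OF has_pd_add[OF ck1_has_pd ck1_has_pd]] by metis

lemma pd_minus: "ck 1 f ==> e \<in> Basis ==> pd e (%x. - f x) x = - pd e f x"
 using pd_eq[OF has_pd_minus[OF ck1_has_pd]] by metis

lemma pd_mult: "ck 1 f ==> ck 1 g ==> e \<in> Basis ==> pd e (%x. f x * g x) x = pd e f x * g x + f x * pd e g x"
 using pd_eq[OF has_pd_mult[OF ck1_has_pd ck1_has_pd]] by metis

lemma pd_cnj: "ck 1 f ==> e \<in> Basis ==> pd e (%x. cnj (f x)) x = cnj (pd e f x)"
 using pd_eq[OF has_pd_cnj[OF ck1_has_pd]] by metis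

lemma pd_const [simp]: "pd e (%_. c) x = 0"
 by (simp add: pd_eq[OF has_pd_const])

lemma pd_cmult: "ck 1 f ==> e \<in> Basis ==> pd e (%x. c * f x) x = c * pd e f x"
 using pd_mult[OF ck_const, of f e c x] by (simp del: ck.simps One_nat_def)

lemma pd_cdivide: "ck 1 f ==> e \<in> Basis ==> pd e (%x. f x / c) x = pd e f x / c"
 using pd_cmult[of f e "inverse c" x] by (simp add: divide_inverse mult.commute)

lemma pd_reflect: "ck 1 f ==> e \<in> Basis ==> pd e (%x. f (a - x)) x = - pd e f (a - x)"
 using pd_eq[OF has_pd_reflect[OF ck1_has_pd]] by metis

lemma pd_diff: "ck 1 f ==> ck 1 g ==> e \<in> Basis ==> pd e (%x. f x - g x) x = pd e f x - pd e g x"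
 using pd_add[OF _ ck_minus, of f g e x] by (simp add: pd_minus)

lemma dz_add: "ck 1 f ==> ck 1 g ==> dz k (%x. f x + g x) x = dz k f x + dz k g x"
 and dzb_add: "ck 1 f ==> ck 1 g ==> dzb k (%x. f x + g x) x = dzb k f x + dzb k g x"
 by (simp_all add: dz_def dzb_def pd_add del: ck.simps One_nat_def) (simp_all add: field_simps)

lemma dz_diff: "ck 1 f ==> ck 1 g ==> dz k (%x. f x - g x) x = dz k f x - dz k g x"
 and dzb_diff: "ck 1 f ==> ck 1 g ==> dzb k (%x. f x - g x) x = dzb k f x - dzb k g x"
 by (simp_all add: dz_def dzb_def pd_diff del: ck.simps One_nat_def) (simp_all add: field_simps)

lemma dz_mult: "ck 1 f ==> ck 1 g ==> dz k (%x. f x * g x) x = dz k f x * g x + f x * dz k g x"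
 and dzb_mult: "ck 1 f ==> ck 1 g ==> dzb k (%x. f x * g x) x = dzb k f x * g x + f x * dzb k g x"
 by (simp_all add: dz_def dzb_def pd_mult del: ck.simps One_nat_def) (simp_all add: field_simps)

lemma dz_const [simp]: "dz k (%_. c) x = 0" and dzb_const [simp]: "dzb k (%_. c) x = 0"
 by (simp_all add: dz_def dzb_def)

lemma dz_cnj: "ck 1 f ==> dz k (%x. cnj (f x)) x = cnj (dzb k f x)"
 and dzb_cnj: "ck 1 f ==> dzb k (%x. cnj (f x)) x = cnj (dz k f x)"
 by (simp_all add: dz_def dzb_def pd_cnj del: ck.simps One_nat_def)

lemma dz_sum: "(\<And>i. i \<in> A ==> ck 1 (f i)) ==> dz k (%x. \<Sum>i\<in>A. f i x) x = (\<Sum>i\<in>A. dz k (f i) x)"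
 and dzb_sum: "(\<And>i. i \<in> A ==> ck 1 (f i)) ==> dzb k (%x. \<Sum>i\<in>A. f i x) x = (\<Sum>i\<in>A. dzb k (f i) x)"
 by (induction A rule: infinite_finite_induct)
  (simp_all add: dz_add dzb_add ck_sum del: ck.simps One_nat_def)

lemma dz_reflect: "ck 1 f ==> dz k (%x. f (a - x)) x = - dz k f (a - x)"
 and dzb_reflect: "ck 1 f ==> dzb k (%x. f (a - x)) x = - dzb k f (a - x)"
 by (simp_all add: dz_def dzb_def pd_reflect del: ck.simps One_nat_def) (simp_all add: field_simps)

lemma dz_inverse:
 assumes "ck 1 f" "\<And>x. f x ~= 0"
 shows "dz k (%x. inverse (f x)) x = - dz k f x * (inverse (f x) * inverse (f x))"
  and "dzb k (%x. inverse (f x)) x = - dzb k f x * (inverse (f x) * inverse (f x))"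
proof -
 have "pd e (%x. inverse (f x)) x = - pd e f x * (inverse (f x) * inverse (f x))" if "e \<in> Basis" for e
  using pd_eq[OF has_pd_inverse[OF ck1_has_pd[OF assms(1) that] assms(2)]] by metis
 then show "dz k (%x. inverse (f x)) x = - dz k f x * (inverse (f x) * inverse (f x))"
  "dzb k (%x. inverse (f x)) x = - dzb k f x * (inverse (f x) * inverse (f x))"
  using assms(2)[of x] by (simp_all add: dz_def dzb_def) (simp_all add: field_simps)
qed

lemma dzb_dz_commute: "ck 2 f ==> dzb j (dz k f) x = dz k (dzb j f) x"
 and dzb_dzb_commute: "ck 2 f ==> dzb j (dzb k f) x = dzb k (dzb j f) x"
proof -
 assume f: "ck 2 f"
 then have ck: "ck 1 (pd e f)" if "e \<in> Basis" for e
  using that ck_pd[of 1 f e] by (simp add: numeral_2_eq_2)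
 have 1: "pd e (dz k f) x = (pd e (pd (axis k 1) f) x - \<i> * pd e (pd (axis k \<i>) f) x) / 2"
  "pd e (dzb k f) x = (pd e (pd (axis k 1) f) x + \<i> * pd e (pd (axis k \<i>) f) x) / 2" if "e \<in> Basis" for e k
 proof -
  have "dz k f = (%x. (1/2) * (pd (axis k 1) f x - \<i> * pd (axis k \<i>) f x))"
   "dzb k f = (%x. (1/2) * (pd (axis k 1) f x + \<i> * pd (axis k \<i>) f x))"
   by (simp_all add: dz_def dzb_def fun_eq_iff)
  then show "pd e (dz k f) x = (pd e (pd (axis k 1) f) x - \<i> * pd e (pd (axis k \<i>) f) x) / 2"
   "pd e (dzb k f) x = (pd e (pd (axis k 1) f) x + \<i> * pd e (pd (axis k \<i>) f) x) / 2"
   by (simp_all only:) (simp_all add: pd_cmult pd_cdivide pd_add pd_diff that ck ck_add ck_diff ck_mult ck_const del: ck.simps One_nat_def)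
 qed
 note c = pd_commute[OF f axis_Basis(1) axis_Basis(1)] pd_commute[OF f axis_Basis(1) axis_Basis(2)]
  pd_commute[OF f axis_Basis(2) axis_Basis(1)] pd_commute[OF f axis_Basis(2) axis_Basis(2)]
 show "dzb j (dz k f) x = dz k (dzb j f) x"
  unfolding dz_def[of k "dzb j f"] dzb_def[of j "dz k f"] 1[OF axis_Basis(1)] 1[OF axis_Basis(2)]
  using c(1)[of j k x] c(2)[of j k x] c(3)[of j k x] c(4)[of j k x] by (simp add: field_simps)
 show "dzb j (dzb k f) x = dzb k (dzb j f) x"
  unfolding dzb_def[of k "dzb j f"] dzb_def[of j "dzb k f"] 1[OF axis_Basis(1)] 1[OF axis_Basis(2)]
  using c(1)[of j k x] c(2)[of j k x] c(3)[of j k x] c(4)[of j k x] by (simp add: field_simps)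
qed

lemma integral_dz_eq_0:
 assumes "ck 1 f" "csupp f"
 shows "(\<integral>x. dz k f x \<partial>lborel) = 0" "(\<integral>x. dzb k f x \<partial>lborel) = 0"
proof -
 have i: "integrable lborel (pd e f)" if "e \<in> Basis" for e
  using assms that by (intro integrable_csupp csupp_pd) auto
 show "(\<integral>x. dz k f x \<partial>lborel) = 0" "(\<integral>x. dzb k f x \<partial>lborel) = 0"
  unfolding dz_def dzb_def using i[OF axis_Basis(1)] i[OF axis_Basis(2)]
  by (simp_all add: integral_pd_eq_0 assms del: ck.simps One_nat_def)
qed

section \<open>Plurisubharmonic weights and the twisted Bochner inequality\<close>

text \<open>Here E = exp (-phi), and \<open>ph k\<close> is the derivative of phi in z_k; phi itself
  is not mentioned. Condition \<open>psh\<close> bounds the complex Hessian of phi from below by 2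
  |a_m|^2 for each m; a single component is recorded because the twist will depend on a single
  coordinate.\<close>

locale psh_weight =
 fixes E :: "complex^'n::finite => real" and ph :: "'n => complex^'n => complex"
 assumes E_pos: "E x > 0"
  and E_ck: "ck 1 (%x. complex_of_real (E x))"
  and dzE: "dz k (%x. complex_of_real (E x)) x = - ph k x * E x"
  and ph_ck: "ck 1 (ph k)"
  and psh: "Re (\<Sum>j\<in>UNIV. \<Sum>k\<in>UNIV. a j * cnj (dzb j (ph k) x * a k)) \<ge> 2 * (norm (a m))\<^sup>2"
  and E_int: "integrable lborel E"
begin

text \<open>\<open>D k a\<close> is 1/E times the z_k-derivative of a E, so minus \<open>D k\<close>
  is the formal adjoint of \<open>dzb k\<close> in L^2 with weight E.\<close>

definition D :: "'n => (complex^'n => complex) => complex^'n => complex" where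
 "D k a x = dz k a x - ph k x * a x"

text \<open>The weighted complex Laplacian on functions: the adjoint of dbar applied to dbar v.
  Since test forms are always of the shape dbar v, closedness of forms comes for free.\<close>

definition Lop :: "(complex^'n => complex) => complex^'n => complex" where
 "Lop v x = - (\<Sum>j\<in>UNIV. D j (dzb j v) x)"

lemma ck_D: "ck 2 a ==> ck 1 (D k a)"
 unfolding D_def[abs_def]
 using ck_le[of 2 a 1] ck_dz[of 1 a k] ph_ck[of k]
 by (intro ck_diff ck_mult) (simp_all add: numeral_2_eq_2 del: ck.simps)

lemma ck0_D: "ck 1 a ==> continuous_on UNIV (D k a)"
 unfolding D_def[abs_def] using ck_dz[of 0 a k] ph_ck[of k] ck_cont[of 1 a]
 by (intro continuous_intros) auto

lemma csupp_D: "csupp a ==> csupp (D k a)"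
 using csupp_add[OF csupp_dz[of a k] csupp_mult2[of a "%x. - ph k x"]]
 by (simp add: D_def[abs_def])

lemma dz_mult_E:
 assumes "ck 1 a"
 shows "dz k (%x. a x * E x) x = D k a x * E x"
 using dz_mult[OF assms E_ck, of k x] by (simp add: dzE D_def algebra_simps)

lemma dzb_mult_E:
 assumes "ck 1 a"
 shows "dzb k (%x. cnj (a x) * E x) x = cnj (D k a x) * E x"
proof -
 have "dzb k (%x. cnj (a x * E x)) x = cnj (dz k (%x. a x * E x) x)"
  by (rule dzb_cnj) (intro ck_mult assms E_ck)
 then show ?thesis by (simp add: dz_mult_E assms del: ck.simps One_nat_def)
qed

text \<open>Commuting \<open>dzb j\<close> past \<open>D k\<close> produces the complex Hessian of
  phi; this is the source of the curvature term in the Bochner inequality.\<close>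

lemma dzb_D:
 assumes "ck 2 a"
 shows "dzb j (D k a) x = D k (dzb j a) x - dzb j (ph k) x * a x"
proof -
 have a1: "ck 1 a" and d: "ck 1 (dz k a)"
  using assms ck_dz[of 1 a k] ck_le[of 2 a 1] by (simp_all add: numeral_2_eq_2 del: ck.simps)
 have "dzb j (D k a) x = dzb j (dz k a) x - (dzb j (ph k) x * a x + ph k x * dzb j a x)"
  unfolding D_def[abs_def] using a1 d
  by (simp add: dzb_diff dzb_mult ck_mult ph_ck del: ck.simps One_nat_def)
 then show ?thesis
  by (simp add: D_def dzb_dz_commute[OF assms])
qed

text \<open>The twisted Morrey-Kohn-Hoermander estimate for the exact form with components
  \<open>dzb j v\<close>, obtained by integrating a divergence. Per unit of |dzb_m v|^2 the
  curvature yields 2 \<open>eta\<close>, the twist takes away its mixed second derivative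
  \<open>etamm\<close>, and absorbing the cross term costs 1; what remains is the bound imposed on
  \<open>kk\<close>.\<close>

lemma bochner_inequality:
 fixes eta :: "complex^'n => real"
 assumes v: "ck 3 v" "csupp v"
  and eta: "ck 2 (%x. complex_of_real (eta x))" "\<And>x. eta x \<ge> 0"
   "\<And>j x. j ~= m ==> dz j (%x. complex_of_real (eta x)) x = 0"
   "\<And>x. dz m (dzb m (%x. complex_of_real (eta x))) x = complex_of_real (etamm x)"
  and kk: "continuous_on UNIV kk" "\<And>x. kk x <= 2 * eta x - etamm x - 1"
 shows "(\<integral>x. kk x * (norm (dzb m v x))\<^sup>2 * E x \<partial>lborel)
   <= (\<integral>x. (eta x + (norm (dz m (%x. complex_of_real (eta x)) x))\<^sup>2) * (norm (Lop v x))\<^sup>2 * E x \<partial>lborel)"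
proof -
 let ?e = "%x. complex_of_real (eta x)"
 define al where "al = (%j. dzb j v)"
 have al2: "ck 2 (al j)" for j
  using v(1) ck_dzb[of 2 v j] by (simp add: al_def eval_nat_numeral del: ck.simps)
 have al1: "ck 1 (al j)" for j using al2[of j] ck_le[of 2 "al j" 1] by simp
 have dal1: "ck 1 (dzb j (al k))" for j k
  using al2[of k] ck_dzb[of 1 "al k" j] by (simp add: numeral_2_eq_2 del: ck.simps)
 have e1: "ck 1 ?e" using eta(1) ck_le[of 2 ?e 1] by simp
 have de1: "ck 1 (dzb k ?e)" for k
  using eta(1) ck_dzb[of 1 ?e k] by (simp add: numeral_2_eq_2 del: ck.simps)
 have al_supp: "csupp (al j)" for j unfolding al_def by (intro csupp_dzb v)
 have dzb_e: "dzb j ?e x = cnj (dz j ?e x)" for j x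
  using dzb_cnj[OF e1, of j x] by simp
 \<comment> \<open>\<open>q j k\<close> times E equals dz_j F1 - dzb_k F2 + dz_j F3 with the
   functions below. Two families of terms cancel there: those with D_k (dzb_j al_k), common to F1
   and F2, and those pairing dzb_k eta with dzb_j al_k, common to F2 and F3.\<close>
 define q where "q = (%j k x. ?e x * D j (al j) x * cnj (D k (al k) x) + dz j ?e x * al j x * cnj (D k (al k) x)
   - ?e x * (al j x * cnj (dzb j (ph k) x * al k x)) - ?e x * (dzb k (al j) x * cnj (dzb j (al k) x))
   + dzb k ?e x * D j (al j) x * cnj (al k x) + dz j (dzb k ?e) x * al j x * cnj (al k x))"
 have q0: "integrable lborel (%x. q j k x * E x) \<and> (\<integral>x. q j k x * E x \<partial>lborel) = 0" for j k
 proof -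
  define F1 where "F1 = (%x. (al j x * E x) * (?e x * cnj (D k (al k) x)))"
  define F2 where "F2 = (%x. (?e x * al j x) * (cnj (dzb j (al k) x) * E x))"
  define F3 where "F3 = (%x. (al j x * E x) * (dzb k ?e x * cnj (al k x)))"
  have ckF: "ck 1 F1" "ck 1 F2" "ck 1 F3"
   unfolding F1_def F2_def F3_def
   by (intro ck_mult ck_cnj al1 E_ck e1 ck_D al2 de1 dal1)+
  have supF: "csupp F1" "csupp F2" "csupp F3"
   unfolding F1_def F2_def F3_def using al_supp[of j]
   by (intro csupp_mult1 csupp_mult2; simp)+
  have i: "integrable lborel (dz j F1)" "integrable lborel (dzb k F2)" "integrable lborel (dz j F3)"
   using ckF supF ck_dz[of 0] ck_dzb[of 0] by (auto intro!: integrable_csupp csupp_dz csupp_dzb)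
  have d1: "dz j F1 x = E x * (?e x * D j (al j) x * cnj (D k (al k) x) + dz j ?e x * al j x * cnj (D k (al k) x)
    + ?e x * al j x * cnj (D k (dzb j (al k)) x) - ?e x * (al j x * cnj (dzb j (ph k) x * al k x)))" for x
  proof -
   have "dz j F1 x = D j (al j) x * E x * (?e x * cnj (D k (al k) x))
     + al j x * E x * (dz j ?e x * cnj (D k (al k) x) + ?e x * cnj (D k (dzb j (al k)) x - dzb j (ph k) x * al k x))"
    unfolding F1_def
    by (subst dz_mult) (auto simp del: ck.simps One_nat_def intro!: ck_mult ck_cnj al1 E_ck e1 ck_D al2
      simp: dz_mult_E[OF al1] dz_mult[OF e1 ck_cnj[OF ck_D[OF al2]]] dz_cnj[OF ck_D[OF al2]] dzb_D[OF al2])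
   then show ?thesis by (simp add: algebra_simps)
  qed
  have d2: "dzb k F2 x = E x * (dzb k ?e x * al j x * cnj (dzb j (al k) x) + ?e x * (dzb k (al j) x * cnj (dzb j (al k) x))
    + ?e x * al j x * cnj (D k (dzb j (al k)) x))" for x
  proof -
   have "dzb k F2 x = (dzb k ?e x * al j x + ?e x * dzb k (al j) x) * (cnj (dzb j (al k) x) * E x)
     + (?e x * al j x) * (cnj (D k (dzb j (al k)) x) * E x)"
    unfolding F2_def
    by (subst dzb_mult) (auto simp del: ck.simps One_nat_def intro!: ck_mult ck_cnj al1 E_ck e1 dal1
      simp: dzb_mult_E[OF dal1] dzb_mult[OF e1 al1])
   then show ?thesis by (simp add: algebra_simps)
  qed
  have d3: "dz j F3 x = E x * (dzb k ?e x * D j (al j) x * cnj (al k x) + dz j (dzb k ?e) x * al j x * cnj (al k x)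
    + dzb k ?e x * al j x * cnj (dzb j (al k) x))" for x
  proof -
   have "dz j F3 x = D j (al j) x * E x * (dzb k ?e x * cnj (al k x))
     + al j x * E x * (dz j (dzb k ?e) x * cnj (al k x) + dzb k ?e x * cnj (dzb j (al k) x))"
    unfolding F3_def
    by (subst dz_mult) (auto simp del: ck.simps One_nat_def intro!: ck_mult ck_cnj al1 E_ck de1
      simp: dz_mult_E[OF al1] dz_mult[OF de1 ck_cnj[OF al1]] dz_cnj[OF al1])
   then show ?thesis by (simp add: algebra_simps)
  qed
  have "q j k x * E x = dz j F1 x - dzb k F2 x + dz j F3 x" for x
   unfolding d1 d2 d3 q_def by (simp add: algebra_simps)
  then show ?thesis
   using i integral_dz_eq_0[OF ckF(1) supF(1)] integral_dz_eq_0[OF ckF(2) supF(2)]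
    integral_dz_eq_0[OF ckF(3) supF(3)] by simp
 qed
 define S where "S = (%x. \<Sum>j\<in>UNIV. D j (al j) x)"
 have S_L: "Lop v x = - S x" for x by (simp add: Lop_def S_def al_def)
 define G where "G = (%x. Re (\<Sum>j\<in>UNIV. \<Sum>k\<in>UNIV. q j k x) * E x)"
 have "(%x. (\<Sum>j\<in>UNIV. \<Sum>k\<in>UNIV. q j k x) * complex_of_real (E x)) = (%x. \<Sum>j\<in>UNIV. \<Sum>k\<in>UNIV. q j k x * E x)"
  by (simp add: sum_distrib_right)
 then have Q: "integrable lborel (%x. (\<Sum>j\<in>UNIV. \<Sum>k\<in>UNIV. q j k x) * complex_of_real (E x))"
  "(\<integral>x. (\<Sum>j\<in>UNIV. \<Sum>k\<in>UNIV. q j k x) * complex_of_real (E x) \<partial>lborel) = 0"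
  using q0 by (simp_all add: integral_sum integrable_sum)
 have G_Re: "G = (%x. Re ((\<Sum>j\<in>UNIV. \<Sum>k\<in>UNIV. q j k x) * complex_of_real (E x)))"
  by (simp add: G_def)
 have Gi: "integrable lborel G" and G0: "(\<integral>x. G x \<partial>lborel) = 0"
  unfolding G_Re using integrable_Re[OF Q(1)] integral_Re[OF Q(1)] Q(2) by simp_all
 let ?em = "%x. dz m ?e x"
 have G_le: "G x <= (eta x + (norm (?em x))\<^sup>2) * (norm (Lop v x))\<^sup>2 * E x - kk x * (norm (al m x))\<^sup>2 * E x" for x
 proof -
  define H where "H = (\<Sum>j\<in>UNIV. \<Sum>k\<in>UNIV. al j x * cnj (dzb j (ph k) x * al k x))"
  define B where "B = (\<Sum>j\<in>UNIV. \<Sum>k\<in>UNIV. dzb k (al j) x * cnj (dzb j (al k) x))"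
  have s1: "(\<Sum>j\<in>UNIV. \<Sum>k\<in>UNIV. ?e x * D j (al j) x * cnj (D k (al k) x)) = ?e x * (S x * cnj (S x))"
  proof -
   have "S x * cnj (S x) = (\<Sum>j\<in>UNIV. \<Sum>k\<in>UNIV. D j (al j) x * cnj (D k (al k) x))"
    unfolding S_def cnj_sum by (rule sum_product)
   then show ?thesis by (simp add: sum_distrib_left mult.assoc)
  qed
  have s2: "(\<Sum>j\<in>UNIV. \<Sum>k\<in>UNIV. dz j ?e x * al j x * cnj (D k (al k) x)) = ?em x * al m x * cnj (S x)"
  proof -
   have "(\<Sum>j\<in>UNIV. \<Sum>k\<in>UNIV. dz j ?e x * al j x * cnj (D k (al k) x)) = (\<Sum>j\<in>UNIV. dz j ?e x * al j x * cnj (S x))"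
    by (simp add: S_def sum_distrib_left)
   also have "... = (\<Sum>j\<in>UNIV. if j = m then ?em x * al m x * cnj (S x) else 0)"
    by (rule sum.cong) (auto simp: eta(3))
   finally show ?thesis by simp
  qed
  have s3: "(\<Sum>j\<in>UNIV. \<Sum>k\<in>UNIV. dzb k ?e x * D j (al j) x * cnj (al k x)) = cnj (?em x) * S x * cnj (al m x)"
  proof -
   have "(\<Sum>j\<in>UNIV. \<Sum>k\<in>UNIV. dzb k ?e x * D j (al j) x * cnj (al k x)) = (\<Sum>k\<in>UNIV. dzb k ?e x * S x * cnj (al k x))"
    by (subst sum.swap) (simp add: S_def sum_distrib_left sum_distrib_right mult.assoc)
   also have "... = (\<Sum>k\<in>UNIV. if k = m then cnj (?em x) * S x * cnj (al m x) else 0)"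
    by (rule sum.cong) (auto simp: eta(3) dzb_e)
   finally show ?thesis by simp
  qed
  have z: "dz j (dzb k ?e) x = (if j = m \<and> k = m then etamm x else 0)" for j k
  proof (cases "k = m")
   case True
   show ?thesis
   proof (cases "j = m")
    case False
    have "dz j (dzb m ?e) x = dzb m (dz j ?e) x" using dzb_dz_commute[OF eta(1)] by simp
    also have "dz j ?e = (%_. 0)" using eta(3)[OF False] by auto
    finally show ?thesis using False True by simp
   qed (use True eta(4) in simp)
  next
   case False
   then have "dzb k ?e = (%_. 0)" using eta(3)[OF False] by (auto simp: dzb_e)
   then show ?thesis using False by simp
  qed
  have s4: "(\<Sum>j\<in>UNIV. \<Sum>k\<in>UNIV. dz j (dzb k ?e) x * al j x * cnj (al k x)) = etamm x * (al m x * cnj (al m x))"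
  proof -
   have "(\<Sum>j\<in>UNIV. \<Sum>k\<in>UNIV. dz j (dzb k ?e) x * al j x * cnj (al k x))
     = (\<Sum>j\<in>UNIV. if j = m then (\<Sum>k\<in>UNIV. if k = m then etamm x * (al m x * cnj (al m x)) else 0) else 0)"
   proof (rule sum.cong[OF refl])
    fix j
    have "dz j (dzb k ?e) x * al j x * cnj (al k x) = (if j = m then (if k = m then etamm x * (al m x * cnj (al m x)) else 0) else 0)" for k
     by (simp add: z)
    then show "(\<Sum>k\<in>UNIV. dz j (dzb k ?e) x * al j x * cnj (al k x))
     = (if j = m then (\<Sum>k\<in>UNIV. if k = m then etamm x * (al m x * cnj (al m x)) else 0) else 0)"
     by simp
   qed
   then show ?thesis by simp
  qed
  have Q: "(\<Sum>j\<in>UNIV. \<Sum>k\<in>UNIV. q j k x) = ?e x * (S x * cnj (S x)) + ?em x * al m x * cnj (S x)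
    - ?e x * H - ?e x * B + cnj (?em x) * S x * cnj (al m x) + etamm x * (al m x * cnj (al m x))"
   unfolding q_def sum.distrib sum_subtractf s1 s2 s3 s4 by (simp add: H_def B_def sum_distrib_left)
  \<comment> \<open>The form is exact, hence dzb_j al_k = dzb_k al_j, and B is a sum of
    squares.\<close>
  have Bpos: "Re B \<ge> 0"
  proof -
   have "dzb k (al j) x * cnj (dzb j (al k) x) = complex_of_real ((norm (dzb k (al j) x))\<^sup>2)" for j k
   proof -
    have "ck 2 v" using v(1) ck_le[of 3 v 2] by simp
    then have "dzb j (al k) x = dzb k (al j) x" unfolding al_def by (rule dzb_dzb_commute)
    then show ?thesis using complex_norm_square[of "dzb k (al j) x"] by simp
   qed
   then show ?thesis by (simp add: B_def sum_nonneg)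
  qed
  have Hpos: "Re H \<ge> 2 * (norm (al m x))\<^sup>2" unfolding H_def by (rule psh)
  \<comment> \<open>By 2ab <= a^2 + b^2 the cross term splits in two: one square adds |dz_m eta|^2
    to the weight of |Lop v|^2, the other is the 1 subtracted in the bound for
    \<open>kk\<close>.\<close>
  have cross: "Re (?em x * al m x * cnj (S x)) + Re (cnj (?em x) * S x * cnj (al m x))
    <= (norm (?em x))\<^sup>2 * (norm (S x))\<^sup>2 + (norm (al m x))\<^sup>2"
  proof -
   have "Re (cnj (?em x) * S x * cnj (al m x)) = Re (?em x * al m x * cnj (S x))"
    by (simp add: algebra_simps)
   then have "Re (?em x * al m x * cnj (S x)) + Re (cnj (?em x) * S x * cnj (al m x)) = 2 * Re (?em x * al m x * cnj (S x))"
    by (simp only: mult_2)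
   also have "... <= 2 * norm (?em x * al m x * cnj (S x))"
    by (intro mult_left_mono complex_Re_le_cmod) simp
   also have "... = 2 * (norm (?em x) * norm (S x)) * norm (al m x)" by (simp add: norm_mult)
   also have "... <= (norm (?em x) * norm (S x))\<^sup>2 + (norm (al m x))\<^sup>2"
    using sum_squares_bound by blast
   finally show ?thesis by (simp add: power_mult_distrib)
  qed
  have "Re (\<Sum>j\<in>UNIV. \<Sum>k\<in>UNIV. q j k x) = eta x * (norm (S x))\<^sup>2 + Re (?em x * al m x * cnj (S x))
    - eta x * Re H - eta x * Re B + Re (cnj (?em x) * S x * cnj (al m x)) + etamm x * (norm (al m x))\<^sup>2"
   unfolding Q complex_norm_square[symmetric] by simp
  also have "... <= eta x * (norm (S x))\<^sup>2 + ((norm (?em x))\<^sup>2 * (norm (S x))\<^sup>2 + (norm (al m x))\<^sup>2)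
    - eta x * (2 * (norm (al m x))\<^sup>2) + etamm x * (norm (al m x))\<^sup>2"
   using cross mult_left_mono[OF Hpos eta(2)[of x]] mult_nonneg_nonneg[OF eta(2)[of x] Bpos] by linarith
  also have "... = (eta x + (norm (?em x))\<^sup>2) * (norm (S x))\<^sup>2 - (2 * eta x - etamm x - 1) * (norm (al m x))\<^sup>2"
   by (simp add: algebra_simps)
  also have "... <= (eta x + (norm (?em x))\<^sup>2) * (norm (S x))\<^sup>2 - kk x * (norm (al m x))\<^sup>2"
   using mult_right_mono[OF kk(2)[of x], of "(norm (al m x))\<^sup>2"] by simp
  finally show ?thesis
   using E_pos[of x] unfolding G_def S_L by (simp add: left_diff_distrib[symmetric] mult_right_mono)
 qed
 have Ec: "continuous_on UNIV E"
  using continuous_on_Re[OF ck_cont[OF E_ck]] by simp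
 have ec: "continuous_on UNIV eta"
  using continuous_on_Re[OF ck_cont[OF e1]] by simp
 have emc: "continuous_on UNIV ?em" using ck_dz[of 0 ?e m] e1 by auto
 have alc: "continuous_on UNIV (al m)" using ck_cont[OF al1] .
 have Lc: "continuous_on UNIV (Lop v)"
  unfolding Lop_def[abs_def] using ck0_D[OF al1] by (intro continuous_intros) (auto simp: al_def)
 have Ls: "csupp (Lop v)"
  unfolding Lop_def[abs_def] using csupp_sum[of UNIV "%j. D j (al j)"] csupp_D[OF al_supp]
  by (auto simp: al_def intro!: csupp_comp[where h = uminus])
 have i1: "integrable lborel (%x. (eta x + (norm (?em x))\<^sup>2) * (norm (Lop v x))\<^sup>2 * E x)"
  using csupp_comp[OF Ls, of "%t. (norm t)\<^sup>2"]
  by (intro integrable_csupp continuous_intros ec emc Lc Ec csupp_mult1 csupp_mult2) auto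
 have i2: "integrable lborel (%x. kk x * (norm (al m x))\<^sup>2 * E x)"
  using csupp_comp[OF al_supp[of m], of "%t. (norm t)\<^sup>2"]
  by (intro integrable_csupp continuous_intros kk(1) alc Ec csupp_mult1 csupp_mult2) auto
 have "0 <= (\<integral>x. (eta x + (norm (?em x))\<^sup>2) * (norm (Lop v x))\<^sup>2 * E x - kk x * (norm (al m x))\<^sup>2 * E x \<partial>lborel)"
  using integral_mono[OF Gi Bochner_Integration.integrable_diff[OF i1 i2] G_le] G0 by simp
 then show ?thesis
  unfolding Bochner_Integration.integral_diff[OF i1 i2] by (simp add: al_def)
qed

end

section \<open>Completeness of L^2 and Riesz representation\<close>

lemma borel_measurable_cnj [measurable (raw)]:
 "f \<in> borel_measurable M ==> (%x. cnj (f x)) \<in> borel_measurable M"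
 by (rule borel_measurable_continuous_on[of cnj]) (auto intro: continuous_intros)

lemma le_sqrt_mult: "x\<^sup>2 <= a * b ==> x <= sqrt a * sqrt b"
 by (simp add: real_le_rsqrt real_sqrt_mult[symmetric])

lemma L2_Cauchy_Schwarz:
 fixes f g :: "'a => complex"
 assumes [measurable]: "f \<in> borel_measurable M" "g \<in> borel_measurable M"
  and f: "integrable M (%x. (norm (f x))\<^sup>2)" and g: "integrable M (%x. (norm (g x))\<^sup>2)"
 shows "integrable M (%x. f x * g x)"
  and "norm (\<integral>x. f x * g x \<partial>M) <= sqrt (\<integral>x. (norm (f x))\<^sup>2 \<partial>M) * sqrt (\<integral>x. (norm (g x))\<^sup>2 \<partial>M)"
proof -
 show i: "integrable M (%x. f x * g x)"
 proof (rule Bochner_Integration.integrable_bound[OF Bochner_Integration.integrable_add[OF f g]])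
  have "norm (f x * g x) <= (norm (f x))\<^sup>2 + (norm (g x))\<^sup>2" for x
  proof -
   have "2 * (norm (f x) * norm (g x)) <= (norm (f x))\<^sup>2 + (norm (g x))\<^sup>2" "0 <= norm (f x) * norm (g x)"
    using sum_squares_bound[of "norm (f x)" "norm (g x)"] by (simp_all add: mult.assoc)
   then show ?thesis unfolding norm_mult by linarith
  qed
  then have "norm (f x * g x) <= norm ((norm (f x))\<^sup>2 + (norm (g x))\<^sup>2)" for x
   by simp
  then show "AE x in M. norm (f x * g x) <= norm ((norm (f x))\<^sup>2 + (norm (g x))\<^sup>2)" by simp
 qed measurable
 have nonneg: "0 <= (\<integral>x. (norm (f x))\<^sup>2 \<partial>M)" "0 <= (\<integral>x. (norm (g x))\<^sup>2 \<partial>M)"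
  by (intro integral_nonneg_AE; simp)+
 have ni: "integrable M (%x. norm (f x) * norm (g x))"
  using integrable_norm[OF i] by (simp add: norm_mult)
 have sq: "ennreal (norm z) ^ 2 = ennreal ((norm z)\<^sup>2)" for z :: complex
  by (simp add: ennreal_power)
 have "(\<integral>\<^sup>+x. ennreal (norm (f x)) * ennreal (norm (g x)) \<partial>M)\<^sup>2
   <= (\<integral>\<^sup>+x. ennreal (norm (f x)) ^ 2 \<partial>M) * (\<integral>\<^sup>+x. ennreal (norm (g x)) ^ 2 \<partial>M)"
  by (rule Cauchy_Schwarz_nn_integral) auto
 then have "ennreal ((\<integral>x. norm (f x) * norm (g x) \<partial>M)\<^sup>2)
   <= ennreal ((\<integral>x. (norm (f x))\<^sup>2 \<partial>M) * (\<integral>x. (norm (g x))\<^sup>2 \<partial>M))"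
  unfolding sq using f g ni nonneg
  by (simp add: nn_integral_eq_integral ennreal_mult[symmetric] ennreal_power)
 then have "(\<integral>x. norm (f x) * norm (g x) \<partial>M)\<^sup>2 <= (\<integral>x. (norm (f x))\<^sup>2 \<partial>M) * (\<integral>x. (norm (g x))\<^sup>2 \<partial>M)"
  using nonneg by (simp add: ennreal_le_iff)
 then have "(\<integral>x. norm (f x) * norm (g x) \<partial>M) <= sqrt (\<integral>x. (norm (f x))\<^sup>2 \<partial>M) * sqrt (\<integral>x. (norm (g x))\<^sup>2 \<partial>M)"
  by (rule le_sqrt_mult)
 moreover have "norm (\<integral>x. f x * g x \<partial>M) <= (\<integral>x. norm (f x) * norm (g x) \<partial>M)"
  using integral_norm_bound[of M "%x. f x * g x"] by (simp add: norm_mult)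
 ultimately show "norm (\<integral>x. f x * g x \<partial>M) <= sqrt (\<integral>x. (norm (f x))\<^sup>2 \<partial>M) * sqrt (\<integral>x. (norm (g x))\<^sup>2 \<partial>M)"
  by linarith
qed

text \<open>Weights 2^j against squared distances 4^-j leave a finite integral, so almost everywhere
  |f (j+1) - f j|^2 is O(2^-j) and the telescoping series converges geometrically.\<close>

lemma rapidly_Cauchy_L2_imp_AE_convergent:
 fixes f :: "nat => 'a => complex"
 assumes [measurable]: "\<And>j. f j \<in> borel_measurable M"
  and b: "\<And>j. (\<integral>\<^sup>+x. ennreal ((norm (f (Suc j) x - f j x))\<^sup>2) \<partial>M) <= ennreal ((1/4)^j)"
 obtains U where "U \<in> borel_measurable M" "AE x in M. (%j. f j x) \<longlonglongrightarrow> U x"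
proof -
 have "(\<integral>\<^sup>+x. (\<Sum>j. ennreal (2^j) * ennreal ((norm (f (Suc j) x - f j x))\<^sup>2)) \<partial>M)
   = (\<Sum>j. ennreal (2^j) * (\<integral>\<^sup>+x. ennreal ((norm (f (Suc j) x - f j x))\<^sup>2) \<partial>M))"
  by (simp add: nn_integral_suminf nn_integral_cmult)
 also have "... <= (\<Sum>j. ennreal (2^j) * ennreal ((1/4)^j))"
  by (intro suminf_le mult_left_mono b) auto
 also have "... = (\<Sum>j. ennreal ((1/2)^j))"
  by (simp add: ennreal_mult[symmetric] power_mult_distrib[symmetric])
 also have "... = ennreal (\<Sum>j. (1/2)^j)"
  by (intro suminf_ennreal2) (auto intro: summable_geometric)
 also have "... < \<infinity>" by simp
 finally have fin: "(\<integral>\<^sup>+x. (\<Sum>j. ennreal (2^j) * ennreal ((norm (f (Suc j) x - f j x))\<^sup>2)) \<partial>M) ~= \<infinity>"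
  by simp
 have "AE x in M. (\<Sum>j. ennreal (2^j) * ennreal ((norm (f (Suc j) x - f j x))\<^sup>2)) ~= \<infinity>"
  by (rule nn_integral_PInf_AE[OF _ fin]) measurable
 then have "AE x in M. (%j. f j x) \<longlonglongrightarrow> lim (%j. f j x)"
 proof (rule AE_mp, intro AE_I2 impI)
  fix x
  define a where "a = (%j. ennreal (2^j) * ennreal ((norm (f (Suc j) x - f j x))\<^sup>2))"
  define s where "s = (\<Sum>j. a j)"
  assume "(\<Sum>j. ennreal (2^j) * ennreal ((norm (f (Suc j) x - f j x))\<^sup>2)) ~= \<infinity>"
  then have "s ~= \<infinity>" by (simp only: s_def a_def not_False_eq_True)
  then obtain B where B: "s = ennreal B" "B \<ge> 0"
   by (cases s rule: ennreal_cases) auto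
  have "norm (f (Suc j) x - f j x) <= sqrt B * (sqrt (1/2))^j" for j
  proof -
   have "a j <= s"
    unfolding s_def using sum_le_suminf[of a "{j}"] by simp
   then have "ennreal (2^j * (norm (f (Suc j) x - f j x))\<^sup>2) <= ennreal B"
    by (simp add: a_def B ennreal_mult)
   then have "2^j * (norm (f (Suc j) x - f j x))\<^sup>2 <= B"
    using B by (simp add: ennreal_le_iff)
   then have "(norm (f (Suc j) x - f j x))\<^sup>2 <= B * (1/2)^j"
    by (simp add: field_simps power_divide)
   then have "norm (f (Suc j) x - f j x) <= sqrt (B * (1/2)^j)"
    using real_le_rsqrt by blast
   then show ?thesis by (simp add: real_sqrt_mult real_sqrt_power)
  qed
  moreover have "summable (%j. sqrt B * (sqrt (1/2))^j)"
   by (intro summable_mult summable_geometric) (simp add: real_sqrt_divide)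
  ultimately have "summable (%j. f (Suc j) x - f j x)"
   using summable_comparison_test'[of "%j. sqrt B * (sqrt (1/2))^j" 0 "%j. f (Suc j) x - f j x"] by blast
  then have "convergent (%j. f j x)"
  proof -
   assume "summable (%j. f (Suc j) x - f j x)"
   then have "(%n. \<Sum>j<n. f (Suc j) x - f j x) \<longlonglongrightarrow> (\<Sum>j. f (Suc j) x - f j x)"
    by (rule summable_LIMSEQ)
   then have "(%n. f n x - f 0 x) \<longlonglongrightarrow> (\<Sum>j. f (Suc j) x - f j x)"
    by (simp add: sum_lessThan_telescope[of "%j. f j x"])
   from tendsto_add[OF this tendsto_const[of "f 0 x"]] show ?thesis
    by (simp add: convergentI)
  qed
  then show "(%j. f j x) \<longlonglongrightarrow> lim (%j. f j x)"
   by (simp add: convergent_LIMSEQ_iff)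
 qed
 moreover have "(%x. lim (%j. f j x)) \<in> borel_measurable M"
  by (rule borel_measurable_lim_metric) simp
 ultimately show ?thesis using that by blast
qed

text \<open>Riesz representation for a conjugate-linear functional that is bounded by the
 \<open>L\<^sup>2\<close> norm of a linear map \<open>T\<close>: minimise \<open>\<parallel>T v\<parallel>\<^sup>2 - 2 Re (l v)\<close>.\<close>

lemma L2_representation:
 fixes T :: "'v => 'a => complex" and comb :: "'v => complex => 'v => 'v" and l :: "'v => complex"
 assumes V: "v0 \<in> V" "\<And>v c w. v \<in> V ==> w \<in> V ==> comb v c w \<in> V"
  and Tlin: "\<And>v c w x. v \<in> V ==> w \<in> V ==> T (comb v c w) x = T v x + c * T w x"
  and llin: "\<And>v c w. v \<in> V ==> w \<in> V ==> l (comb v c w) = l v + cnj c * l w"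
  and Tm: "\<And>v. v \<in> V ==> T v \<in> borel_measurable M"
  and T2: "\<And>v. v \<in> V ==> integrable M (%x. (norm (T v x))\<^sup>2)"
  and A: "A \<ge> 0" and bd: "\<And>v. v \<in> V ==> (norm (l v))\<^sup>2 <= A * (\<integral>x. (norm (T v x))\<^sup>2 \<partial>M)"
 obtains U where "U \<in> borel_measurable M" "integrable M (%x. (norm (U x))\<^sup>2)"
  "(\<integral>x. (norm (U x))\<^sup>2 \<partial>M) <= A" "\<And>v. v \<in> V ==> (\<integral>x. U x * cnj (T v x) \<partial>M) = l v"
proof -
 define q where "q = (%v. \<integral>x. (norm (T v x))\<^sup>2 \<partial>M)"
 define b where "b = (%v w. \<integral>x. T v x * cnj (T w x) \<partial>M)"
 define J where "J = (%v. q v - 2 * Re (l v))"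
 have q0: "q v \<ge> 0" for v unfolding q_def by (intro integral_nonneg_AE) simp
 have cT: "(%x. cnj (T v x)) \<in> borel_measurable M" if "v \<in> V" for v
  using Tm[OF that] by measurable
 have bi: "integrable M (%x. T v x * cnj (T w x))" if "v \<in> V" "w \<in> V" for v w
  by (rule L2_Cauchy_Schwarz) (use that Tm cT T2 in auto)
 have sq: "complex_of_real ((norm (a + c * d))\<^sup>2) = (norm a)\<^sup>2 + (cnj c * (a * cnj d)) + cnj (cnj c * (a * cnj d)) + (norm c)\<^sup>2 * (norm d)\<^sup>2"
  for a c d :: complex
  unfolding of_real_power[symmetric] of_real_mult of_real_add complex_norm_square by (simp add: algebra_simps)
 have qcomb: "q (comb v c w) = q v + 2 * Re (cnj c * b v w) + (norm c)\<^sup>2 * q w" if vw: "v \<in> V" "w \<in> V" for v w c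
 proof -
  have pt: "(norm (T (comb v c w) x))\<^sup>2 = (norm (T v x))\<^sup>2 + 2 * Re (cnj c * (T v x * cnj (T w x))) + (norm c)\<^sup>2 * (norm (T w x))\<^sup>2" for x
   using arg_cong[OF sq[of "T v x" c "T w x"], of Re] by (simp add: Tlin[OF vw] algebra_simps)
  have i: "integrable M (%x. cnj c * (T v x * cnj (T w x)))" using bi[OF vw] by simp
  have "(\<integral>x. Re (cnj c * (T v x * cnj (T w x))) \<partial>M) = Re (\<integral>x. cnj c * (T v x * cnj (T w x)) \<partial>M)"
   by (rule integral_Re[OF i])
  also have "... = Re (cnj c * b v w)" unfolding b_def by simp
  finally have r: "(\<integral>x. Re (cnj c * (T v x * cnj (T w x))) \<partial>M) = Re (cnj c * b v w)" .
  have i2: "integrable M (%x. 2 * Re (cnj c * (T v x * cnj (T w x))))"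
   by (intro integrable_mult_right integrable_Re i)
  have i3: "integrable M (%x. (norm c)\<^sup>2 * (norm (T w x))\<^sup>2)"
   by (intro integrable_mult_right T2 vw)
  have "q (comb v c w) = (\<integral>x. (norm (T v x))\<^sup>2 + 2 * Re (cnj c * (T v x * cnj (T w x))) + (norm c)\<^sup>2 * (norm (T w x))\<^sup>2 \<partial>M)"
   unfolding q_def pt ..
  also have "... = (\<integral>x. (norm (T v x))\<^sup>2 \<partial>M) + (\<integral>x. 2 * Re (cnj c * (T v x * cnj (T w x))) \<partial>M) + (\<integral>x. (norm c)\<^sup>2 * (norm (T w x))\<^sup>2 \<partial>M)"
   by (simp only: Bochner_Integration.integral_add[OF Bochner_Integration.integrable_add[OF T2[OF vw(1)] i2] i3]
     Bochner_Integration.integral_add[OF T2[OF vw(1)] i2])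
  finally show ?thesis by (simp only: integral_mult_right_zero r q_def)
 qed
 have Jcomb: "J (comb v c w) = J v + (norm c)\<^sup>2 * q w + 2 * Re (cnj c * (b v w - l w))" if "v \<in> V" "w \<in> V" for v w c
  using that unfolding J_def by (simp add: qcomb llin algebra_simps)
 have Jlow: "J v \<ge> - A" if "v \<in> V" for v
 proof -
  have "(norm (l v))\<^sup>2 <= A * q v" using bd[OF that] by (simp add: q_def)
  then have "norm (l v) <= sqrt A * sqrt (q v)"
   by (rule le_sqrt_mult)
  moreover have "2 * sqrt A * sqrt (q v) <= (sqrt A)\<^sup>2 + (sqrt (q v))\<^sup>2" by (rule sum_squares_bound)
  moreover have "(sqrt A)\<^sup>2 = A" "(sqrt (q v))\<^sup>2 = q v" using A q0 by auto
  moreover have "Re (l v) <= norm (l v)" by (rule complex_Re_le_cmod)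
  ultimately show ?thesis unfolding J_def by linarith
 qed
 define d where "d = Inf (J ` V)"
 have bb: "bdd_below (J ` V)" using Jlow by (auto intro!: bdd_belowI)
 have dle: "d <= J v" if "v \<in> V" for v unfolding d_def using bb that by (intro cInf_lower) auto
 have near: "\<exists>v\<in>V. J v < d + e" if "e > 0" for e
 proof -
  have "Inf (J ` V) < d + e" using that by (simp add: d_def)
  then show ?thesis using cInf_lessD[of "J ` V" "d + e"] V(1) by auto
 qed
 \<comment> \<open>At a near-minimiser v the form b v is close to l: moving v by -t \<beta> w cannot
   bring J below d, and the resulting quadratic inequality in t is used at its optimum t = 1 / q
   w.\<close>
 have beta: "(norm (b v w - l w))\<^sup>2 <= (J v - d) * q w" if vw: "v \<in> V" "w \<in> V" for v w
 proof -
  define \<beta> where "\<beta> = b v w - l w"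
  have key: "0 <= (J v - d) + t\<^sup>2 * (norm \<beta>)\<^sup>2 * q w - 2 * t * (norm \<beta>)\<^sup>2" for t :: real
  proof -
   have "Re (cnj \<beta> * \<beta>) = (norm \<beta>)\<^sup>2"
    using arg_cong[OF complex_norm_square[of \<beta>], of Re] by (simp add: mult.commute)
   moreover have "Re (cnj (- complex_of_real t * \<beta>) * \<beta>) = - t * Re (cnj \<beta> * \<beta>)"
    by (simp add: algebra_simps)
   ultimately have e: "Re (cnj (- complex_of_real t * \<beta>) * \<beta>) = - t * (norm \<beta>)\<^sup>2"
    by (simp only:)
   have "d <= J (comb v (- complex_of_real t * \<beta>) w)" using dle V vw by blast
   then have "d <= J v + (norm (- complex_of_real t * \<beta>))\<^sup>2 * q w + 2 * Re (cnj (- complex_of_real t * \<beta>) * \<beta>)"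
    unfolding Jcomb[OF vw] \<beta>_def[symmetric] .
   then show ?thesis unfolding e by (simp add: norm_mult power_mult_distrib algebra_simps)
  qed
  show ?thesis
  proof (cases "q w = 0")
   case True
   have "\<beta> = 0"
   proof (rule ccontr)
    assume "\<beta> ~= 0"
    then have p: "(norm \<beta>)\<^sup>2 > 0" by simp
    \<comment> \<open>With q w = 0 the inequality is affine in t, and this t makes its right side
      negative.\<close>
    show False using key[of "(J v - d + 1) / (norm \<beta>)\<^sup>2"] p True dle[OF vw(1)] by simp
   qed
   then show ?thesis using True by (simp add: \<beta>_def)
  next
   case False
   then have qp: "q w > 0" using q0[of w] by simp
   have "0 <= (J v - d) + (1 / q w)\<^sup>2 * (norm \<beta>)\<^sup>2 * q w - 2 * (1 / q w) * (norm \<beta>)\<^sup>2" by (rule key)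
   also have "... = (J v - d) - (norm \<beta>)\<^sup>2 / q w" using qp by (simp add: power2_eq_square field_simps)
   finally show ?thesis using qp by (simp add: field_simps \<beta>_def)
  qed
 qed
 \<comment> \<open>If y is the T-distance of two e-near minimisers, the estimates give y^2 <= e + 2
   (sqrt e) y, hence y <= 3 sqrt e; this is the origin of the 9.\<close>
 have close: "q (comb v2 (-1) v1) <= 9 * e" if vv: "v1 \<in> V" "v2 \<in> V" "J v1 <= d + e" "J v2 <= d + e" for v1 v2 e
 proof -
  define w where "w = comb v2 (-1) v1"
  have w: "w \<in> V" using V vv by (simp add: w_def)
  have e: "e \<ge> 0" using dle[OF vv(1)] vv(3) by simp
  have Tw: "T w x = T v2 x - T v1 x" for x using Tlin[OF vv(2,1)] by (simp add: w_def)
  have "J (comb v1 1 w) = J v2"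
  proof -
   have "T (comb v1 1 w) x = T v2 x" for x using Tlin[OF vv(1) w] Tw by simp
   moreover have "l (comb v1 1 w) = l v2" using llin[OF vv(1) w, of 1] llin[OF vv(2,1), of "-1"] by (simp add: w_def)
   ultimately show ?thesis by (simp add: J_def q_def)
  qed
  then have "q w = J v2 - J v1 - 2 * Re (b v1 w - l w)" using Jcomb[OF vv(1) w, of 1] by simp
  moreover have "- Re (b v1 w - l w) <= norm (b v1 w - l w)" using abs_Re_le_cmod[of "b v1 w - l w"] by linarith
  moreover have "norm (b v1 w - l w) <= sqrt e * sqrt (q w)"
  proof -
   have "(norm (b v1 w - l w))\<^sup>2 <= e * q w"
    using order_trans[OF beta[OF vv(1) w] mult_right_mono[of "J v1 - d" e "q w"]] vv(3) q0 by simp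
   then show ?thesis by (rule le_sqrt_mult)
  qed
  moreover have "J v2 - J v1 <= e" using dle[OF vv(1)] vv(4) by simp
  ultimately have "q w <= e + 2 * (sqrt e * sqrt (q w))" by linarith
  moreover have "(sqrt (q w))\<^sup>2 = q w" "(sqrt e)\<^sup>2 = e" using q0 e by auto
  ultimately have "(sqrt (q w))\<^sup>2 <= (sqrt e)\<^sup>2 + 2 * sqrt e * sqrt (q w)" by simp
  then have "(sqrt (q w) - sqrt e)\<^sup>2 <= 2 * (sqrt e)\<^sup>2" by (simp add: power2_eq_square algebra_simps)
  also have "... <= (2 * sqrt e)\<^sup>2" by simp
  finally have "sqrt (q w) - sqrt e <= 2 * sqrt e" by (rule power2_le_imp_le) (use e in simp)
  then have "sqrt (q w) <= 3 * sqrt e" by simp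
  then have "(sqrt (q w))\<^sup>2 <= (3 * sqrt e)\<^sup>2" using q0 by (intro power_mono) auto
  then show ?thesis using q0 e by (simp add: power_mult_distrib w_def)
 qed
 \<comment> \<open>Dividing by 9 offsets the factor in \<open>close\<close>, so that squared
   distances become at most 4^-j.\<close>
 have "\<forall>j. \<exists>v\<in>V. J v < d + (1/4)^j / 9" using near by simp
 then obtain v where vV: "\<And>j. v j \<in> V" and vJ: "\<And>j. J (v j) < d + (1/4)^j / 9" by metis
 have cauchy: "(\<integral>\<^sup>+x. ennreal ((norm (T (v i) x - T (v j) x))\<^sup>2) \<partial>M) <= ennreal ((1/4)^j)" if "j <= i" for i j
 proof -
  have "(1/4::real)^i <= (1/4)^j" using that by (intro power_decreasing) auto
  then have "q (comb (v i) (-1) (v j)) <= 9 * ((1/4)^j / 9)"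
   using vJ[of i] vJ[of j] by (intro close vV) linarith+
  moreover have "(\<integral>\<^sup>+x. ennreal ((norm (T (v i) x - T (v j) x))\<^sup>2) \<partial>M) = ennreal (q (comb (v i) (-1) (v j)))"
  proof -
   have "T (v i) x - T (v j) x = T (comb (v i) (-1) (v j)) x" for x using Tlin[OF vV[of i] vV[of j]] by simp
   then show ?thesis unfolding q_def
    using T2[OF V(2)[OF vV[of i] vV[of j], of "-1"]] by (simp add: nn_integral_eq_integral)
  qed
  ultimately show ?thesis by (simp add: ennreal_leI)
 qed
 obtain U where Um[measurable]: "U \<in> borel_measurable M" and UT: "AE x in M. (%j. T (v j) x) \<longlonglongrightarrow> U x"
 proof (rule rapidly_Cauchy_L2_imp_AE_convergent[of "%j. T (v j)" M])
  show "T (v j) \<in> borel_measurable M" for j by (rule Tm[OF vV])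
  show "(\<integral>\<^sup>+x. ennreal ((norm (T (v (Suc j)) x - T (v j) x))\<^sup>2) \<partial>M) <= ennreal ((1/4)^j)" for j
   by (rule cauchy) simp
 qed
 have Tvm [measurable]: "T (v j) \<in> borel_measurable M" for j using Tm[OF vV] .
 have dist: "(\<integral>\<^sup>+x. ennreal ((norm (U x - T (v j) x))\<^sup>2) \<partial>M) <= ennreal ((1/4)^j)" for j
 proof -
  have "(\<integral>\<^sup>+x. ennreal ((norm (U x - T (v j) x))\<^sup>2) \<partial>M) = (\<integral>\<^sup>+x. liminf (%i. ennreal ((norm (T (v i) x - T (v j) x))\<^sup>2)) \<partial>M)"
  proof (rule nn_integral_cong_AE, rule AE_mp[OF UT], intro AE_I2 impI)
   fix x assume "(%j. T (v j) x) \<longlonglongrightarrow> U x"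
   then have "(%i. ennreal ((norm (T (v i) x - T (v j) x))\<^sup>2)) \<longlonglongrightarrow> ennreal ((norm (U x - T (v j) x))\<^sup>2)"
    by (intro tendsto_ennrealI tendsto_intros)
   from lim_imp_Liminf[OF _ this]
   show "ennreal ((norm (U x - T (v j) x))\<^sup>2) = liminf (%i. ennreal ((norm (T (v i) x - T (v j) x))\<^sup>2))" by simp
  qed
  also have "... <= liminf (%i. \<integral>\<^sup>+x. ennreal ((norm (T (v i) x - T (v j) x))\<^sup>2) \<partial>M)"
   by (rule nn_integral_liminf) measurable
  also have "... <= ennreal ((1/4)^j)"
  proof -
   have "liminf (%i. \<integral>\<^sup>+x. ennreal ((norm (T (v i) x - T (v j) x))\<^sup>2) \<partial>M) <= liminf (%i. ennreal ((1/4)^j))"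
    by (rule Liminf_mono) (use cauchy in \<open>auto simp: eventually_sequentially\<close>)
   then show ?thesis by (simp add: Liminf_const)
  qed
  finally show ?thesis .
 qed
 have Di: "integrable M (%x. (norm (U x - T (v j) x))\<^sup>2)" for j
  using dist[of j] by (intro integrableI_nonneg) (auto intro: le_less_trans)
 have Dle: "(\<integral>x. (norm (U x - T (v j) x))\<^sup>2 \<partial>M) <= (1/4)^j" for j
  using dist[of j] nn_integral_eq_integral[OF Di[of j]] by (simp add: ennreal_le_iff)
 have Ui: "integrable M (%x. (norm (U x))\<^sup>2)"
 proof (rule Bochner_Integration.integrable_bound)
  show "integrable M (%x. 2 * (norm (U x - T (v 0) x))\<^sup>2 + 2 * (norm (T (v 0) x))\<^sup>2)"
   using Di[of 0] T2[OF vV[of 0]] by simp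
  have "(norm (U x))\<^sup>2 <= 2 * (norm (U x - T (v 0) x))\<^sup>2 + 2 * (norm (T (v 0) x))\<^sup>2" for x
  proof -
   have "norm (U x) <= norm (U x - T (v 0) x) + norm (T (v 0) x)"
    using norm_triangle_ineq[of "U x - T (v 0) x" "T (v 0) x"] by simp
   then have "(norm (U x))\<^sup>2 <= (norm (U x - T (v 0) x) + norm (T (v 0) x))\<^sup>2" by (intro power_mono) auto
   also have "... <= 2 * (norm (U x - T (v 0) x))\<^sup>2 + 2 * (norm (T (v 0) x))\<^sup>2"
    using sum_squares_bound[of "norm (U x - T (v 0) x)" "norm (T (v 0) x)"] by (simp add: power2_sum)
   finally show ?thesis .
  qed
  then show "AE x in M. norm ((norm (U x))\<^sup>2) <= norm (2 * (norm (U x - T (v 0) x))\<^sup>2 + 2 * (norm (T (v 0) x))\<^sup>2)"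
   by simp
 qed measurable
 have lim0: "(%j. (1/4::real)^j) \<longlonglongrightarrow> 0" by (rule LIMSEQ_power_zero) simp
 have repr: "(\<integral>x. U x * cnj (T w x) \<partial>M) = l w" if w: "w \<in> V" for w
 proof -
  have 1: "norm ((\<integral>x. U x * cnj (T w x) \<partial>M) - b (v j) w) <= sqrt ((1/4)^j) * sqrt (q w)" for j
  proof -
   have iw: "integrable M (%x. (norm (cnj (T w x)))\<^sup>2)" using T2[OF w] by simp
   have "(\<integral>x. U x * cnj (T w x) \<partial>M) - b (v j) w = (\<integral>x. (U x - T (v j) x) * cnj (T w x) \<partial>M)"
    unfolding b_def left_diff_distrib
    by (rule Bochner_Integration.integral_diff[symmetric])
     (use L2_Cauchy_Schwarz(1)[OF Um cT[OF w] Ui iw] bi[OF vV w] in auto)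
   moreover have "norm (\<integral>x. (U x - T (v j) x) * cnj (T w x) \<partial>M)
     <= sqrt (\<integral>x. (norm (U x - T (v j) x))\<^sup>2 \<partial>M) * sqrt (\<integral>x. (norm (cnj (T w x)))\<^sup>2 \<partial>M)"
    by (rule L2_Cauchy_Schwarz(2)[OF _ cT[OF w] Di iw]) measurable
   moreover have "... <= sqrt ((1/4)^j) * sqrt (q w)"
    using Dle[of j] by (intro mult_mono) (auto simp: q_def)
   ultimately show ?thesis by simp
  qed
  have 2: "norm (b (v j) w - l w) <= sqrt ((1/4)^j) * sqrt (q w)" for j
  proof -
   have "(norm (b (v j) w - l w))\<^sup>2 <= (J (v j) - d) * q w" by (rule beta[OF vV w])
   also have "... <= (1/4)^j * q w"
   proof (rule mult_right_mono[OF _ q0])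
    have "0 <= (1/4::real)^j" by simp
    then show "J (v j) - d <= (1/4)^j" using vJ[of j] by linarith
   qed
   finally show ?thesis by (rule le_sqrt_mult)
  qed
  have "norm ((\<integral>x. U x * cnj (T w x) \<partial>M) - l w) <= 2 * (sqrt ((1/4)^j) * sqrt (q w))" for j
   using 1[of j] 2[of j] norm_triangle_ineq[of "(\<integral>x. U x * cnj (T w x) \<partial>M) - b (v j) w" "b (v j) w - l w"] by simp
  moreover have "(%j. 2 * (sqrt ((1/4)^j) * sqrt (q w))) \<longlonglongrightarrow> 2 * (sqrt 0 * sqrt (q w))"
   by (intro tendsto_intros lim0)
  ultimately have "norm ((\<integral>x. U x * cnj (T w x) \<partial>M) - l w) <= 0"
   by (intro LIMSEQ_le_const[of "%j. 2 * (sqrt ((1/4)^j) * sqrt (q w))"]) auto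
  then show ?thesis by simp
 qed
 define u where "u = (\<integral>x. (norm (U x))\<^sup>2 \<partial>M)"
 have "u <= A + (1/4)^j" for j
 proof -
  have i: "integrable M (%x. U x * cnj (T (v j) x))"
   by (rule L2_Cauchy_Schwarz) (use T2[OF vV] Ui in auto)
  have pt: "(norm (U x - T (v j) x))\<^sup>2 = (norm (U x))\<^sup>2 - 2 * Re (U x * cnj (T (v j) x)) + (norm (T (v j) x))\<^sup>2" for x
   using arg_cong[OF sq[of "U x" "-1" "T (v j) x"], of Re] by simp
  have "(\<integral>x. (norm (U x - T (v j) x))\<^sup>2 \<partial>M) = (\<integral>x. (norm (U x))\<^sup>2 - 2 * Re (U x * cnj (T (v j) x)) \<partial>M) + (\<integral>x. (norm (T (v j) x))\<^sup>2 \<partial>M)"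
   unfolding pt using Ui integrable_Re[OF i] T2[OF vV]
   by (intro Bochner_Integration.integral_add Bochner_Integration.integrable_diff integrable_mult_right)
  also have "(\<integral>x. (norm (U x))\<^sup>2 - 2 * Re (U x * cnj (T (v j) x)) \<partial>M) = u - 2 * Re (l (v j))"
   by (simp only: Bochner_Integration.integral_diff[OF Ui integrable_mult_right[OF integrable_Re[OF i]]]
     integral_mult_right_zero integral_Re[OF i] repr[OF vV] u_def)
  finally have "u - 2 * Re (l (v j)) + q (v j) <= (1/4)^j" using Dle[of j] by (simp add: q_def)
  moreover have "2 * Re (l (v j)) <= A + q (v j)" using Jlow[OF vV, of j] by (simp add: J_def)
  ultimately show ?thesis by linarith
 qed
 moreover have "(%j. A + (1/4::real)^j) \<longlonglongrightarrow> A + 0" by (intro tendsto_intros lim0)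
 ultimately have "u <= A" using LIMSEQ_le_const[of "%j. A + (1/4::real)^j" "A + 0" u] by auto
 then show ?thesis using that[OF Um Ui] repr by (simp add: u_def)
qed

section \<open>Cutoffs and mollifiers of finite smoothness\<close>

lemma DERIV_max0_power:
 "((%s::real. (max 0 s) ^ Suc (Suc n)) has_real_derivative real (Suc (Suc n)) * (max 0 s) ^ Suc n) (at s)"
proof -
 consider "s > 0" | "s < 0" | "s = 0" by linarith
 then show ?thesis
 proof cases
  case 1
  have "((%s::real. s ^ Suc (Suc n)) has_real_derivative real (Suc (Suc n)) * s ^ Suc n) (at s)"
   using DERIV_pow[of "Suc (Suc n)" s] by simp
  then have "((%s::real. (max 0 s) ^ Suc (Suc n)) has_real_derivative real (Suc (Suc n)) * s ^ Suc n) (at s)"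
   by (rule has_field_derivative_transform_within_open[of _ _ _ "{0<..}"]) (use 1 in auto)
  then show ?thesis using 1 by (simp add: max_def)
 next
  case 2
  have "((%s::real. (max 0 s) ^ Suc (Suc n)) has_real_derivative 0) (at s)"
   by (rule has_field_derivative_transform_within_open[of "%_. 0" _ _ "{..<0}"]) (use 2 in auto)
  then show ?thesis using 2 by (simp add: max_def)
 next
  case 3
  have "((%h::real. ((max 0 (0 + h)) ^ Suc (Suc n) - (max 0 0) ^ Suc (Suc n)) / h) \<longlongrightarrow> 0) (at 0)"
  proof (rule Lim_null_comparison)
   show "\<forall>\<^sub>F h in at (0::real). norm (((max 0 (0 + h)) ^ Suc (Suc n) - (max 0 0) ^ Suc (Suc n)) / h) <= \<bar>h\<bar> ^ Suc n"
    by (rule always_eventually) (auto simp: max_def abs_mult power_abs mult_nonpos_nonneg)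
   have "((%h::real. \<bar>h\<bar> ^ Suc n) \<longlongrightarrow> \<bar>0\<bar> ^ Suc n) (at 0)"
    by (intro tendsto_intros)
   then show "((%h::real. \<bar>h\<bar> ^ Suc n) \<longlongrightarrow> 0) (at 0)" by simp
  qed
  then show ?thesis using 3 by (simp add: DERIV_def)
 qed
qed

lemma has_pd_inner: "has_pd (%x. complex_of_real (x \<bullet> b)) e (%_. complex_of_real (e \<bullet> b))"
 unfolding has_pd_def
proof
 fix x
 have "((%t. (x + t *\<^sub>R e) \<bullet> b) has_real_derivative e \<bullet> b) (at 0)"
  by (auto intro!: derivative_eq_intros simp: inner_add_left)
 then show "((%t. complex_of_real ((x + t *\<^sub>R e) \<bullet> b)) has_vector_derivative complex_of_real (e \<bullet> b)) (at 0)"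
  unfolding has_real_derivative_iff_has_vector_derivative
  by (rule bounded_linear.has_vector_derivative[OF bounded_linear_of_real])
qed

lemma ck_inner: "ck n (%x. complex_of_real (x \<bullet> b))"
proof (cases n)
 case (Suc m)
 show ?thesis unfolding Suc
  by (rule ck_SucI[OF _ has_pd_inner]) (auto intro!: continuous_intros ck_const)
qed (auto intro!: continuous_intros)

text \<open>A truncated power of 1 - |x|^2/r^2. It has class C^(n-1), enough for the few derivatives
  that are taken, and its derivatives are explicit.\<close>

definition bump :: "real => nat => 'a::euclidean_space => real" where
 "bump r n x = (max 0 (1 - (x \<bullet> x) / r\<^sup>2)) ^ n"

lemma continuous_on_bump: "continuous_on UNIV (bump r n)"
 unfolding bump_def[abs_def] divide_inverse by (intro continuous_intros)

lemma has_pd_bump: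
 "has_pd (%x. complex_of_real (bump r (Suc (Suc n)) x)) e
   (%x. of_nat (Suc (Suc n)) * complex_of_real (bump r (Suc n) x) * (complex_of_real (x \<bullet> e) * complex_of_real (- 2 / r\<^sup>2)))"
 unfolding has_pd_def
proof
 fix x
 have "((%t. 1 - ((x + t *\<^sub>R e) \<bullet> (x + t *\<^sub>R e)) / r\<^sup>2) has_real_derivative - 2 * (x \<bullet> e) / r\<^sup>2) (at 0)"
 proof -
  have "(%t. 1 - ((x + t *\<^sub>R e) \<bullet> (x + t *\<^sub>R e)) / r\<^sup>2) = (%t. 1 - (x \<bullet> x + t * (2 * (x \<bullet> e)) + t\<^sup>2 * (e \<bullet> e)) / r\<^sup>2)"
   by (auto simp: fun_eq_iff inner_add_left inner_add_right inner_commute power2_eq_square)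
  then show ?thesis
   unfolding divide_inverse by (auto intro!: derivative_eq_intros)
 qed
 from DERIV_chain2[OF DERIV_max0_power this, of n]
 have "((%t. bump r (Suc (Suc n)) (x + t *\<^sub>R e)) has_real_derivative
   real (Suc (Suc n)) * bump r (Suc n) x * ((x \<bullet> e) * (- 2 / r\<^sup>2))) (at 0)"
  by (simp add: bump_def algebra_simps del: power_Suc of_nat_Suc)
 then have "((%t. complex_of_real (bump r (Suc (Suc n)) (x + t *\<^sub>R e))) has_vector_derivative
   complex_of_real (real (Suc (Suc n)) * bump r (Suc n) x * ((x \<bullet> e) * (- 2 / r\<^sup>2)))) (at 0)"
  unfolding has_real_derivative_iff_has_vector_derivative
  by (rule bounded_linear.has_vector_derivative[OF bounded_linear_of_real])
 moreover have "complex_of_real (real (Suc (Suc n)) * bump r (Suc n) x * ((x \<bullet> e) * (- 2 / r\<^sup>2)))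
  = of_nat (Suc (Suc n)) * complex_of_real (bump r (Suc n) x) * (complex_of_real (x \<bullet> e) * complex_of_real (- 2 / r\<^sup>2))"
  by (simp only: of_real_mult of_real_of_nat_eq)
 ultimately show "((%t. complex_of_real (bump r (Suc (Suc n)) (x + t *\<^sub>R e))) has_vector_derivative
   of_nat (Suc (Suc n)) * complex_of_real (bump r (Suc n) x) * (complex_of_real (x \<bullet> e) * complex_of_real (- 2 / r\<^sup>2))) (at 0)"
  by (simp only:)
qed

lemma ck_bump: "ck n (%x::'a::euclidean_space. complex_of_real (bump r (Suc n) x))"
proof (induction n)
 case 0
 then show ?case using continuous_on_bump by (auto intro!: continuous_intros)
next
 case (Suc n)
 show ?case
 proof (rule ck_SucI[OF _ has_pd_bump])
  show "continuous_on UNIV (%x::'a. complex_of_real (bump r (Suc (Suc n)) x))"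
   using continuous_on_bump by (auto intro!: continuous_intros)
  show "ck n (%x. of_nat (Suc (Suc n)) * complex_of_real (bump r (Suc n) x) * (complex_of_real (x \<bullet> e) * complex_of_real (- 2 / r\<^sup>2)))" for e :: 'a
   by (intro ck_mult ck_const Suc ck_inner)
 qed
qed

lemma bump_nonneg: "bump r n x \<ge> 0"
 by (simp add: bump_def)

lemma bump_le_1: "bump r n x <= 1"
 unfolding bump_def by (intro power_le_one) auto

lemma bump_eq_0: "r > 0 ==> norm x \<ge> r ==> bump r (Suc n) x = 0"
proof -
 assume "r > 0" "norm x \<ge> r"
 then have "r\<^sup>2 <= x \<bullet> x" by (metis dot_square_norm less_imp_le power_mono)
 then show ?thesis using \<open>r > 0\<close> by (simp add: bump_def max_def field_simps)
qed

lemma csupp_bump: "r > 0 ==> csupp (bump r (Suc n))"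
 unfolding csupp_def using bump_eq_0 by (metis less_imp_le)

lemma integral_bump_pos:
 assumes "r > 0" shows "(\<integral>x. bump r (Suc n) (x::'a::euclidean_space) \<partial>lborel) > 0"
proof -
 have c: "continuous_on UNIV (bump r (Suc n) :: 'a => real)" by (rule continuous_on_bump)
 have i: "integrable lborel (bump r (Suc n) :: 'a => real)"
  by (rule integrable_csupp[OF c csupp_bump[OF assms]])
 have "(\<integral>x. indicator (ball (0::'a) (r/2)) x * (3/4::real) ^ Suc n \<partial>lborel) <= (\<integral>x. bump r (Suc n) (x::'a) \<partial>lborel)"
 proof (rule integral_mono[OF _ i])
  show "integrable lborel (%x. indicator (ball (0::'a) (r/2)) x * (3/4::real) ^ Suc n)"
   using emeasure_lborel_ball_finite[of "0::'a" "r/2"] by (intro integrable_mult_left integrable_real_indicator) auto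
  fix x :: 'a
  show "indicator (ball (0::'a) (r/2)) x * (3/4::real) ^ Suc n <= bump r (Suc n) x"
  proof (cases "norm x < r/2")
   case True
   then have "(norm x)\<^sup>2 <= (r/2)\<^sup>2" by (intro power_mono) auto
   then have "3/4 <= 1 - (x \<bullet> x) / r\<^sup>2" using assms by (simp add: dot_square_norm power_divide field_simps)
   then have "3/4 <= max 0 (1 - (x \<bullet> x) / r\<^sup>2)" by (rule order_trans[OF _ max.cobounded2])
   then have "(3/4) ^ Suc n <= bump r (Suc n) x" unfolding bump_def by (rule power_mono) simp
   then show ?thesis using True by simp
  qed (simp add: bump_nonneg)
 qed
 moreover have "(\<integral>x. indicator (ball (0::'a) (r/2)) x * (3/4::real) ^ Suc n \<partial>lborel) > 0"
  using content_ball_pos[of "r/2" "0::'a"] assms by simp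
 ultimately show ?thesis by linarith
qed

text \<open>The exponent 4 gives class C^3, the regularity required of test functions for
  \<open>Lop\<close>; mollifiers are themselves used as such test functions.\<close>

definition mol :: "real => 'a::euclidean_space => real" where
 "mol r x = bump r 4 x / (\<integral>y. bump r 4 (y::'a) \<partial>lborel)"

lemma
 fixes x :: "'a::euclidean_space"
 assumes "r > 0"
 shows mol_nonneg: "mol r x \<ge> 0"
  and mol_even: "mol r (- x) = mol r x"
  and mol_eq_0: "norm x \<ge> r ==> mol r x = 0"
  and continuous_on_mol: "continuous_on UNIV (mol r :: 'a => real)"
  and csupp_mol: "csupp (mol r :: 'a => real)"
  and ck_mol: "ck 3 (%x::'a. complex_of_real (mol r x))"
  and integrable_mol: "integrable lborel (mol r :: 'a => real)"
  and integral_mol: "(\<integral>x. mol r (x::'a) \<partial>lborel) = 1"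
proof -
 let ?I = "\<integral>y. bump r 4 (y::'a) \<partial>lborel"
 have I: "?I > 0" using integral_bump_pos[OF assms, of 3] by (simp add: eval_nat_numeral)
 show "mol r x \<ge> 0" using bump_nonneg[of r 4 x] I by (simp add: mol_def)
 show "mol r (- x) = mol r x" by (simp add: mol_def bump_def)
 show 0: "norm x \<ge> r ==> mol r x = 0" for x :: 'a using bump_eq_0[OF assms, of x 3] by (simp add: mol_def eval_nat_numeral)
 show c: "continuous_on UNIV (mol r :: 'a => real)"
  unfolding mol_def[abs_def] using continuous_on_bump I by (intro continuous_intros) auto
 show s: "csupp (mol r :: 'a => real)" unfolding csupp_def using 0 by (metis less_imp_le)
 have "(%x. complex_of_real (mol r (x::'a))) = (%x. complex_of_real (bump r (Suc 3) x) * complex_of_real (1 / ?I))"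
  by (simp add: mol_def fun_eq_iff eval_nat_numeral)
 then show "ck 3 (%x. complex_of_real (mol r (x::'a)))"
  using ck_mult[OF ck_bump[of 3 r] ck_const] by metis
 show "integrable lborel (mol r :: 'a => real)" by (rule integrable_csupp[OF c s])
 show "(\<integral>x. mol r (x::'a) \<partial>lborel) = 1" using I by (simp add: mol_def)
qed

section \<open>Convolution with mollifiers\<close>

definition locint :: "('a::euclidean_space => complex) => bool" where
 "locint f \<longleftrightarrow> f \<in> borel_measurable borel \<and> (\<forall>R. integrable lborel (%x. indicator (cball 0 R) x * norm (f x)))"

definition conv :: "('a::euclidean_space => complex) => ('a => complex) => 'a => complex" where
 "conv f k y = (\<integral>x. f x * k (y - x) \<partial>lborel)"

lemma locint_integrable:
 assumes f: "locint f" and g: "g \<in> borel_measurable borel" "\<And>x. norm (g x) <= M * indicator (cball 0 R) x"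
 shows "integrable lborel (%x. f x * g x)"
proof (rule Bochner_Integration.integrable_bound)
 show "integrable lborel (%x. M * (indicator (cball 0 R) x * norm (f x)))"
  using f by (simp add: locint_def)
 have [measurable]: "f \<in> borel_measurable borel" using f by (simp add: locint_def)
 note g(1)[measurable]
 show "(%x. f x * g x) \<in> borel_measurable lborel" by measurable
 have "norm (f x * g x) <= norm (M * (indicator (cball 0 R) x * norm (f x)))" for x
 proof -
  have "norm (f x * g x) = norm (f x) * norm (g x)" by (rule norm_mult)
  also have "... <= norm (f x) * (M * indicator (cball 0 R) x)" by (intro mult_left_mono g) simp
  also have "... <= norm (M * (indicator (cball 0 R) x * norm (f x)))" by (simp add: ac_simps)
  finally show ?thesis .
 qed
 then show "AE x in lborel. norm (f x * g x) <= norm (M * (indicator (cball 0 R) x * norm (f x)))" by simp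
qed

lemma locint_tendsto:
 assumes f: "locint f" and g: "\<And>m. g m \<in> borel_measurable borel" "\<And>m x. norm (g m x) <= M * indicator (cball 0 R) x"
  "\<And>x. (%m. g m x) \<longlonglongrightarrow> g' x" and g': "g' \<in> borel_measurable borel"
 shows "(%m. \<integral>x. f x * g m x \<partial>lborel) \<longlonglongrightarrow> (\<integral>x. f x * g' x \<partial>lborel)"
proof (rule integral_dominated_convergence)
 show "integrable lborel (%x. M * (indicator (cball 0 R) x * norm (f x)))"
  using f by (simp add: locint_def)
 have [measurable]: "f \<in> borel_measurable borel" using f by (simp add: locint_def)
 note g(1)[measurable] g'[measurable]
 show "(%x. f x * g' x) \<in> borel_measurable lborel" "(%x. f x * g m x) \<in> borel_measurable lborel" for m
  by measurable
 show "AE x in lborel. (%m. f x * g m x) \<longlonglongrightarrow> f x * g' x"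
  using g(3) by (intro AE_I2 tendsto_intros)
 have "norm (f x * g m x) <= M * (indicator (cball 0 R) x * norm (f x))" for x m
 proof -
  have "norm (f x * g m x) = norm (f x) * norm (g m x)" by (rule norm_mult)
  also have "... <= norm (f x) * (M * indicator (cball 0 R) x)" by (intro mult_left_mono g) simp
  finally show ?thesis by (simp add: ac_simps)
 qed
 then show "AE x in lborel. norm (f x * g m x) <= M * (indicator (cball 0 R) x * norm (f x))" for m by simp
qed

text \<open>One majorant for all translates by y in a ball of radius B: it is the dominating
  function whenever an integral against k (y - x) is shown to be continuous or differentiable in
  y.\<close>

lemma csupp_shift_bound:
 fixes k :: "'a::euclidean_space => complex"
 assumes "continuous_on UNIV k" "csupp k"
 obtains M S where "M \<ge> 0" "\<And>B x y. norm y <= B ==> norm (k (y - x)) <= M * indicator (cball 0 (B + S)) x"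
proof -
 obtain M where M: "M \<ge> 0" "\<And>x. norm (k x) <= M" using bounded_csupp[OF assms] by blast
 obtain S where S: "\<And>x. S < norm x ==> k x = 0" using assms by (auto simp: csupp_def)
 have "norm (k (y - x)) <= M * indicator (cball 0 (B + S)) x" if "norm y <= B" for B x y
 proof (cases "norm x <= B + S")
  case False
  then have "S < norm (y - x)" using that norm_triangle_ineq3[of y x] by linarith
  then show ?thesis using S False by simp
 qed (use M in simp)
 then show ?thesis using that M(1) by blast
qed

lemma conv_integrable:
 assumes "locint f" "continuous_on UNIV k" "csupp k"
 shows "integrable lborel (%x. f x * k (y - x))"
proof -
 obtain M S where MS: "M \<ge> 0" "\<And>B x y. norm y <= B ==> norm (k (y - x)) <= M * indicator (cball 0 (B + S)) x"
  using csupp_shift_bound[OF assms(2,3)] by blast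
 have "continuous_on UNIV (%x. k (y - x))"
  by (rule continuous_on_compose2[OF assms(2)]) (auto intro: continuous_intros)
 then show ?thesis
  by (intro locint_integrable[OF assms(1) _ MS(2)[OF order_refl]] borel_measurable_continuous_onI)
qed

lemma continuous_on_conv:
 assumes "locint f" "continuous_on UNIV k" "csupp k"
 shows "continuous_on UNIV (conv f k)"
 unfolding continuous_on_sequentially
proof (intro allI ballI impI, elim conjE)
 fix u :: "nat => 'a" and a assume u: "u \<longlonglongrightarrow> a"
 obtain M S where MS: "M \<ge> 0" "\<And>B x y. norm y <= B ==> norm (k (y - x)) <= M * indicator (cball 0 (B + S)) x"
  using csupp_shift_bound[OF assms(2,3)] by blast
 obtain B where B: "\<And>m. norm (u m) <= B"
  using convergent_imp_Bseq[OF convergentI[OF u]] by (auto simp: Bseq_def)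
 have c: "continuous_on UNIV (%x. k (y - x))" for y
  by (rule continuous_on_compose2[OF assms(2)]) (auto intro: continuous_intros)
 have "(%m. \<integral>x. f x * k (u m - x) \<partial>lborel) \<longlonglongrightarrow> (\<integral>x. f x * k (a - x) \<partial>lborel)"
 proof (rule locint_tendsto[OF assms(1)])
  show "(%x. k (u m - x)) \<in> borel_measurable borel" "(%x. k (a - x)) \<in> borel_measurable borel" for m
   by (rule borel_measurable_continuous_onI[OF c])+
  show "norm (k (u m - x)) <= M * indicator (cball 0 (B + S)) x" for m x by (rule MS(2)[OF B])
  show "(%m. k (u m - x)) \<longlonglongrightarrow> k (a - x)" for x
   by (rule continuous_on_tendsto_compose[OF assms(2)]) (auto intro!: tendsto_intros u)
 qed
 then show "(conv f k \<circ> u) \<longlonglongrightarrow> conv f k a" by (simp add: conv_def o_def)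
qed

text \<open>The derivative falls on the kernel. Difference quotients of k are bounded through the
  mean value inequality by the maximum of its derivative, so dominated convergence applies for f
  merely locally integrable.\<close>

lemma has_pd_conv:
 assumes f: "locint f" and k: "ck 1 k" "csupp k" and e: "e \<in> Basis"
 shows "has_pd (conv f k) e (conv f (pd e k))"
 unfolding has_pd_def
proof
 fix y
 have h: "has_pd k e (pd e k)" and kc: "continuous_on UNIV k" and pc: "continuous_on UNIV (pd e k)"
  using k e by auto
 have ps: "csupp (pd e k)" by (rule csupp_pd[OF k(2)])
 obtain M S where MS: "M \<ge> 0" "\<And>B x y. norm y <= B ==> norm (pd e k (y - x)) <= M * indicator (cball 0 (B + S)) x"
  using csupp_shift_bound[OF pc ps] by blast
 have ne: "norm e = 1" using e by simp
 have c: "continuous_on UNIV (%x. k (y - x))" for y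
  by (rule continuous_on_compose2[OF kc]) (auto intro: continuous_intros)
 have c': "continuous_on UNIV (%x. pd e k (y - x))" for y
  by (rule continuous_on_compose2[OF pc]) (auto intro: continuous_intros)
 have "((%t. (conv f k (y + t *\<^sub>R e) - conv f k y) /\<^sub>R t) \<longlongrightarrow> conv f (pd e k) y) (at 0)"
 proof (rule LIMSEQ_SEQ_conv[THEN iffD1, rule_format], elim conjE)
  fix s :: "nat => real" assume s0: "\<forall>n. s n ~= 0" and s: "s \<longlonglongrightarrow> 0"
  obtain B where B: "\<And>m. norm (s m) <= B"
   using convergent_imp_Bseq[OF convergentI[OF s]] by (auto simp: Bseq_def)
  have "B \<ge> 0" using B[of 0] norm_ge_zero order_trans by blast
  let ?g = "%m x. (k ((y - x) + s m *\<^sub>R e) - k (y - x)) /\<^sub>R s m"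
  have "(%m. \<integral>x. f x * ?g m x \<partial>lborel) \<longlonglongrightarrow> (\<integral>x. f x * pd e k (y - x) \<partial>lborel)"
  proof (rule locint_tendsto[OF f])
   show "?g m \<in> borel_measurable borel" for m
    using c[of y] c[of "y + s m *\<^sub>R e"] by (intro borel_measurable_continuous_onI continuous_intros) (simp_all add: algebra_simps)
   show "(%x. pd e k (y - x)) \<in> borel_measurable borel" by (rule borel_measurable_continuous_onI[OF c'])
   show "norm (?g m x) <= M * indicator (cball 0 (norm y + B + S)) x" for m x
   proof -
    have ex: "\<exists>t. \<bar>t\<bar> <= B \<and> norm (k ((y - x) + s m *\<^sub>R e) - k (y - x)) <= \<bar>s m\<bar> * norm (pd e k ((y - x) + t *\<^sub>R e))"
    proof -
     \<comment> \<open>The increment s m may be negative; a < b are its endpoints in increasing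
       order.\<close>
     define a b where "a = min 0 (s m)" and "b = max 0 (s m)"
     have ab: "a < b" "b - a = \<bar>s m\<bar>" "\<bar>a\<bar> <= B" "\<bar>b\<bar> <= B"
      using s0[rule_format, of m] B[of m] by (auto simp: a_def b_def)
     have "\<exists>t\<in>{a<..<b}. norm (k ((y - x) + b *\<^sub>R e) - k ((y - x) + a *\<^sub>R e)) <= norm ((b - a) *\<^sub>R pd e k ((y - x) + t *\<^sub>R e))"
     proof (rule mvt_general[where f = "%s. k ((y - x) + s *\<^sub>R e)" and f' = "%s h. h *\<^sub>R pd e k ((y - x) + s *\<^sub>R e)"])
      show "continuous_on {a..b} (%s. k ((y - x) + s *\<^sub>R e))"
       using has_vector_derivative_continuous[OF has_pd_at[OF h, of "y - x"]]
       by (intro continuous_at_imp_continuous_on) auto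
      show "((%s. k ((y - x) + s *\<^sub>R e)) has_derivative (%h. h *\<^sub>R pd e k ((y - x) + s *\<^sub>R e))) (at s)" for s
       using has_pd_at[OF h, of "y - x" s] by (simp add: has_vector_derivative_def)
     qed (rule ab)
     then obtain t where t: "a < t" "t < b"
      "norm (k ((y - x) + b *\<^sub>R e) - k ((y - x) + a *\<^sub>R e)) <= norm ((b - a) *\<^sub>R pd e k ((y - x) + t *\<^sub>R e))" by auto
     have "norm (k ((y - x) + s m *\<^sub>R e) - k (y - x)) = norm (k ((y - x) + b *\<^sub>R e) - k ((y - x) + a *\<^sub>R e))"
      by (auto simp: a_def b_def min_def max_def norm_minus_commute)
     then have "norm (k ((y - x) + s m *\<^sub>R e) - k (y - x)) <= \<bar>s m\<bar> * norm (pd e k ((y - x) + t *\<^sub>R e))"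
      using t(3) ab(1,2) by simp
     moreover have "\<bar>t\<bar> <= B" using t(1,2) ab(3,4) by linarith
     ultimately show ?thesis by blast
    qed
    then obtain t where t: "\<bar>t\<bar> <= B" "norm (k ((y - x) + s m *\<^sub>R e) - k (y - x)) <= \<bar>s m\<bar> * norm (pd e k ((y - x) + t *\<^sub>R e))" by blast
    have nb: "norm (y + t *\<^sub>R e) <= norm y + B" using norm_triangle_ineq[of y "t *\<^sub>R e"] t(1) ne by simp
    have "norm (?g m x) = norm (k ((y - x) + s m *\<^sub>R e) - k (y - x)) / \<bar>s m\<bar>" by (simp add: divide_inverse mult.commute)
    also have "... <= norm (pd e k ((y - x) + t *\<^sub>R e))"
     using t(2) s0[rule_format, of m] by (simp add: divide_le_eq mult.commute)
    also have "(y - x) + t *\<^sub>R e = (y + t *\<^sub>R e) - x" by simp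
    also have "norm (pd e k ((y + t *\<^sub>R e) - x)) <= M * indicator (cball 0 (norm y + B + S)) x"
     by (rule MS(2)[OF nb])
    finally show ?thesis .
   qed
   show "(%m. ?g m x) \<longlonglongrightarrow> pd e k (y - x)" for x
   proof -
    have "((%t. k ((y - x) + t *\<^sub>R e)) has_vector_derivative pd e k (y - x)) (at 0)"
     using h by (auto simp: has_pd_def)
    then have "((%h. norm (k ((y - x) + h *\<^sub>R e) - k (y - x) - h *\<^sub>R pd e k (y - x)) / norm h) \<longlongrightarrow> 0) (at 0)"
     by (simp add: has_vector_derivative_def has_derivative_at)
    moreover have "filterlim s (at 0) sequentially"
     by (rule filterlim_atI[OF s]) (use s0 in simp)
    ultimately have *: "(%m. norm (k ((y - x) + s m *\<^sub>R e) - k (y - x) - s m *\<^sub>R pd e k (y - x)) / norm (s m)) \<longlonglongrightarrow> 0"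
     by (rule filterlim_compose)
    have "norm (k ((y - x) + s m *\<^sub>R e) - k (y - x) - s m *\<^sub>R pd e k (y - x)) / norm (s m) = norm (?g m x - pd e k (y - x))" for m
    proof -
     have "?g m x - pd e k (y - x) = (k ((y - x) + s m *\<^sub>R e) - k (y - x) - s m *\<^sub>R pd e k (y - x)) /\<^sub>R s m"
      using s0[rule_format, of m] by (simp add: scaleR_diff_right)
     then show ?thesis by (simp add: divide_inverse mult.commute)
    qed
    then have "(%m. ?g m x - pd e k (y - x)) \<longlonglongrightarrow> 0"
     using * by (simp add: tendsto_norm_zero_iff)
    then show ?thesis using LIM_zero_iff by blast
   qed
  qed
  moreover have "(\<integral>x. f x * ?g m x \<partial>lborel) = (conv f k (y + s m *\<^sub>R e) - conv f k y) /\<^sub>R s m" for m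
  proof -
   have i: "integrable lborel (%x. f x * k ((y - x) + s m *\<^sub>R e))" "integrable lborel (%x. f x * k (y - x))"
    using conv_integrable[OF f kc k(2), of "y + s m *\<^sub>R e"] conv_integrable[OF f kc k(2), of y]
    by (simp_all add: algebra_simps)
   have "(\<integral>x. f x * ?g m x \<partial>lborel) = (\<integral>x. (f x * k ((y - x) + s m *\<^sub>R e) - f x * k (y - x)) /\<^sub>R s m \<partial>lborel)"
    by (intro Bochner_Integration.integral_cong) (auto simp: scaleR_conv_of_real algebra_simps)
   also have "... = ((\<integral>x. f x * k ((y - x) + s m *\<^sub>R e) \<partial>lborel) - (\<integral>x. f x * k (y - x) \<partial>lborel)) /\<^sub>R s m"
    by (subst integral_scaleR_right, subst Bochner_Integration.integral_diff[OF i]) simp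
   finally show ?thesis by (simp add: conv_def algebra_simps)
  qed
  ultimately show "(%n. (conv f k (y + s n *\<^sub>R e) - conv f k y) /\<^sub>R s n) \<longlonglongrightarrow> conv f (pd e k) y"
   unfolding conv_def[of f "pd e k"] by (simp only:)
 qed
 then show "((%t. conv f k (y + t *\<^sub>R e)) has_vector_derivative conv f (pd e k) y) (at 0)"
  unfolding has_vector_derivative_def has_derivative_at
 proof (intro conjI)
  assume *: "((%t. (conv f k (y + t *\<^sub>R e) - conv f k y) /\<^sub>R t) \<longlongrightarrow> conv f (pd e k) y) (at 0)"
  show "bounded_linear (%x. x *\<^sub>R conv f (pd e k) y)" by (rule bounded_linear_scaleR_left)
  have "((%t. norm ((conv f k (y + t *\<^sub>R e) - conv f k y) /\<^sub>R t - conv f (pd e k) y)) \<longlongrightarrow> 0) (at 0)"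
   using * by (simp add: tendsto_norm_zero_iff LIM_zero_iff)
  then show "((%t. norm (conv f k (y + (0 + t) *\<^sub>R e) - conv f k (y + 0 *\<^sub>R e) - t *\<^sub>R conv f (pd e k) y) / norm t) \<longlongrightarrow> 0) (at 0)"
  proof (rule Lim_transform_eventually)
   show "\<forall>\<^sub>F t in at 0. norm ((conv f k (y + t *\<^sub>R e) - conv f k y) /\<^sub>R t - conv f (pd e k) y)
     = norm (conv f k (y + (0 + t) *\<^sub>R e) - conv f k (y + 0 *\<^sub>R e) - t *\<^sub>R conv f (pd e k) y) / norm t"
   proof (rule eventually_at_filter[THEN iffD2], rule always_eventually, intro allI impI)
    fix t :: real assume "t ~= 0"
    then have "(conv f k (y + t *\<^sub>R e) - conv f k y) /\<^sub>R t - conv f (pd e k) y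
     = (conv f k (y + (0 + t) *\<^sub>R e) - conv f k (y + 0 *\<^sub>R e) - t *\<^sub>R conv f (pd e k) y) /\<^sub>R t"
     by (simp add: scaleR_diff_right)
    then show "norm ((conv f k (y + t *\<^sub>R e) - conv f k y) /\<^sub>R t - conv f (pd e k) y)
      = norm (conv f k (y + (0 + t) *\<^sub>R e) - conv f k (y + 0 *\<^sub>R e) - t *\<^sub>R conv f (pd e k) y) / norm t"
     by (simp add: divide_inverse mult.commute)
   qed
  qed
 qed
qed

lemma ck_conv: "locint f ==> ck n k ==> csupp k ==> ck n (conv f k)"
proof (induction n arbitrary: k)
 case 0
 then show ?case by (simp add: continuous_on_conv)
next
 case (Suc n)
 have 1: "ck 1 k" using ck_le[OF Suc.prems(2), of 1] by simp
 show ?case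
 proof (rule ck_SucI)
  show "continuous_on UNIV (conv f k)"
   by (rule continuous_on_conv[OF Suc.prems(1) ck_cont[OF Suc.prems(2)] Suc.prems(3)])
  show "has_pd (conv f k) e (conv f (pd e k))" if "e \<in> Basis" for e
   by (rule has_pd_conv[OF Suc.prems(1) 1 Suc.prems(3) that])
  show "ck n (conv f (pd e k))" if "e \<in> Basis" for e
   by (rule Suc.IH[OF Suc.prems(1) ck_pd[OF Suc.prems(2) that] csupp_pd[OF Suc.prems(3)]])
 qed
qed

lemma dz_conv:
 assumes "locint f" "ck 1 k" "csupp k"
 shows "dz j (conv f k) = conv f (dz j k)" "dzb j (conv f k) = conv f (dzb j k)"
proof -
 have i: "integrable lborel (%x. f x * pd e k (y - x))" if "e \<in> Basis" for e y
  using assms that by (intro conv_integrable csupp_pd) auto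
 have p: "pd e (conv f k) = conv f (pd e k)" if "e \<in> Basis" for e
  by (rule pd_eq[OF has_pd_conv[OF assms that]])
 have "conv f (dz j k) y = (conv f (pd (axis j 1) k) y - \<i> * conv f (pd (axis j \<i>) k) y) / 2" for y
 proof -
  have "conv f (dz j k) y = (\<integral>x. (f x * pd (axis j 1) k (y - x) - \<i> * (f x * pd (axis j \<i>) k (y - x))) / 2 \<partial>lborel)"
   unfolding conv_def dz_def by (intro Bochner_Integration.integral_cong) (auto simp: field_simps)
  then show ?thesis unfolding conv_def
   using i[OF axis_Basis(1)] i[OF axis_Basis(2)] by simp
 qed
 then show "dz j (conv f k) = conv f (dz j k)"
  by (simp add: dz_def fun_eq_iff p)
 have "conv f (dzb j k) y = (conv f (pd (axis j 1) k) y + \<i> * conv f (pd (axis j \<i>) k) y) / 2" for y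
 proof -
  have "conv f (dzb j k) y = (\<integral>x. (f x * pd (axis j 1) k (y - x) + \<i> * (f x * pd (axis j \<i>) k (y - x))) / 2 \<partial>lborel)"
   unfolding conv_def dzb_def by (intro Bochner_Integration.integral_cong) (auto simp: field_simps)
  then show ?thesis unfolding conv_def
   using i[OF axis_Basis(1)] i[OF axis_Basis(2)] by simp
 qed
 then show "dzb j (conv f k) = conv f (dzb j k)"
  by (simp add: dzb_def fun_eq_iff p)
qed

lemma dz_minus: "ck 1 f ==> dz k (%x. - f x) x = - dz k f x"
 and dzb_minus: "ck 1 f ==> dzb k (%x. - f x) x = - dzb k f x"
 by (simp_all add: dz_def dzb_def pd_minus del: ck.simps One_nat_def) (simp_all add: field_simps)

lemma nn_integral_mol:
 assumes "r > 0" shows "(\<integral>\<^sup>+x. ennreal (mol r (y - x :: 'a::euclidean_space)) \<partial>lborel) = 1"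
  and "(\<integral>\<^sup>+x. ennreal (mol r (x - y :: 'a)) \<partial>lborel) = 1"
proof -
 have [measurable]: "mol r \<in> borel_measurable (borel :: 'a measure)"
  by (rule borel_measurable_continuous_onI[OF continuous_on_mol[OF assms]])
 have "(\<integral>\<^sup>+x. ennreal (mol r (x :: 'a)) \<partial>lborel) = 1"
  by (simp add: nn_integral_eq_integral integrable_mol[OF assms] mol_nonneg[OF assms] integral_mol[OF assms])
 then show 1: "(\<integral>\<^sup>+x. ennreal (mol r (y - x :: 'a)) \<partial>lborel) = 1"
  using nn_integral_lborel_reflect[of "%x. ennreal (mol r x)" y] by simp
 have "mol r (x - y) = mol r (y - x)" for x :: 'a
  using mol_even[OF assms, of "x - y"] by simp
 then show "(\<integral>\<^sup>+x. ennreal (mol r (x - y :: 'a)) \<partial>lborel) = 1" using 1 by simp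
qed

text \<open>Cauchy-Schwarz against the probability density \<open>mol r (y - x)\<close>, then
  Tonelli. Since x and y differ by less than r wherever the density is positive, the weight at y may
  be replaced by a majorant evaluated at x.\<close>

lemma mol_average_bound:
 fixes F g G :: "'a::euclidean_space => ennreal"
 assumes r: "r > 0" and [measurable]: "F \<in> borel_measurable borel" "g \<in> borel_measurable borel" "G \<in> borel_measurable borel"
  and gG: "\<And>x y. norm (y - x) < r ==> g y <= G x"
 shows "(\<integral>\<^sup>+y. g y * (\<integral>\<^sup>+x. F x * ennreal (mol r (y - x)) \<partial>lborel)\<^sup>2 \<partial>lborel) <= (\<integral>\<^sup>+x. (F x)\<^sup>2 * G x \<partial>lborel)"
proof -
 have [measurable]: "mol r \<in> borel_measurable (borel :: 'a measure)"
  by (rule borel_measurable_continuous_onI[OF continuous_on_mol[OF r]])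
 have sq: "ennreal (mol r z) = ennreal (sqrt (mol r z)) * ennreal (sqrt (mol r z))" for z :: 'a
  using mol_nonneg[OF r, of z] by (simp add: ennreal_mult[symmetric])
 have CS: "(\<integral>\<^sup>+x. F x * ennreal (mol r (y - x)) \<partial>lborel)\<^sup>2 <= (\<integral>\<^sup>+x. (F x)\<^sup>2 * ennreal (mol r (y - x)) \<partial>lborel)" for y
 proof -
  have "(\<integral>\<^sup>+x. (F x * ennreal (sqrt (mol r (y - x)))) * ennreal (sqrt (mol r (y - x))) \<partial>lborel)\<^sup>2
   <= (\<integral>\<^sup>+x. (F x * ennreal (sqrt (mol r (y - x)))) ^ 2 \<partial>lborel) * (\<integral>\<^sup>+x. ennreal (sqrt (mol r (y - x))) ^ 2 \<partial>lborel)"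
   by (rule Cauchy_Schwarz_nn_integral) auto
  moreover have p: "(F x * ennreal (sqrt (mol r (y - x)))) * ennreal (sqrt (mol r (y - x))) = F x * ennreal (mol r (y - x))"
   "ennreal (sqrt (mol r (y - x))) ^ 2 = ennreal (mol r (y - x))" for x
   by (simp_all add: mult.assoc sq[symmetric] power2_eq_square)
  ultimately show ?thesis
   by (simp only: p power_mult_distrib nn_integral_mol(1)[OF r] mult_1_right)
 qed
 have "(\<integral>\<^sup>+y. g y * (\<integral>\<^sup>+x. F x * ennreal (mol r (y - x)) \<partial>lborel)\<^sup>2 \<partial>lborel)
   <= (\<integral>\<^sup>+y. g y * (\<integral>\<^sup>+x. (F x)\<^sup>2 * ennreal (mol r (y - x)) \<partial>lborel) \<partial>lborel)"
  by (intro nn_integral_mono mult_left_mono CS) simp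
 also have "... = (\<integral>\<^sup>+y. \<integral>\<^sup>+x. g y * ((F x)\<^sup>2 * ennreal (mol r (y - x))) \<partial>lborel \<partial>lborel)"
  by (simp add: nn_integral_cmult)
 also have "... = (\<integral>\<^sup>+x. \<integral>\<^sup>+y. g y * ((F x)\<^sup>2 * ennreal (mol r (y - x))) \<partial>lborel \<partial>lborel)"
  by (subst lborel_pair.Fubini') auto
 also have "... <= (\<integral>\<^sup>+x. \<integral>\<^sup>+y. ((F x)\<^sup>2 * G x) * ennreal (mol r (y - x)) \<partial>lborel \<partial>lborel)"
 proof (intro nn_integral_mono)
  fix x y :: 'a
  show "g y * ((F x)\<^sup>2 * ennreal (mol r (y - x))) <= ((F x)\<^sup>2 * G x) * ennreal (mol r (y - x))"
  proof (cases "norm (y - x) < r")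
   case True
   then have "g y * ((F x)\<^sup>2 * ennreal (mol r (y - x))) <= G x * ((F x)\<^sup>2 * ennreal (mol r (y - x)))"
    by (intro mult_right_mono gG) auto
   then show ?thesis by (simp add: ac_simps)
  qed (simp add: mol_eq_0[OF r])
 qed
 also have "... = (\<integral>\<^sup>+x. (F x)\<^sup>2 * G x \<partial>lborel)"
  by (simp add: nn_integral_cmult nn_integral_mol(2)[OF r])
 finally show ?thesis .
qed

text \<open>Asymmetric on purpose: y alone is confined to the ball, and d <= 1 keeps x within radius
  R + 1.\<close>

lemma uniformly_continuous_on_ball:
 fixes f :: "'a::euclidean_space => 'b::metric_space"
 assumes "continuous_on UNIV f" "e > 0"
 obtains d where "0 < d" "d <= 1" "\<And>x y. norm y <= R ==> norm (x - y) < d ==> dist (f x) (f y) < e"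
proof -
 have "uniformly_continuous_on (cball 0 (R + 1)) f"
  by (intro compact_uniformly_continuous continuous_on_subset[OF assms(1)]) auto
 then obtain d where d: "d > 0" "\<And>x y. x \<in> cball 0 (R + 1) ==> y \<in> cball 0 (R + 1) ==> dist x y < d ==> dist (f x) (f y) < e"
  using assms(2) unfolding uniformly_continuous_on_def by (metis dist_commute)
 have "dist (f x) (f y) < e" if "norm y <= R" "norm (x - y) < min d 1" for x y
 proof (rule d(2))
  have "norm x <= norm (x - y) + norm y" using norm_triangle_ineq[of "x - y" y] by simp
  then show "x \<in> cball 0 (R + 1)" "y \<in> cball 0 (R + 1)" using that by auto
  show "dist x y < d" using that by (simp add: dist_norm)
 qed
 then show ?thesis using that[of "min d 1"] d(1) by auto
qed

lemma locint_mult_cont: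
 fixes f g :: "'a::euclidean_space => complex"
 assumes "locint f" "continuous_on UNIV g"
 shows "locint (%x. g x * f x)"
 unfolding locint_def
proof (intro conjI allI)
 have [measurable]: "f \<in> borel_measurable borel" "g \<in> borel_measurable borel"
  using assms by (auto simp: locint_def borel_measurable_continuous_onI)
 show "(%x. g x * f x) \<in> borel_measurable borel" by measurable
 fix R :: real
 have [measurable]: "cball 0 R \<in> sets (borel :: 'a measure)" by simp
 have "compact (g ` cball 0 R)"
  by (intro compact_continuous_image continuous_on_subset[OF assms(2)]) auto
 then obtain M where M: "\<And>x. x \<in> cball 0 R ==> norm (g x) <= M"
  using compact_imp_bounded bounded_iff by (metis imageI)
 show "integrable lborel (%x. indicator (cball 0 R) x * norm (g x * f x))"
 proof (rule Bochner_Integration.integrable_bound)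
  show "integrable lborel (%x. M * (indicator (cball 0 R) x * norm (f x)))"
   using assms(1) by (simp add: locint_def)
  have "norm (indicator (cball 0 R) x * norm (g x * f x)) <= norm (M * (indicator (cball 0 R) x * norm (f x)))" for x
  proof (cases "x \<in> cball 0 R")
   case True
   have "norm (g x) * norm (f x) <= \<bar>M\<bar> * norm (f x)"
    using M[OF True] by (intro mult_right_mono) auto
   then show ?thesis using True by (simp add: norm_mult abs_mult)
  qed simp
  then show "AE x in lborel. norm (indicator (cball 0 R) x * norm (g x * f x)) <= norm (M * (indicator (cball 0 R) x * norm (f x)))"
   by simp
 qed measurable
qed

lemma locint_integrableI: "integrable lborel f ==> locint f"
 unfolding locint_def
proof (intro conjI allI)
 assume f: "integrable lborel f"
 then show "f \<in> borel_measurable borel" by simp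
 fix R
 show "integrable lborel (%x. indicator (cball 0 R) x * norm (f x))"
  using integrable_real_mult_indicator[OF _ integrable_norm[OF f], of "cball 0 R"] by (simp add: mult.commute)
qed

text \<open>Fubini moves the mollifier from W to q, and averaging q over distances below r changes
  it by at most d.\<close>

lemma integral_conv_mol:
 fixes W q :: "'a::euclidean_space => complex"
 assumes W: "integrable lborel W" and q: "continuous_on UNIV q" "csupp q" and r: "r > 0"
  and close: "\<And>x y. norm (x - y) < r ==> norm (q y - q x) <= d"
 shows "norm ((\<integral>y. conv W (%x. complex_of_real (mol r x)) y * q y \<partial>lborel) - (\<integral>x. W x * q x \<partial>lborel))
   <= d * (\<integral>x. norm (W x) \<partial>lborel)"
proof -
 let ?m = "%x::'a. complex_of_real (mol r x)"
 have [measurable]: "W \<in> borel_measurable borel" "q \<in> borel_measurable borel" "mol r \<in> borel_measurable (borel :: 'a measure)"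
  using W q continuous_on_mol[OF r] by (auto intro: borel_measurable_continuous_onI)
 obtain M where M: "M \<ge> 0" "\<And>x. norm (q x) <= M" using bounded_csupp[OF q] by blast
 have nW: "(\<integral>\<^sup>+x. ennreal (norm (W x)) \<partial>lborel) < \<infinity>" using W by (simp add: integrable_iff_bounded)
 have int2: "integrable (lborel \<Otimes>\<^sub>M lborel) (%(x, y). W x * ?m (y - x) * q y)"
 proof (rule integrableI_bounded)
  show "(%(x, y). W x * ?m (y - x) * q y) \<in> borel_measurable (lborel \<Otimes>\<^sub>M lborel)" by measurable
  have "(\<integral>\<^sup>+p. ennreal (norm (case p of (x, y) => W x * ?m (y - x) * q y)) \<partial>(lborel \<Otimes>\<^sub>M lborel))
   = (\<integral>\<^sup>+x. \<integral>\<^sup>+y. ennreal (norm (W x * ?m (y - x) * q y)) \<partial>lborel \<partial>lborel)"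
   by (subst lborel.nn_integral_fst[symmetric]) auto
  also have "... <= (\<integral>\<^sup>+x. \<integral>\<^sup>+y. (ennreal M * ennreal (norm (W x))) * ennreal (mol r (y - x)) \<partial>lborel \<partial>lborel)"
  proof (intro nn_integral_mono)
   fix x y
   have "norm (W x * ?m (y - x) * q y) <= (M * norm (W x)) * mol r (y - x)"
    using mult_left_mono[OF M(2)[of y], of "norm (W x) * mol r (y - x)"] mol_nonneg[OF r, of "y - x"]
    by (simp add: norm_mult ac_simps)
   then show "ennreal (norm (W x * ?m (y - x) * q y)) <= (ennreal M * ennreal (norm (W x))) * ennreal (mol r (y - x))"
    using M(1) mol_nonneg[OF r, of "y - x"] ennreal_leI[of "norm (W x * ?m (y - x) * q y)" "(M * norm (W x)) * mol r (y - x)"]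
    by (simp add: ennreal_mult)
  qed
  also have "... = ennreal M * (\<integral>\<^sup>+x. ennreal (norm (W x)) \<partial>lborel)"
   by (simp add: nn_integral_cmult nn_integral_mol(2)[OF r])
  also have "... < \<infinity>" using nW by (simp add: ennreal_mult_less_top)
  finally show "(\<integral>\<^sup>+p. ennreal (norm (case p of (x, y) => W x * ?m (y - x) * q y)) \<partial>(lborel \<Otimes>\<^sub>M lborel)) < \<infinity>" .
 qed
 have "(\<integral>y. conv W ?m y * q y \<partial>lborel) = (\<integral>y. \<integral>x. W x * ?m (y - x) * q y \<partial>lborel \<partial>lborel)"
  by (simp add: conv_def)
 also have "... = (\<integral>x. \<integral>y. W x * ?m (y - x) * q y \<partial>lborel \<partial>lborel)"
  by (rule lborel_pair.Fubini_integral[OF int2])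
 also have "... = (\<integral>x. W x * (\<integral>y. ?m (y - x) * q y \<partial>lborel) \<partial>lborel)"
  by (simp add: mult.assoc)
 finally have eq: "(\<integral>y. conv W ?m y * q y \<partial>lborel) = (\<integral>x. W x * (\<integral>y. ?m (y - x) * q y \<partial>lborel) \<partial>lborel)" .
 have im: "integrable lborel (%y. ?m (y - x))" for x
 proof (rule integrableI_bounded)
  show "(%y. ?m (y - x)) \<in> borel_measurable lborel" by measurable
  have "ennreal (norm (?m (y - x))) = ennreal (mol r (y - x))" for y using mol_nonneg[OF r, of "y - x"] by simp
  then show "(\<integral>\<^sup>+y. ennreal (norm (?m (y - x))) \<partial>lborel) < \<infinity>" by (simp add: nn_integral_mol(2)[OF r])
 qed
 have im1: "(\<integral>y. mol r (y - x) \<partial>lborel) = 1" for x :: 'a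
  using integral_lborel_shift[of "mol r" "- x"] integral_mol[OF r, where 'a = 'a] by simp
 have imr: "integrable lborel (%y. mol r (y - x))" for x :: 'a using integrable_Re[OF im[of x]] by simp
 have iq: "integrable lborel (%y. ?m (y - x) * q y)" for x
 proof (rule Bochner_Integration.integrable_bound)
  show "integrable lborel (%y. complex_of_real M * ?m (y - x))" using im[of x] by simp
  show "(%y. ?m (y - x) * q y) \<in> borel_measurable lborel" by measurable
  show "AE y in lborel. norm (?m (y - x) * q y) <= norm (complex_of_real M * ?m (y - x))"
   using M by (intro AE_I2) (auto simp: norm_mult mult.commute intro!: mult_right_mono)
 qed
 have inner: "norm ((\<integral>y. ?m (y - x) * q y \<partial>lborel) - q x) <= d" for x
 proof -
  have "q x = (\<integral>y. ?m (y - x) * q x \<partial>lborel)"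
   by (simp add: im1)
  then have "(\<integral>y. ?m (y - x) * q y \<partial>lborel) - q x = (\<integral>y. ?m (y - x) * q y \<partial>lborel) - (\<integral>y. ?m (y - x) * q x \<partial>lborel)"
   by (simp only:)
  also have "... = (\<integral>y. ?m (y - x) * (q y - q x) \<partial>lborel)"
   using iq[of x] im[of x] by (simp add: right_diff_distrib)
  finally have e: "(\<integral>y. ?m (y - x) * q y \<partial>lborel) - q x = (\<integral>y. ?m (y - x) * (q y - q x) \<partial>lborel)" .
  have "norm ((\<integral>y. ?m (y - x) * q y \<partial>lborel) - q x) <= (\<integral>y. norm (?m (y - x) * (q y - q x)) \<partial>lborel)"
   unfolding e by (rule integral_norm_bound)
  also have "... <= (\<integral>y. d * mol r (y - x) \<partial>lborel)"
  proof (rule integral_mono)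
   show "integrable lborel (%y. norm (?m (y - x) * (q y - q x)))"
    using iq[of x] im[of x] by (intro integrable_norm) (simp add: right_diff_distrib)
   show "integrable lborel (%y. d * mol r (y - x))" using imr by simp
   show "norm (?m (y - x) * (q y - q x)) <= d * mol r (y - x)" for y
   proof (cases "norm (y - x) < r")
    case True
    then have "norm (q y - q x) <= d" using close[of x y] by (simp add: norm_minus_commute)
    then have "norm (q y - q x) * mol r (y - x) <= d * mol r (y - x)"
     using mol_nonneg[OF r, of "y - x"] by (rule mult_right_mono)
    then show ?thesis using mol_nonneg[OF r, of "y - x"] by (simp add: norm_mult mult.commute)
   qed (simp add: mol_eq_0[OF r])
  qed
  also have "... = d" by (simp add: im1)
  finally show ?thesis .
 qed
 have inm: "(%x. \<integral>y. ?m (y - x) * q y \<partial>lborel) \<in> borel_measurable borel"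
  using lborel.borel_measurable_lebesgue_integral[of "%x y. ?m (y - x) * q y" borel] by simp
 note inm[measurable]
 have i1: "integrable lborel (%x. W x * ((\<integral>y. ?m (y - x) * q y \<partial>lborel) - q x))"
 proof (rule Bochner_Integration.integrable_bound)
  show "integrable lborel (%x. d * norm (W x))" using W by simp
  show "(%x. W x * ((\<integral>y. ?m (y - x) * q y \<partial>lborel) - q x)) \<in> borel_measurable lborel" by measurable
  have "norm (W x * ((\<integral>y. ?m (y - x) * q y \<partial>lborel) - q x)) <= norm (d * norm (W x))" for x
  proof -
   have "norm (W x) * norm ((\<integral>y. ?m (y - x) * q y \<partial>lborel) - q x) <= norm (W x) * d"
    by (intro mult_left_mono inner) simp
   then show ?thesis by (simp add: norm_mult mult.commute)
  qed
  then show "AE x in lborel. norm (W x * ((\<integral>y. ?m (y - x) * q y \<partial>lborel) - q x)) <= norm (d * norm (W x))" by simp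
 qed
 have i2: "integrable lborel (%x. W x * q x)"
 proof (rule Bochner_Integration.integrable_bound)
  show "integrable lborel (%x. M * norm (W x))" using W by simp
  show "(%x. W x * q x) \<in> borel_measurable lborel" by measurable
  have "norm (q x) * norm (W x) <= M * norm (W x)" for x by (intro mult_right_mono M(2)) simp
  then show "AE x in lborel. norm (W x * q x) <= norm (M * norm (W x))"
   using M(1) by (intro AE_I2) (simp add: norm_mult mult.commute[of "norm (W _)"])
 qed
 have "(\<integral>x. W x * (\<integral>y. ?m (y - x) * q y \<partial>lborel) \<partial>lborel) - (\<integral>x. W x * q x \<partial>lborel)
   = (\<integral>x. W x * ((\<integral>y. ?m (y - x) * q y \<partial>lborel) - q x) \<partial>lborel)"
  using Bochner_Integration.integral_add[OF i1 i2] by (simp add: algebra_simps)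
 also have "norm ... <= (\<integral>x. norm (W x * ((\<integral>y. ?m (y - x) * q y \<partial>lborel) - q x)) \<partial>lborel)"
  by (rule integral_norm_bound)
 also have "... <= (\<integral>x. d * norm (W x) \<partial>lborel)"
 proof (rule integral_mono)
  show "integrable lborel (%x. norm (W x * ((\<integral>y. ?m (y - x) * q y \<partial>lborel) - q x)))"
   by (rule integrable_norm[OF i1])
  show "integrable lborel (%x. d * norm (W x))" using W by simp
  show "norm (W x * ((\<integral>y. ?m (y - x) * q y \<partial>lborel) - q x)) <= d * norm (W x)" for x
   using mult_left_mono[OF inner[of x], of "norm (W x)"] by (simp add: norm_mult mult.commute)
 qed
 finally show ?thesis unfolding eq by simp
qed

section \<open>Weak solutions of \<open>Lop h = 0\<close> satisfy the Cauchy-Riemann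
  equations\<close>

context psh_weight
begin

lemma E_cont: "continuous_on UNIV E"
 using continuous_on_Re[OF ck_cont[OF E_ck]] by simp

lemma ph_cont: "continuous_on UNIV (ph k)"
 using ck_cont[OF ph_ck] .

lemma dzbE: "dzb k (%x. complex_of_real (E x)) x = - cnj (ph k x) * E x"
 using dzb_cnj[OF E_ck, of k x] by (simp add: dzE)

definition iE :: "complex^'n => complex" where "iE x = inverse (complex_of_real (E x))"

lemma iE_ck: "ck 1 iE"
 unfolding iE_def[abs_def] using E_pos by (intro ck_inverse E_ck) (metis less_irrefl of_real_eq_0_iff)

lemma dzb_iE: "dzb k iE x = cnj (ph k x) * iE x"
proof -
 have nz: "complex_of_real (E x) ~= 0" for x using E_pos[of x] by simp
 show ?thesis
  unfolding iE_def[abs_def] dz_inverse(2)[OF E_ck nz] dzbE using nz[of x] by (simp add: field_simps)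
qed

lemma norm_iE: "norm (iE x) = 1 / E x"
 using E_pos[of x] by (simp add: iE_def norm_inverse divide_inverse)

text \<open>The derivative of (1 - |x|^2/R^2)^2 along e is at most 4 |x . e| / R^2 in size, and |x|
  <= R on the support. The decay in R is what removes the cutoff error in the end.\<close>

lemma cutoff_bounds:
 fixes x :: "complex^'n"
 assumes "R > 0"
 shows "norm (dzb j (%x. complex_of_real (bump R 2 x)) x) <= 4 / R * indicator (cball 0 R) x"
proof -
 have p: "norm (pd e (%x. complex_of_real (bump R 2 x)) x) <= 4 / R * indicator (cball 0 R) x" if e: "e \<in> Basis" for e :: "complex^'n"
 proof -
  have eq: "pd e (%x. complex_of_real (bump R 2 x)) x = 2 * complex_of_real (bump R 1 x) * (complex_of_real (x \<bullet> e) * complex_of_real (- 2 / R\<^sup>2))"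
   using pd_eq[OF has_pd_bump[of R 0 e]] by (simp add: numeral_2_eq_2 fun_eq_iff)
  show ?thesis
  proof (cases "norm x <= R")
   case True
   have "\<bar>x \<bullet> e\<bar> <= R" using Basis_le_norm[OF e, of x] True by linarith
   then have "bump R 1 x * \<bar>x \<bullet> e\<bar> <= 1 * R"
    using bump_nonneg[of R 1 x] bump_le_1[of R 1 x] by (intro mult_mono) auto
   moreover have "norm (pd e (%x. complex_of_real (bump R 2 x)) x) = (bump R 1 x * \<bar>x \<bullet> e\<bar>) * (4 / R\<^sup>2)"
    unfolding eq using bump_nonneg[of R 1 x] by (simp add: norm_mult norm_divide norm_power abs_mult)
   ultimately have "norm (pd e (%x. complex_of_real (bump R 2 x)) x) <= R * (4 / R\<^sup>2)"
    by (simp add: mult_right_mono divide_right_mono)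
   also have "... = 4 / R" using assms by (simp add: power2_eq_square)
   finally show ?thesis using True by simp
  next
   case False
   then have "bump R 1 x = 0" using bump_eq_0[OF assms, of x 0] by simp
   then show ?thesis unfolding eq using False by simp
  qed
 qed
 have "norm (dzb j (%x. complex_of_real (bump R 2 x)) x)
   <= (norm (pd (axis j 1) (%x. complex_of_real (bump R 2 x)) x) + norm (pd (axis j \<i>) (%x. complex_of_real (bump R 2 x)) x)) / 2"
  unfolding dzb_def
  using norm_triangle_ineq[of "pd (axis j 1) (%x. complex_of_real (bump R 2 x)) x" "\<i> * pd (axis j \<i>) (%x. complex_of_real (bump R 2 x)) x"]
  by (simp add: norm_divide norm_mult)
 also have "... <= 4 / R * indicator (cball 0 R) x"
 proof -
  define c where "c = 4 / R * indicator (cball 0 R) x"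
  have "norm (pd (axis j 1) (%x. complex_of_real (bump R 2 x)) x) <= c"
   "norm (pd (axis j \<i>) (%x. complex_of_real (bump R 2 x)) x) <= c"
   unfolding c_def by (rule p, rule axis_Basis)+
  moreover have "(a + b) / 2 <= d" if "a <= d" "b <= d" for a b d :: real using that by (simp add: field_simps)
  ultimately show ?thesis unfolding c_def by blast
 qed
 finally show ?thesis .
qed

text \<open>A weak \<open>L\<^sup>2\<close> solution of \<open>L h = 0\<close> is a weak solution of the Cauchy--Riemann equations:
 mollify \<open>h E\<close>, which turns the equation into \<open>\<Sum>\<^sub>j \<partial>\<^sub>j \<beta>\<^sub>j = 0\<close> up to a commutator without derivatives, and use
 the energy (Caccioppoli) estimate with a cutoff of radius \<open>R\<close>.\<close>

lemma weak_solution_estimate: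
 fixes j0 :: 'n
 assumes h: "h \<in> borel_measurable borel" and h2: "integrable lborel (%x. (norm (h x))\<^sup>2 * E x)"
  and weak: "\<And>v. ck 3 v ==> csupp v ==> (\<integral>x. h x * cnj (Lop v x) * E x \<partial>lborel) = 0"
  and psi: "ck 1 psi" and supp: "\<And>x. R0 < norm x ==> psi x = 0"
  and R: "R \<ge> 1" "R \<ge> 2 * R0"
 shows "norm (\<integral>x. h x * dzb j0 psi x \<partial>lborel) <=
   (5 + 8 * real CARD('n) * (1 + 128 * (\<integral>x. (norm (h x))\<^sup>2 * E x \<partial>lborel)) + (\<integral>x. (norm (psi x))\<^sup>2 / E x \<partial>lborel)) / R"
proof -
 note h[measurable]
 have Em[measurable]: "E \<in> borel_measurable borel" by (rule borel_measurable_continuous_onI[OF E_cont])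
 have [measurable]: "cball 0 R \<in> sets (borel :: (complex^'n) measure)" by simp
 define A0 where "A0 = (\<integral>x. (norm (h x))\<^sup>2 * E x \<partial>lborel)"
 have A0: "A0 \<ge> 0" unfolding A0_def using E_pos by (intro integral_nonneg_AE) (simp add: less_imp_le)
 \<comment> \<open>In terms of W the weak equation says that the sum of dz_j (dzb_j W + cnj ph_j W)
   vanishes, the bracket being E dzb_j h. Mollifying W instead of h keeps the outer derivative free
   of variable coefficients.\<close>
 define W where "W = (%x. h x * complex_of_real (E x))"
 have [measurable]: "W \<in> borel_measurable borel" unfolding W_def by measurable
 have Wi: "integrable lborel W"
 proof (rule Bochner_Integration.integrable_bound[OF Bochner_Integration.integrable_add[OF h2 E_int]])
  have "norm (W x) <= norm ((norm (h x))\<^sup>2 * E x + E x)" for x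
  proof -
   have "norm (h x) <= (norm (h x))\<^sup>2 + 1"
   proof -
    have "2 * norm (h x) <= (norm (h x))\<^sup>2 + 1" using sum_squares_bound[of "norm (h x)" 1] by simp
    then show ?thesis using norm_ge_zero[of "h x"] by linarith
   qed
   then have "norm (h x) * E x <= ((norm (h x))\<^sup>2 + 1) * E x" using E_pos[of x] by (intro mult_right_mono) auto
   then show ?thesis using E_pos[of x] by (simp add: W_def norm_mult algebra_simps)
  qed
  then show "AE x in lborel. norm (W x) <= norm ((norm (h x))\<^sup>2 * E x + E x)" by simp
 qed measurable
 define A2 where "A2 = (\<integral>x. norm (W x) \<partial>lborel)"
 have A2: "A2 \<ge> 0" unfolding A2_def by simp
 have Wl: "locint W" by (rule locint_integrableI[OF Wi])
 have pWl: "locint (%x. cnj (ph j x) * W x)" for j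
  by (rule locint_mult_cont[OF Wl]) (intro continuous_intros ph_cont)
 have W2: "(norm (W x))\<^sup>2 / E x = (norm (h x))\<^sup>2 * E x" for x
  using E_pos[of x] by (simp add: W_def norm_mult power_mult_distrib power2_eq_square)
 define q where "q = (%x. dzb j0 psi x * iE x)"
 have dpsi: "continuous_on UNIV (dzb j0 psi)" using ck_dzb[of 0 psi j0] psi by auto
 have qc: "continuous_on UNIV q" unfolding q_def using dpsi ck_cont[OF iE_ck] by (intro continuous_intros)
 have psis: "csupp psi" unfolding csupp_def using supp by blast
 have qs: "csupp q" unfolding q_def by (intro csupp_mult1 csupp_dzb psis)
 \<comment> \<open>Tolerance for the oscillation of \<open>ph\<close> at the mollification scale,
   chosen so that the commutator contributes O(1/R^2); \<open>dq\<close> below plays the same part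
   for q with error 1/R.\<close>
 define om where "om = 1 / (R * (1 + 2 * A0))"
 have om: "om > 0" "om <= 1" "2 * om\<^sup>2 * A0 <= 1 / R\<^sup>2"
 proof -
  show "om > 0" using R A0 by (simp add: om_def)
  have "1 <= R * (1 + 2 * A0)" using R A0 mult_mono[of 1 R 1 "1 + 2 * A0"] by simp
  then show "om <= 1" using R A0 by (simp add: om_def divide_le_eq_1)
  have "2 * om\<^sup>2 * A0 = (2 * A0 / (1 + 2 * A0)\<^sup>2) * (1 / R\<^sup>2)"
   by (simp add: om_def power_divide power_mult_distrib)
  also have "... <= 1 * (1 / R\<^sup>2)"
  proof (rule mult_right_mono)
   have "2 * A0 <= (1 + 2 * A0)\<^sup>2" using A0 by (simp add: power2_eq_square algebra_simps)
   then show "2 * A0 / (1 + 2 * A0)\<^sup>2 <= 1" using A0 by (simp add: divide_le_eq_1)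
  qed simp
  finally show "2 * om\<^sup>2 * A0 <= 1 / R\<^sup>2" by simp
 qed
 obtain S where S: "\<And>x. S < norm x ==> q x = 0" using qs by (auto simp: csupp_def)
 have "\<exists>e>0. \<forall>y. norm y <= R \<longrightarrow> e <= E y"
 proof -
  have "compact (E ` cball 0 R)" "E ` cball 0 R ~= {}"
   using R by (auto intro!: compact_continuous_image continuous_on_subset[OF E_cont])
  then obtain s where "s \<in> E ` cball 0 R" "\<forall>t\<in>E ` cball 0 R. s <= t" using compact_attains_inf by blast
  then obtain x0 where "\<forall>t\<in>cball 0 R. E x0 <= E t" by auto
  then show ?thesis using E_pos[of x0] by (intro exI[of _ "E x0"]) auto
 qed
 then obtain e0 where e0: "e0 > 0" "\<And>y. norm y <= R ==> e0 <= E y" by blast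
 obtain d1 where d1: "0 < d1" "d1 <= 1" "\<And>x y. norm y <= R ==> norm (x - y) < d1 ==> dist (E x) (E y) < e0"
  using uniformly_continuous_on_ball[OF E_cont e0(1)] by blast
 have ex: "\<exists>d. 0 < d \<and> (\<forall>x y. norm y <= R \<longrightarrow> norm (x - y) < d \<longrightarrow> dist (ph j x) (ph j y) < om)" for j
  by (rule uniformly_continuous_on_ball[OF ph_cont[of j] om(1), of R]) blast
 have "\<exists>d. \<forall>j. 0 < d j \<and> (\<forall>x y. norm y <= R \<longrightarrow> norm (x - y) < d j \<longrightarrow> dist (ph j x) (ph j y) < om)"
  by (rule choice) (use ex in blast)
 then obtain d2 where d2: "\<And>j. 0 < d2 j" "\<And>j x y. norm y <= R ==> norm (x - y) < d2 j ==> dist (ph j x) (ph j y) < om"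
  by blast
 define dq where "dq = 1 / (R * (1 + A2))"
 have dq: "dq > 0" "dq * A2 <= 1 / R"
 proof -
  show "dq > 0" using R A2 by (simp add: dq_def)
  have "dq * A2 = (A2 / (1 + A2)) * (1 / R)" by (simp add: dq_def)
  also have "... <= 1 * (1 / R)" using A2 R by (intro mult_right_mono) (auto simp: divide_le_eq_1)
  finally show "dq * A2 <= 1 / R" by simp
 qed
 obtain d3 where d3: "0 < d3" "d3 <= 1" "\<And>x y. norm y <= S + 1 ==> norm (x - y) < d3 ==> dist (q x) (q y) < dq"
  using uniformly_continuous_on_ball[OF qc dq(1)] by blast
 \<comment> \<open>The mollification radius is fixed after R: within distance \<open>ep\<close> of
   the ball of radius R, E decreases by at most a factor 2 and each \<open>ph j\<close> moves by at
   most \<open>om\<close>, while q moves by at most \<open>dq\<close> everywhere.\<close>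
 define ep where "ep = Min (insert d1 (insert d3 (range d2)))"
 have "ep > 0" unfolding ep_def using d1(1) d2(1) d3(1) by (subst Min_gr_iff) auto
 moreover have "ep <= d1" "ep <= d3" "ep <= d2 j" for j unfolding ep_def by (rule Min_le; simp)+
 ultimately have ep: "ep > 0" "ep <= d1" "ep <= d3" "\<And>j. ep <= d2 j" by blast+
 have clE: "1 / E y <= 2 / E x" if "norm y <= R" "norm (y - x) < ep" for x y
 proof -
  have "dist (E x) (E y) < e0" using d1(3)[OF that(1), of x] that(2) ep by (simp add: norm_minus_commute)
  then have "E x <= 2 * E y" using e0(2)[OF that(1)] by (simp add: dist_real_def)
  then show ?thesis using E_pos[of x] E_pos[of y] by (simp add: field_simps)
 qed
 have clP: "norm (ph j y - ph j x) <= om" if "norm y <= R" "norm (y - x) < ep" for x y j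
  using d2(2)[OF that(1), of x j] that(2) ep(4)[of j] by (simp add: dist_norm norm_minus_commute)
 have clq: "norm (q y - q x) <= dq" if "norm (x - y) < ep" for x y
 proof (cases "norm y <= S + 1")
  case True
  then show ?thesis using d3(3)[OF True, of x] that ep by (simp add: dist_norm norm_minus_commute)
 next
  case False
  moreover have "norm y <= norm x + norm (x - y)" using norm_triangle_ineq4[of x "x - y"] by simp
  moreover have "norm (x - y) < 1" using that ep d1(2) by linarith
  ultimately have "S < norm x" "S < norm y" by linarith+
  then show ?thesis using S dq by simp
 qed
 define rc where "rc = (%x::complex^'n. complex_of_real (mol ep x))"
 have rc3: "ck 3 rc" unfolding rc_def by (rule ck_mol[OF ep(1)])
 have rc2: "ck 2 rc" and rc1: "ck 1 rc" by (rule ck_le[OF rc3]; simp)+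
 have rcs: "csupp rc" unfolding rc_def using csupp_mol[OF ep(1)] by (rule csupp_comp) simp
 have drc: "ck 1 (dzb j rc)" "ck 1 (dz j rc)" for j
  using rc2 ck_dzb[of 1 rc j] ck_dz[of 1 rc j] by (simp_all add: numeral_2_eq_2 del: ck.simps)
 have rcc: "continuous_on UNIV rc" by (rule ck_cont[OF rc1])
 \<comment> \<open>\<open>be j\<close> is the mollification of E dzb_j h, with the derivative
   shifted to the kernel.\<close>
 define be where "be = (%j y. conv W (dzb j rc) y + conv (%x. cnj (ph j x) * W x) rc y)"
 have be1: "ck 1 (be j)" for j
  unfolding be_def by (intro ck_add ck_conv Wl pWl drc rc1 csupp_dzb rcs)
 have div0: "(\<Sum>j\<in>UNIV. dz j (be j) y) = 0" for y
 proof -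
  have dzbe: "dz j (be j) y = conv W (dz j (dzb j rc)) y + conv (%x. cnj (ph j x) * W x) (dz j rc) y" for j
   unfolding be_def
   by (subst dz_add) (simp_all add: ck_conv Wl pWl drc rc1 csupp_dzb rcs dz_conv del: ck.simps One_nat_def)
  \<comment> \<open>The reflected translate of the mollifier as test function turns the weak
    equation into a pointwise identity at y.\<close>
  define v where "v = (%x. rc (y - x))"
  have v3: "ck 3 v" and vs: "csupp v" unfolding v_def by (intro ck_reflect rc3 csupp_reflect rcs)+
  have dv: "dzb j v = (%x. - dzb j rc (y - x))" for j
   unfolding v_def using dzb_reflect[OF rc1] by (simp add: fun_eq_iff)
  have ddv: "dz j (dzb j v) x = dz j (dzb j rc) (y - x)" for j x
  proof -
   have "dz j (%x. - dzb j rc (y - x)) x = - dz j (%x. dzb j rc (y - x)) x"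
    by (rule dz_minus) (intro ck_reflect drc)
   then show ?thesis unfolding dv using dz_reflect[OF drc(1), of j j y x] by simp
  qed
  have cn1: "cnj (dzb j rc z) = dz j rc z" for j z
   using dz_cnj[OF rc1, of j z] by (simp add: rc_def)
  have cn2: "cnj (dz j (dzb j rc) z) = dz j (dzb j rc) z" for j z
  proof -
   have "cnj (dz j (dzb j rc) z) = dzb j (%x. cnj (dzb j rc x)) z" using dzb_cnj[OF drc(1), of j j z] by simp
   also have "... = dzb j (dz j rc) z" by (simp add: cn1)
   also have "... = dz j (dzb j rc) z" by (rule dzb_dz_commute[OF rc2])
   finally show ?thesis .
  qed
  have L: "h x * cnj (Lop v x) * E x = - (\<Sum>j\<in>UNIV. W x * dz j (dzb j rc) (y - x) + (cnj (ph j x) * W x) * dz j rc (y - x))" for x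
  proof -
   have "cnj (Lop v x) = - (\<Sum>j\<in>UNIV. dz j (dzb j rc) (y - x) + cnj (ph j x) * dz j rc (y - x))"
    by (simp add: Lop_def D_def ddv) (simp add: dv cn1 cn2)
   then show ?thesis by (simp add: W_def sum_distrib_left sum_distrib_right algebra_simps)
  qed
  have i1: "integrable lborel (%x. W x * dz j (dzb j rc) (y - x))" for j
   using ck_dz[of 0 "dzb j rc" j] drc(1)[of j]
   by (intro conv_integrable Wl csupp_dz csupp_dzb rcs) auto
  have i2: "integrable lborel (%x. (cnj (ph j x) * W x) * dz j rc (y - x))" for j
   by (intro conv_integrable pWl csupp_dz rcs ck_cont[OF drc(2)])
  have "0 = (\<integral>x. h x * cnj (Lop v x) * E x \<partial>lborel)" using weak[OF v3 vs] by simp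
  also have "... = - (\<Sum>j\<in>UNIV. conv W (dz j (dzb j rc)) y + conv (%x. cnj (ph j x) * W x) (dz j rc) y)"
   unfolding L conv_def using i1 i2 by (simp add: Bochner_Integration.integral_sum)
  finally show ?thesis by (simp add: dzbe)
 qed
 define We where "We = conv W rc"
 have We1: "ck 1 We" unfolding We_def by (intro ck_conv Wl rc1 rcs)
 \<comment> \<open>The commutator of mollification with multiplication by cnj ph_j. No derivative of
   W occurs in it, so the oscillation bound \<open>om\<close> controls it.\<close>
 define re where "re = (%j y. cnj (ph j y) * We y - conv (%x. cnj (ph j x) * W x) rc y)"
 have rec: "continuous_on UNIV (re j)" for j
  unfolding re_def using ck_cont[OF We1] continuous_on_conv[OF pWl rcc rcs]
  by (intro continuous_intros ph_cont) auto
 define He where "He = (%y. We y * iE y)"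
 have He1: "ck 1 He" unfolding He_def by (intro ck_mult We1 iE_ck)
 have dHe: "dzb j He y = (be j y + re j y) * iE y" for j y
 proof -
  have "dzb j He y = dzb j We y * iE y + We y * (cnj (ph j y) * iE y)"
   unfolding He_def by (simp add: dzb_mult We1 iE_ck dzb_iE del: ck.simps One_nat_def)
  moreover have "dzb j We y = conv W (dzb j rc) y" unfolding We_def by (simp add: dz_conv Wl rc1 rcs del: ck.simps One_nat_def)
  ultimately show ?thesis by (simp add: be_def re_def algebra_simps)
 qed
 define ch :: "complex^'n => real" where "ch = bump R 2"
 define cx where "cx = (%x::complex^'n. complex_of_real (ch x))"
 have R0: "R > 0" using R by simp
 have cx1: "ck 1 cx" unfolding cx_def ch_def using ck_bump[of 1 R] by (simp add: numeral_2_eq_2 del: ck.simps)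
 have chs: "csupp (ch :: complex^'n => real)" unfolding ch_def using csupp_bump[OF R0, of 1] by (simp add: numeral_2_eq_2)
 have cxs: "csupp cx" unfolding cx_def using chs by (rule csupp_comp) simp
 have ch0: "ch x \<ge> 0" "ch x <= 1" for x :: "complex^'n" unfolding ch_def by (rule bump_nonneg bump_le_1)+
 have chout: "ch x = 0" if "norm x > R" for x :: "complex^'n" unfolding ch_def using bump_eq_0[OF R0, of x 1] that by (simp add: numeral_2_eq_2)
 \<comment> \<open>R >= 2 R0 puts the support of psi into the half-radius ball, where the cutoff is
   at least (3/4)^2.\<close>
 have chin: "ch x \<ge> 1/2" if "norm x <= R0" for x :: "complex^'n"
 proof -
  have "norm x <= R / 2" using that R by linarith
  then have "(norm x)\<^sup>2 <= (R/2)\<^sup>2" by (intro power_mono) auto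
  then have "3/4 <= 1 - (x \<bullet> x) / R\<^sup>2" using R0 by (simp add: dot_square_norm power_divide field_simps)
  then have "3/4 <= max 0 (1 - (x \<bullet> x) / R\<^sup>2)" by (rule order_trans[OF _ max.cobounded2])
  then have "(3/4)^2 <= ch x" unfolding ch_def bump_def by (rule power_mono) simp
  then show ?thesis by (simp add: power2_eq_square)
 qed
 have chc: "continuous_on UNIV (ch :: complex^'n => real)" unfolding ch_def by (rule continuous_on_bump)
 have dch: "norm (dzb j cx x) <= 4 / R * indicator (cball 0 R) x" for j x
  unfolding cx_def ch_def by (rule cutoff_bounds[OF R0])
 define b2 r2 w2 where "b2 = (%j x. (ch x)\<^sup>2 * (norm (be j x))\<^sup>2 / E x)"
  and "r2 = (%j x. (ch x)\<^sup>2 * (norm (re j x))\<^sup>2 / E x)"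
  and "w2 = (%j x. (norm (dzb j cx x))\<^sup>2 * (norm (We x))\<^sup>2 / E x)"
 have Enz: "\<forall>x\<in>UNIV. E x ~= 0" using E_pos by (metis less_irrefl)
 have cdcx: "continuous_on UNIV (dzb j cx)" for j using ck_dzb[of 0 cx j] cx1 by auto
 have cont: "continuous_on UNIV (b2 j)" "continuous_on UNIV (r2 j)" "continuous_on UNIV (w2 j)" for j
  unfolding b2_def r2_def w2_def
  by (intro continuous_intros chc E_cont Enz ck_cont[OF be1] rec cdcx ck_cont[OF We1])+
 have cs: "csupp (b2 j)" "csupp (r2 j)" "csupp (w2 j)" for j
  unfolding b2_def r2_def w2_def divide_inverse
  using csupp_comp[OF chs, of "%t. t\<^sup>2"] csupp_comp[OF csupp_dzb[OF cxs, of j], of "%t. (norm t)\<^sup>2"]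
  by (intro csupp_mult1; simp)+
 have int: "integrable lborel (b2 j)" "integrable lborel (r2 j)" "integrable lborel (w2 j)" for j
  using cont cs by (auto intro: integrable_csupp)
 \<comment> \<open>The identity sum of dz_j (be_j) = 0 is tested with ch^2 times the conjugate of
   He. Since E dzb_j He = be_j + re_j, the leading term is ch^2 |be_j|^2 / E; half of it absorbs the
   products with re_j and with the derivative of the cutoff.\<close>
 have energy: "(\<integral>x. (\<Sum>j\<in>UNIV. b2 j x) \<partial>lborel) / 2 <= (\<integral>x. (\<Sum>j\<in>UNIV. r2 j x + 4 * w2 j x) \<partial>lborel)"
 proof -
  define G where "G = (%x. cx x * cx x * He x)"
  have G1: "ck 1 G" unfolding G_def by (intro ck_mult cx1 He1)
  have Gs: "csupp G" unfolding G_def by (intro csupp_mult1 cxs)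
  have dG: "dzb j G x = 2 * cx x * dzb j cx x * He x + cx x * cx x * ((be j x + re j x) * iE x)" for j x
   unfolding G_def
   by (simp add: dzb_mult ck_mult cx1 He1 dHe algebra_simps del: ck.simps One_nat_def)
  have F1: "ck 1 (%x. be j x * cnj (G x))" for j by (intro ck_mult ck_cnj be1 G1)
  have Fs: "csupp (%x. be j x * cnj (G x))" for j
   using csupp_comp[OF Gs, of cnj] by (intro csupp_mult2) simp
  have dF: "dz j (%x. be j x * cnj (G x)) x = dz j (be j) x * cnj (G x) + be j x * cnj (dzb j G x)" for j x
   by (simp add: dz_mult dz_cnj be1 G1 ck_cnj del: ck.simps One_nat_def)
  have Fi: "integrable lborel (dz j (%x. be j x * cnj (G x)))" for j
   using ck_dz[of 0 "%x. be j x * cnj (G x)" j] F1[of j] by (intro integrable_csupp csupp_dz Fs) auto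
  have s0: "(\<integral>x. (\<Sum>j\<in>UNIV. dz j (%x. be j x * cnj (G x)) x) \<partial>lborel) = 0"
   using Fi integral_dz_eq_0(1)[OF F1 Fs] by (simp add: Bochner_Integration.integral_sum)
  have si: "integrable lborel (%x. \<Sum>j\<in>UNIV. dz j (%x. be j x * cnj (G x)) x)" using Fi by simp
  have sF: "(\<Sum>j\<in>UNIV. dz j (%x. be j x * cnj (G x)) x) = (\<Sum>j\<in>UNIV. be j x * cnj (dzb j G x))" for x
   unfolding dF sum.distrib sum_distrib_right[symmetric] div0 by simp
  have pt: "b2 j x / 2 - (r2 j x + 4 * w2 j x) <= Re (be j x * cnj (dzb j G x))" for j x
  proof -
   define b r g t where "b = norm (be j x)" and "r = norm (re j x)" and "g = norm (dzb j cx x)" and "t = norm (We x)"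
   define Z1 where "Z1 = be j x * cnj (2 * cx x * dzb j cx x * He x)"
   define Z2 where "Z2 = be j x * cnj (cx x * cx x * (re j x * iE x))"
   have "be j x * cnj (cx x * cx x * (be j x * iE x)) = complex_of_real ((ch x)\<^sup>2 * b\<^sup>2 / E x)"
    using complex_norm_square[of "be j x"]
    by (simp add: b_def cx_def iE_def divide_inverse power2_eq_square)
   moreover have "be j x * cnj (dzb j G x) = Z1 + be j x * cnj (cx x * cx x * (be j x * iE x)) + Z2"
    unfolding dG Z1_def Z2_def by (simp add: algebra_simps)
   ultimately have 1: "Re (be j x * cnj (dzb j G x)) = Re Z1 + (ch x)\<^sup>2 * b\<^sup>2 / E x + Re Z2" by simp
   have nZ1: "norm Z1 = 2 * (ch x * b) * (g * t) / E x"
    unfolding Z1_def He_def using ch0[of x] by (simp add: norm_mult norm_iE cx_def b_def g_def t_def)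
   have nZ2: "norm Z2 = (ch x * b) * (ch x * r) / E x"
    unfolding Z2_def using ch0[of x] by (simp add: norm_mult norm_iE cx_def b_def r_def)
   have sq1: "2 * (ch x * b) * (g * t) <= (ch x * b)\<^sup>2 / 4 + 4 * (g * t)\<^sup>2"
   proof -
    have "0 <= (ch x * b / 2 - 2 * (g * t))\<^sup>2" by simp
    then show ?thesis by (simp add: power2_eq_square algebra_simps)
   qed
   have sq2: "(ch x * b) * (ch x * r) <= (ch x * b)\<^sup>2 / 4 + (ch x * r)\<^sup>2"
   proof -
    have "0 <= (ch x * b / 2 - (ch x * r))\<^sup>2" by simp
    then show ?thesis by (simp add: power2_eq_square algebra_simps)
   qed
   have n1: "norm Z1 <= ((ch x * b)\<^sup>2 / 4 + 4 * (g * t)\<^sup>2) / E x"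
    unfolding nZ1 using sq1 E_pos[of x] by (intro divide_right_mono) auto
   have n2: "norm Z2 <= ((ch x * b)\<^sup>2 / 4 + (ch x * r)\<^sup>2) / E x"
    unfolding nZ2 using sq2 E_pos[of x] by (intro divide_right_mono) auto
   have "Re Z1 \<ge> - norm Z1" "Re Z2 \<ge> - norm Z2"
    using abs_Re_le_cmod[of Z1] abs_Re_le_cmod[of Z2] by linarith+
   moreover have "b2 j x / 2 - (r2 j x + 4 * w2 j x) = (ch x)\<^sup>2 * b\<^sup>2 / E x - ((ch x * b)\<^sup>2 / 4 + 4 * (g * t)\<^sup>2) / E x - ((ch x * b)\<^sup>2 / 4 + (ch x * r)\<^sup>2) / E x"
    unfolding b2_def r2_def w2_def b_def[symmetric] r_def[symmetric] g_def[symmetric] t_def[symmetric]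
    using E_pos[of x] by (simp add: power_mult_distrib field_simps)
   ultimately show ?thesis using 1 n1 n2 by linarith
  qed
  have "(\<integral>x. (\<Sum>j\<in>UNIV. b2 j x / 2 - (r2 j x + 4 * w2 j x)) \<partial>lborel) <= (\<integral>x. Re (\<Sum>j\<in>UNIV. dz j (%x. be j x * cnj (G x)) x) \<partial>lborel)"
  proof (rule integral_mono)
   show "integrable lborel (%x. \<Sum>j\<in>UNIV. b2 j x / 2 - (r2 j x + 4 * w2 j x))" using int by simp
   show "integrable lborel (%x. Re (\<Sum>j\<in>UNIV. dz j (%x. be j x * cnj (G x)) x))" by (rule integrable_Re[OF si])
   show "(\<Sum>j\<in>UNIV. b2 j x / 2 - (r2 j x + 4 * w2 j x)) <= Re (\<Sum>j\<in>UNIV. dz j (%x. be j x * cnj (G x)) x)" for x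
    unfolding sF Re_sum by (intro sum_mono pt)
  qed
  also have "... = 0" using integral_Re[OF si] s0 by simp
  finally have "(\<integral>x. (\<Sum>j\<in>UNIV. b2 j x) / 2 - (\<Sum>j\<in>UNIV. r2 j x + 4 * w2 j x) \<partial>lborel) <= 0"
   by (simp add: sum_subtractf sum_divide_distrib)
  then show ?thesis using int by (simp add: Bochner_Integration.integral_diff)
 qed
 have nW: "ennreal (norm (\<integral>x. W x * k x * rc (y - x) \<partial>lborel)) <= ennreal c * (\<integral>\<^sup>+x. ennreal (norm (W x)) * ennreal (mol ep (y - x)) \<partial>lborel)"
  if k: "continuous_on UNIV k" and c: "c \<ge> 0" "\<And>x. norm (y - x) < ep ==> norm (k x) <= c" for k c y
 proof -
  have i: "integrable lborel (%x. W x * k x * rc (y - x))"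
   using conv_integrable[OF locint_mult_cont[OF Wl k] rcc rcs, of y] by (simp add: mult.commute)
  have mm: "mol ep \<in> borel_measurable (borel :: (complex^'n) measure)"
   by (rule borel_measurable_continuous_onI[OF continuous_on_mol[OF ep(1)]])
  note mm[measurable]
  have "ennreal (norm (\<integral>x. W x * k x * rc (y - x) \<partial>lborel)) <= (\<integral>\<^sup>+x. ennreal (norm (W x * k x * rc (y - x))) \<partial>lborel)"
   by (rule integral_norm_bound_ennreal[OF i])
  also have "... <= (\<integral>\<^sup>+x. ennreal c * (ennreal (norm (W x)) * ennreal (mol ep (y - x))) \<partial>lborel)"
  proof (rule nn_integral_mono)
   fix x
   have "norm (W x * k x * rc (y - x)) <= c * (norm (W x) * mol ep (y - x))"
   proof (cases "norm (y - x) < ep")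
    case True
    have "norm (W x * k x * rc (y - x)) = norm (k x) * (norm (W x) * mol ep (y - x))"
     using mol_nonneg[OF ep(1), of "y - x"] by (simp add: rc_def norm_mult)
    also have "... <= c * (norm (W x) * mol ep (y - x))"
     using mol_nonneg[OF ep(1), of "y - x"] by (intro mult_right_mono c(2)[OF True]) auto
    finally show ?thesis .
   next
    case False
    then show ?thesis using mol_eq_0[OF ep(1), of "y - x"] by (simp add: rc_def)
   qed
   then show "ennreal (norm (W x * k x * rc (y - x))) <= ennreal c * (ennreal (norm (W x)) * ennreal (mol ep (y - x)))"
    using c(1) mol_nonneg[OF ep(1), of "y - x"] ennreal_leI[of "norm (W x * k x * rc (y - x))" "c * (norm (W x) * mol ep (y - x))"]
    by (simp add: ennreal_mult)
  qed
  also have "... = ennreal c * (\<integral>\<^sup>+x. ennreal (norm (W x)) * ennreal (mol ep (y - x)) \<partial>lborel)"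
   by (simp add: nn_integral_cmult)
  finally show ?thesis .
 qed
 have avg: "(\<integral>\<^sup>+y. ennreal (c * indicator (cball 0 R) y / E y) * (\<integral>\<^sup>+x. ennreal (norm (W x)) * ennreal (mol ep (y - x)) \<partial>lborel)\<^sup>2 \<partial>lborel)
   <= ennreal (2 * c * A0)" if c: "c \<ge> 0" for c
 proof -
  have "(\<integral>\<^sup>+y. ennreal (c * indicator (cball 0 R) y / E y) * (\<integral>\<^sup>+x. ennreal (norm (W x)) * ennreal (mol ep (y - x)) \<partial>lborel)\<^sup>2 \<partial>lborel)
   <= (\<integral>\<^sup>+x. (ennreal (norm (W x)))\<^sup>2 * ennreal (c * (2 / E x)) \<partial>lborel)"
  proof (rule mol_average_bound[OF ep(1)])
   fix x y :: "complex^'n" assume xy: "norm (y - x) < ep"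
   show "ennreal (c * indicator (cball 0 R) y / E y) <= ennreal (c * (2 / E x))"
   proof (cases "norm y <= R")
    case True
    have "c * (1 / E y) <= c * (2 / E x)" by (intro mult_left_mono clE True xy c)
    then show ?thesis using True by (intro ennreal_leI) simp
   next
    case False
    then show ?thesis using c E_pos[of x] by simp
   qed
  qed measurable
  also have "... = (\<integral>\<^sup>+x. ennreal (2 * c * ((norm (h x))\<^sup>2 * E x)) \<partial>lborel)"
  proof (rule nn_integral_cong)
   fix x
   have "(ennreal (norm (W x)))\<^sup>2 * ennreal (c * (2 / E x)) = ennreal ((norm (W x))\<^sup>2 * (c * (2 / E x)))"
    using c E_pos[of x] by (subst ennreal_mult) (auto simp: ennreal_power)
   also have "(norm (W x))\<^sup>2 * (c * (2 / E x)) = 2 * c * ((norm (W x))\<^sup>2 / E x)" by simp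
   finally show "(ennreal (norm (W x)))\<^sup>2 * ennreal (c * (2 / E x)) = ennreal (2 * c * ((norm (h x))\<^sup>2 * E x))"
    unfolding W2 .
  qed
  also have "... = ennreal (2 * c * A0)"
  proof -
   have "integrable lborel (%x. 2 * c * ((norm (h x))\<^sup>2 * E x))" using h2 by (rule integrable_mult_right)
   moreover have "AE x in lborel. 0 <= 2 * c * ((norm (h x))\<^sup>2 * E x)"
    using c E_pos by (intro AE_I2 mult_nonneg_nonneg) (auto simp: less_imp_le)
   ultimately show ?thesis by (subst nn_integral_eq_integral) (auto simp: A0_def)
  qed
  finally show ?thesis .
 qed
 have to_real: "(\<integral>x. f x \<partial>lborel) <= 2 * c * A0"
  if f: "integrable lborel f" "\<And>x. f x \<ge> 0" and c: "c \<ge> 0"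
   and le: "\<And>y. ennreal (f y) <= ennreal (c * indicator (cball 0 R) y / E y) * (\<integral>\<^sup>+x. ennreal (norm (W x)) * ennreal (mol ep (y - x)) \<partial>lborel)\<^sup>2"
  for f c
 proof -
  have "ennreal (\<integral>x. f x \<partial>lborel) = (\<integral>\<^sup>+x. ennreal (f x) \<partial>lborel)"
   using f by (simp add: nn_integral_eq_integral)
  also have "... <= ennreal (2 * c * A0)"
   by (rule order_trans[OF nn_integral_mono[OF le] avg[OF c]])
  finally show ?thesis using c A0 by (simp add: ennreal_le_iff)
 qed
 have r2_le: "(\<integral>x. r2 j x \<partial>lborel) <= 1 / R\<^sup>2" for j
 proof -
  have "(\<integral>x. r2 j x \<partial>lborel) <= 2 * om\<^sup>2 * A0"
  proof (rule to_real[OF int(2)])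
   show "r2 j x \<ge> 0" for x using E_pos[of x] by (simp add: r2_def)
   fix y
   let ?a = "\<integral>\<^sup>+x. ennreal (norm (W x)) * ennreal (mol ep (y - x)) \<partial>lborel"
   show "ennreal (r2 j y) <= ennreal (om\<^sup>2 * indicator (cball 0 R) y / E y) * ?a\<^sup>2"
   proof (cases "norm y <= R")
    case True
    have i1: "integrable lborel (%x. W x * rc (y - x))" by (rule conv_integrable[OF Wl rcc rcs])
    have i2: "integrable lborel (%x. (cnj (ph j x) * W x) * rc (y - x))" by (rule conv_integrable[OF pWl rcc rcs])
    have "re j y = (\<integral>x. cnj (ph j y) * (W x * rc (y - x)) - (cnj (ph j x) * W x) * rc (y - x) \<partial>lborel)"
     unfolding re_def We_def conv_def using i1 i2 by simp
    also have "... = (\<integral>x. W x * (cnj (ph j y) - cnj (ph j x)) * rc (y - x) \<partial>lborel)"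
     by (intro Bochner_Integration.integral_cong) (auto simp: algebra_simps)
    finally have re_eq: "re j y = (\<integral>x. W x * (cnj (ph j y) - cnj (ph j x)) * rc (y - x) \<partial>lborel)" .
    have "ennreal (norm (re j y)) <= ennreal om * ?a"
     unfolding re_eq
    proof (rule nW)
     show "continuous_on UNIV (%x. cnj (ph j y) - cnj (ph j x))" by (intro continuous_intros ph_cont)
     show "norm (cnj (ph j y) - cnj (ph j x)) <= om" if "norm (y - x) < ep" for x
      using clP[OF True that, of j] by (metis complex_cnj_diff complex_mod_cnj)
    qed (use om in simp)
    then have "(ennreal (norm (re j y)))\<^sup>2 <= (ennreal om * ?a)\<^sup>2" by (intro power_mono) auto
    then have "ennreal (1 / E y) * (ennreal (norm (re j y)))\<^sup>2 <= ennreal (1 / E y) * (ennreal om * ?a)\<^sup>2"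
     by (intro mult_left_mono) auto
    also have "... = ennreal (om\<^sup>2 * indicator (cball 0 R) y / E y) * ?a\<^sup>2"
    proof -
     have "ennreal (om\<^sup>2 * indicator (cball 0 R) y / E y) = ennreal (1 / E y) * (ennreal om)\<^sup>2"
     proof -
      have "(ennreal om)\<^sup>2 = ennreal (om\<^sup>2)" using om by (simp add: ennreal_power)
      moreover have "ennreal (1 / E y) * ennreal (om\<^sup>2) = ennreal (1 / E y * om\<^sup>2)"
       using E_pos[of y] by (subst ennreal_mult) auto
      ultimately show ?thesis using True by simp
     qed
     then show ?thesis by (simp add: power_mult_distrib ac_simps)
    qed
    finally have "ennreal (1 / E y) * (ennreal (norm (re j y)))\<^sup>2 <= ennreal (om\<^sup>2 * indicator (cball 0 R) y / E y) * ?a\<^sup>2" .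
    moreover have "ennreal (r2 j y) <= ennreal (1 / E y) * (ennreal (norm (re j y)))\<^sup>2"
    proof -
     have "(ch y)\<^sup>2 <= 1" using ch0[of y] by (simp add: power_le_one)
     then have "(ch y)\<^sup>2 * (norm (re j y))\<^sup>2 / E y <= 1 * (norm (re j y))\<^sup>2 / E y"
      using E_pos[of y] by (intro divide_right_mono mult_right_mono) auto
     then have "ennreal (r2 j y) <= ennreal (1 / E y * (norm (re j y))\<^sup>2)" unfolding r2_def by (intro ennreal_leI) simp
     also have "... = ennreal (1 / E y) * (ennreal (norm (re j y)))\<^sup>2"
      using E_pos[of y] by (subst ennreal_mult) (auto simp: ennreal_power)
     finally show ?thesis .
    qed
    ultimately show ?thesis by (rule order_trans[rotated])
   next
    case False
    then show ?thesis using chout[of y] by (simp add: r2_def)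
   qed
  qed simp
  then show ?thesis using om(3) by linarith
 qed
 have w2_le: "(\<integral>x. w2 j x \<partial>lborel) <= 32 * A0 / R\<^sup>2" for j
 proof -
  have "(\<integral>x. w2 j x \<partial>lborel) <= 2 * (16 / R\<^sup>2) * A0"
  proof (rule to_real[OF int(3)])
   show "w2 j x \<ge> 0" for x using E_pos[of x] by (simp add: w2_def)
   fix y
   let ?a = "\<integral>\<^sup>+x. ennreal (norm (W x)) * ennreal (mol ep (y - x)) \<partial>lborel"
   have "ennreal (norm (We y)) <= ennreal 1 * ?a"
    using nW[of "%_. 1" 1 y] by (simp add: We_def conv_def)
   then have a: "(ennreal (norm (We y)))\<^sup>2 <= ?a\<^sup>2" by (intro power_mono) auto
   have "(norm (dzb j cx y))\<^sup>2 <= (4 / R * indicator (cball 0 R) y)\<^sup>2" by (intro power_mono dch) simp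
   also have "... = 16 / R\<^sup>2 * indicator (cball 0 R) y" by (auto simp: power_divide indicator_def)
   finally have "(norm (dzb j cx y))\<^sup>2 * (norm (We y))\<^sup>2 / E y <= (16 / R\<^sup>2 * indicator (cball 0 R) y) * (norm (We y))\<^sup>2 / E y"
    using E_pos[of y] by (intro divide_right_mono mult_right_mono) auto
   then have "ennreal (w2 j y) <= ennreal ((16 / R\<^sup>2 * indicator (cball 0 R) y / E y) * (norm (We y))\<^sup>2)"
    unfolding w2_def by (intro ennreal_leI) simp
   also have "... = ennreal (16 / R\<^sup>2 * indicator (cball 0 R) y / E y) * (ennreal (norm (We y)))\<^sup>2"
    using E_pos[of y] by (subst ennreal_mult) (auto simp: ennreal_power)
   also have "... <= ennreal (16 / R\<^sup>2 * indicator (cball 0 R) y / E y) * ?a\<^sup>2"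
    by (intro mult_left_mono a) auto
   finally show "ennreal (w2 j y) <= ennreal (16 / R\<^sup>2 * indicator (cball 0 R) y / E y) * ?a\<^sup>2" .
  qed simp
  then show ?thesis by (simp add: ac_simps)
 qed
 have B: "(\<integral>x. b2 j0 x \<partial>lborel) <= 2 * real CARD('n) * (1 + 128 * A0) / R\<^sup>2"
 proof -
  have "(\<integral>x. (\<Sum>j\<in>UNIV. r2 j x + 4 * w2 j x) \<partial>lborel) = (\<Sum>j\<in>UNIV. (\<integral>x. r2 j x \<partial>lborel) + 4 * (\<integral>x. w2 j x \<partial>lborel))"
   using int by (simp add: Bochner_Integration.integral_sum)
  also have "... <= (\<Sum>j\<in>(UNIV::'n set). 1 / R\<^sup>2 + 4 * (32 * A0 / R\<^sup>2))"
   by (intro sum_mono add_mono mult_left_mono r2_le w2_le) auto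
  also have "... = real CARD('n) * (1 + 128 * A0) / R\<^sup>2" by (simp add: algebra_simps add_divide_distrib)
  finally have "(\<integral>x. (\<Sum>j\<in>UNIV. b2 j x) \<partial>lborel) <= 2 * (real CARD('n) * (1 + 128 * A0) / R\<^sup>2)" using energy by simp
  moreover have "(\<integral>x. b2 j0 x \<partial>lborel) <= (\<integral>x. (\<Sum>j\<in>UNIV. b2 j x) \<partial>lborel)"
  proof (rule integral_mono[OF int(1)])
   show "integrable lborel (%x. \<Sum>j\<in>UNIV. b2 j x)" using int by simp
   show "b2 j0 x <= (\<Sum>j\<in>UNIV. b2 j x)" for x
    using E_pos[of x] by (intro member_le_sum) (auto simp: b2_def)
  qed
  ultimately show ?thesis by simp
 qed
 define P where "P = (\<integral>x. (norm (psi x))\<^sup>2 / E x \<partial>lborel)"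
 have Pi: "integrable lborel (%x. (norm (psi x))\<^sup>2 / E x)"
  using csupp_comp[OF psis, of "%t. (norm t)\<^sup>2"] unfolding divide_inverse
  by (intro integrable_csupp csupp_mult1 continuous_intros ck_cont[OF psi] E_cont Enz) auto
 \<comment> \<open>Integration by parts puts \<open>dzb j0\<close> on He, where be and re appear.
   Young's inequality with factors of order R and 1/R balances b2 and r2, both O(1/R^2), against the
   fixed integral of |psi|^2 / E, for a total of O(1/R).\<close>
 have main: "norm (\<integral>x. He x * dzb j0 psi x \<partial>lborel) <= 2 * R * ((\<integral>x. b2 j0 x \<partial>lborel) + (\<integral>x. r2 j0 x \<partial>lborel)) + P / R"
 proof -
  have ck: "ck 1 (%x. He x * psi x)" by (intro ck_mult He1 psi)
  have su: "csupp (%x. He x * psi x)" by (rule csupp_mult2[OF psis])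
  have e: "dzb j0 (%x. He x * psi x) x = (be j0 x + re j0 x) * iE x * psi x + He x * dzb j0 psi x" for x
   by (simp add: dzb_mult He1 psi dHe del: ck.simps One_nat_def)
  have c1: "continuous_on UNIV (%x. (be j0 x + re j0 x) * iE x * psi x)"
   by (intro continuous_intros ck_cont[OF be1] rec ck_cont[OF iE_ck] ck_cont[OF psi])
  have i1: "integrable lborel (%x. (be j0 x + re j0 x) * iE x * psi x)"
   by (rule integrable_csupp[OF c1 csupp_mult2[OF psis]])
  have i2: "integrable lborel (%x. He x * dzb j0 psi x)"
  proof (rule integrable_csupp)
   show "continuous_on UNIV (%x. He x * dzb j0 psi x)" by (intro continuous_intros ck_cont[OF He1] dpsi)
   show "csupp (%x. He x * dzb j0 psi x)" by (rule csupp_mult2[OF csupp_dzb[OF psis]])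
  qed
  have "(\<integral>x. (be j0 x + re j0 x) * iE x * psi x \<partial>lborel) + (\<integral>x. He x * dzb j0 psi x \<partial>lborel) = 0"
   using integral_dz_eq_0(2)[OF ck su, of j0] unfolding e Bochner_Integration.integral_add[OF i1 i2] .
  then have "norm (\<integral>x. He x * dzb j0 psi x \<partial>lborel) = norm (\<integral>x. (be j0 x + re j0 x) * iE x * psi x \<partial>lborel)"
   by (simp add: add_eq_0_iff)
  also have "... <= (\<integral>x. norm ((be j0 x + re j0 x) * iE x * psi x) \<partial>lborel)" by (rule integral_norm_bound)
  also have "... <= (\<integral>x. 2 * R * (b2 j0 x + r2 j0 x) + ((norm (psi x))\<^sup>2 / E x) / R \<partial>lborel)"
  proof (rule integral_mono)
   show "integrable lborel (%x. norm ((be j0 x + re j0 x) * iE x * psi x))" by (rule integrable_norm[OF i1])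
   show "integrable lborel (%x. 2 * R * (b2 j0 x + r2 j0 x) + ((norm (psi x))\<^sup>2 / E x) / R)"
    by (intro Bochner_Integration.integrable_add integrable_mult_right integrable_divide int Pi)
   show "norm ((be j0 x + re j0 x) * iE x * psi x) <= 2 * R * (b2 j0 x + r2 j0 x) + ((norm (psi x))\<^sup>2 / E x) / R" for x
   proof (cases "norm x <= R0")
    case False
    then have "psi x = 0" using supp by simp
    then show ?thesis using E_pos[of x] R by (simp add: b2_def r2_def)
   next
    case True
    define b r p where "b = norm (be j0 x)" and "r = norm (re j0 x)" and "p = norm (psi x)"
    have c4: "1 <= 4 * (ch x)\<^sup>2" using power_mono[OF chin[OF True], of 2] by (simp add: power_divide)
    have s1: "a * p <= R / 2 * a\<^sup>2 + p\<^sup>2 / (2 * R)" for a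
    proof -
     have "0 <= (R * a - p)\<^sup>2" by simp
     then have "2 * R * (a * p) <= R\<^sup>2 * a\<^sup>2 + p\<^sup>2" by (simp add: power2_eq_square algebra_simps)
     then show ?thesis using R0 by (simp add: field_simps power2_eq_square)
    qed
    have s2: "R / 2 * a\<^sup>2 <= 2 * R * ((ch x)\<^sup>2 * a\<^sup>2)" for a
     using mult_right_mono[OF c4, of "R / 2 * a\<^sup>2"] R0 by (simp add: ac_simps)
    have "norm ((be j0 x + re j0 x) * iE x * psi x) <= ((b + r) * p) / E x"
    proof -
     have "norm ((be j0 x + re j0 x) * iE x * psi x) = norm (be j0 x + re j0 x) * p / E x"
      by (simp add: norm_mult norm_iE p_def)
     also have "... <= ((b + r) * p) / E x"
      unfolding b_def r_def using E_pos[of x] by (intro divide_right_mono mult_right_mono norm_triangle_ineq) (auto simp: p_def)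
     finally show ?thesis .
    qed
    also have "... <= (2 * R * ((ch x)\<^sup>2 * b\<^sup>2) + 2 * R * ((ch x)\<^sup>2 * r\<^sup>2) + p\<^sup>2 / R) / E x"
    proof (rule divide_right_mono)
     have "p\<^sup>2 / (2 * R) + p\<^sup>2 / (2 * R) = p\<^sup>2 / R" using R0 by (simp add: field_simps)
     then show "(b + r) * p <= 2 * R * ((ch x)\<^sup>2 * b\<^sup>2) + 2 * R * ((ch x)\<^sup>2 * r\<^sup>2) + p\<^sup>2 / R"
      using s1[of b] s1[of r] s2[of b] s2[of r] unfolding distrib_right by linarith
    qed (use E_pos[of x] in simp)
    also have "... = 2 * R * (b2 j0 x + r2 j0 x) + ((norm (psi x))\<^sup>2 / E x) / R"
     unfolding b2_def r2_def b_def r_def p_def using E_pos[of x] R0 by (simp add: field_simps)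
    finally show ?thesis .
   qed
  qed
  also have "... = 2 * R * ((\<integral>x. b2 j0 x \<partial>lborel) + (\<integral>x. r2 j0 x \<partial>lborel)) + P / R"
   by (simp only: Bochner_Integration.integral_add[OF integrable_mult_right[OF Bochner_Integration.integrable_add[OF int(1) int(2)]]
     integrable_divide[OF Pi]] Bochner_Integration.integral_add[OF int(1) int(2)]
     integral_mult_right_zero integral_divide_zero P_def)
  finally show ?thesis .
 qed
 have eqHe: "(\<integral>x. He x * dzb j0 psi x \<partial>lborel) = (\<integral>y. conv W rc y * q y \<partial>lborel)"
  by (intro Bochner_Integration.integral_cong) (auto simp: He_def We_def q_def)
 have eqh: "(\<integral>x. h x * dzb j0 psi x \<partial>lborel) = (\<integral>x. W x * q x \<partial>lborel)"
  by (intro Bochner_Integration.integral_cong) (use E_pos in \<open>auto simp: W_def q_def iE_def less_imp_neq[symmetric]\<close>)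
 have "norm ((\<integral>y. conv W rc y * q y \<partial>lborel) - (\<integral>x. W x * q x \<partial>lborel)) <= dq * A2"
  unfolding rc_def A2_def by (rule integral_conv_mol[OF Wi qc qs ep(1) clq])
 then have "norm ((\<integral>x. He x * dzb j0 psi x \<partial>lborel) - (\<integral>x. h x * dzb j0 psi x \<partial>lborel)) <= 1 / R"
  unfolding eqHe eqh using dq(2) by linarith
 then have "norm (\<integral>x. h x * dzb j0 psi x \<partial>lborel) <= norm (\<integral>x. He x * dzb j0 psi x \<partial>lborel) + 1 / R"
  using norm_triangle_ineq2[of "\<integral>x. h x * dzb j0 psi x \<partial>lborel" "\<integral>x. He x * dzb j0 psi x \<partial>lborel"]
  by (simp add: norm_minus_commute)
 also have "... <= 2 * R * (2 * real CARD('n) * (1 + 128 * A0) / R\<^sup>2 + 1 / R\<^sup>2) + P / R + 1 / R"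
  using main mult_left_mono[OF add_mono[OF B r2_le[of j0]], of "2 * R"] R0 by linarith
 also have "... <= (5 + 8 * real CARD('n) * (1 + 128 * A0) + P) / R"
 proof -
  have "2 * R * (2 * real CARD('n) * (1 + 128 * A0) / R\<^sup>2 + 1 / R\<^sup>2) + P / R + 1 / R = (3 + 4 * real CARD('n) * (1 + 128 * A0) + P) / R"
   using R0 by (simp add: power2_eq_square field_simps)
  also have "... <= (5 + 8 * real CARD('n) * (1 + 128 * A0) + P) / R"
   using R0 A0 by (intro divide_right_mono) (auto intro!: mult_right_mono)
  finally show ?thesis .
 qed
 finally show ?thesis by (simp add: A0_def P_def)
qed

text \<open>The numerator in \<open>weak_solution_estimate\<close> does not involve R, so R tends to
  infinity.\<close>

lemma weak_solution_dzb:
 assumes h: "h \<in> borel_measurable borel" and h2: "integrable lborel (%x. (norm (h x))\<^sup>2 * E x)"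
  and weak: "\<And>v. ck 3 v ==> csupp v ==> (\<integral>x. h x * cnj (Lop v x) * E x \<partial>lborel) = 0"
  and psi: "ck 1 psi" "csupp psi"
 shows "(\<integral>x. h x * dzb j psi x \<partial>lborel) = 0"
proof -
 obtain R0 where R0: "\<And>x. R0 < norm x ==> psi x = 0" using psi by (auto simp: csupp_def)
 define K where "K = 5 + 8 * real CARD('n) * (1 + 128 * (\<integral>x. (norm (h x))\<^sup>2 * E x \<partial>lborel)) + (\<integral>x. (norm (psi x))\<^sup>2 / E x \<partial>lborel)"
 have "norm (\<integral>x. h x * dzb j psi x \<partial>lborel) <= K / real (Suc m)" if "real (Suc m) \<ge> 2 * R0" for m
  unfolding K_def by (rule weak_solution_estimate[OF h h2 weak psi(1) R0]) (use that in auto)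
 moreover have "\<forall>\<^sub>F m in sequentially. 2 * R0 <= real (Suc m)"
  using real_arch_simple[of "2 * R0"] by (auto simp: eventually_sequentially intro: order_trans)
   (metis le_SucI of_nat_le_iff of_nat_Suc order_trans)
 ultimately have ev: "\<forall>\<^sub>F m in sequentially. norm (\<integral>x. h x * dzb j psi x \<partial>lborel) <= K / real (Suc m)"
  by (auto elim: eventually_mono)
 have lim: "(%m. K / real (Suc m)) \<longlonglongrightarrow> 0"
  using tendsto_mult[OF tendsto_const[of K] LIMSEQ_inverse_real_of_nat] by (simp add: divide_inverse)
 have "norm (\<integral>x. h x * dzb j psi x \<partial>lborel) <= 0"
  by (rule tendsto_lowerbound[OF lim ev]) simp
 then show ?thesis by simp
qed

end

section \<open>Chain rule, and the twisting function\<close>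

lemma has_pd_real_comp:
 fixes f :: "'a::euclidean_space => real"
 assumes f: "has_pd (%x. complex_of_real (f x)) e f'" and g: "\<And>x. (g has_real_derivative g' (f x)) (at (f x))"
 shows "has_pd (%x. complex_of_real (g (f x))) e (%x. complex_of_real (g' (f x)) * f' x)"
 unfolding has_pd_def
proof
 fix x
 have d: "((%t. complex_of_real (f (x + t *\<^sub>R e))) has_vector_derivative f' x) (at 0)"
  using f by (simp add: has_pd_def)
 have r: "((%t. f (x + t *\<^sub>R e)) has_vector_derivative Re (f' x)) (at 0)"
  using bounded_linear.has_vector_derivative[OF bounded_linear_Re d] by simp
 have "((%t. complex_of_real (f (x + t *\<^sub>R e))) has_vector_derivative complex_of_real (Re (f' x))) (at 0)"
  by (rule bounded_linear.has_vector_derivative[OF bounded_linear_of_real r])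
 then have f': "f' x = complex_of_real (Re (f' x))" using vector_derivative_unique_at[OF d] by blast
 have "((%t. g (f (x + t *\<^sub>R e))) has_real_derivative g' (f x) * Re (f' x)) (at 0)"
  using DERIV_chain2[of g "g' (f x)" "%t. f (x + t *\<^sub>R e)" 0 "Re (f' x)" UNIV] g[of x] r
  by (simp add: has_real_derivative_iff_has_vector_derivative)
 then have "((%t. complex_of_real (g (f (x + t *\<^sub>R e)))) has_vector_derivative complex_of_real (g' (f x) * Re (f' x))) (at 0)"
  unfolding has_real_derivative_iff_has_vector_derivative
  by (rule bounded_linear.has_vector_derivative[OF bounded_linear_of_real])
 moreover have "complex_of_real (g' (f x) * Re (f' x)) = complex_of_real (g' (f x)) * f' x"
  by (subst (2) f') simp
 ultimately show "((%t. complex_of_real (g (f (x + t *\<^sub>R e)))) has_vector_derivative complex_of_real (g' (f x)) * f' x) (at 0)"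
  by (simp only:)
qed

lemma dz_real_comp:
 fixes f :: "complex^'n::finite => real"
 assumes f: "ck 1 (%x. complex_of_real (f x))" and g: "\<And>x. (g has_real_derivative g' (f x)) (at (f x))"
 shows "dz k (%x. complex_of_real (g (f x))) x = complex_of_real (g' (f x)) * dz k (%x. complex_of_real (f x)) x"
  and "dzb k (%x. complex_of_real (g (f x))) x = complex_of_real (g' (f x)) * dzb k (%x. complex_of_real (f x)) x"
proof -
 have "pd e (%x. complex_of_real (g (f x))) x = complex_of_real (g' (f x)) * pd e (%x. complex_of_real (f x)) x" if "e \<in> Basis" for e
  using pd_eq[OF has_pd_real_comp[where g' = g', OF ck1_has_pd[OF f that] g]] by metis
 then show "dz k (%x. complex_of_real (g (f x))) x = complex_of_real (g' (f x)) * dz k (%x. complex_of_real (f x)) x"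
  "dzb k (%x. complex_of_real (g (f x))) x = complex_of_real (g' (f x)) * dzb k (%x. complex_of_real (f x)) x"
  by (simp_all add: dz_def dzb_def) (simp_all add: field_simps)
qed

lemma ck_real_comp:
 fixes f :: "'a::euclidean_space => real"
 assumes f: "ck (Suc n) (%x. complex_of_real (f x))" and g: "\<And>x. (g has_real_derivative g' (f x)) (at (f x))"
  and g': "ck n (%x. complex_of_real (g' (f x)))"
 shows "ck (Suc n) (%x. complex_of_real (g (f x)))"
proof (rule ck_SucI)
 have fc: "continuous_on UNIV f" using continuous_on_Re[OF ck_cont[OF f]] by simp
 have "continuous_on UNIV (%x. g (f x))"
 proof (rule continuous_at_imp_continuous_on, rule ballI)
  fix x
  have "isCont f x" using fc by (simp add: continuous_on_eq_continuous_at)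
  moreover have "isCont g (f x)" by (rule DERIV_isCont[OF g])
  ultimately show "isCont (%x. g (f x)) x" by (rule isCont_o2)
 qed
 then show "continuous_on UNIV (%x. complex_of_real (g (f x)))" by (intro continuous_intros)
 show "has_pd (%x. complex_of_real (g (f x))) e (%x. complex_of_real (g' (f x)) * pd e (%x. complex_of_real (f x)) x)" if "e \<in> Basis" for e
  by (rule has_pd_real_comp[OF ck_has_pd[OF f that] g])
 show "ck n (%x. complex_of_real (g' (f x)) * pd e (%x. complex_of_real (f x)) x)" if "e \<in> Basis" for e
  by (rule ck_mult[OF g' ck_pd[OF f that]])
qed

lemma has_pd_nth: "has_pd (%x. x $ k) e (%_. e $ k)"
 unfolding has_pd_def
proof
 fix x :: "complex^'a"
 have "((%t. x $ k + of_real t * e $ k) has_vector_derivative e $ k) (at 0)"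
  by (auto intro!: derivative_eq_intros)
 then show "((%t. (x + t *\<^sub>R e) $ k) has_vector_derivative e $ k) (at 0)"
  by (simp add: scaleR_conv_of_real[of _ "e $ k"])
qed

lemma ck_nth: "ck n (%x. x $ k)"
proof (cases n)
 case (Suc m)
 show ?thesis unfolding Suc
  by (rule ck_SucI[OF _ has_pd_nth]) (auto intro!: continuous_intros ck_const)
qed (auto intro!: continuous_intros)

lemma dz_nth: "dz j (%x. x $ k) x = (if j = k then 1 else 0)" "dzb j (%x. x $ k) x = 0"
 by (auto simp: dz_def dzb_def pd_eq[OF has_pd_nth] axis_def)

text \<open>The twisting function of the Ohsawa--Takegoshi argument, a smoothing of \<open>1 - log (s / (1 + s))\<close> where
 \<open>s = |z\<^sub>m - w|\<^sup>2\<close>; its complex Hessian produces the kernel \<open>t / (s + t)\<^sup>2\<close>, an approximate delta function on the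
 hyperplane \<open>z\<^sub>m = w\<close>.\<close>

locale twist =
 fixes m :: "'n::finite" and w :: complex and t :: real
 assumes t: "0 < t" "t <= 1"
begin

definition sd :: "complex^'n => real" where "sd x = (norm (x $ m - w))\<^sup>2"
definition eta :: "complex^'n => real" where "eta x = 1 + (ln (1 + sd x) - ln (sd x + t))"
definition deta :: "complex^'n => complex" where
 "deta x = complex_of_real (1 / (1 + sd x) - 1 / (sd x + t)) * cnj (x $ m - w)"
definition kk :: "complex^'n => real" where "kk x = t / (sd x + t)\<^sup>2"
text \<open>A bounded smoothing of 1/(z_m - w): multiplied by z_m - w it becomes s/(s + t), and its
  conjugate derivative in z_m is the kernel \<open>kk\<close>.\<close>

definition u0 :: "complex^'n => complex" where "u0 x = cnj (x $ m - w) * inverse (complex_of_real (sd x + t))"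
text \<open>The weight that |Lop v|^2 acquires in the Bochner inequality for this twist.\<close>

definition Om :: "complex^'n => real" where "Om x = eta x + (norm (deta x))\<^sup>2"

lemma sd_nonneg: "sd x \<ge> 0" by (simp add: sd_def)

lemma sd_complex: "complex_of_real (sd x) = (x $ m - w) * cnj (x $ m - w)"
 unfolding sd_def by (rule complex_norm_square)

lemma ck_lin: "ck n (%x. x $ m - w)"
 by (intro ck_diff ck_nth ck_const)

lemma dz_lin: "dz j (%x. x $ m - w) x = (if j = m then 1 else 0)" "dzb j (%x. x $ m - w) x = 0"
 by (simp_all add: dz_diff dzb_diff ck_nth ck_const dz_nth del: ck.simps One_nat_def)

lemma ck_sd: "ck n (%x. complex_of_real (sd x))"
 unfolding sd_complex by (intro ck_mult ck_cnj ck_lin)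

lemma dz_sd: "dz j (%x. complex_of_real (sd x)) x = (if j = m then cnj (x $ m - w) else 0)"
 "dzb j (%x. complex_of_real (sd x)) x = (if j = m then x $ m - w else 0)"
 unfolding sd_complex
 by (simp_all add: dz_mult dzb_mult ck_lin ck_cnj dz_lin dz_cnj dzb_cnj del: ck.simps One_nat_def complex_cnj_diff)

lemma ck_sd_plus: "ck n (%x. complex_of_real (sd x + c))"
 unfolding of_real_add by (intro ck_add ck_sd ck_const)

lemma dz_sd_plus: "dz j (%x. complex_of_real (sd x + c)) x = dz j (%x. complex_of_real (sd x)) x"
 "dzb j (%x. complex_of_real (sd x + c)) x = dzb j (%x. complex_of_real (sd x)) x"
 unfolding of_real_add by (simp_all add: dz_add dzb_add ck_sd ck_const del: ck.simps One_nat_def)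

lemma ck_inv_sd: "c > 0 ==> ck n (%x. complex_of_real (1 / (sd x + c)))"
proof -
 assume c: "c > 0"
 have "ck n (%x. inverse (complex_of_real (sd x + c)))"
 proof (rule ck_inverse[OF _ ck_sd_plus])
  show "complex_of_real (sd x + c) ~= 0" for x using sd_nonneg[of x] c by (simp only: of_real_eq_0_iff)
 qed
 then show ?thesis by (simp add: inverse_eq_divide)
qed

lemma ck_ln_sd: "c > 0 ==> ck (Suc n) (%x. complex_of_real (ln (sd x + c)))"
proof (rule ck_real_comp[of n "%x. sd x + c" ln "%y. 1 / y"])
 assume c: "c > 0"
 show "ck (Suc n) (%x. complex_of_real (sd x + c))" by (rule ck_sd_plus)
 show "(ln has_real_derivative 1 / (sd x + c)) (at (sd x + c))" for x
  using sd_nonneg[of x] c by (auto intro!: derivative_eq_intros)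
 show "ck n (%x. complex_of_real (1 / (sd x + c)))" by (rule ck_inv_sd[OF c])
qed

lemma dz_ln_sd:
 assumes c: "c > 0"
 shows "dz j (%x. complex_of_real (ln (sd x + c))) x = complex_of_real (1 / (sd x + c)) * dz j (%x. complex_of_real (sd x)) x"
  "dzb j (%x. complex_of_real (ln (sd x + c))) x = complex_of_real (1 / (sd x + c)) * dzb j (%x. complex_of_real (sd x)) x"
proof -
 have d: "(ln has_real_derivative 1 / (sd x + c)) (at (sd x + c))" for x
  using sd_nonneg[of x] c by (auto intro!: derivative_eq_intros)
 show "dz j (%x. complex_of_real (ln (sd x + c))) x = complex_of_real (1 / (sd x + c)) * dz j (%x. complex_of_real (sd x)) x"
  "dzb j (%x. complex_of_real (ln (sd x + c))) x = complex_of_real (1 / (sd x + c)) * dzb j (%x. complex_of_real (sd x)) x"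
  using dz_real_comp[of "%x. sd x + c" ln "%y. 1 / y", OF ck_sd_plus d] by (simp_all only: dz_sd_plus)
qed

lemma eta_complex: "complex_of_real (eta x) = 1 + (complex_of_real (ln (sd x + 1)) - complex_of_real (ln (sd x + t)))"
 by (simp add: eta_def add.commute)

lemma ck_eta: "ck (Suc n) (%x. complex_of_real (eta x))"
 unfolding eta_complex using t by (intro ck_add ck_const ck_diff ck_ln_sd) auto

lemma dz_eta: "dz j (%x. complex_of_real (eta x)) x = (if j = m then deta x else 0)"
 and dzb_eta: "dzb j (%x. complex_of_real (eta x)) x = (if j = m then cnj (deta x) else 0)"
proof -
 have c: "ck 1 (%x. complex_of_real (ln (sd x + 1)))" "ck 1 (%x. complex_of_real (ln (sd x + t)))"
  using ck_ln_sd[of 1 0] ck_ln_sd[of t 0] t by simp_all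
 show "dz j (%x. complex_of_real (eta x)) x = (if j = m then deta x else 0)"
  unfolding eta_complex using t
  by (simp add: dz_add dz_diff c ck_diff ck_const dz_ln_sd dz_sd deta_def del: ck.simps One_nat_def)
   (simp add: algebra_simps)
 show "dzb j (%x. complex_of_real (eta x)) x = (if j = m then cnj (deta x) else 0)"
  unfolding eta_complex using t
  by (simp add: dzb_add dzb_diff c ck_diff ck_const dz_ln_sd dz_sd deta_def del: ck.simps One_nat_def)
   (simp add: algebra_simps)
qed

lemma dz_dzb_eta: "dz m (dzb m (%x. complex_of_real (eta x))) x = complex_of_real (1 / (1 + sd x)\<^sup>2 - kk x)"
proof -
 have inv: "dz m (%x. complex_of_real (1 / (sd x + c))) x = - cnj (x $ m - w) * complex_of_real (1 / (sd x + c)\<^sup>2)" if c: "c > 0" for c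
 proof -
  have nz: "complex_of_real (sd x + c) ~= 0" for x using sd_nonneg[of x] c by (simp only: of_real_eq_0_iff)
  have "dz m (%x. inverse (complex_of_real (sd x + c))) x
   = - cnj (x $ m - w) * (inverse (complex_of_real (sd x + c)) * inverse (complex_of_real (sd x + c)))"
   unfolding dz_inverse(1)[OF ck_sd_plus nz] dz_sd_plus dz_sd by simp
  then show ?thesis by (simp add: power2_eq_square divide_inverse)
 qed
 have e: "dzb m (%x. complex_of_real (eta x)) = (%x. (complex_of_real (1 / (sd x + 1)) - complex_of_real (1 / (sd x + t))) * (x $ m - w))"
  unfolding dzb_eta by (simp add: deta_def fun_eq_iff add.commute)
 have "dz m (dzb m (%x. complex_of_real (eta x))) x
   = (- cnj (x $ m - w) * complex_of_real (1 / (sd x + 1)\<^sup>2) - (- cnj (x $ m - w) * complex_of_real (1 / (sd x + t)\<^sup>2))) * (x $ m - w)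
    + (complex_of_real (1 / (sd x + 1)) - complex_of_real (1 / (sd x + t)))"
  unfolding e using t inv[of 1] inv[of t]
  by (simp only: dz_mult[OF ck_diff[OF ck_inv_sd ck_inv_sd] ck_lin] dz_diff[OF ck_inv_sd ck_inv_sd] dz_lin zero_less_one) simp
 also have "... = - (complex_of_real (sd x) * complex_of_real (1 / (sd x + 1)\<^sup>2)) + complex_of_real (sd x) * complex_of_real (1 / (sd x + t)\<^sup>2)
   + complex_of_real (1 / (sd x + 1)) - complex_of_real (1 / (sd x + t))"
 proof -
  have gen: "(- b * P - (- b * Q)) * a + (p - q) = - (a * b * P) + a * b * Q + p - q" for a b P Q p q :: complex
   by (simp add: algebra_simps)
  show ?thesis unfolding sd_complex[of x] by (rule gen)
 qed
 also have "... = complex_of_real (- (sd x * (1 / (sd x + 1)\<^sup>2)) + sd x * (1 / (sd x + t)\<^sup>2) + 1 / (sd x + 1) - 1 / (sd x + t))"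
  by simp
 also have "- (sd x * (1 / (sd x + 1)\<^sup>2)) + sd x * (1 / (sd x + t)\<^sup>2) + 1 / (sd x + 1) - 1 / (sd x + t) = 1 / (1 + sd x)\<^sup>2 - kk x"
 proof -
  have p: "sd x + 1 ~= 0" "sd x + t ~= 0" using sd_nonneg[of x] t by linarith+
  have a: "1 / (sd x + 1) = (sd x + 1) / (sd x + 1)\<^sup>2" "1 / (sd x + t) = (sd x + t) / (sd x + t)\<^sup>2"
   using p by (simp_all add: power2_eq_square)
  show ?thesis unfolding kk_def a by (simp add: add.commute[of 1] diff_divide_distrib add_divide_distrib)
 qed
 finally show ?thesis .
qed

lemma eta_ge_1: "eta x \<ge> 1"
 using sd_nonneg[of x] t by (simp add: eta_def)

lemma kk_pos: "kk x > 0"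
 unfolding kk_def using sd_nonneg[of x] t by (intro divide_pos_pos) auto

lemma kk_le: "kk x <= 1 / t"
proof -
 have "t * t <= (sd x + t)\<^sup>2" using sd_nonneg[of x] t by (simp add: power2_eq_square mult_mono)
 then show ?thesis unfolding kk_def using sd_nonneg[of x] t by (simp add: divide_simps)
qed

text \<open>This is the hypothesis of \<open>bochner_inequality\<close>. Since eta >= 1, the term 2
  eta covers both unit losses: the subtracted 1 and 1/(1 + s)^2 <= 1.\<close>

lemma kk_bound: "kk x <= 2 * eta x - (1 / (1 + sd x)\<^sup>2 - kk x) - 1"
proof -
 have "1 <= (1 + sd x)\<^sup>2" using sd_nonneg[of x] by (simp add: power2_eq_square algebra_simps)
 then have "1 / (1 + sd x)\<^sup>2 <= 1" by (simp add: divide_le_eq_1)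
 then show ?thesis using eta_ge_1[of x] by linarith
qed

lemma sd_cont: "continuous_on UNIV sd"
 using continuous_on_Re[OF ck_cont[OF ck_sd]] by simp

lemma kk_cont: "continuous_on UNIV kk"
 unfolding kk_def[abs_def]
proof (intro continuous_intros sd_cont ballI)
 fix x show "(sd x + t)\<^sup>2 ~= 0" using sd_nonneg[of x] t by (simp add: add_nonneg_eq_0_iff)
qed

lemma deta_cont: "continuous_on UNIV deta"
 using ck_dz[of 0 "%x. complex_of_real (eta x)" m] ck_eta[of 0] by (simp add: dz_eta[abs_def] del: ck.simps(2))

lemma Om_cont: "continuous_on UNIV Om"
 unfolding Om_def[abs_def] using continuous_on_Re[OF ck_cont[OF ck_eta[of 0]]]
 by (intro continuous_intros deta_cont) simp

lemma Om_ge_1: "Om x \<ge> 1"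
 using eta_ge_1[of x] by (simp add: Om_def add_increasing2)

lemma norm_deta: "(norm (deta x))\<^sup>2 <= sd x / (sd x + t)\<^sup>2"
proof -
 have "0 <= 1 / (1 + sd x)" "1 / (1 + sd x) <= 1 / (sd x + t)"
  using sd_nonneg[of x] t by (auto intro: divide_left_mono)
 then have "\<bar>1 / (1 + sd x) - 1 / (sd x + t)\<bar> <= 1 / (sd x + t)" by linarith
 then have "\<bar>1 / (1 + sd x) - 1 / (sd x + t)\<bar>\<^sup>2 <= (1 / (sd x + t))\<^sup>2" by (intro power_mono) auto
 then have "(1 / (1 + sd x) - 1 / (sd x + t))\<^sup>2 * sd x <= (1 / (sd x + t))\<^sup>2 * sd x"
  using sd_nonneg[of x] by (intro mult_right_mono) auto
 moreover have "(norm (deta x))\<^sup>2 = (1 / (1 + sd x) - 1 / (sd x + t))\<^sup>2 * sd x"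
  unfolding deta_def norm_mult norm_of_real power_mult_distrib complex_mod_cnj sd_def[symmetric] by simp
 ultimately show ?thesis by (simp add: power_divide)
qed

lemma ln_quot_le: "ln (1 + sd x) - ln (sd x + t) <= 1 / (sd x + t)"
proof -
 have p: "sd x + t > 0" using sd_nonneg[of x] t by linarith
 have "ln (1 + sd x) - ln (sd x + t) = ln ((1 + sd x) / (sd x + t))"
  using sd_nonneg[of x] p by (simp add: ln_div)
 also have "... <= (1 + sd x) / (sd x + t) - 1"
  using sd_nonneg[of x] p by (intro ln_le_minus_one) auto
 also have "... = (1 - t) / (sd x + t)" using p by (simp add: field_simps)
 also have "... <= 1 / (sd x + t)" using p t by (intro divide_right_mono) auto
 finally show ?thesis .
qed

text \<open>Om grows at most like 1 + 2/(s + t) near the hyperplane, and one factor s neutralises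
  this. The second bound is free of t, which is why the norm of the extension stays controlled as t
  tends to 0.\<close>

lemma Om_le: "Om x <= 1 + 2 / t" and sd_Om_le: "sd x * Om x <= sd x + 2"
proof -
 have p: "sd x + t > 0" using sd_nonneg[of x] t by linarith
 have a: "1 / (sd x + t) <= 1 / t" using sd_nonneg[of x] t by (intro divide_left_mono) auto
 have b: "sd x / (sd x + t)\<^sup>2 <= 1 / (sd x + t)" using p t by (simp add: divide_simps power2_eq_square)
 have "eta x <= 1 + 1 / (sd x + t)" using ln_quot_le[of x] by (simp add: eta_def)
 then have O: "Om x <= 1 + 2 * (1 / (sd x + t))" unfolding Om_def using norm_deta[of x] b by linarith
 show "Om x <= 1 + 2 / t" using O a by simp
 have "sd x * Om x <= sd x * (1 + 2 * (1 / (sd x + t)))" using O sd_nonneg[of x] by (rule mult_left_mono)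
 also have "... = sd x + 2 * (sd x / (sd x + t))" by (simp add: algebra_simps)
 also have "... <= sd x + 2 * 1"
  using p t sd_nonneg[of x] by (intro add_left_mono mult_left_mono) (auto simp: divide_le_eq_1)
 finally show "sd x * Om x <= sd x + 2" by simp
qed

lemma ck_u0: "ck 1 u0"
 unfolding u0_def[abs_def]
proof (intro ck_mult ck_cnj ck_lin ck_inverse[OF _ ck_sd_plus])
 show "complex_of_real (sd x + t) ~= 0" for x using sd_nonneg[of x] t by (simp only: of_real_eq_0_iff)
qed

lemma dzb_u0: "dzb j u0 x = (if j = m then complex_of_real (kk x) else 0)"
proof -
 have nz: "complex_of_real (sd x + t) ~= 0" for x using sd_nonneg[of x] t by (simp only: of_real_eq_0_iff)
 have "dzb j u0 x = dzb j (%x. cnj (x $ m - w)) x * inverse (complex_of_real (sd x + t))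
   + cnj (x $ m - w) * (- dzb j (%x. complex_of_real (sd x)) x * (inverse (complex_of_real (sd x + t)) * inverse (complex_of_real (sd x + t))))"
  unfolding u0_def[abs_def]
  by (subst dzb_mult[OF ck_cnj[OF ck_lin] ck_inverse[OF nz ck_sd_plus]])
   (simp only: dz_inverse(2)[OF ck_sd_plus nz] dz_sd_plus)
 also have "dzb j (%x. cnj (x $ m - w)) x = (if j = m then 1 else 0)"
  using dzb_cnj[OF ck_lin, of j x] by (simp add: dz_lin)
 finally have e0: "dzb j u0 x = (if j = m then 1 else 0) * inverse (complex_of_real (sd x + t))
   + cnj (x $ m - w) * (- dzb j (%x. complex_of_real (sd x)) x * (inverse (complex_of_real (sd x + t)) * inverse (complex_of_real (sd x + t))))" .
 have e: "dzb j u0 x = (if j = m then inverse (complex_of_real (sd x + t))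
   - complex_of_real (sd x) * (inverse (complex_of_real (sd x + t)) * inverse (complex_of_real (sd x + t))) else 0)"
 proof (cases "j = m")
  case True
  have gen: "1 * I + b * (- a * (I * I)) = I - (a * b) * (I * I)" for a b I :: complex
   by (simp add: algebra_simps)
  show ?thesis unfolding e0 dz_sd sd_complex[of x] by (simp only: True simp_thms if_True gen)
 qed (simp add: e0 dz_sd)
 have "inverse (sd x + t) - sd x * (inverse (sd x + t) * inverse (sd x + t)) = kk x"
 proof -
  have p: "sd x + t ~= 0" using sd_nonneg[of x] t by linarith
  have "inverse c - s * (inverse c * inverse c) = (c - s) / c\<^sup>2" if "c ~= 0" for c s :: real
   using that by (simp add: power2_eq_square divide_inverse) (simp add: field_simps)
  from this[OF p] show ?thesis by (simp add: kk_def)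
 qed
 then have "complex_of_real (inverse (sd x + t) - sd x * (inverse (sd x + t) * inverse (sd x + t))) = complex_of_real (kk x)" by simp
 then show ?thesis unfolding e by simp
qed

lemma one_minus_u0: "1 - (x $ m - w) * u0 x = complex_of_real (t / (sd x + t))"
proof -
 have p: "sd x + t ~= 0" using sd_nonneg[of x] t by linarith
 have "(x $ m - w) * u0 x = complex_of_real (sd x * inverse (sd x + t))"
  unfolding u0_def of_real_mult sd_complex of_real_inverse by simp
 moreover have "1 - sd x * inverse (sd x + t) = t / (sd x + t)" using p by (simp add: field_simps)
 ultimately show ?thesis by (metis of_real_1 of_real_diff)
qed

lemma norm_u0: "(norm (u0 x))\<^sup>2 <= 1 / t"
proof -
 have p: "sd x + t > 0" using sd_nonneg[of x] t by linarith
 have "(norm (u0 x))\<^sup>2 = sd x / (sd x + t)\<^sup>2"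
  unfolding u0_def norm_mult power_mult_distrib complex_mod_cnj sd_def[symmetric] norm_inverse norm_of_real
  using p by (simp add: power_inverse divide_inverse)
 also have "... <= 1 / t"
 proof -
  have "sd x * t <= (sd x + t)\<^sup>2" using sd_nonneg[of x] t by (simp add: power2_eq_square algebra_simps)
  then show ?thesis using p t by (simp add: divide_simps)
 qed
 finally show ?thesis .
qed

end

section \<open>Ohsawa-Takegoshi extension of the constant 1 from a hyperplane\<close>

lemma norm_nth_le_vec: "norm (x $ k) <= norm (x :: complex^'n::finite)"
 by (rule Finite_Cartesian_Product.norm_nth_le)

lemma norm_add_sq_le: "(norm (a + b))\<^sup>2 <= 2 * (norm a)\<^sup>2 + 2 * (norm (b::'a::real_normed_vector))\<^sup>2"
proof -
 have "(norm (a + b))\<^sup>2 <= (norm a + norm b)\<^sup>2" by (intro power_mono norm_triangle_ineq) auto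
 also have "... <= 2 * (norm a)\<^sup>2 + 2 * (norm b)\<^sup>2"
  using sum_squares_bound[of "norm a" "norm b"] by (simp add: power2_sum)
 finally show ?thesis .
qed

context psh_weight
begin

lemma Lop_cont: "ck 3 v ==> continuous_on UNIV (Lop v)"
 unfolding Lop_def[abs_def] using ck_dzb[of 2 v] ck_cont[OF ck_D[of "dzb _ v"]]
 by (intro continuous_intros) (simp add: numeral_3_eq_3 numeral_2_eq_2 del: ck.simps)

lemma csupp_Lop: "csupp v ==> csupp (Lop v)"
 unfolding Lop_def[abs_def] by (intro csupp_comp[of _ uminus] csupp_sum csupp_D csupp_dzb) auto

lemma Lop_lin:
 assumes v: "ck 3 v" and u: "ck 3 u"
 shows "Lop (%x. v x + c * u x) x = Lop v x + c * Lop u x"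
proof -
 have c1: "ck 1 v" "ck 1 u" using ck_le[OF v, of 1] ck_le[OF u, of 1] by (simp_all del: ck.simps)
 have c2: "ck 1 (dzb j v)" "ck 1 (dzb j u)" for j
  using ck_le[OF ck_dzb[of 2 v j], of 1] ck_le[OF ck_dzb[of 2 u j], of 1] assms
  by (simp_all add: numeral_3_eq_3 numeral_2_eq_2 del: ck.simps)
 have d: "dzb j (%x. v x + c * u x) = (%x. dzb j v x + c * dzb j u x)" for j
  by (simp add: fun_eq_iff dzb_add dzb_mult ck_mult ck_const c1 del: ck.simps One_nat_def)
 have "D j (%x. dzb j v x + c * dzb j u x) x = D j (dzb j v) x + c * D j (dzb j u) x" for j
  unfolding D_def by (simp add: dz_add dz_mult ck_mult ck_const c2 algebra_simps del: ck.simps One_nat_def)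
 then show ?thesis unfolding Lop_def d by (simp add: sum.distrib sum_distrib_left)
qed

text \<open>2 |h| <= |h|^2 E + 1/E, and 1/E is bounded on balls.\<close>

lemma locint_of_weighted_L2:
 assumes [measurable]: "h \<in> borel_measurable borel" and h2: "integrable lborel (%x. (norm (h x))\<^sup>2 * E x)"
 shows "locint h"
 unfolding locint_def
proof (intro conjI allI)
 fix R :: real
 have c: "continuous_on UNIV (%x. 1 / E x)"
  using E_pos by (intro continuous_intros E_cont) (auto simp: less_imp_neq[THEN not_sym])
 have i: "integrable lborel (%x. indicator (cball 0 R) x *\<^sub>R (1 / E x))"
  using borel_integrable_compact[OF compact_cball continuous_on_subset[OF c], of 0 R]
  by (simp add: set_integrable_def[symmetric])
 have [measurable]: "cball 0 R \<in> sets (borel :: (complex^'n) measure)" by simp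
 show "integrable lborel (%x. indicator (cball 0 R) x * norm (h x))"
 proof (rule Bochner_Integration.integrable_bound[OF Bochner_Integration.integrable_add[OF h2 i]])
  show "AE x in lborel. norm (indicator (cball 0 R) x * norm (h x)) <= norm ((norm (h x))\<^sup>2 * E x + indicator (cball 0 R) x *\<^sub>R (1 / E x))"
  proof (rule AE_I2)
   fix x
   have e: "E x > 0" by (rule E_pos)
   have "2 * norm (h x) <= (norm (h x))\<^sup>2 * E x + 1 / E x"
    using e zero_le_power2[of "norm (h x) * E x - 1"] by (simp add: field_simps power2_eq_square)
   then have "norm (h x) <= (norm (h x))\<^sup>2 * E x + 1 / E x" using norm_ge_zero[of "h x"] by linarith
   then show "norm (indicator (cball 0 R) x * norm (h x)) <= norm ((norm (h x))\<^sup>2 * E x + indicator (cball 0 R) x *\<^sub>R (1 / E x))"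
    using e by (auto simp: indicator_def)
  qed
 qed simp
qed simp

end

locale twisted_weight = psh_weight E ph + twist m w t
 for E :: "complex^'n::finite => real" and ph :: "'n => complex^'n => complex" and m :: 'n and w :: complex and t :: real
begin

lemma E_meas [measurable]: "E \<in> borel_measurable borel"
 by (rule borel_measurable_continuous_onI[OF E_cont])

lemma kk_meas [measurable]: "kk \<in> borel_measurable borel"
 by (rule borel_measurable_continuous_onI[OF kk_cont])

lemma Om_meas [measurable]: "Om \<in> borel_measurable borel"
 by (rule borel_measurable_continuous_onI[OF Om_cont])

lemma u0_meas [measurable]: "u0 \<in> borel_measurable borel"
 by (rule borel_measurable_continuous_onI[OF ck_cont[OF ck_u0]])

lemma integrable_kkE: "integrable lborel (%x. kk x * E x)"
proof (rule Bochner_Integration.integrable_bound[OF integrable_mult_right[OF E_int, of "1 / t"]])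
 show "AE x in lborel. norm (kk x * E x) <= norm (1 / t * E x)"
 proof (rule AE_I2)
  fix x show "norm (kk x * E x) <= norm (1 / t * E x)"
   using mult_right_mono[OF kk_le[of x] less_imp_le[OF E_pos[of x]]] kk_pos[of x] E_pos[of x] t by (simp add: abs_mult)
 qed
qed measurable

text \<open>Cauchy-Schwarz with kk E split into two square roots leaves the integral of kk |dzb_m
  v|^2 E, which the Bochner inequality bounds by the weighted norm of \<open>Lop v\<close>. It is
  the a priori estimate required for the Riesz argument.\<close>

lemma twisted_estimate:
 assumes v: "ck 3 v" "csupp v"
 shows "(norm (\<integral>x. of_real (kk x) * cnj (dzb m v x) * of_real (E x) \<partial>lborel))\<^sup>2
   <= (\<integral>x. kk x * E x \<partial>lborel) * (\<integral>x. (norm (Lop v x * of_real (sqrt (Om x * E x))))\<^sup>2 \<partial>lborel)"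
proof -
 have dc: "continuous_on UNIV (dzb m v)"
  using ck_cont[OF ck_dzb[of 2 v m]] v(1) by (simp add: numeral_3_eq_3 numeral_2_eq_2 del: ck.simps)
 have sc: "continuous_on UNIV (%x. complex_of_real (sqrt (kk x * E x)))"
  by (intro continuous_intros kk_cont E_cont)
 define f where "f = (%x. complex_of_real (sqrt (kk x * E x)))"
 define g where "g = (%x. cnj (dzb m v x) * complex_of_real (sqrt (kk x * E x)))"
 have kE: "kk x * E x \<ge> 0" for x using kk_pos[of x] E_pos[of x] by simp
 have [measurable]: "f \<in> borel_measurable lborel" "g \<in> borel_measurable lborel"
  unfolding f_def g_def using dc sc by (auto intro!: borel_measurable_continuous_onI continuous_intros)
 have f2: "(norm (f x))\<^sup>2 = kk x * E x" for x using kE[of x] by (simp add: f_def)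
 have g2: "(norm (g x))\<^sup>2 = kk x * (norm (dzb m v x))\<^sup>2 * E x" for x
  using kE[of x] by (simp add: g_def norm_mult power_mult_distrib)
 have gi: "integrable lborel (%x. kk x * (norm (dzb m v x))\<^sup>2 * E x)"
 proof (rule integrable_csupp)
  show "continuous_on UNIV (%x. kk x * (norm (dzb m v x))\<^sup>2 * E x)" by (intro continuous_intros kk_cont dc E_cont)
  show "csupp (%x. kk x * (norm (dzb m v x))\<^sup>2 * E x)"
   by (intro csupp_mult1 csupp_mult2 csupp_comp[of "dzb m v" "%z. (norm z)\<^sup>2"] csupp_dzb v) simp
 qed
 have fg: "f x * g x = of_real (kk x) * cnj (dzb m v x) * of_real (E x)" for x
 proof -
  have "complex_of_real (sqrt (kk x * E x)) * complex_of_real (sqrt (kk x * E x)) = complex_of_real (kk x * E x)"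
   using kE[of x] by (simp only: of_real_mult[symmetric] real_sqrt_mult_self abs_of_nonneg)
  then show ?thesis unfolding f_def g_def by (simp add: mult.left_commute mult.commute)
 qed
 have "norm (\<integral>x. f x * g x \<partial>lborel) <= sqrt (\<integral>x. (norm (f x))\<^sup>2 \<partial>lborel) * sqrt (\<integral>x. (norm (g x))\<^sup>2 \<partial>lborel)"
  by (rule L2_Cauchy_Schwarz(2)) (auto simp: f2 g2 integrable_kkE gi)
 then have "(norm (\<integral>x. f x * g x \<partial>lborel))\<^sup>2 <= (sqrt (\<integral>x. (norm (f x))\<^sup>2 \<partial>lborel) * sqrt (\<integral>x. (norm (g x))\<^sup>2 \<partial>lborel))\<^sup>2"
  by (intro power_mono) auto
 also have "... = (\<integral>x. kk x * E x \<partial>lborel) * (\<integral>x. kk x * (norm (dzb m v x))\<^sup>2 * E x \<partial>lborel)"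
  unfolding power_mult_distrib f2 g2 using kE less_imp_le[OF kk_pos] less_imp_le[OF E_pos] by simp
 also have "... <= (\<integral>x. kk x * E x \<partial>lborel) * (\<integral>x. (norm (Lop v x * of_real (sqrt (Om x * E x))))\<^sup>2 \<partial>lborel)"
 proof (rule mult_left_mono)
  have "(\<integral>x. kk x * (norm (dzb m v x))\<^sup>2 * E x \<partial>lborel)
   <= (\<integral>x. (eta x + (norm (dz m (%x. complex_of_real (eta x)) x))\<^sup>2) * (norm (Lop v x))\<^sup>2 * E x \<partial>lborel)"
  proof (rule bochner_inequality[OF v, where etamm = "%x. 1 / (1 + sd x)\<^sup>2 - kk x"])
   show "ck 2 (%x. complex_of_real (eta x))" using ck_eta[of 1] by (simp add: numeral_2_eq_2 del: ck.simps)
   show "eta x \<ge> 0" for x using eta_ge_1[of x] by linarith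
  qed (auto simp: dz_eta dz_dzb_eta kk_cont kk_bound)
  also have "(%x. (eta x + (norm (dz m (%x. complex_of_real (eta x)) x))\<^sup>2) * (norm (Lop v x))\<^sup>2 * E x)
    = (%x. (norm (Lop v x * of_real (sqrt (Om x * E x))))\<^sup>2)"
  proof
   fix x
   have "Om x * E x \<ge> 0" using Om_ge_1[of x] E_pos[of x] by simp
   then show "(eta x + (norm (dz m (%x. complex_of_real (eta x)) x))\<^sup>2) * (norm (Lop v x))\<^sup>2 * E x
     = (norm (Lop v x * of_real (sqrt (Om x * E x))))\<^sup>2"
    by (simp add: norm_mult power_mult_distrib dz_eta Om_def[symmetric])
  qed
  finally show "(\<integral>x. kk x * (norm (dzb m v x))\<^sup>2 * E x \<partial>lborel)
   <= (\<integral>x. (norm (Lop v x * of_real (sqrt (Om x * E x))))\<^sup>2 \<partial>lborel)" .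
  show "0 <= (\<integral>x. kk x * E x \<partial>lborel)" using kE by simp
 qed
 finally show ?thesis by (simp only: fg)
qed

text \<open>Riesz representation for the map v to \<open>Lop v\<close> times sqrt (Om E). Up to
  normalisation U solves in the weak sense the same equation as \<open>u0\<close>, but with norm
  bounded by the integral of kk E.\<close>

lemma twisted_solution:
 obtains U where "U \<in> borel_measurable lborel" "integrable lborel (%x. (norm (U x))\<^sup>2)"
  "(\<integral>x. (norm (U x))\<^sup>2 \<partial>lborel) <= (\<integral>x. kk x * E x \<partial>lborel)"
  "\<And>v. ck 3 v ==> csupp v ==> (\<integral>x. U x * cnj (Lop v x * of_real (sqrt (Om x * E x))) \<partial>lborel)
    = (\<integral>x. of_real (kk x) * cnj (dzb m v x) * of_real (E x) \<partial>lborel)"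
proof (rule L2_representation[where V = "{v. ck 3 v \<and> csupp v}" and ?v0.0 = "%_. 0" and comb = "%v c u x. v x + c * u x"
   and T = "%v x. Lop v x * complex_of_real (sqrt (Om x * E x))" and M = "lborel"
   and l = "%v. \<integral>x. of_real (kk x) * cnj (dzb m v x) * of_real (E x) \<partial>lborel" and A = "\<integral>x. kk x * E x \<partial>lborel"])
 have csq: "continuous_on UNIV (%x. sqrt (Om x * E x))" by (intro continuous_intros Om_cont E_cont)
 show "(%_. 0) \<in> {v. ck 3 v \<and> csupp v}" by (simp add: ck_const csupp_def del: ck.simps)
 show "(%x. v x + c * u x) \<in> {v. ck 3 v \<and> csupp v}" if "v \<in> {v. ck 3 v \<and> csupp v}" "u \<in> {v. ck 3 v \<and> csupp v}" for v c u
  using that by (auto intro!: ck_add ck_mult ck_const csupp_add csupp_mult2 simp del: ck.simps)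
 show "Lop (%x. v x + c * u x) x * complex_of_real (sqrt (Om x * E x))
   = Lop v x * complex_of_real (sqrt (Om x * E x)) + c * (Lop u x * complex_of_real (sqrt (Om x * E x)))"
  if "v \<in> {v. ck 3 v \<and> csupp v}" "u \<in> {v. ck 3 v \<and> csupp v}" for v c u x
  using that by (simp add: Lop_lin algebra_simps del: ck.simps)
 show "(\<integral>x. of_real (kk x) * cnj (dzb m (%x. v x + c * u x) x) * of_real (E x) \<partial>lborel)
   = (\<integral>x. of_real (kk x) * cnj (dzb m v x) * of_real (E x) \<partial>lborel)
   + cnj c * (\<integral>x. of_real (kk x) * cnj (dzb m u x) * of_real (E x) \<partial>lborel)"
  if "v \<in> {v. ck 3 v \<and> csupp v}" "u \<in> {v. ck 3 v \<and> csupp v}" for v c u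
 proof -
  have vu: "ck 1 v" "ck 1 u" "csupp v" "csupp u" using that ck_le[of 3 _ 1] by (auto simp del: ck.simps)
  have i: "integrable lborel (%x. of_real (kk x) * cnj (dzb m a x) * complex_of_real (E x))" if "ck 1 a" "csupp a" for a
  proof (rule integrable_csupp)
   have "continuous_on UNIV (dzb m a)" using ck_dzb[of 0 a m] that by simp
   then show "continuous_on UNIV (%x. of_real (kk x) * cnj (dzb m a x) * complex_of_real (E x))"
    by (intro continuous_intros kk_cont E_cont)
   show "csupp (%x. of_real (kk x) * cnj (dzb m a x) * complex_of_real (E x))"
    by (intro csupp_mult1 csupp_mult2 csupp_comp[of "dzb m a" cnj] csupp_dzb that) simp
  qed
  have e: "of_real (kk x) * cnj (dzb m (%x. v x + c * u x) x) * complex_of_real (E x)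
   = of_real (kk x) * cnj (dzb m v x) * complex_of_real (E x) + cnj c * (of_real (kk x) * cnj (dzb m u x) * complex_of_real (E x))" for x
   by (simp add: dzb_add dzb_mult vu ck_mult ck_const algebra_simps del: ck.simps One_nat_def)
  show ?thesis
   unfolding e by (simp only: Bochner_Integration.integral_add[OF i[OF vu(1,3)] integrable_mult_right[OF i[OF vu(2,4)]]] integral_mult_right_zero)
 qed
 have Tc: "continuous_on UNIV (%x. Lop v x * complex_of_real (sqrt (Om x * E x)))" if "ck 3 v" for v
  by (intro continuous_intros Lop_cont that csq)
 show "(%x. Lop v x * complex_of_real (sqrt (Om x * E x))) \<in> borel_measurable lborel" if "v \<in> {v. ck 3 v \<and> csupp v}" for v
  using that Tc[of v] by (simp add: borel_measurable_continuous_onI del: ck.simps)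
 show "integrable lborel (%x. (norm (Lop v x * complex_of_real (sqrt (Om x * E x))))\<^sup>2)" if "v \<in> {v. ck 3 v \<and> csupp v}" for v
 proof (rule integrable_csupp)
  show "continuous_on UNIV (%x. (norm (Lop v x * complex_of_real (sqrt (Om x * E x))))\<^sup>2)"
   using that by (intro continuous_on_power continuous_on_norm Tc) simp
  show "csupp (%x. (norm (Lop v x * complex_of_real (sqrt (Om x * E x))))\<^sup>2)"
   using that by (intro csupp_comp[of "%x. Lop v x * complex_of_real (sqrt (Om x * E x))" "%z. (norm z)\<^sup>2"] csupp_mult1 csupp_Lop) auto
 qed
 show "0 <= (\<integral>x. kk x * E x \<partial>lborel)" using less_imp_le[OF kk_pos] less_imp_le[OF E_pos] by simp
qed (use twisted_estimate in auto)

text \<open>E times the conjugate of \<open>Lop v\<close> is minus a divergence in the conjugate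
  variables; integrating by parts onto \<open>u0\<close>, the component dzb_m u0 = kk survives. So
  \<open>u0\<close> represents the same functional as U.\<close>

lemma integral_u0_Lop:
 assumes v: "ck 3 v" "csupp v"
 shows "integrable lborel (%x. u0 x * cnj (Lop v x) * of_real (E x))"
  and "(\<integral>x. u0 x * cnj (Lop v x) * of_real (E x) \<partial>lborel) = (\<integral>x. of_real (kk x) * cnj (dzb m v x) * of_real (E x) \<partial>lborel)"
proof -
 have c2: "ck 1 (dzb j v)" for j
  using ck_le[OF ck_dzb[of 2 v j], of 1] v(1) by (simp_all add: numeral_3_eq_3 numeral_2_eq_2 del: ck.simps)
 define q where "q = (%j x. cnj (dzb j v x) * complex_of_real (E x))"
 have q1: "ck 1 (q j)" for j unfolding q_def by (intro ck_mult ck_cnj c2 E_ck)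
 have qs: "csupp (q j)" for j unfolding q_def
  by (intro csupp_mult1 csupp_comp[of "dzb j v" cnj] csupp_dzb v) simp
 have L: "u0 x * cnj (Lop v x) * of_real (E x) = - (\<Sum>j\<in>UNIV. u0 x * dzb j (q j) x)" for x
  unfolding Lop_def q_def dzb_mult_E[OF c2]
  by (simp add: sum_distrib_left sum_distrib_right mult.assoc)
 have dqc: "continuous_on UNIV (dzb j (q j))" for j using ck_dzb[of 0 "q j" j] q1 by simp
 have i: "integrable lborel (%x. u0 x * dzb j (q j) x)" for j
  by (intro integrable_csupp continuous_intros ck_cont[OF ck_u0] csupp_mult2 csupp_dzb qs dqc)
 show "integrable lborel (%x. u0 x * cnj (Lop v x) * of_real (E x))" unfolding L using i by (intro Bochner_Integration.integrable_minus Bochner_Integration.integrable_sum) auto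
 have "continuous_on UNIV (dzb j u0)" for j using ck_dzb[of 0 u0 j] ck_u0 by simp
 then have i2: "integrable lborel (%x. dzb j u0 x * q j x)" for j
  by (intro integrable_csupp continuous_intros ck_cont[OF q1] csupp_mult2 qs)
 have ibp: "(\<integral>x. u0 x * dzb j (q j) x \<partial>lborel) = - (\<integral>x. dzb j u0 x * q j x \<partial>lborel)" for j
 proof -
  have "(\<integral>x. dzb j (%x. u0 x * q j x) x \<partial>lborel) = 0"
   by (intro integral_dz_eq_0(2) ck_mult ck_u0 q1 csupp_mult2 qs)
  then have "(\<integral>x. dzb j u0 x * q j x \<partial>lborel) + (\<integral>x. u0 x * dzb j (q j) x \<partial>lborel) = 0"
   unfolding dzb_mult[OF ck_u0 q1] by (simp only: Bochner_Integration.integral_add[OF i2 i])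
  then show ?thesis by (simp add: eq_neg_iff_add_eq_0 add.commute)
 qed
 have "(\<integral>x. u0 x * cnj (Lop v x) * of_real (E x) \<partial>lborel) = (\<Sum>j\<in>UNIV. \<integral>x. dzb j u0 x * q j x \<partial>lborel)"
  unfolding L using i by (simp add: ibp sum_negf)
 also have "... = (\<Sum>j\<in>UNIV. if j = m then (\<integral>x. of_real (kk x) * q m x \<partial>lborel) else 0)"
  unfolding dzb_u0 by (intro sum.cong) auto
 also have "... = (\<integral>x. of_real (kk x) * cnj (dzb m v x) * of_real (E x) \<partial>lborel)"
  by (simp add: q_def mult.assoc)
 finally show "(\<integral>x. u0 x * cnj (Lop v x) * of_real (E x) \<partial>lborel) = (\<integral>x. of_real (kk x) * cnj (dzb m v x) * of_real (E x) \<partial>lborel)" .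
qed

text \<open>\<open>u0\<close> and the Riesz solution u represent the same functional, so their
  difference h is annihilated weakly. In 1 - (z_m - w) h the part from \<open>u0\<close> leaves t/(s
  + t), whose square is t kk, and the part from u is controlled by s Om <= s + 2.\<close>

lemma weak_extension:
 obtains h where "h \<in> borel_measurable borel" "integrable lborel (%x. (norm (h x))\<^sup>2 * E x)"
  "\<And>v. ck 3 v ==> csupp v ==> (\<integral>x. h x * cnj (Lop v x) * E x \<partial>lborel) = 0"
  "\<And>R. (\<integral>\<^sup>+x. indicator (cball 0 R) x * ennreal ((norm (1 - (x $ m - w) * h x))\<^sup>2 * E x) \<partial>lborel)
    <= ennreal (2 * ((R + norm w)\<^sup>2 + 3) * (\<integral>x. kk x * E x \<partial>lborel))"
proof -
 obtain U where U [measurable]: "U \<in> borel_measurable lborel" and U2: "integrable lborel (%x. (norm (U x))\<^sup>2)"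
  and UA: "(\<integral>x. (norm (U x))\<^sup>2 \<partial>lborel) <= (\<integral>x. kk x * E x \<partial>lborel)"
  and Uw: "\<And>v. ck 3 v ==> csupp v ==> (\<integral>x. U x * cnj (Lop v x * of_real (sqrt (Om x * E x))) \<partial>lborel)
    = (\<integral>x. of_real (kk x) * cnj (dzb m v x) * of_real (E x) \<partial>lborel)"
  using twisted_solution by blast
 \<comment> \<open>Undoes the factor sqrt (Om E) built into the Riesz map; it gives |u|^2 E = |U|^2
   Om.\<close>
 define u where "u = (%x. U x * of_real (sqrt (Om x / E x)))"
 define h where "h = (%x. u0 x - u x)"
 have OE: "Om x / E x \<ge> 0" "Om x \<ge> 0" "E x > 0" for x using Om_ge_1[of x] E_pos[of x] by auto
 have um [measurable]: "u \<in> borel_measurable borel" unfolding u_def using U by simp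
 have hm [measurable]: "h \<in> borel_measurable borel" unfolding h_def by simp
 have u2: "(norm (u x))\<^sup>2 * E x = (norm (U x))\<^sup>2 * Om x" for x
  unfolding u_def using OE[of x] by (simp add: norm_mult power_mult_distrib)
 have h2: "integrable lborel (%x. (norm (h x))\<^sup>2 * E x)"
 proof (rule Bochner_Integration.integrable_bound)
  show "integrable lborel (%x. 2 / t * E x + 2 * (1 + 2 / t) * (norm (U x))\<^sup>2)"
   by (intro Bochner_Integration.integrable_add integrable_mult_right E_int U2)
  show "AE x in lborel. norm ((norm (h x))\<^sup>2 * E x) <= norm (2 / t * E x + 2 * (1 + 2 / t) * (norm (U x))\<^sup>2)"
  proof (rule AE_I2)
   fix x
   have "(norm (h x))\<^sup>2 * E x <= (2 * (norm (u0 x))\<^sup>2 + 2 * (norm (u x))\<^sup>2) * E x"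
    using norm_add_sq_le[of "u0 x" "- u x"] OE[of x] by (intro mult_right_mono) (auto simp: h_def)
   also have "... = 2 * (norm (u0 x))\<^sup>2 * E x + 2 * ((norm (U x))\<^sup>2 * Om x)"
    unfolding u2[symmetric] by (simp add: algebra_simps)
   also have "... <= 2 * (1 / t) * E x + 2 * ((norm (U x))\<^sup>2 * (1 + 2 / t))"
    using norm_u0[of x] Om_le[of x] OE[of x] by (intro add_mono mult_right_mono mult_left_mono) auto
   finally have "(norm (h x))\<^sup>2 * E x <= 2 / t * E x + 2 * (1 + 2 / t) * (norm (U x))\<^sup>2" by (simp add: algebra_simps)
   then show "norm ((norm (h x))\<^sup>2 * E x) <= norm (2 / t * E x + 2 * (1 + 2 / t) * (norm (U x))\<^sup>2)"
    using OE(3)[of x] by simp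
  qed
 qed simp
 have weak: "(\<integral>x. h x * cnj (Lop v x) * E x \<partial>lborel) = 0" if v: "ck 3 v" "csupp v" for v
 proof -
  have [measurable]: "Lop v \<in> borel_measurable borel" by (rule borel_measurable_continuous_onI[OF Lop_cont[OF v(1)]])
  have LU: "u x * cnj (Lop v x) * of_real (E x) = U x * cnj (Lop v x * of_real (sqrt (Om x * E x)))" for x
  proof -
   have "sqrt (Om x / E x) * E x = sqrt (Om x * E x)"
    using OE[of x] by (simp add: real_sqrt_divide real_sqrt_mult field_simps)
   then have "complex_of_real (sqrt (Om x / E x)) * of_real (E x) = of_real (sqrt (Om x * E x))"
    by (simp only: of_real_mult[symmetric])
   then show ?thesis unfolding u_def by (simp add: mult.assoc mult.left_commute mult.commute)
  qed
  have sqm: "continuous_on UNIV (%x. cnj (Lop v x * complex_of_real (sqrt (Om x * E x))))"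
   by (intro continuous_intros Lop_cont v Om_cont E_cont)
  have i: "integrable lborel (%x. U x * cnj (Lop v x * of_real (sqrt (Om x * E x))))"
  proof (rule L2_Cauchy_Schwarz(1)[OF U _ U2])
   show "(%x. cnj (Lop v x * complex_of_real (sqrt (Om x * E x)))) \<in> borel_measurable lborel"
    using borel_measurable_continuous_onI[OF sqm] by simp
   show "integrable lborel (%x. (norm (cnj (Lop v x * complex_of_real (sqrt (Om x * E x)))))\<^sup>2)"
   proof (rule integrable_csupp)
    show "continuous_on UNIV (%x. (norm (cnj (Lop v x * complex_of_real (sqrt (Om x * E x)))))\<^sup>2)"
     by (intro continuous_on_power continuous_on_norm sqm)
    show "csupp (%x. (norm (cnj (Lop v x * complex_of_real (sqrt (Om x * E x)))))\<^sup>2)"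
     using v by (intro csupp_comp[of "%x. Lop v x * complex_of_real (sqrt (Om x * E x))" "%z. (norm (cnj z))\<^sup>2"] csupp_mult1 csupp_Lop) auto
   qed
  qed
  have e: "h x * cnj (Lop v x) * E x = u0 x * cnj (Lop v x) * of_real (E x) - U x * cnj (Lop v x * of_real (sqrt (Om x * E x)))" for x
   unfolding LU[symmetric] h_def by (simp add: algebra_simps)
  show ?thesis unfolding e
   by (simp only: Bochner_Integration.integral_diff[OF integral_u0_Lop(1)[OF v] i] integral_u0_Lop(2)[OF v] Uw[OF v] diff_self)
 qed
 have bound: "(\<integral>\<^sup>+x. indicator (cball 0 R) x * ennreal ((norm (1 - (x $ m - w) * h x))\<^sup>2 * E x) \<partial>lborel)
    <= ennreal (2 * ((R + norm w)\<^sup>2 + 3) * (\<integral>x. kk x * E x \<partial>lborel))" for R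
 proof -
  have pt: "indicator (cball 0 R) x * ennreal ((norm (1 - (x $ m - w) * h x))\<^sup>2 * E x)
    <= ennreal (2 * (kk x * E x) + 2 * ((R + norm w)\<^sup>2 + 2) * (norm (U x))\<^sup>2)" for x
  proof (cases "x \<in> cball 0 R")
   case True
   have p: "sd x + t > 0" using sd_nonneg[of x] t by linarith
   have "norm (x $ m - w) <= norm x + norm w" using norm_triangle_ineq4[of "x $ m" w] norm_nth_le_vec[of x m] by linarith
   then have "norm (x $ m - w) <= R + norm w" using True by simp
   then have sdR: "sd x <= (R + norm w)\<^sup>2" unfolding sd_def by (intro power_mono) auto
   have e: "1 - (x $ m - w) * h x = of_real (t / (sd x + t)) + (x $ m - w) * u x"
    using one_minus_u0[of x] by (simp add: h_def algebra_simps)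
   have "(norm (1 - (x $ m - w) * h x))\<^sup>2 <= 2 * (norm (complex_of_real (t / (sd x + t))))\<^sup>2 + 2 * (norm ((x $ m - w) * u x))\<^sup>2"
    unfolding e by (rule norm_add_sq_le)
   also have "(norm (complex_of_real (t / (sd x + t))))\<^sup>2 = t * kk x"
    unfolding kk_def norm_of_real by (simp add: power_divide power2_eq_square)
   also have "(norm ((x $ m - w) * u x))\<^sup>2 = sd x * (norm (u x))\<^sup>2"
    by (simp add: norm_mult power_mult_distrib sd_def)
   finally have "(norm (1 - (x $ m - w) * h x))\<^sup>2 * E x <= (2 * (t * kk x) + 2 * (sd x * (norm (u x))\<^sup>2)) * E x"
    using OE[of x] by (intro mult_right_mono) auto
   also have "... = 2 * (t * (kk x * E x)) + 2 * (sd x * Om x * (norm (U x))\<^sup>2)"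
    using u2[of x] by (simp add: algebra_simps)
   also have "... <= 2 * (1 * (kk x * E x)) + 2 * (((R + norm w)\<^sup>2 + 2) * (norm (U x))\<^sup>2)"
    using t kk_pos[of x] OE[of x] sd_Om_le[of x] sdR by (intro add_mono mult_left_mono mult_right_mono) auto
   finally show ?thesis using True by (auto intro!: ennreal_leI simp: algebra_simps)
  next
   case False
   then show ?thesis by simp
  qed
  have nn: "0 <= 2 * (kk x * E x) + 2 * ((R + norm w)\<^sup>2 + 2) * (norm (U x))\<^sup>2" for x
   using kk_pos[of x] OE[of x] by (intro add_nonneg_nonneg mult_nonneg_nonneg) auto
  have i: "integrable lborel (%x. 2 * (kk x * E x))" "integrable lborel (%x. 2 * ((R + norm w)\<^sup>2 + 2) * (norm (U x))\<^sup>2)"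
   by (intro integrable_mult_right integrable_kkE U2)+
  have "(\<integral>\<^sup>+x. indicator (cball 0 R) x * ennreal ((norm (1 - (x $ m - w) * h x))\<^sup>2 * E x) \<partial>lborel)
    <= (\<integral>\<^sup>+x. ennreal (2 * (kk x * E x) + 2 * ((R + norm w)\<^sup>2 + 2) * (norm (U x))\<^sup>2) \<partial>lborel)"
   by (intro nn_integral_mono pt)
  also have "... = ennreal (\<integral>x. 2 * (kk x * E x) + 2 * ((R + norm w)\<^sup>2 + 2) * (norm (U x))\<^sup>2 \<partial>lborel)"
   using nn by (intro nn_integral_eq_integral Bochner_Integration.integrable_add i) auto
  also have "(\<integral>x. 2 * (kk x * E x) + 2 * ((R + norm w)\<^sup>2 + 2) * (norm (U x))\<^sup>2 \<partial>lborel)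
    = 2 * (\<integral>x. kk x * E x \<partial>lborel) + 2 * ((R + norm w)\<^sup>2 + 2) * (\<integral>x. (norm (U x))\<^sup>2 \<partial>lborel)"
   by (simp only: Bochner_Integration.integral_add[OF i] integral_mult_right_zero)
  also have "ennreal ... <= ennreal (2 * (\<integral>x. kk x * E x \<partial>lborel) + 2 * ((R + norm w)\<^sup>2 + 2) * (\<integral>x. kk x * E x \<partial>lborel))"
   using UA by (intro ennreal_leI add_left_mono mult_left_mono) auto
  finally show ?thesis by (simp add: algebra_simps)
 qed
 show thesis by (rule that[OF hm h2 weak bound])
qed

text \<open>h is only a measurable function with a weak equation; its mollification G satisfies the
  Cauchy-Riemann equations classically, and F = 1 - (y_m - w) G equals 1 on the hyperplane by its
  form. The slack \<theta> pays for commuting the factor y_m - w with the averaging. The constant 8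
  is the product of 2 from the weak bound, 2 from squaring a sum and 2 from the variation of
  E.\<close>

theorem extension_from_hyperplane:
 assumes th: "\<theta> > 0"
 obtains F where "ck 1 F" "\<And>j y. dzb j F y = 0" "\<And>y. y $ m = w ==> F y = 1"
  "(\<integral>\<^sup>+y. indicator (cball 0 R) y * ennreal ((norm (F y))\<^sup>2 * E y) \<partial>lborel)
    <= ennreal (8 * ((R + 1 + norm w)\<^sup>2 + 3) * (\<integral>x. kk x * E x \<partial>lborel) + \<theta>)"
proof -
 obtain h where hm [measurable]: "h \<in> borel_measurable borel" and h2: "integrable lborel (%x. (norm (h x))\<^sup>2 * E x)"
  and hw: "\<And>v. ck 3 v ==> csupp v ==> (\<integral>x. h x * cnj (Lop v x) * E x \<partial>lborel) = 0"
  and hb: "\<And>R. (\<integral>\<^sup>+x. indicator (cball 0 R) x * ennreal ((norm (1 - (x $ m - w) * h x))\<^sup>2 * E x) \<partial>lborel)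
    <= ennreal (2 * ((R + norm w)\<^sup>2 + 3) * (\<integral>x. kk x * E x \<partial>lborel))"
  using weak_extension by blast
 have lh: "locint h" by (rule locint_of_weighted_L2[OF hm h2])
 define H where "H = (\<integral>x. (norm (h x))\<^sup>2 * E x \<partial>lborel)"
 have H0: "H \<ge> 0" unfolding H_def using less_imp_le[OF E_pos] by simp
 have "continuous_on UNIV (%x. ln (E x))"
  using E_pos by (intro continuous_intros E_cont) (auto simp: less_imp_neq[THEN not_sym])
 \<comment> \<open>Uniform continuity of ln E controls ratios: within distance d the weight changes
   by a factor of at most 2.\<close>
 from uniformly_continuous_on_ball[OF this, of "ln 2" R] obtain d where d: "0 < d" "d <= 1"
  and dE: "\<And>x y. norm y <= R ==> norm (x - y) < d ==> dist (ln (E x)) (ln (E y)) < ln 2" by auto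
 define e where "e = min d (\<theta> / (4 * (H + 1)))"
 have e: "0 < e" "e <= d" "e <= \<theta> / (4 * (H + 1))" using d th H0 by (auto simp: e_def)
 have e1: "e <= 1" using e d by linarith
 define rho where "rho = (%x::complex^'n. complex_of_real (mol e x))"
 have rho: "ck 1 rho" "csupp rho" unfolding rho_def using ck_le[OF ck_mol[OF e(1)], of 1] csupp_comp[OF csupp_mol[OF e(1)], of complex_of_real]
  by (simp_all del: ck.simps)
 define G where "G = conv h rho"
 have G1: "ck 1 G" unfolding G_def by (rule ck_conv[OF lh rho])
 have dG: "dzb j G y = 0" for j y
 proof -
  have "dzb j G y = (\<integral>x. h x * dzb j rho (y - x) \<partial>lborel)"
   unfolding G_def dz_conv(2)[OF lh rho] by (simp add: conv_def)
  also have "... = - (\<integral>x. h x * dzb j (%x. rho (y - x)) x \<partial>lborel)"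
   unfolding dzb_reflect[OF rho(1)] by simp
  also have "(\<integral>x. h x * dzb j (%x. rho (y - x)) x \<partial>lborel) = 0"
   by (rule weak_solution_dzb[OF hm h2 hw ck_reflect[OF rho(1)] csupp_reflect[OF rho(2)]])
  finally show ?thesis by simp
 qed
 define F where "F = (%y. 1 - (y $ m - w) * G y)"
 have F1: "ck 1 F" unfolding F_def by (intro ck_diff ck_mult ck_lin ck_const G1)
 have Fz: "dzb j F y = 0" for j y
  unfolding F_def by (simp add: dzb_diff dzb_mult ck_mult ck_lin ck_const G1 dG dz_lin del: ck.simps One_nat_def)
 have Fw: "F y = 1" if "y $ m = w" for y using that by (simp add: F_def)
 \<comment> \<open>F y is the average over x of 1 - (y_m - w) h x; replacing y_m by x_m costs at
   most e |h x|.\<close>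
 define f where "f = (%x. norm (1 - (x $ m - w) * h x) + e * norm (h x))"
 have f0: "f x \<ge> 0" for x unfolding f_def using e by (intro add_nonneg_nonneg mult_nonneg_nonneg) auto
 have fm [measurable]: "f \<in> borel_measurable borel" unfolding f_def by measurable
 have Fle: "ennreal (norm (F y)) <= (\<integral>\<^sup>+x. ennreal (f x) * ennreal (mol e (y - x)) \<partial>lborel)" for y
 proof -
  have mm: "(%x. mol e (y - x)) \<in> borel_measurable borel"
   by (intro borel_measurable_continuous_onI continuous_on_compose2[OF continuous_on_mol[OF e(1)]] continuous_intros) auto
  have "integrable lborel (%x. mol e (y - x))"
  proof (rule integrable_csupp)
   show "continuous_on UNIV (%x. mol e (y - x))"
    by (intro continuous_on_compose2[OF continuous_on_mol[OF e(1)]] continuous_intros) auto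
  qed (rule csupp_reflect[OF csupp_mol[OF e(1)]])
  then have i1: "integrable lborel (%x. rho (y - x))" unfolding rho_def by (rule integrable_of_real)
  have i2: "integrable lborel (%x. h x * rho (y - x))" by (rule conv_integrable[OF lh ck_cont[OF rho(1)] rho(2)])
  have one: "(\<integral>x. rho (y - x) \<partial>lborel) = 1"
  proof -
   have "(\<integral>x. mol e (y - x) \<partial>lborel) = (\<integral>x. mol e (x::complex^'n) \<partial>lborel)"
    by (rule integral_lborel_reflect) (rule borel_measurable_continuous_onI[OF continuous_on_mol[OF e(1)]])
   then show ?thesis unfolding rho_def by (simp add: integral_mol[OF e(1)])
  qed
  have "F y = (\<integral>x. rho (y - x) - (y $ m - w) * (h x * rho (y - x)) \<partial>lborel)"
   unfolding F_def G_def conv_def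
   by (simp only: Bochner_Integration.integral_diff[OF i1 integrable_mult_right[OF i2]] integral_mult_right_zero one)
  also have "ennreal (norm ...) <= (\<integral>\<^sup>+x. norm (rho (y - x) - (y $ m - w) * (h x * rho (y - x))) \<partial>lborel)"
   by (rule integral_norm_bound_ennreal) (intro Bochner_Integration.integrable_diff i1 integrable_mult_right i2)
  also have "... <= (\<integral>\<^sup>+x. ennreal (f x) * ennreal (mol e (y - x)) \<partial>lborel)"
  proof (rule nn_integral_mono)
   fix x
   have "norm (rho (y - x) - (y $ m - w) * (h x * rho (y - x))) <= f x * mol e (y - x)"
   proof (cases "norm (y - x) \<ge> e")
    case True
    then show ?thesis by (simp add: rho_def mol_eq_0[OF e(1)])
   next
    case False
    have "norm (x $ m - y $ m) <= norm (x - y)" using norm_nth_le_vec[of "x - y" m] by simp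
    then have xy: "norm (x $ m - y $ m) <= e" using False by (simp add: norm_minus_commute)
    have "rho (y - x) - (y $ m - w) * (h x * rho (y - x)) = ((1 - (x $ m - w) * h x) + (x $ m - y $ m) * h x) * rho (y - x)"
     by (simp add: algebra_simps)
    also have "norm ... = norm ((1 - (x $ m - w) * h x) + (x $ m - y $ m) * h x) * mol e (y - x)"
     by (simp add: norm_mult rho_def mol_nonneg[OF e(1)])
    also have "... <= f x * mol e (y - x)"
    proof (rule mult_right_mono[OF _ mol_nonneg[OF e(1)]])
     have "norm ((1 - (x $ m - w) * h x) + (x $ m - y $ m) * h x) <= norm (1 - (x $ m - w) * h x) + norm (x $ m - y $ m) * norm (h x)"
      using norm_triangle_ineq[of "1 - (x $ m - w) * h x" "(x $ m - y $ m) * h x"] by (simp only: norm_mult)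
     also have "... <= f x" unfolding f_def by (intro add_left_mono mult_right_mono xy) auto
     finally show "norm ((1 - (x $ m - w) * h x) + (x $ m - y $ m) * h x) <= f x" .
    qed
    finally show ?thesis .
   qed
   then show "ennreal (norm (rho (y - x) - (y $ m - w) * (h x * rho (y - x)))) <= ennreal (f x) * ennreal (mol e (y - x))"
    by (subst ennreal_mult[symmetric]) (auto intro: f0 mol_nonneg[OF e(1)] ennreal_leI)
  qed
  finally show ?thesis .
 qed
 define g where "g = (%y. indicator (cball 0 R) y * ennreal (E y))"
 define K where "K = (%x. indicator (cball 0 (R + 1)) x * ennreal (2 * E x))"
 have [measurable]: "cball 0 R \<in> sets (borel :: (complex^'n) measure)" "cball 0 (R + 1) \<in> sets (borel :: (complex^'n) measure)" by simp_all
 have "(\<integral>\<^sup>+y. indicator (cball 0 R) y * ennreal ((norm (F y))\<^sup>2 * E y) \<partial>lborel)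
   <= (\<integral>\<^sup>+y. g y * (\<integral>\<^sup>+x. ennreal (f x) * ennreal (mol e (y - x)) \<partial>lborel)\<^sup>2 \<partial>lborel)"
 proof (rule nn_integral_mono)
  fix y
  have "ennreal ((norm (F y))\<^sup>2 * E y) = ennreal (E y) * (ennreal (norm (F y)))\<^sup>2"
   using E_pos[of y] by (subst ennreal_mult) (auto simp: ennreal_power mult.commute)
  also have "... <= ennreal (E y) * (\<integral>\<^sup>+x. ennreal (f x) * ennreal (mol e (y - x)) \<partial>lborel)\<^sup>2"
   by (intro mult_left_mono power_mono Fle) auto
  finally show "indicator (cball 0 R) y * ennreal ((norm (F y))\<^sup>2 * E y) <= g y * (\<integral>\<^sup>+x. ennreal (f x) * ennreal (mol e (y - x)) \<partial>lborel)\<^sup>2"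
   unfolding g_def by (simp add: mult.assoc mult_left_mono)
 qed
 also have "... <= (\<integral>\<^sup>+x. (ennreal (f x))\<^sup>2 * K x \<partial>lborel)"
 proof (rule mol_average_bound[OF e(1)])
  show "g y <= K x" if xy: "norm (y - x) < e" for x y
  proof (cases "norm y <= R")
   case True
   have n: "norm (x - y) < d" using xy e by (simp add: norm_minus_commute)
   have "ln (E y) <= ln (E x) + ln 2" using dE[OF True n] by (simp add: dist_real_def)
   also have "... = ln (2 * E x)" using E_pos[of x] by (simp add: ln_mult)
   finally have "E y <= 2 * E x" using E_pos[of x] E_pos[of y] by simp
   moreover have "norm x <= R + 1" using norm_triangle_ineq[of y "x - y"] n True d by simp
   ultimately show ?thesis using True by (simp add: g_def K_def ennreal_leI)
  qed (simp add: g_def)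
 qed (simp_all add: g_def K_def)
 also have "... <= (\<integral>\<^sup>+x. ennreal 4 * (indicator (cball 0 (R + 1)) x * ennreal ((norm (1 - (x $ m - w) * h x))\<^sup>2 * E x)) + ennreal (4 * e) * ennreal ((norm (h x))\<^sup>2 * E x) \<partial>lborel)"
 proof (rule nn_integral_mono)
  fix x
  have E0: "E x \<ge> 0" using E_pos[of x] by simp
  show "(ennreal (f x))\<^sup>2 * K x <= ennreal 4 * (indicator (cball 0 (R + 1)) x * ennreal ((norm (1 - (x $ m - w) * h x))\<^sup>2 * E x)) + ennreal (4 * e) * ennreal ((norm (h x))\<^sup>2 * E x)"
  proof (cases "x \<in> cball 0 (R + 1)")
   case True
   define a where "a = norm (1 - (x $ m - w) * h x)"
   define b where "b = norm (h x)"
   have "(a + e * b)\<^sup>2 <= 2 * a\<^sup>2 + 2 * (e * b)\<^sup>2" using norm_add_sq_le[of a "e * b"] by simp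
   also have "(e * b)\<^sup>2 <= e * b\<^sup>2"
   proof -
    have "e * e * b\<^sup>2 <= e * 1 * b\<^sup>2" using e e1 by (intro mult_right_mono mult_left_mono) auto
    then show ?thesis by (simp add: power2_eq_square mult_ac)
   qed
   finally have "(f x)\<^sup>2 * (2 * E x) <= (2 * a\<^sup>2 + 2 * (e * b\<^sup>2)) * (2 * E x)"
    unfolding f_def a_def[symmetric] b_def[symmetric] using E0 by (intro mult_right_mono) auto
   also have "... = 4 * (a\<^sup>2 * E x) + 4 * e * (b\<^sup>2 * E x)" by (simp add: algebra_simps)
   finally have le: "ennreal ((f x)\<^sup>2 * (2 * E x)) <= ennreal (4 * (a\<^sup>2 * E x) + 4 * e * (b\<^sup>2 * E x))" by (rule ennreal_leI)
   have "(ennreal (f x))\<^sup>2 * K x = ennreal ((f x)\<^sup>2 * (2 * E x))"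
    using True E0 f0[of x] unfolding K_def by (simp add: ennreal_mult ennreal_power)
   also note le
   also have "ennreal (4 * (a\<^sup>2 * E x) + 4 * e * (b\<^sup>2 * E x)) = ennreal (4 * (a\<^sup>2 * E x)) + ennreal (4 * e * (b\<^sup>2 * E x))"
    using E0 e by (intro ennreal_plus mult_nonneg_nonneg) auto
   also have "ennreal (4 * (a\<^sup>2 * E x)) = ennreal 4 * ennreal (a\<^sup>2 * E x)" using E0 by (intro ennreal_mult) auto
   also have "ennreal (4 * e * (b\<^sup>2 * E x)) = ennreal (4 * e) * ennreal (b\<^sup>2 * E x)" using E0 e by (intro ennreal_mult) auto
   finally show ?thesis using True unfolding a_def b_def by simp
  qed (simp add: K_def)
 qed
 also have "... = ennreal 4 * (\<integral>\<^sup>+x. indicator (cball 0 (R + 1)) x * ennreal ((norm (1 - (x $ m - w) * h x))\<^sup>2 * E x) \<partial>lborel)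
   + ennreal (4 * e) * (\<integral>\<^sup>+x. ennreal ((norm (h x))\<^sup>2 * E x) \<partial>lborel)"
  by (subst nn_integral_add) (simp_all add: nn_integral_cmult)
 also have "... <= ennreal 4 * ennreal (2 * ((R + 1 + norm w)\<^sup>2 + 3) * (\<integral>x. kk x * E x \<partial>lborel)) + ennreal (4 * e) * ennreal H"
 proof (intro add_mono mult_left_mono hb)
  show "(\<integral>\<^sup>+x. ennreal ((norm (h x))\<^sup>2 * E x) \<partial>lborel) <= ennreal H"
   unfolding H_def using less_imp_le[OF E_pos] by (subst nn_integral_eq_integral[OF h2]) auto
 qed auto
 also have "... = ennreal (4 * (2 * ((R + 1 + norm w)\<^sup>2 + 3) * (\<integral>x. kk x * E x \<partial>lborel)) + 4 * e * H)"
 proof -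
  have A0: "(\<integral>x. kk x * E x \<partial>lborel) \<ge> 0" using less_imp_le[OF kk_pos] less_imp_le[OF E_pos] by simp
  have p: "0 <= 2 * ((R + 1 + norm w)\<^sup>2 + 3) * (\<integral>x. kk x * E x \<partial>lborel)"
   by (intro mult_nonneg_nonneg A0) auto
  show ?thesis using p e H0 by (simp only: ennreal_mult[symmetric] ennreal_plus[symmetric] mult_nonneg_nonneg zero_le_numeral less_imp_le)
 qed
 also have "... <= ennreal (8 * ((R + 1 + norm w)\<^sup>2 + 3) * (\<integral>x. kk x * E x \<partial>lborel) + \<theta>)"
 proof -
  have "4 * e * H <= 4 * e * (H + 1)" using e by simp
  also have "... <= \<theta>" using e(3) H0 by (simp add: field_simps)
  finally show ?thesis by (intro ennreal_leI) (simp add: algebra_simps)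
 qed
 finally show thesis by (intro that[OF F1 Fz Fw])
qed

end

section \<open>Mean value inequalities on polydisks\<close>

lemma upd_shift_Re: "upd z k (Complex 0 y) + x *\<^sub>R axis k 1 = upd z k (Complex x y)"
 and upd_shift_Im: "upd z k (Complex x 0) + y *\<^sub>R axis k \<i> = upd z k (Complex x y)"
 by (auto simp: vec_eq_iff axis_def complex_eq_iff)

text \<open>Continuity of one of the two real partial derivatives makes the slice totally
  differentiable, and dzb_k F = 0 makes the derivative complex linear.\<close>

lemma holomorphic_slice:
 fixes F :: "complex^'n::finite => complex"
 assumes F: "ck 1 F" and CR: "\<And>y. dzb k F y = 0"
 shows "(%t. F (upd z k t)) holomorphic_on S"
proof -
 define a where "a = pd (axis k 1) F"
 define b where "b = pd (axis k \<i>) F"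
 have ha: "has_pd F (axis k 1) a" and hb: "has_pd F (axis k \<i>) b"
  unfolding a_def b_def using ck1_has_pd[OF F] by auto
 have bc: "continuous_on UNIV b" unfolding b_def using F by simp
 have ab: "b y = \<i> * a y" for y
 proof -
  have "a y + \<i> * b y = 0" using CR[of y] by (simp add: dzb_def a_def b_def)
  then have "\<i> * (a y + \<i> * b y) = 0" by simp
  then have "\<i> * a y - b y = 0" by (simp add: distrib_left mult.assoc[symmetric])
  then show ?thesis by simp
 qed
 have "((%t. F (upd z k t)) has_field_derivative a (upd z k t)) (at t)" for t
 proof -
  define f where "f = (%x y. F (upd z k (Complex x y)))"
  have fx: "((%x. f x (Im t)) has_derivative (%h. h *\<^sub>R a (upd z k t))) (at (Re t))"
   using has_pd_at[OF ha, of "upd z k (Complex 0 (Im t))" "Re t"]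
   by (simp add: f_def upd_shift_Re has_vector_derivative_def)
  have fy: "((%y. f x y) has_derivative blinfun_apply (blinfun_scaleR_left (b (upd z k (Complex x y))))) (at y)" for x y
   using has_pd_at[OF hb, of "upd z k (Complex x 0)" y]
   by (simp add: f_def upd_shift_Im has_vector_derivative_def)
  have "continuous_on UNIV (%p. blinfun_scaleR_left (b (upd z k (Complex (fst p) (snd p)))))"
   by (intro bounded_linear.continuous_on[OF bounded_linear_blinfun_scaleR_left] continuous_on_compose2[OF bc]
     continuous_intros) auto
  then have fyc: "continuous (at (Re t, Im t) within UNIV \<times> UNIV) (%(x, y). blinfun_scaleR_left (b (upd z k (Complex x y))))"
   by (simp add: continuous_on_eq_continuous_at split_def)
  have "((%(x, y). f x y) has_derivative (%(tx, ty). tx *\<^sub>R a (upd z k t) + blinfun_apply (blinfun_scaleR_left (b (upd z k (Complex (Re t) (Im t))))) ty))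
    (at (Re t, Im t) within UNIV \<times> UNIV)"
   by (rule has_derivative_partialsI[OF _ _ fyc]) (use fx fy in auto)
  then have d: "((%(x, y). f x y) has_derivative (%(tx, ty). tx *\<^sub>R a (upd z k t) + ty *\<^sub>R b (upd z k t))) (at (Re t, Im t))"
   by simp
  have r: "((%t. (Re t, Im t)) has_derivative (%h. (Re h, Im h))) (at t)"
   by (auto intro!: derivative_eq_intros)
  have "((%t. F (upd z k t)) has_derivative (%h. Re h *\<^sub>R a (upd z k t) + Im h *\<^sub>R b (upd z k t))) (at t)"
   using has_derivative_compose[OF r d] by (simp add: f_def)
  moreover have "(%h. Re h *\<^sub>R a (upd z k t) + Im h *\<^sub>R b (upd z k t)) = (*) (a (upd z k t))"
   unfolding ab by (auto simp: fun_eq_iff complex_eq_iff algebra_simps)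
  ultimately show ?thesis by (simp add: has_field_derivative_def)
 qed
 then show ?thesis unfolding holomorphic_on_def field_differentiable_def by (blast intro: DERIV_subset)
qed

text \<open>Cauchy's formula at 0 for v to f (z + u v). The radius u is complex, so that afterwards
  it can be integrated over a disk.\<close>

lemma circle_mean_value:
 assumes f: "f holomorphic_on UNIV"
 shows "ennreal (norm (f z)) <= (\<integral>\<^sup>+x. indicator {0..1} x * ennreal (norm (f (z + u * exp (2 * of_real pi * \<i> * of_real x)))) \<partial>lborel)"
proof -
 define h where "h = (%v. f (z + u * v))"
 have "h holomorphic_on UNIV" unfolding h_def
  by (intro holomorphic_on_compose_gen[OF _ f, unfolded o_def] holomorphic_intros) auto
 then have hh: "h holomorphic_on cball 0 1" by (rule holomorphic_on_subset) auto
 have fc: "continuous_on UNIV f" by (rule holomorphic_on_imp_continuous_on[OF f])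
 define G where "G = (%x::real. f (z + u * exp (2 * of_real pi * \<i> * of_real x)))"
 have Gc: "continuous_on UNIV G" unfolding G_def by (intro continuous_on_compose2[OF fc] continuous_intros) auto
 have "((%x. (h (exp (2 * of_real pi * \<i> * of_real x)) / exp (2 * of_real pi * \<i> * of_real x)) *
   (2 * of_real pi * \<i> * exp (2 * of_real pi * \<i> * of_real x))) has_integral (2 * of_real pi * \<i> * h 0)) {0..1::real}"
  using Cauchy_integral_circlepath_simple[OF hh, of 0]
  unfolding has_contour_integral vector_derivative_circlepath unfolding circlepath by simp
 then have "((%x. (2 * of_real pi * \<i>) * G x) has_integral (2 * of_real pi * \<i> * h 0)) {0..1::real}"
  by (simp add: G_def h_def mult_ac)
 from has_integral_mult_right[OF this, of "inverse (2 * of_real pi * \<i>)"]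
 have I: "(G has_integral f z) {0..1}" by (simp add: h_def field_simps)
 have ni: "(%x. norm (G x)) integrable_on {0..1}"
  by (intro integrable_continuous_real continuous_on_norm continuous_on_subset[OF Gc]) auto
 have le: "norm (f z) <= integral {0..1} (%x. norm (G x))"
  using integral_norm_bound_integral[OF has_integral_integrable[OF I] ni] integral_unique[OF I] by simp
 have [measurable]: "G \<in> borel_measurable borel" by (rule borel_measurable_continuous_onI[OF Gc])
 have "(%x. if x \<in> {0..1} then norm (G x) else 0) = (%x. indicator {0..1} x * norm (G x))"
  by (auto simp: fun_eq_iff indicator_def)
 moreover have "((%x. if x \<in> {0..1} then norm (G x) else 0) has_integral integral {0..1} (%x. norm (G x))) UNIV"
  using integrable_integral[OF ni] by (simp only: has_integral_restrict_UNIV)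
 ultimately have "((%x. indicator {0..1} x * norm (G x)) has_integral integral {0..1} (%x. norm (G x))) UNIV" by (simp only:)
 then have "(\<integral>\<^sup>+x. ennreal (indicator {0..1} x * norm (G x)) \<partial>lborel) = ennreal (integral {0..1} (%x. norm (G x)))"
  by (intro nn_integral_has_integral_lborel) auto
 moreover have "(%x. ennreal (indicator {0..1} x * norm (G x))) = (%x. indicator {0..1} x * ennreal (norm (G x)))"
  by (auto simp: fun_eq_iff indicator_def)
 ultimately show ?thesis using ennreal_leI[OF le] by (simp add: G_def)
qed

text \<open>Instead of polar coordinates, the integral over the disk is averaged over rotations u to
  u exp (2 pi i x); each of them is an isometry, and the average over x is the circle mean.\<close>

lemma area_mean_value:
 assumes f: "f holomorphic_on UNIV"
 shows "ennreal (norm (f a)) * (\<integral>\<^sup>+u. indicator (ball 0 r) (u::complex) \<partial>lborel)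
   <= (\<integral>\<^sup>+u. indicator (ball 0 r) u * ennreal (norm (f (a + u))) \<partial>lborel)"
proof -
 have fc: "continuous_on UNIV f" by (rule holomorphic_on_imp_continuous_on[OF f])
 have [measurable]: "f \<in> borel_measurable borel" by (rule borel_measurable_continuous_onI[OF fc])
 have [measurable]: "ball 0 r \<in> sets (borel :: complex measure)" by simp
 define ex where "ex = (%x::real. exp (2 * of_real pi * \<i> * of_real x))"
 have exm [measurable]: "ex \<in> borel_measurable borel"
  unfolding ex_def by (intro borel_measurable_continuous_onI continuous_intros)
 have nex: "norm (ex x) = 1" for x by (simp add: ex_def norm_exp_eq_Re)
 define g where "g = (%u. indicator (ball 0 r) u * ennreal (norm (f (a + u))))"
 have [measurable]: "g \<in> borel_measurable borel" unfolding g_def by measurable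
 have rot: "(\<integral>\<^sup>+u. g (u * ex x) \<partial>lborel) = (\<integral>\<^sup>+u. g u \<partial>lborel)" for x
  by (rule nn_integral_lborel_isometry)
   (auto intro!: bounded_linear.linear[OF bounded_linear_mult_left] simp: norm_mult nex)
 have "ennreal (norm (f a)) * (\<integral>\<^sup>+u. indicator (ball 0 r) (u::complex) \<partial>lborel)
   = (\<integral>\<^sup>+u. indicator (ball 0 r) (u::complex) * ennreal (norm (f a)) \<partial>lborel)"
  unfolding mult.commute[of "ennreal (norm (f a))"] by (rule nn_integral_multc[symmetric]) simp
 also have "... <= (\<integral>\<^sup>+u. \<integral>\<^sup>+x. indicator {0..1} x * g (u * ex x) \<partial>lborel \<partial>lborel)"
 proof (rule nn_integral_mono)
  fix u
  have "indicator (ball 0 r) u * ennreal (norm (f a)) <= indicator (ball 0 r) u * (\<integral>\<^sup>+x. indicator {0..1} x * ennreal (norm (f (a + u * ex x))) \<partial>lborel)"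
   unfolding ex_def by (intro mult_left_mono circle_mean_value f) auto
  also have "... = (\<integral>\<^sup>+x. indicator (ball 0 r) u * (indicator {0..1} x * ennreal (norm (f (a + u * ex x)))) \<partial>lborel)"
   by (rule nn_integral_cmult[symmetric]) simp
  also have "... = (\<integral>\<^sup>+x. indicator {0..1} x * g (u * ex x) \<partial>lborel)"
   by (intro nn_integral_cong) (auto simp: g_def indicator_def norm_mult nex)
  finally show "indicator (ball 0 r) u * ennreal (norm (f a)) <= (\<integral>\<^sup>+x. indicator {0..1} x * g (u * ex x) \<partial>lborel)" .
 qed
 also have "... = (\<integral>\<^sup>+x. \<integral>\<^sup>+u. indicator {0..1} x * g (u * ex x) \<partial>lborel \<partial>lborel)"
  by (rule lborel_pair.Fubini'[symmetric]) measurable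
 also have "... = (\<integral>\<^sup>+x. indicator {0..1::real} x * (\<integral>\<^sup>+u. g u \<partial>lborel) \<partial>lborel)"
  by (simp add: nn_integral_cmult rot)
 also have "... = (\<integral>\<^sup>+u. g u \<partial>lborel)" by (simp add: nn_integral_multc)
 finally show ?thesis by (simp add: g_def)
qed

definition pdisk :: "complex^'n::finite => real => (complex^'n) set" where
 "pdisk a r = {x. \<forall>i. norm (x $ i - a $ i) < r}"

lemma open_pdisk: "open (pdisk a r)"
proof -
 have "pdisk a r = (\<Inter>i\<in>UNIV. {x. norm (x $ i - a $ i) < r})" by (auto simp: pdisk_def)
 moreover have "open {x. norm (x $ i - a $ i) < r}" for i
  by (intro open_Collect_less continuous_intros)
 ultimately show ?thesis by (simp add: open_INT)
qed

lemma sets_pdisk [measurable]: "pdisk a r \<in> sets borel"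
 using open_pdisk by (rule borel_open)

lemma pdisk_subset_cball:
 assumes "r \<ge> 0" shows "pdisk (0::complex^'n::finite) r \<subseteq> cball 0 (real CARD('n) * r)"
proof
 fix x :: "complex^'n" assume x: "x \<in> pdisk 0 r"
 have "norm x <= (\<Sum>i\<in>UNIV. norm (x $ i))" by (simp add: norm_vec_def L2_set_le_sum)
 also have "... <= (\<Sum>i\<in>(UNIV::'n set). r)" using x by (intro sum_mono) (auto simp: pdisk_def intro: less_imp_le)
 finally show "x \<in> cball 0 (real CARD('n) * r)" by simp
qed

lemma nn_integral_pdisk_shift: "(\<integral>\<^sup>+x. indicator (pdisk (a::complex^'n::finite) r) x \<partial>lborel) = emeasure lborel (pdisk (0::complex^'n) r)"
proof -
 have s: "(\<integral>\<^sup>+x. indicator (pdisk a r) (a + x) \<partial>lborel) = (\<integral>\<^sup>+x. indicator (pdisk a r) x \<partial>lborel)"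
  by (rule nn_integral_lborel_shift) simp
 have i: "indicator (pdisk a r) (a + x) = (indicator (pdisk 0 r) x :: ennreal)" for x
  by (simp add: pdisk_def indicator_def)
 show ?thesis using s[symmetric] unfolding i by simp
qed

lemma emeasure_lborel_open_neq_0:
 fixes S :: "'a::euclidean_space set"
 assumes "open S" "S ~= {}" shows "emeasure lborel S ~= 0"
proof
 assume "emeasure lborel S = 0"
 then have "S \<in> null_sets lborel" using assms by (simp add: null_sets_def)
 then have "S \<in> null_sets lebesgue" by (rule null_sets_completionI)
 then have "negligible S" by (simp add: negligible_iff_null_sets)
 then show False using open_not_negligible[OF assms] by blast
qed

lemma emeasure_pdisk:
 assumes "r > 0"
 shows "emeasure lborel (pdisk (0::complex^'n::finite) r) < \<infinity>" "emeasure lborel (pdisk (0::complex^'n) r) > 0"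
proof -
 have "emeasure lborel (pdisk (0::complex^'n) r) <= emeasure lborel (cball (0::complex^'n) (real CARD('n) * r))"
  using assms by (intro emeasure_mono pdisk_subset_cball) auto
 also have "... < \<infinity>" using emeasure_bounded_finite[OF bounded_cball] by simp
 finally show "emeasure lborel (pdisk (0::complex^'n) r) < \<infinity>" .
 have "0 \<in> pdisk (0::complex^'n) r" using assms by (simp add: pdisk_def)
 then have "emeasure lborel (pdisk (0::complex^'n) r) ~= 0" using emeasure_lborel_open_neq_0[OF open_pdisk] by blast
 then show "emeasure lborel (pdisk (0::complex^'n) r) > 0" by (simp add: zero_less_iff_neq_zero)
qed

text \<open>The plane inequality is applied to one coordinate after another, with
  \<open>nn_integral_upd\<close> separating the coordinate in question.\<close>

lemma polydisc_mean_value: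
 fixes F :: "complex^'n::finite => complex"
 assumes Fc: "continuous_on UNIV F" and hol: "\<And>z k. (%t. F (upd z k t)) holomorphic_on UNIV" and r: "r > 0"
 shows "ennreal (norm (F a)) * emeasure lborel (pdisk (0::complex^'n) r)
  <= (\<integral>\<^sup>+x. indicator (pdisk a r) x * ennreal (norm (F x)) \<partial>lborel)"
proof -
 define y where "y = (%I x. (\<chi> i. if i \<in> I then x $ i else a $ i) :: complex^'n)"
 have yc: "continuous_on UNIV (y I)" for I
 proof -
  have "continuous_on UNIV (%x::complex^'n. if i \<in> I then x $ i else a $ i)" for i
   by (cases "i \<in> I") (auto intro!: continuous_intros)
  then show ?thesis unfolding y_def by (intro continuous_on_vec_lambda)
 qed
 have [measurable]: "F \<in> borel_measurable borel" by (rule borel_measurable_continuous_onI[OF Fc])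
 have ym [measurable]: "y I \<in> borel_measurable borel" for I by (rule borel_measurable_continuous_onI[OF yc])
 \<comment> \<open>Coordinates in I vary, the others are frozen at the centre a: J {} is the volume
   times |F a|, J UNIV the integral of |F|, and J grows with I.\<close>
 define J where "J = (%I. \<integral>\<^sup>+x. indicator (pdisk a r) x * ennreal (norm (F (y I x))) \<partial>lborel)"
 have step: "J I <= J (insert k I)" if k: "k \<notin> I" for I k
 proof -
  define b where "b = (%w::complex. indicator (ball (a $ k) r) w :: ennreal)"
  have [measurable]: "b \<in> borel_measurable borel" unfolding b_def by (rule borel_measurable_indicator) simp
  define v where "v = (\<integral>\<^sup>+w. b w \<partial>lborel)"
  have v: "v = (\<integral>\<^sup>+u. indicator (ball 0 r) (u::complex) \<partial>lborel)"
  proof -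
   have "(\<integral>\<^sup>+u. b (a $ k + u) \<partial>lborel) = v" unfolding v_def by (rule nn_integral_lborel_shift) simp
   moreover have "b (a $ k + u) = indicator (ball 0 r) u" for u by (simp add: b_def indicator_def dist_norm)
   ultimately show ?thesis by simp
  qed
  have vfin: "v ~= \<infinity>" "v ~= 0"
   unfolding v using r emeasure_bounded_finite[OF bounded_ball, of "0::complex" r] emeasure_lborel_open_neq_0[of "ball (0::complex) r"] by auto
  define f where "f = (%x. indicator (pdisk a r) x * ennreal (norm (F (y (insert k I) x))))"
  have [measurable]: "f \<in> borel_measurable borel" unfolding f_def by measurable
  have inner: "ennreal (norm (F (y I z))) * v <= (\<integral>\<^sup>+w. indicator (ball (a $ k) r) w * ennreal (norm (F (upd (y I z) k w))) \<partial>lborel)" for z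
  proof -
   have "ennreal (norm (F (upd (y I z) k (a $ k)))) * v
    <= (\<integral>\<^sup>+u. indicator (ball 0 r) u * ennreal (norm (F (upd (y I z) k (a $ k + u)))) \<partial>lborel)"
    unfolding v by (rule area_mean_value[OF hol, of "y I z" k "a $ k" r])
   also have "upd (y I z) k (a $ k) = y I z" using k by (simp add: y_def vec_eq_iff)
   also have "(\<integral>\<^sup>+u. indicator (ball 0 r) u * ennreal (norm (F (upd (y I z) k (a $ k + u)))) \<partial>lborel)
     = (\<integral>\<^sup>+u. indicator (ball (a $ k) r) (a $ k + u) * ennreal (norm (F (upd (y I z) k (a $ k + u)))) \<partial>lborel)"
    by (intro nn_integral_cong) (simp add: indicator_def dist_norm)
   also have "... = (\<integral>\<^sup>+w. indicator (ball (a $ k) r) w * ennreal (norm (F (upd (y I z) k w))) \<partial>lborel)"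
   proof (rule nn_integral_lborel_shift[of "%w. indicator (ball (a $ k) r) w * ennreal (norm (F (upd (y I z) k w)))"])
    define fw where "fw = (%w. F (upd (y I z) k w))"
    have "continuous_on UNIV fw" unfolding fw_def by (rule holomorphic_on_imp_continuous_on[OF hol])
    then have [measurable]: "fw \<in> borel_measurable borel" by (rule borel_measurable_continuous_onI)
    have [measurable]: "ball (a $ k) r \<in> sets borel" by simp
    have "(%w. indicator (ball (a $ k) r) w * ennreal (norm (fw w))) \<in> borel_measurable borel" by measurable
    then show "(%w. indicator (ball (a $ k) r) w * ennreal (norm (F (upd (y I z) k w)))) \<in> borel_measurable borel"
     by (simp add: fw_def)
   qed
   finally show ?thesis .
  qed
  have "J I * v = (\<integral>\<^sup>+z. indicator (pdisk a r) z * ennreal (norm (F (y I z))) * v \<partial>lborel)"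
   unfolding J_def by (rule nn_integral_multc[symmetric]) measurable
  also have "... <= (\<integral>\<^sup>+z. \<integral>\<^sup>+w. f (upd z k w) * b (z $ k) \<partial>lborel \<partial>lborel)"
  proof (rule nn_integral_mono)
   fix z
   show "indicator (pdisk a r) z * ennreal (norm (F (y I z))) * v <= (\<integral>\<^sup>+w. f (upd z k w) * b (z $ k) \<partial>lborel)"
   proof (cases "z \<in> pdisk a r")
    case True
    have "f (upd z k w) * b (z $ k) = indicator (ball (a $ k) r) w * ennreal (norm (F (upd (y I z) k w)))" for w
    proof -
     have "y (insert k I) (upd z k w) = upd (y I z) k w" using k by (auto simp: y_def vec_eq_iff)
     moreover have "indicator (pdisk a r) (upd z k w) = (indicator (ball (a $ k) r) w :: ennreal)"
      using True by (auto simp: pdisk_def indicator_def dist_norm norm_minus_commute split: if_splits)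
     moreover have "b (z $ k) = 1" using True by (simp add: b_def pdisk_def dist_norm norm_minus_commute)
     ultimately show ?thesis by (simp add: f_def)
    qed
    then show ?thesis using inner[of z] True by simp
   qed simp
  qed
  also have "... = (\<integral>\<^sup>+z. f z \<partial>lborel) * (\<integral>\<^sup>+w. b w \<partial>lborel)" by (rule nn_integral_upd[symmetric]) auto
  also have "... = J (insert k I) * v" by (simp add: f_def J_def v_def)
  finally show ?thesis using vfin by (simp add: ennreal_mult_le_mult_iff mult.commute[of _ v])
 qed
 have "J {} <= J I" if "finite I" for I
  using that by (induction I) (auto intro: order_trans step)
 then have "J {} <= J UNIV" by simp
 moreover have "y {} x = a" "y UNIV x = x" for x by (simp_all add: y_def vec_eq_iff)
 ultimately have "(\<integral>\<^sup>+x. indicator (pdisk a r) x * ennreal (norm (F a)) \<partial>lborel) <= (\<integral>\<^sup>+x. indicator (pdisk a r) x * ennreal (norm (F x)) \<partial>lborel)"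
  by (simp add: J_def)
 moreover have "(\<integral>\<^sup>+x. indicator (pdisk a r) x * ennreal (norm (F a)) \<partial>lborel) = ennreal (norm (F a)) * (\<integral>\<^sup>+x. indicator (pdisk a r) x \<partial>lborel)"
  unfolding mult.commute[of "ennreal (norm (F a))"] by (rule nn_integral_multc) simp
 ultimately show ?thesis by (simp only: nn_integral_pdisk_shift)
qed

text \<open>Cauchy's estimate on circles of radius r about points of the disk of radius r, all of
  which lie in the disk of radius 2r.\<close>

lemma holomorphic_difference_bound:
 assumes f: "f holomorphic_on UNIV" and r: "r > 0" and B: "\<And>t. norm t <= 2 * r ==> norm (f t) <= B"
  and xy: "norm x <= r" "norm y <= r"
 shows "norm (f x - f y) <= B / r * norm (x - y)"
proof (rule field_differentiable_bound[of "cball 0 r" f "deriv f" "B / r"])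
 fix t :: complex assume t: "t \<in> cball 0 r"
 show "(f has_field_derivative deriv f t) (at t within cball 0 r)"
  using holomorphic_derivI[OF f open_UNIV, of t] by (auto intro: DERIV_subset)
 have "norm ((deriv ^^ 1) f t) <= fact 1 * B / r ^ 1"
 proof (rule Cauchy_inequality)
  show "f holomorphic_on ball t r" by (rule holomorphic_on_subset[OF f]) simp
  show "continuous_on (cball t r) f" by (rule continuous_on_subset[OF holomorphic_on_imp_continuous_on[OF f]]) simp
  fix s assume "norm (t - s) = r"
  then have "norm s <= 2 * r" using t norm_triangle_ineq2[of s t] by (simp add: norm_minus_commute)
  then show "norm (f s) <= B" by (rule B)
 qed (rule r)
 then show "norm (deriv f t) <= B / r" by simp
qed (use xy in auto)

section \<open>Integrable majorants\<close>

lemma nn_integral_inverse_1_plus_square: "(\<integral>\<^sup>+(x::real). ennreal (1 / (1 + x\<^sup>2)) \<partial>lborel) < \<infinity>"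
proof -
 define f where "f = (%x::real. 1 / (1 + x\<^sup>2))"
 have fm [measurable]: "f \<in> borel_measurable borel" unfolding f_def by measurable
 have h: "(\<integral>\<^sup>+x. ennreal (f x) * indicator {0..} x \<partial>lborel) = ennreal (pi / 2 - arctan 0)"
 proof (rule nn_integral_FTC_atLeast[OF fm])
  fix x :: real
  show "(arctan has_real_derivative f x) (at x)"
   unfolding f_def using DERIV_arctan[of x] by (simp add: inverse_eq_divide)
 qed (auto simp: f_def tendsto_arctan_at_top)
 have r: "(\<integral>\<^sup>+x. ennreal (f x) * indicator {..0} x \<partial>lborel) = (\<integral>\<^sup>+x. ennreal (f (0 - x)) * indicator {..0} (0 - x) \<partial>lborel)"
  by (rule nn_integral_lborel_reflect[of "%x. ennreal (f x) * indicator {..0} x" 0, symmetric]) simp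
 also have "... = (\<integral>\<^sup>+x. ennreal (f x) * indicator {0..} x \<partial>lborel)"
  by (intro nn_integral_cong) (auto simp: f_def indicator_def)
 finally have h2: "(\<integral>\<^sup>+x. ennreal (f x) * indicator {..0} x \<partial>lborel) = ennreal (pi / 2 - arctan 0)" using h by simp
 have "(\<integral>\<^sup>+x. ennreal (f x) \<partial>lborel) <= (\<integral>\<^sup>+x. ennreal (f x) * indicator {0..} x + ennreal (f x) * indicator {..0} x \<partial>lborel)"
  by (intro nn_integral_mono) (auto simp: indicator_def)
 also have "... = (\<integral>\<^sup>+x. ennreal (f x) * indicator {0..} x \<partial>lborel) + (\<integral>\<^sup>+x. ennreal (f x) * indicator {..0} x \<partial>lborel)"
  by (rule nn_integral_add) measurable
 also have "... < \<infinity>" unfolding h h2 by simp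
 finally show ?thesis by (simp add: f_def)
qed

text \<open>A common majorant for the Gaussian on C^n and the Cauchy-type kernel in the plane; its
  product form reduces both to the arctangent.\<close>

lemma nn_integral_prod_inverse:
 "(\<integral>\<^sup>+(x::'a::euclidean_space). (\<Prod>b\<in>Basis. ennreal (1 / (1 + (x \<bullet> b)\<^sup>2))) \<partial>lborel) < \<infinity>"
proof -
 have "(\<integral>\<^sup>+(x::'a). (\<Prod>b\<in>Basis. ennreal (1 / (1 + (x \<bullet> b)\<^sup>2))) \<partial>lborel) = (\<Prod>b\<in>(Basis::'a set). (\<integral>\<^sup>+(x::real). ennreal (1 / (1 + x\<^sup>2)) \<partial>lborel))"
  by (rule nn_integral_lborel_prod[of "%_ x. ennreal (1 / (1 + x\<^sup>2))"]) auto
 also have "... < \<infinity>" using nn_integral_inverse_1_plus_square by (simp add: power_less_top_ennreal)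
 finally show ?thesis .
qed

lemma nn_integral_gaussian: "(\<integral>\<^sup>+(x::'a::euclidean_space). ennreal (exp (- 2 * (norm x)\<^sup>2)) \<partial>lborel) < \<infinity>"
proof (rule le_less_trans[OF _ nn_integral_prod_inverse], rule nn_integral_mono)
 fix x :: 'a
 have "(norm x)\<^sup>2 = (\<Sum>b\<in>Basis. (x \<bullet> b)\<^sup>2)"
  unfolding power2_norm_eq_inner by (subst euclidean_inner) (simp add: power2_eq_square)
 then have "exp (- 2 * (norm x)\<^sup>2) = (\<Prod>b\<in>Basis. exp (- 2 * (x \<bullet> b)\<^sup>2))"
  by (simp add: exp_sum[symmetric] sum_distrib_left)
 also have "... <= (\<Prod>b\<in>Basis. 1 / (1 + (x \<bullet> b)\<^sup>2))"
 proof (intro prod_mono conjI)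
  fix b
  have "1 + (x \<bullet> b)\<^sup>2 <= exp ((x \<bullet> b)\<^sup>2)" by (rule exp_ge_add_one_self)
  also have "... <= exp (2 * (x \<bullet> b)\<^sup>2)" by simp
  finally show "exp (- 2 * (x \<bullet> b)\<^sup>2) <= 1 / (1 + (x \<bullet> b)\<^sup>2)"
   by (simp add: exp_minus field_simps add_pos_nonneg)
 qed simp
 finally show "ennreal (exp (- 2 * (norm x)\<^sup>2)) <= (\<Prod>b\<in>Basis. ennreal (1 / (1 + (x \<bullet> b)\<^sup>2)))"
  by (subst prod_ennreal) (auto intro: ennreal_leI)
qed

text \<open>This is the profile of t/(s + t)^2 after rescaling by sqrt t; its mass is the
  \<open>c0\<close> of the local estimate.\<close>

lemma nn_integral_cauchy_kernel: "(\<integral>\<^sup>+(x::complex). ennreal (1 / (1 + (norm x)\<^sup>2)\<^sup>2) \<partial>lborel) < \<infinity>"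
proof (rule le_less_trans[OF _ nn_integral_prod_inverse], rule nn_integral_mono)
 fix x :: complex
 have "(1 + (Re x)\<^sup>2) * (1 + (Im x)\<^sup>2) <= (1 + (norm x)\<^sup>2)\<^sup>2"
 proof -
  have "(1 + (p + q))\<^sup>2 - (1 + p) * (1 + q) = p + q + p * p + p * q + q * q" for p q :: real
   by (simp add: power2_eq_square algebra_simps)
  moreover have "0 <= p + q + p * p + p * q + q * q" if "p \<ge> 0" "q \<ge> 0" for p q :: real using that by simp
  ultimately show ?thesis unfolding cmod_power2 by (metis diff_ge_0_iff_ge zero_le_power2)
 qed
 then have "1 / (1 + (norm x)\<^sup>2)\<^sup>2 <= 1 / ((1 + (Re x)\<^sup>2) * (1 + (Im x)\<^sup>2))"
 proof (intro divide_left_mono mult_pos_pos)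
  have "1 + (norm x)\<^sup>2 > 0" by (simp add: add_pos_nonneg)
  then show "0 < (1 + (norm x)\<^sup>2)\<^sup>2" by simp
 qed (auto simp: add_pos_nonneg)
 also have "... = (\<Prod>b\<in>Basis. 1 / (1 + (x \<bullet> b)\<^sup>2))" by (simp add: Basis_complex_def)
 finally show "ennreal (1 / (1 + (norm x)\<^sup>2)\<^sup>2) <= (\<Prod>b\<in>Basis. ennreal (1 / (1 + (x \<bullet> b)\<^sup>2)))"
  by (subst prod_ennreal) (auto intro: ennreal_leI)
qed

lemma nn_integral_lborel_affine:
 fixes f :: "'a::euclidean_space => ennreal"
 assumes [measurable]: "f \<in> borel_measurable borel" and c: "c > 0"
 shows "(\<integral>\<^sup>+x. f x \<partial>lborel) = (\<integral>\<^sup>+x. ennreal (c ^ DIM('a)) * f (a + c *\<^sub>R x) \<partial>lborel)"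
proof -
 have "(\<integral>\<^sup>+x. f x \<partial>lborel) = (\<integral>\<^sup>+x. f x \<partial>density (distr lborel borel (%x. a + c *\<^sub>R x)) (%_. \<bar>c\<bar>^DIM('a)))"
  using c by (subst lborel_affine[of c a]) auto
 also have "... = (\<integral>\<^sup>+x. ennreal (c ^ DIM('a)) * f (a + c *\<^sub>R x) \<partial>lborel)"
  using c by (subst nn_integral_density) (auto simp: nn_integral_distr)
 finally show ?thesis .
qed

section \<open>Weights from sums of squares of holomorphic functions\<close>

text \<open>The weight phi = 2 |x|^2 + al log (sum of |q_i|^2). The lower bound c keeps the
  logarithm smooth and E bounded by a Gaussian; the quadratic term provides integrability and the
  curvature 2.\<close>

locale log_sum_weight =
 fixes q :: "'i::finite => complex^'n::finite => complex" and al c :: real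
 assumes q_ck: "ck 2 (q i)" and q_hol: "dzb j (q i) x = 0"
  and al: "al > 0" and c: "c > 0" and q_ge: "c <= (\<Sum>i\<in>UNIV. (norm (q i x))\<^sup>2)"
begin

definition Q :: "complex^'n => real" where "Q x = (\<Sum>i\<in>UNIV. (norm (q i x))\<^sup>2)"
definition fe :: "complex^'n => real" where "fe x = 2 * (norm x)\<^sup>2 + al * ln (Q x)"
definition E :: "complex^'n => real" where "E x = exp (- fe x)"
definition T :: "'n => complex^'n => complex" where "T k x = (\<Sum>i\<in>UNIV. dz k (q i) x * cnj (q i x))"
definition ph :: "'n => complex^'n => complex" where
 "ph k x = complex_of_real al * (T k x * inverse (complex_of_real (Q x))) + 2 * cnj (x $ k)"

lemma Q_pos: "Q x > 0" using c q_ge[of x] by (simp add: Q_def)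

lemma Q_complex: "complex_of_real (Q x) = (\<Sum>i\<in>UNIV. q i x * cnj (q i x))"
 unfolding Q_def by (simp add: complex_norm_square[symmetric])

lemma Q_nz: "complex_of_real (Q x) ~= 0" using Q_pos[of x] by simp

lemma q_ck1: "ck 1 (q i)" using ck_le[OF q_ck, of 1] by (simp del: ck.simps)

lemma dq_ck: "ck 1 (dz k (q i))" using ck_dz[of 1 "q i" k] q_ck by (simp add: numeral_2_eq_2 del: ck.simps)

lemma ck_Q: "ck 2 (%x. complex_of_real (Q x))"
 unfolding Q_complex by (intro ck_sum ck_mult ck_cnj q_ck)

lemma ck1_Q: "ck 1 (%x. complex_of_real (Q x))" using ck_le[OF ck_Q, of 1] by (simp del: ck.simps)

lemma dz_Q: "dz k (%x. complex_of_real (Q x)) x = T k x"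
 "dzb k (%x. complex_of_real (Q x)) x = cnj (T k x)"
proof -
 have m: "ck 1 (%x. q i x * cnj (q i x))" for i by (intro ck_mult ck_cnj q_ck1)
 show "dz k (%x. complex_of_real (Q x)) x = T k x"
  unfolding Q_complex T_def dz_sum[OF m] dz_mult[OF q_ck1 ck_cnj[OF q_ck1]] dz_cnj[OF q_ck1] q_hol by simp
 show "dzb k (%x. complex_of_real (Q x)) x = cnj (T k x)"
  unfolding Q_complex T_def dzb_sum[OF m] dzb_mult[OF q_ck1 ck_cnj[OF q_ck1]] dzb_cnj[OF q_ck1] q_hol by (simp add: mult.commute)
qed

lemma Q_cont: "continuous_on UNIV Q" using continuous_on_Re[OF ck_cont[OF ck_Q]] by simp

lemma ln_deriv: "(ln has_real_derivative 1 / Q x) (at (Q x))"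
 using Q_pos[of x] by (auto intro!: derivative_eq_intros)

lemma ck_lnQ: "ck 1 (%x. complex_of_real (ln (Q x)))"
proof -
 have "ck (Suc 0) (%x. complex_of_real (ln (Q x)))"
 proof (rule ck_real_comp[where g' = "%y. 1 / y", OF _ ln_deriv])
  show "ck (Suc 0) (%x. complex_of_real (Q x))" using ck1_Q by (simp only: One_nat_def)
  have "continuous_on UNIV (%x. complex_of_real (1 / Q x))"
   using Q_pos by (intro continuous_intros Q_cont) (auto simp: less_imp_neq[THEN not_sym])
  then show "ck 0 (%x. complex_of_real (1 / Q x))" by simp
 qed
 then show ?thesis by (simp only: One_nat_def)
qed

lemma dz_lnQ: "dz k (%x. complex_of_real (ln (Q x))) x = complex_of_real (1 / Q x) * T k x"
 using dz_real_comp(1)[of Q ln "%y. 1 / y", OF ck1_Q ln_deriv] by (simp only: dz_Q)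

lemma norm_complex: "complex_of_real ((norm x)\<^sup>2) = (\<Sum>i\<in>UNIV. x $ i * cnj (x $ i))" for x :: "complex^'n"
 unfolding norm_sq_vec by (simp add: complex_norm_square[symmetric])

lemma ck_norm: "ck 1 (%x::complex^'n. complex_of_real ((norm x)\<^sup>2))"
 unfolding norm_complex by (intro ck_sum ck_mult ck_cnj ck_nth)

lemma dz_norm: "dz k (%x::complex^'n. complex_of_real ((norm x)\<^sup>2)) x = cnj (x $ k)"
proof -
 have m: "ck 1 (%x::complex^'n. x $ i * cnj (x $ i))" for i by (intro ck_mult ck_cnj ck_nth)
 have "dz k (%x::complex^'n. complex_of_real ((norm x)\<^sup>2)) x = (\<Sum>i\<in>UNIV. if i = k then cnj (x $ i) else 0)"
  unfolding norm_complex dz_sum[OF m] dz_mult[OF ck_nth ck_cnj[OF ck_nth]] dz_cnj[OF ck_nth] dz_nth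
  by (intro sum.cong) auto
 then show ?thesis by simp
qed

lemma fe_complex: "complex_of_real (fe x) = 2 * complex_of_real ((norm x)\<^sup>2) + complex_of_real al * complex_of_real (ln (Q x))"
 by (simp add: fe_def)

lemma ck_fe: "ck 1 (%x. complex_of_real (fe x))"
 unfolding fe_complex by (intro ck_add ck_mult ck_const ck_norm ck_lnQ)

lemma dz_fe: "dz k (%x. complex_of_real (fe x)) x = ph k x"
 unfolding fe_complex dz_add[OF ck_mult[OF ck_const ck_norm] ck_mult[OF ck_const ck_lnQ]]
  dz_mult[OF ck_const ck_norm] dz_mult[OF ck_const ck_lnQ] dz_norm dz_lnQ ph_def
 by (simp add: divide_inverse mult.commute)

lemma exp_deriv: "((%y. exp (- y)) has_real_derivative - exp (- fe x)) (at (fe x))"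
 by (auto intro!: derivative_eq_intros)

lemma E_ck': "ck 1 (%x. complex_of_real (E x))"
proof -
 have fc: "continuous_on UNIV fe" using continuous_on_Re[OF ck_cont[OF ck_fe]] by simp
 have "ck (Suc 0) (%x. complex_of_real (exp (- fe x)))"
 proof (rule ck_real_comp[where g' = "%y. - exp (- y)", OF _ exp_deriv])
  show "ck (Suc 0) (%x. complex_of_real (fe x))" using ck_fe by (simp only: One_nat_def)
  have "continuous_on UNIV (%x. complex_of_real (- exp (- fe x)))" by (intro continuous_intros fc)
  then show "ck 0 (%x. complex_of_real (- exp (- fe x)))" by simp
 qed
 then show ?thesis by (simp only: One_nat_def E_def)
qed

lemma dz_E: "dz k (%x. complex_of_real (E x)) x = - ph k x * complex_of_real (E x)"
 using dz_real_comp(1)[of fe "%y. exp (- y)" "%y. - exp (- y)", OF ck_fe exp_deriv, of k x] unfolding E_def dz_fe by simp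

lemma T_ck: "ck 1 (T k)" unfolding T_def[abs_def] by (intro ck_sum ck_mult ck_cnj dq_ck q_ck1)

lemma iQ_ck: "ck 1 (%x. inverse (complex_of_real (Q x)))" by (rule ck_inverse[OF Q_nz ck1_Q])

lemma ph_ck': "ck 1 (ph k)"
 unfolding ph_def[abs_def] by (intro ck_add ck_mult ck_const ck_cnj ck_nth T_ck iQ_ck)

lemma dzb_T: "dzb j (T k) x = (\<Sum>i\<in>UNIV. dz k (q i) x * cnj (dz j (q i) x))"
proof -
 have m: "ck 1 (%x. dz k (q i) x * cnj (q i x))" for i by (intro ck_mult ck_cnj q_ck1 dq_ck)
 have "dzb j (q i) = (%_. 0)" for i by (simp add: fun_eq_iff q_hol)
 then have z: "dzb j (dz k (q i)) x = 0" for i using dzb_dz_commute[OF q_ck, of j k i x] by simp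
 show ?thesis unfolding T_def[abs_def] dzb_sum[OF m] dzb_mult[OF dq_ck ck_cnj[OF q_ck1]] dzb_cnj[OF q_ck1] z by simp
qed

lemma dzb_ph: "dzb j (ph k) x = complex_of_real al * (dzb j (T k) x * inverse (complex_of_real (Q x))
  - T k x * cnj (T j x) * (inverse (complex_of_real (Q x)) * inverse (complex_of_real (Q x)))) + (if j = k then 2 else 0)"
 unfolding ph_def[abs_def] dzb_add[OF ck_mult[OF ck_const ck_mult[OF T_ck iQ_ck]] ck_mult[OF ck_const ck_cnj[OF ck_nth]]]
  dzb_mult[OF ck_const ck_mult[OF T_ck iQ_ck]] dzb_mult[OF ck_const ck_cnj[OF ck_nth]] dzb_mult[OF T_ck iQ_ck]
  dz_inverse(2)[OF ck1_Q Q_nz] dzb_cnj[OF ck_nth] dz_nth dz_Q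
 by simp

text \<open>The quadratic term contributes 2 |a|^2. With V_i the derivative of q_i along a, the rest
  is al/Q^2 times Q (sum of |V_i|^2) - |sum of V_i cnj q_i|^2, nonnegative by Cauchy-Schwarz in
  i.\<close>

lemma psh': "Re (\<Sum>j\<in>UNIV. \<Sum>k\<in>UNIV. a j * cnj (dzb j (ph k) x * a k)) \<ge> 2 * (norm (a m))\<^sup>2"
proof -
 define V where "V = (%i. \<Sum>j\<in>UNIV. a j * dz j (q i) x)"
 define Y where "Y = (\<Sum>j\<in>UNIV. a j * T j x)"
 define iq where "iq = inverse (Q x)"
 have iq: "iq > 0" using Q_pos[of x] by (simp add: iq_def)
 have Y: "Y = (\<Sum>i\<in>UNIV. V i * cnj (q i x))"
  unfolding Y_def V_def T_def sum_distrib_left sum_distrib_right by (subst sum.swap) (simp add: mult.assoc)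
 have s1: "(\<Sum>j\<in>UNIV. \<Sum>k\<in>UNIV. a j * cnj (dzb j (T k) x * a k)) = (\<Sum>i\<in>UNIV. V i * cnj (V i))"
 proof -
  have "(\<Sum>i\<in>UNIV. V i * cnj (V i)) = (\<Sum>i\<in>UNIV. \<Sum>j\<in>UNIV. \<Sum>k\<in>UNIV. (a j * dz j (q i) x) * cnj (a k * dz k (q i) x))"
   unfolding V_def cnj_sum sum_product ..
  also have "... = (\<Sum>j\<in>UNIV. \<Sum>i\<in>UNIV. \<Sum>k\<in>UNIV. (a j * dz j (q i) x) * cnj (a k * dz k (q i) x))" by (rule sum.swap)
  also have "... = (\<Sum>j\<in>UNIV. \<Sum>k\<in>UNIV. \<Sum>i\<in>UNIV. (a j * dz j (q i) x) * cnj (a k * dz k (q i) x))"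
   by (intro sum.cong refl sum.swap)
  also have "... = (\<Sum>j\<in>UNIV. \<Sum>k\<in>UNIV. a j * cnj (dzb j (T k) x * a k))"
   unfolding dzb_T by (simp add: sum_distrib_left sum_distrib_right mult_ac)
  finally show ?thesis ..
 qed
 have s2: "(\<Sum>j\<in>UNIV. \<Sum>k\<in>UNIV. a j * cnj (T k x * cnj (T j x) * a k)) = Y * cnj Y"
  unfolding Y_def cnj_sum sum_product by (simp add: mult_ac)
 have s3: "(\<Sum>j\<in>UNIV. \<Sum>k\<in>UNIV. a j * cnj ((if j = k then 2 else 0) * a k)) = 2 * (\<Sum>j\<in>UNIV. a j * cnj (a j))"
 proof -
  have "(\<Sum>k\<in>UNIV. a j * cnj ((if j = k then 2 else 0) * a k)) = 2 * (a j * cnj (a j))" for j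
  proof -
   have "(\<Sum>k\<in>UNIV. a j * cnj ((if j = k then 2 else 0) * a k)) = (\<Sum>k\<in>UNIV. if j = k then 2 * (a j * cnj (a k)) else 0)"
    by (intro sum.cong) auto
   then show ?thesis by simp
  qed
  then show ?thesis by (simp add: sum_distrib_left)
 qed
 have "(\<Sum>j\<in>UNIV. \<Sum>k\<in>UNIV. a j * cnj (dzb j (ph k) x * a k))
  = (\<Sum>j\<in>UNIV. \<Sum>k\<in>UNIV. complex_of_real (al * iq) * (a j * cnj (dzb j (T k) x * a k))
    - complex_of_real (al * (iq * iq)) * (a j * cnj (T k x * cnj (T j x) * a k)) + a j * cnj ((if j = k then 2 else 0) * a k))"
  unfolding dzb_ph iq_def by (intro sum.cong refl) (simp add: algebra_simps)
 also have "... = complex_of_real (al * iq) * (\<Sum>i\<in>UNIV. V i * cnj (V i)) - complex_of_real (al * (iq * iq)) * (Y * cnj Y) + 2 * (\<Sum>j\<in>UNIV. a j * cnj (a j))"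
  by (simp only: sum.distrib sum_subtractf sum_distrib_left[of "complex_of_real (al * iq)", symmetric] sum_distrib_left[of "complex_of_real (al * (iq * iq))", symmetric] s1 s2 s3)
 also have "... = complex_of_real (al * iq * (\<Sum>i\<in>UNIV. (norm (V i))\<^sup>2) - al * (iq * iq) * (norm Y)\<^sup>2 + 2 * (\<Sum>j\<in>UNIV. (norm (a j))\<^sup>2))"
  by (simp add: complex_norm_square[symmetric])
 finally have eq: "Re (\<Sum>j\<in>UNIV. \<Sum>k\<in>UNIV. a j * cnj (dzb j (ph k) x * a k))
  = al * iq * (\<Sum>i\<in>UNIV. (norm (V i))\<^sup>2) - al * (iq * iq) * (norm Y)\<^sup>2 + 2 * (\<Sum>j\<in>UNIV. (norm (a j))\<^sup>2)" by simp
 have "norm Y <= (\<Sum>i\<in>UNIV. norm (V i) * norm (q i x))"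
  unfolding Y using norm_sum[of "%i. V i * cnj (q i x)" UNIV] by (simp add: norm_mult)
 then have "(norm Y)\<^sup>2 <= (\<Sum>i\<in>UNIV. norm (V i) * norm (q i x))\<^sup>2" by (intro power_mono) auto
 also have "... <= (\<Sum>i\<in>UNIV. (norm (V i))\<^sup>2) * Q x"
  unfolding Q_def by (rule Cauchy_Schwarz_ineq_sum)
 finally have "(iq * iq) * (norm Y)\<^sup>2 <= (iq * iq) * ((\<Sum>i\<in>UNIV. (norm (V i))\<^sup>2) * Q x)" by (intro mult_left_mono) auto
 also have "... = iq * (\<Sum>i\<in>UNIV. (norm (V i))\<^sup>2)" using Q_pos[of x] by (simp add: iq_def field_simps)
 finally have "al * ((iq * iq) * (norm Y)\<^sup>2) <= al * (iq * (\<Sum>i\<in>UNIV. (norm (V i))\<^sup>2))" using al by simp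
 moreover have "(norm (a m))\<^sup>2 <= (\<Sum>j\<in>UNIV. (norm (a j))\<^sup>2)" by (intro member_le_sum) auto
 ultimately show ?thesis unfolding eq by (simp add: mult.assoc)
qed

lemma E_powr: "E x = exp (- 2 * (norm x)\<^sup>2) * Q x powr (- al)"
 unfolding E_def fe_def using Q_pos[of x] by (simp add: powr_def exp_add[symmetric])

lemma E_le: "E x <= c powr (- al) * exp (- 2 * (norm x)\<^sup>2)"
proof -
 have "Q x powr (- al) <= c powr (- al)" using c al q_ge[of x] by (intro powr_mono2') (auto simp: Q_def)
 then show ?thesis unfolding E_powr by (simp add: mult.commute)
qed

lemma E_int': "integrable lborel E"
proof (rule Bochner_Integration.integrable_bound)
 show "integrable lborel (%x::complex^'n. c powr (- al) * exp (- 2 * (norm x)\<^sup>2))"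
 proof (rule integrable_mult_right, rule integrableI_bounded)
  show "(%x::complex^'n. exp (- 2 * (norm x)\<^sup>2)) \<in> borel_measurable lborel" by simp
  show "(\<integral>\<^sup>+(x::complex^'n). ennreal (norm (exp (- 2 * (norm x)\<^sup>2))) \<partial>lborel) < \<infinity>" using nn_integral_gaussian by simp
 qed
 show "E \<in> borel_measurable lborel"
  using borel_measurable_continuous_onI[OF continuous_on_Re[OF ck_cont[OF E_ck']]] by simp
 show "AE x in lborel. norm (E x) <= norm (c powr (- al) * exp (- 2 * (norm x)\<^sup>2))"
  using E_le by (intro AE_I2) (simp add: E_def)
qed

lemma psh_weight_E: "psh_weight E ph"
 by unfold_locales (rule E_ck' dz_E ph_ck' psh' E_int' | simp add: E_def)+

end

section \<open>Concentration of the twist kernel on a slice\<close>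

text \<open>Substituting z_m = w + sqrt t xi turns the kernel into a fixed profile in xi while the
  point of evaluation tends to the slice; dominated convergence does the rest. The slice integral is
  written over all of C^n with z_m as a dummy variable in a disk, hence the area factor on the
  left.\<close>

lemma slice_kernel_limit:
 fixes E :: "complex^'n::finite => real" and m :: 'n and w :: complex
 assumes Ec: "continuous_on UNIV E" and E0: "\<And>x. E x \<ge> 0" and EM: "\<And>x. E x <= M * exp (- 2 * (norm x)\<^sup>2)" and r: "r > 0"
  and t: "\<And>j. t j > 0" "t \<longlonglongrightarrow> 0"
 shows "(%j. (\<integral>\<^sup>+x. ennreal (t j / ((norm (x $ m - w))\<^sup>2 + t j)\<^sup>2 * E x) \<partial>lborel) * emeasure lborel (ball (0::complex) r))
  \<longlonglongrightarrow> (\<integral>\<^sup>+(x::complex). ennreal (1 / (1 + (norm x)\<^sup>2)\<^sup>2) \<partial>lborel) * (\<integral>\<^sup>+z. ennreal (E (upd z m w)) * indicator (ball 0 r) (z $ m) \<partial>lborel)"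
proof -
 define K where "K = (%x::complex. 1 / (1 + (norm x)\<^sup>2)\<^sup>2)"
 have Kc: "continuous_on UNIV K" unfolding K_def
 proof (intro continuous_intros ballI)
  fix x :: complex have "1 + (norm x)\<^sup>2 > 0" by (simp add: add_pos_nonneg)
  then show "(1 + (norm x)\<^sup>2)\<^sup>2 ~= 0" by simp
 qed
 have [measurable]: "K \<in> borel_measurable borel" by (rule borel_measurable_continuous_onI[OF Kc])
 have K0: "K x \<ge> 0" for x by (simp add: K_def)
 have [measurable]: "E \<in> borel_measurable borel" by (rule borel_measurable_continuous_onI[OF Ec])
 have M0: "M \<ge> 0" using E0[of 0] EM[of 0] by simp
 define b where "b = (%w::complex. indicator (ball 0 r) w :: ennreal)"
 have [measurable]: "b \<in> borel_measurable borel" unfolding b_def by (rule borel_measurable_indicator) simp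
 define G where "G = (%j (p :: (complex^'n) \<times> complex). ennreal (K (snd p) * E (upd (fst p) m (w + sqrt (t j) *\<^sub>R snd p))) * b (fst p $ m))"
 define G' where "G' = (%(p :: (complex^'n) \<times> complex). ennreal (K (snd p) * E (upd (fst p) m w)) * b (fst p $ m))"
 have updm: "(%p. upd (fst p) m (w + s *\<^sub>R snd p)) \<in> borel_measurable (borel \<Otimes>\<^sub>M borel)" for s :: real
  by (simp add: borel_prod) (intro borel_measurable_continuous_onI continuous_intros)
 have Gm [measurable]: "G j \<in> borel_measurable (lborel \<Otimes>\<^sub>M lborel)" for j
  unfolding G_def using measurable_compose[OF updm[of "sqrt (t j)"], of E borel] by (simp cong: measurable_cong_sets) measurable
 have G'm [measurable]: "G' \<in> borel_measurable (lborel \<Otimes>\<^sub>M lborel)"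
  unfolding G'_def using measurable_compose[OF updm[of 0], of E borel] by (simp cong: measurable_cong_sets) measurable
 have G_int: "(\<integral>\<^sup>+p. G j p \<partial>(lborel \<Otimes>\<^sub>M lborel)) = (\<integral>\<^sup>+x. ennreal (t j / ((norm (x $ m - w))\<^sup>2 + t j)\<^sup>2 * E x) \<partial>lborel) * emeasure lborel (ball (0::complex) r)" for j
 proof -
  have t0: "t j > 0" by (rule t)
  define kx where "kx = (%\<zeta>. t j / ((norm (\<zeta> - w))\<^sup>2 + t j)\<^sup>2)"
  have kx0: "kx \<zeta> \<ge> 0" for \<zeta> using t0 by (simp add: kx_def)
  have kxc: "continuous_on UNIV kx" unfolding kx_def
  proof (intro continuous_intros ballI)
   fix x have "(norm (x - w))\<^sup>2 + t j > 0" using t0 by (simp add: add_nonneg_pos)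
   then show "((norm (x - w))\<^sup>2 + t j)\<^sup>2 ~= 0" by simp
  qed
  have [measurable]: "kx \<in> borel_measurable borel" by (rule borel_measurable_continuous_onI[OF kxc])
  have "(\<integral>\<^sup>+x. ennreal (kx (x $ m) * E x) \<partial>lborel) * (\<integral>\<^sup>+\<zeta>. b \<zeta> \<partial>lborel)
    = (\<integral>\<^sup>+z. \<integral>\<^sup>+\<zeta>. ennreal (kx (upd z m \<zeta> $ m) * E (upd z m \<zeta>)) * b (z $ m) \<partial>lborel \<partial>lborel)"
   by (rule nn_integral_upd) measurable
  also have "... = (\<integral>\<^sup>+z. \<integral>\<^sup>+\<xi>. G j (z, \<xi>) \<partial>lborel \<partial>lborel)"
  proof (rule nn_integral_cong)
   fix z :: "complex^'n"
   define f where "f = (%\<zeta>. ennreal (kx \<zeta> * E (upd z m \<zeta>)) * b (z $ m))"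
   have "continuous_on UNIV (%\<zeta>. kx \<zeta> * E (upd z m \<zeta>))"
    by (intro continuous_intros kxc continuous_on_compose2[OF Ec]) auto
   then have "(%\<zeta>. kx \<zeta> * E (upd z m \<zeta>)) \<in> borel_measurable borel" by (rule borel_measurable_continuous_onI)
   then have fm: "f \<in> borel_measurable borel" unfolding f_def by measurable
   have "(\<integral>\<^sup>+\<zeta>. f \<zeta> \<partial>lborel) = (\<integral>\<^sup>+\<xi>. ennreal (sqrt (t j) ^ DIM(complex)) * f (w + sqrt (t j) *\<^sub>R \<xi>) \<partial>lborel)"
    by (rule nn_integral_lborel_affine[OF fm]) (simp add: t0)
   also have "... = (\<integral>\<^sup>+\<xi>. G j (z, \<xi>) \<partial>lborel)"
   proof (rule nn_integral_cong)
    fix \<xi> :: complex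
    have "t j * kx (w + sqrt (t j) *\<^sub>R \<xi>) = K \<xi>"
    proof -
     have "(norm (sqrt (t j) *\<^sub>R \<xi>))\<^sup>2 + t j = t j * (1 + (norm \<xi>)\<^sup>2)"
      using t0 by (simp add: power_mult_distrib algebra_simps)
     then have "t j * kx (w + sqrt (t j) *\<^sub>R \<xi>) = t j * (t j / (t j * (1 + (norm \<xi>)\<^sup>2))\<^sup>2)"
      unfolding kx_def by simp
     also have "... = K \<xi>" unfolding K_def using t0 by (simp add: power_mult_distrib power2_eq_square[of "t j"])
     finally show ?thesis .
    qed
    then have "ennreal (t j) * ennreal (kx (w + sqrt (t j) *\<^sub>R \<xi>) * E (upd z m (w + sqrt (t j) *\<^sub>R \<xi>)))
      = ennreal (K \<xi> * E (upd z m (w + sqrt (t j) *\<^sub>R \<xi>)))"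
     using t0 kx0 E0 by (subst ennreal_mult[symmetric]) (auto simp: mult.assoc[symmetric])
    then show "ennreal (sqrt (t j) ^ DIM(complex)) * f (w + sqrt (t j) *\<^sub>R \<xi>) = G j (z, \<xi>)"
     using t0 by (simp add: f_def G_def mult.assoc[symmetric])
   qed
   finally show "(\<integral>\<^sup>+\<zeta>. ennreal (kx (upd z m \<zeta> $ m) * E (upd z m \<zeta>)) * b (z $ m) \<partial>lborel) = (\<integral>\<^sup>+\<xi>. G j (z, \<xi>) \<partial>lborel)"
    by (simp add: f_def)
  qed
  also have "... = (\<integral>\<^sup>+p. G j p \<partial>(lborel \<Otimes>\<^sub>M lborel))" by (rule lborel.nn_integral_fst) measurable
  finally show ?thesis by (simp add: kx_def b_def)
 qed
 have G'_int: "(\<integral>\<^sup>+p. G' p \<partial>(lborel \<Otimes>\<^sub>M lborel)) = (\<integral>\<^sup>+x. ennreal (K x) \<partial>lborel) * (\<integral>\<^sup>+z. ennreal (E (upd z m w)) * b (z $ m) \<partial>lborel)"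
 proof -
  have "continuous_on UNIV (%z. E (upd z m w))" by (intro continuous_on_compose2[OF Ec] continuous_intros) auto
  then have [measurable]: "(%z. E (upd z m w)) \<in> borel_measurable borel" by (rule borel_measurable_continuous_onI)
  have "(\<integral>\<^sup>+p. G' p \<partial>(lborel \<Otimes>\<^sub>M lborel)) = (\<integral>\<^sup>+z. \<integral>\<^sup>+\<xi>. G' (z, \<xi>) \<partial>lborel \<partial>lborel)"
   by (rule lborel.nn_integral_fst[symmetric]) measurable
  also have "... = (\<integral>\<^sup>+z. \<integral>\<^sup>+\<xi>. ennreal (K \<xi>) * (ennreal (E (upd z m w)) * b (z $ m)) \<partial>lborel \<partial>lborel)"
   unfolding G'_def by (simp add: ennreal_mult K0 E0 mult.assoc)
  also have "... = (\<integral>\<^sup>+z. (\<integral>\<^sup>+\<xi>. ennreal (K \<xi>) \<partial>lborel) * (ennreal (E (upd z m w)) * b (z $ m)) \<partial>lborel)"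
   by (intro nn_integral_cong nn_integral_multc) measurable
  also have "... = (\<integral>\<^sup>+x. ennreal (K x) \<partial>lborel) * (\<integral>\<^sup>+z. ennreal (E (upd z m w)) * b (z $ m) \<partial>lborel)"
   by (rule nn_integral_cmult) measurable
  finally show ?thesis .
 qed
 \<comment> \<open>For |z_m| < r, changing the m-th coordinate lowers |z|^2 by at most r^2, so the
   Gaussian at the changed point is at most exp (2 r^2) times the one at z. This majorant is free of
   j.\<close>
 define D where "D = (%(p :: (complex^'n) \<times> complex). ennreal (M * exp (2 * r\<^sup>2)) * (ennreal (exp (- 2 * (norm (fst p))\<^sup>2)) * ennreal (K (snd p))))"
 have Dm [measurable]: "D \<in> borel_measurable (lborel \<Otimes>\<^sub>M lborel)" unfolding D_def by (simp cong: measurable_cong_sets)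
 have D_fin: "(\<integral>\<^sup>+p. D p \<partial>(lborel \<Otimes>\<^sub>M lborel)) < \<infinity>"
 proof -
  have "(\<integral>\<^sup>+p. D p \<partial>(lborel \<Otimes>\<^sub>M lborel)) = (\<integral>\<^sup>+z. \<integral>\<^sup>+\<xi>. D (z, \<xi>) \<partial>lborel \<partial>lborel)"
   by (rule lborel.nn_integral_fst[symmetric]) measurable
  also have "... = ennreal (M * exp (2 * r\<^sup>2)) * ((\<integral>\<^sup>+(z::complex^'n). ennreal (exp (- 2 * (norm z)\<^sup>2)) \<partial>lborel) * (\<integral>\<^sup>+\<xi>. ennreal (K \<xi>) \<partial>lborel))"
   unfolding D_def by (simp add: nn_integral_cmult nn_integral_multc)
  also have "... < \<infinity>"
   using nn_integral_gaussian[where 'a = "complex^'n"] nn_integral_cauchy_kernel by (simp add: K_def ennreal_mult_less_top)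
  finally show ?thesis .
 qed
 have GD: "G j p <= D p" for j p
 proof (cases "norm (fst p $ m) < r")
  case True
  define z where "z = fst p"
  define y where "y = upd z m (w + sqrt (t j) *\<^sub>R snd p)"
  have "(norm z)\<^sup>2 <= (norm y)\<^sup>2 + r\<^sup>2"
  proof -
   have "(norm z)\<^sup>2 = (norm (z $ m))\<^sup>2 + (\<Sum>i\<in>UNIV-{m}. (norm (z $ i))\<^sup>2)"
    unfolding norm_sq_vec by (subst sum.remove[of _ m]) auto
   also have "(\<Sum>i\<in>UNIV-{m}. (norm (z $ i))\<^sup>2) = (\<Sum>i\<in>UNIV-{m}. (norm (y $ i))\<^sup>2)" unfolding y_def by (intro sum.cong) auto
   also have "... <= (norm y)\<^sup>2" unfolding norm_sq_vec by (intro sum_mono2) auto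
   also have "(norm (z $ m))\<^sup>2 <= r\<^sup>2" using True by (intro power_mono) (auto simp: z_def)
   finally show ?thesis by linarith
  qed
  then have "exp (- 2 * (norm y)\<^sup>2) <= exp (2 * r\<^sup>2) * exp (- 2 * (norm z)\<^sup>2)" by (simp add: exp_add[symmetric])
  then have "M * exp (- 2 * (norm y)\<^sup>2) <= M * (exp (2 * r\<^sup>2) * exp (- 2 * (norm z)\<^sup>2))" using M0 by (rule mult_left_mono)
  then have "E y <= M * (exp (2 * r\<^sup>2) * exp (- 2 * (norm z)\<^sup>2))" using EM[of y] by linarith
  then have "K (snd p) * E y <= K (snd p) * (M * (exp (2 * r\<^sup>2) * exp (- 2 * (norm z)\<^sup>2)))" using K0 by (rule mult_left_mono)
  also have "... = M * exp (2 * r\<^sup>2) * (exp (- 2 * (norm z)\<^sup>2) * K (snd p))" by (simp add: mult_ac)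
  finally have "ennreal (K (snd p) * E y) <= ennreal (M * exp (2 * r\<^sup>2) * (exp (- 2 * (norm z)\<^sup>2) * K (snd p)))" by (rule ennreal_leI)
  also have "... = D p" unfolding D_def z_def using M0 K0 by (simp add: ennreal_mult)
  finally show ?thesis using True by (simp add: G_def b_def y_def z_def)
 qed (simp add: G_def b_def)
 have lim: "(%j. G j p) \<longlonglongrightarrow> G' p" for p
 proof -
  have "(%j. w + sqrt (t j) *\<^sub>R snd p) \<longlonglongrightarrow> w + sqrt 0 *\<^sub>R snd p" by (intro tendsto_intros t)
  then have l1: "(%j. w + sqrt (t j) *\<^sub>R snd p) \<longlonglongrightarrow> w" by simp
  have "continuous_on UNIV (%\<zeta>. E (upd (fst p) m \<zeta>))" by (intro continuous_on_compose2[OF Ec] continuous_intros) auto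
  then have "(%j. E (upd (fst p) m (w + sqrt (t j) *\<^sub>R snd p))) \<longlonglongrightarrow> E (upd (fst p) m w)"
   by (rule continuous_on_tendsto_compose[OF _ l1]) auto
  then have "(%j. ennreal (K (snd p) * E (upd (fst p) m (w + sqrt (t j) *\<^sub>R snd p)))) \<longlonglongrightarrow> ennreal (K (snd p) * E (upd (fst p) m w))"
   by (intro tendsto_ennrealI tendsto_intros)
  then show ?thesis unfolding G_def G'_def b_def by (cases "fst p $ m \<in> ball 0 r") auto
 qed
 have "(%j. \<integral>\<^sup>+p. G j p \<partial>(lborel \<Otimes>\<^sub>M lborel)) \<longlonglongrightarrow> (\<integral>\<^sup>+p. G' p \<partial>(lborel \<Otimes>\<^sub>M lborel))"
  by (rule nn_integral_dominated_convergence[OF Gm G'm Dm]) (use D_fin GD lim in auto)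
 then show ?thesis unfolding G_int G'_int by (simp add: K_def b_def)
qed

section \<open>Polynomials, and regularised negative powers of |p|\<close>

text \<open>Generated by constants, coordinates, sums and products, without reference to
  coefficients. The two operations of the stability induction, freezing a coordinate and
  translating, are then immediate inductions.\<close>

inductive polyfun :: "(complex^'n::finite => complex) => bool" where
 polyfun_const: "polyfun (%_. c)"
| polyfun_nth: "polyfun (%x. x $ i)"
| polyfun_add: "polyfun f ==> polyfun g ==> polyfun (%x. f x + g x)"
| polyfun_mult: "polyfun f ==> polyfun g ==> polyfun (%x. f x * g x)"

lemma polyfun_ck: "polyfun f ==> ck n f"
 by (induction rule: polyfun.induct) (auto intro: ck_const ck_nth ck_add ck_mult simp del: ck.simps)

lemma polyfun_dzb: "polyfun f ==> dzb j f x = 0"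
 by (induction rule: polyfun.induct) (auto simp: dz_nth dzb_add dzb_mult polyfun_ck simp del: ck.simps One_nat_def)

lemma polyfun_sum: "(\<And>i. i \<in> A ==> polyfun (f i)) ==> polyfun (%x. \<Sum>i\<in>A. f i x)"
 by (induction A rule: infinite_finite_induct) (auto intro: polyfun.intros)

lemma polyfun_power: "polyfun f ==> polyfun (%x. f x ^ n)"
 by (induction n) (auto intro: polyfun.intros)

lemma polyfun_upd: "polyfun f ==> polyfun (%x. f (upd x k w))"
proof (induction rule: polyfun.induct)
 case (polyfun_nth i)
 then show ?case by (cases "i = k") (auto intro: polyfun.intros)
qed (auto intro: polyfun.intros)

lemma polyfun_shift: "polyfun f ==> polyfun (%x. f (a + x))"
 by (induction rule: polyfun.induct) (auto intro: polyfun.intros)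

lemma polyfun_cont: "polyfun f ==> continuous_on S f"
 using ck_cont[OF polyfun_ck] continuous_on_subset by blast

lemma powr_le_negpow:
 assumes "s \<ge> 0" "s\<^sup>2 <= y" "\<delta> > 0"
 shows "ennreal (y powr (- (\<delta> / 2))) <= negpow \<delta> s"
proof (cases "s = 0")
 case False
 then have s: "s > 0" using assms by simp
 have "y powr (- (\<delta> / 2)) <= (s\<^sup>2) powr (- (\<delta> / 2))" using assms s by (intro powr_mono2') auto
 also have "(s\<^sup>2) powr (- (\<delta> / 2)) = s powr (- \<delta>)"
  using s by (simp add: powr_powr powr_numeral[symmetric] del: powr_numeral)
 finally show ?thesis using False by (simp add: negpow_def ennreal_leI)
qed (simp add: negpow_def)

lemma negpow_measurable [measurable]: "negpow \<delta> \<in> borel_measurable borel"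
 unfolding negpow_def[abs_def] by measurable

text \<open>Strict positivity of y N matters: \<open>0 powr x = 0\<close>, whereas
  \<open>negpow\<close> is infinite at 0. With y N > 0 the powers diverge when s = 0.\<close>

lemma negpow_liminf:
 assumes s: "s \<ge> 0" and d: "\<delta> > 0" and y: "\<And>N. y N > 0" "y \<longlonglongrightarrow> s\<^sup>2"
 shows "negpow \<delta> s <= liminf (%N. ennreal (y N powr (- (\<delta> / 2))))"
proof (cases "s = 0")
 case False
 then have s: "s > 0" using assms by simp
 have "(%N. y N powr (- (\<delta> / 2))) \<longlonglongrightarrow> (s\<^sup>2) powr (- (\<delta> / 2))" using s by (intro tendsto_intros y) auto
 also have "(s\<^sup>2) powr (- (\<delta> / 2)) = s powr (- \<delta>)"
  using s by (simp add: powr_powr powr_numeral[symmetric] del: powr_numeral)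
 finally have "(%N. ennreal (y N powr (- (\<delta> / 2)))) \<longlonglongrightarrow> negpow \<delta> s"
  using False by (simp add: negpow_def tendsto_ennrealI)
 from lim_imp_Liminf[OF _ this] show ?thesis by simp
next
 case True
 have "filterlim (%N. inverse (y N powr (\<delta> / 2))) at_top sequentially"
 proof (intro filterlim_compose[OF filterlim_inverse_at_top_right])
  have "(%N. y N powr (\<delta> / 2)) \<longlonglongrightarrow> 0"
   using tendsto_zero_powrI[OF _ tendsto_const, of y sequentially "\<delta> / 2"] y True d by (simp add: less_imp_le)
  then show "filterlim (%N. y N powr (\<delta> / 2)) (at_right 0) sequentially"
   using y(1) by (auto simp: filterlim_at intro!: eventuallyI less_imp_neq[THEN not_sym])
 qed
 then have "filterlim (%N. y N powr (- (\<delta> / 2))) at_top sequentially" by (simp add: powr_minus)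
 then have "(%N. ennreal (y N powr (- (\<delta> / 2)))) \<longlonglongrightarrow> \<infinity>"
  by (simp add: ennreal_tendsto_top_eq_at_top)
 from lim_imp_Liminf[OF _ this] show ?thesis by simp
qed

lemma sum_UNIV_Plus_option:
 fixes f :: "'a::finite + 'b::finite option => real"
 shows "(\<Sum>i\<in>UNIV. f i) = (\<Sum>j\<in>UNIV. f (Inl j)) + (\<Sum>i\<in>UNIV. f (Inr (Some i))) + f (Inr None)"
proof -
 have "(\<Sum>i\<in>UNIV. f i) = (\<Sum>j\<in>UNIV. f (Inl j)) + (\<Sum>i\<in>UNIV. f (Inr i))"
  unfolding UNIV_Plus_UNIV[symmetric] by (subst sum.Plus) auto
 also have "(\<Sum>i\<in>UNIV. f (Inr i)) = (\<Sum>i\<in>UNIV. f (Inr (Some i))) + f (Inr None)"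
  unfolding UNIV_option_conv by (subst sum.insert) (auto simp: sum.reindex)
 finally show ?thesis by simp
qed

text \<open>The localisation device. As N grows the added terms vanish inside
  \<open>pdisk 0 R\<close>, while at least 1 is added as soon as a coordinate other than k reaches
  R; the coordinate k is left free because a slice fixes it at w. The last summand keeps the whole
  positive.\<close>

definition approx_norm2 :: "(complex^'n::finite => complex^'j::finite) => 'n => real => nat => complex^'n => real" where
 "approx_norm2 p k R N x = (norm (p x))\<^sup>2 + (\<Sum>i\<in>UNIV - {k}. (norm (x $ i) / R) ^ (2 * Suc N)) + (1 / real (Suc N))\<^sup>2"

text \<open>A polynomial vector whose squared length is \<open>approx_norm2\<close>, so that
  \<open>log_sum_weight\<close> applies. The index type carries the components of p, one power per
  coordinate (0 in the slot of k) and a constant.\<close>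

definition approx_q :: "(complex^'n::finite => complex^'j::finite) => 'n => real => nat => 'j + 'n option => complex^'n => complex" where
 "approx_q p k R N i = (case i of Inl j => (%x. p x $ j)
   | Inr None => (%_. of_real (1 / real (Suc N)))
   | Inr (Some i) => if i = k then (%_. 0) else (%x. (of_real (1 / R) * x $ i) ^ Suc N))"

lemma approx_q_sum:
 assumes "R > 0"
 shows "(\<Sum>i\<in>UNIV. (norm (approx_q p k R N i x))\<^sup>2) = approx_norm2 p k R N x"
proof -
 have "(\<Sum>i\<in>UNIV. (norm (approx_q p k R N (Inr (Some i)) x))\<^sup>2) = (\<Sum>i\<in>UNIV. if i = k then 0 else (norm (x $ i) / R) ^ (2 * Suc N))"
 proof (intro sum.cong refl)
  fix i
  have "(norm ((of_real (1 / R) * x $ i) ^ Suc N))\<^sup>2 = (norm (x $ i) / R) ^ (2 * Suc N)"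
   unfolding norm_power norm_mult norm_of_real power_mult[symmetric] using assms by (simp add: mult.commute)
  then show "(norm (approx_q p k R N (Inr (Some i)) x))\<^sup>2 = (if i = k then 0 else (norm (x $ i) / R) ^ (2 * Suc N))"
   by (simp add: approx_q_def del: power_Suc)
 qed
 also have "... = (\<Sum>i\<in>UNIV - {k}. (norm (x $ i) / R) ^ (2 * Suc N))"
  by (subst sum.remove[of UNIV k]) (auto intro!: sum.cong)
 finally have some: "(\<Sum>i\<in>UNIV. (norm (approx_q p k R N (Inr (Some i)) x))\<^sup>2) = (\<Sum>i\<in>UNIV - {k}. (norm (x $ i) / R) ^ (2 * Suc N))" .
 have none: "(norm (approx_q p k R N (Inr None) x))\<^sup>2 = (1 / real (Suc N))\<^sup>2"
  unfolding approx_q_def by (simp only: sum.case option.case norm_of_real power2_abs)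
 have inl: "(norm (approx_q p k R N (Inl j) x))\<^sup>2 = (norm (p x $ j))\<^sup>2" for j by (simp add: approx_q_def)
 show ?thesis unfolding sum_UNIV_Plus_option approx_norm2_def norm_sq_vec some none inl ..
qed

lemma approx_weight:
 fixes p :: "complex^'n::finite => complex^'j::finite"
 assumes p: "\<And>j. polyfun (%z. p z $ j)" and R: "R > 0" and d: "\<delta> > 0"
 shows "log_sum_weight (approx_q p k R N) (\<delta> / 2) ((1 / real (Suc N))\<^sup>2)"
proof
 have pf: "polyfun (approx_q p k R N i)" for i
 proof (cases i)
  case (Inl j)
  then show ?thesis using p[of j] by (simp add: approx_q_def)
 next
  case (Inr oi)
  have pw: "polyfun (%x::complex^'n. (of_real (1 / R) * x $ i) ^ Suc N)" for i
   by (intro polyfun_power polyfun_mult polyfun_const polyfun_nth)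
  show ?thesis
  proof (cases oi)
   case None
   then show ?thesis using Inr by (simp add: approx_q_def polyfun_const)
  next
   case (Some i')
   then show ?thesis using Inr pw[of i'] by (cases "i' = k") (auto simp add: approx_q_def polyfun_const)
  qed
 qed
 show "ck 2 (approx_q p k R N i)" "dzb j (approx_q p k R N i) x = 0" for i j x
  using polyfun_ck[OF pf] polyfun_dzb[OF pf] by auto
 show "(1 / real (Suc N))\<^sup>2 <= (\<Sum>i\<in>UNIV. (norm (approx_q p k R N i x))\<^sup>2)" for x
  unfolding approx_q_sum[OF R] approx_norm2_def using R by (simp add: add_nonneg_nonneg sum_nonneg)
qed (use d in auto)

lemma approx_norm2_pos: "R > 0 ==> approx_norm2 p k R N x > 0"
 unfolding approx_norm2_def by (intro add_nonneg_pos add_nonneg_nonneg sum_nonneg) auto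

lemma approx_norm2_ge: "R > 0 ==> (norm (p x))\<^sup>2 <= approx_norm2 p k R N x"
 unfolding approx_norm2_def by (simp add: sum_nonneg)

lemma approx_norm2_ge_1:
 assumes "R > 0" "i ~= k" "norm (x $ i) \<ge> R"
 shows "1 <= approx_norm2 p k R N x"
proof -
 have "1 <= (norm (x $ i) / R) ^ (2 * Suc N)" using assms by (intro one_le_power) simp
 also have "... <= (\<Sum>i\<in>UNIV - {k}. (norm (x $ i) / R) ^ (2 * Suc N))" using assms by (intro member_le_sum) auto
 also have "... <= approx_norm2 p k R N x" unfolding approx_norm2_def by simp
 finally show ?thesis .
qed

lemma approx_norm2_le:
 fixes p :: "complex^'n::finite => complex^'j::finite"
 assumes "R > 0" "x \<in> pdisk 0 R" "norm (p x) <= M"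
 shows "approx_norm2 p k R N x <= M\<^sup>2 + real CARD('n) + 1"
proof -
 have "(\<Sum>i\<in>UNIV - {k}. (norm (x $ i) / R) ^ (2 * Suc N)) <= (\<Sum>i\<in>UNIV - {k}. 1)"
  using assms by (intro sum_mono power_le_one) (auto simp: pdisk_def divide_le_eq_1 intro: less_imp_le)
 also have "... <= real CARD('n)" by (simp add: card_Diff_singleton)
 finally have a: "(\<Sum>i\<in>UNIV - {k}. (norm (x $ i) / R) ^ (2 * Suc N)) <= real CARD('n)" .
 have b: "(norm (p x))\<^sup>2 <= M\<^sup>2" using assms by (intro power_mono) auto
 have c: "(1 / real (Suc N))\<^sup>2 <= 1" by (intro power_le_one) auto
 show ?thesis unfolding approx_norm2_def using a b c by linarith
qed

lemma approx_norm2_tendsto: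
 assumes "R > 0" "x \<in> pdisk 0 R"
 shows "(%N. approx_norm2 p k R N x) \<longlonglongrightarrow> (norm (p x))\<^sup>2"
proof -
 have a: "(%N. (norm (x $ i) / R) ^ (2 * Suc N)) \<longlonglongrightarrow> 0" for i
 proof -
  have q: "norm (x $ i) / R < 1" "0 <= norm (x $ i) / R" using assms by (auto simp: pdisk_def)
  have "filterlim (%N. 2 * Suc N) sequentially sequentially"
   by (rule filterlim_subseq) (simp add: strict_mono_def)
  from filterlim_compose[OF LIMSEQ_realpow_zero[OF q(2,1)] this] show ?thesis .
 qed
 have "(%N. 1 / real (Suc N)) \<longlonglongrightarrow> 0" using LIMSEQ_inverse_real_of_nat by (simp add: inverse_eq_divide)
 from tendsto_power[OF this, of 2] have b: "(%N. (1 / real (Suc N))\<^sup>2) \<longlonglongrightarrow> 0" by simp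
 have "(%N. approx_norm2 p k R N x) \<longlonglongrightarrow> (norm (p x))\<^sup>2 + (\<Sum>i\<in>UNIV - {k}. 0) + 0"
  unfolding approx_norm2_def by (intro tendsto_add tendsto_const tendsto_sum a b)
 then show ?thesis by simp
qed

lemma enn_finite_real: assumes "x < (\<infinity>::ennreal)" obtains y where "y \<ge> 0" "x = ennreal y"
 using assms by (cases x) auto

section \<open>From a slice to a neighbourhood of the origin\<close>

text \<open>Inside the polydisk the regularised power is at most \<open>negpow\<close>. Outside,
  some coordinate other than k reaches R, the regularised norm is at least 1 and the Gaussian takes
  over. The bound is uniform in N.\<close>

lemma approx_slice_bound:
 fixes p :: "complex^'n::finite => complex^'j::finite"
 assumes R: "R > 0" and d: "\<delta> > 0" and B: "(\<integral>\<^sup>+z. indicator (pdisk 0 R) z * negpow \<delta> (norm (p (upd z k w))) \<partial>lborel) <= ennreal B" "B \<ge> 0"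
  and Gs: "(\<integral>\<^sup>+(x::complex^'n). ennreal (exp (- 2 * (norm x)\<^sup>2)) \<partial>lborel) = ennreal Gs" "Gs \<ge> 0"
  and p: "continuous_on UNIV p"
 shows "(\<integral>\<^sup>+z. ennreal (exp (- 2 * (norm (upd z k w))\<^sup>2) * approx_norm2 p k R N (upd z k w) powr (- (\<delta> / 2))) * indicator (ball 0 R) (z $ k) \<partial>lborel)
  <= ennreal (B + exp (2 * R\<^sup>2) * Gs)"
proof -
 have "continuous_on UNIV (%z. p (upd z k w))" by (intro continuous_on_compose2[OF p] continuous_intros) auto
 then have [measurable]: "(%z. p (upd z k w)) \<in> borel_measurable borel" by (rule borel_measurable_continuous_onI)
 have pt: "ennreal (exp (- 2 * (norm (upd z k w))\<^sup>2) * approx_norm2 p k R N (upd z k w) powr (- (\<delta> / 2))) * indicator (ball 0 R) (z $ k)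
  <= indicator (pdisk 0 R) z * negpow \<delta> (norm (p (upd z k w))) + ennreal (exp (2 * R\<^sup>2)) * ennreal (exp (- 2 * (norm z)\<^sup>2))" for z
 proof (cases "norm (z $ k) < R")
  case True
  define y where "y = upd z k w"
  have e1: "exp (- 2 * (norm y)\<^sup>2) * approx_norm2 p k R N y powr (- (\<delta> / 2)) <= approx_norm2 p k R N y powr (- (\<delta> / 2))"
   by (rule mult_left_le_one_le) auto
  show ?thesis
  proof (cases "z \<in> pdisk 0 R")
   case in_disk: True
   have "ennreal (exp (- 2 * (norm y)\<^sup>2) * approx_norm2 p k R N y powr (- (\<delta> / 2))) <= ennreal (approx_norm2 p k R N y powr (- (\<delta> / 2)))"
    by (rule ennreal_leI[OF e1])
   also have "... <= negpow \<delta> (norm (p y))" by (rule powr_le_negpow[OF _ approx_norm2_ge[OF R] d]) simp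
   finally show ?thesis using in_disk True by (simp add: y_def add_increasing2)
  next
   case False
   then obtain i where i: "norm (z $ i) \<ge> R" by (auto simp: pdisk_def not_less)
   then have ik: "i ~= k" using True by auto
   have "1 <= approx_norm2 p k R N y" using R ik i by (intro approx_norm2_ge_1[of R i]) (auto simp: y_def)
   then have "approx_norm2 p k R N y powr (- (\<delta> / 2)) <= 1 powr (- (\<delta> / 2))" using d by (intro powr_mono2') auto
   then have "exp (- 2 * (norm y)\<^sup>2) * approx_norm2 p k R N y powr (- (\<delta> / 2)) <= exp (- 2 * (norm y)\<^sup>2) * 1"
    by (intro mult_left_mono) auto
   also have "... <= exp (2 * R\<^sup>2) * exp (- 2 * (norm z)\<^sup>2)"
   proof -
    have "(norm z)\<^sup>2 = (norm (z $ k))\<^sup>2 + (\<Sum>i\<in>UNIV-{k}. (norm (z $ i))\<^sup>2)"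
     unfolding norm_sq_vec by (subst sum.remove[of _ k]) auto
    also have "(\<Sum>i\<in>UNIV-{k}. (norm (z $ i))\<^sup>2) = (\<Sum>i\<in>UNIV-{k}. (norm (y $ i))\<^sup>2)" unfolding y_def by (intro sum.cong) auto
    also have "... <= (norm y)\<^sup>2" unfolding norm_sq_vec by (intro sum_mono2) auto
    also have "(norm (z $ k))\<^sup>2 <= R\<^sup>2" using True by (intro power_mono) auto
    finally have "(norm z)\<^sup>2 <= (norm y)\<^sup>2 + R\<^sup>2" by linarith
    then show ?thesis by (simp add: exp_add[symmetric])
   qed
   finally have "ennreal (exp (- 2 * (norm y)\<^sup>2) * approx_norm2 p k R N y powr (- (\<delta> / 2))) <= ennreal (exp (2 * R\<^sup>2) * exp (- 2 * (norm z)\<^sup>2))"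
    by (rule ennreal_leI)
   then show ?thesis using False True by (simp add: y_def ennreal_mult)
  qed
 qed simp
 have "(\<integral>\<^sup>+z. ennreal (exp (- 2 * (norm (upd z k w))\<^sup>2) * approx_norm2 p k R N (upd z k w) powr (- (\<delta> / 2))) * indicator (ball 0 R) (z $ k) \<partial>lborel)
   <= (\<integral>\<^sup>+z. indicator (pdisk 0 R) z * negpow \<delta> (norm (p (upd z k w))) + ennreal (exp (2 * R\<^sup>2)) * ennreal (exp (- 2 * (norm z)\<^sup>2)) \<partial>lborel)"
  by (intro nn_integral_mono pt)
 also have "... = (\<integral>\<^sup>+z. indicator (pdisk 0 R) z * negpow \<delta> (norm (p (upd z k w))) \<partial>lborel) + ennreal (exp (2 * R\<^sup>2)) * ennreal Gs"
  by (subst nn_integral_add) (measurable, use Gs(1) in \<open>simp add: nn_integral_cmult\<close>)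
 also have "... <= ennreal B + ennreal (exp (2 * R\<^sup>2)) * ennreal Gs" by (intro add_right_mono B)
 also have "... = ennreal (B + exp (2 * R\<^sup>2) * Gs)" using B Gs by (simp add: ennreal_mult ennreal_plus)
 finally show ?thesis .
qed

lemma pdisk_mono: "r <= R ==> pdisk a r \<subseteq> pdisk a R"
 by (auto simp: pdisk_def intro: less_le_trans)

text \<open>If the slice \<open>z\<^sub>k = w\<close> carries an integral of size \<open>\<kappa> / |w|\<^sup>2\<close> with small \<open>\<kappa>\<close>, the extension \<open>F\<close> of the constant \<open>1\<close>
 varies by less than \<open>1/2\<close> between that slice and the origin, so it bounds the integral on a neighbourhood of the origin.\<close>

lemma local_estimate:
 fixes k :: "'n::finite"
 assumes R: "R > 0" and M: "M \<ge> 1" and d: "d > 0"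
 obtains C where "C > 0" and "\<And>(p :: complex^'n => complex^'j::finite) \<delta> w B. (\<And>j. polyfun (%z. p z $ j)) ==> 0 < \<delta> ==> \<delta> <= d ==> w ~= 0
   ==> 4 * norm w <= R ==> (\<And>z. z \<in> pdisk 0 R ==> norm (p z) <= M) ==> B \<ge> 1
   ==> (\<integral>\<^sup>+z. indicator (pdisk 0 R) z * negpow \<delta> (norm (p (upd z k w))) \<partial>lborel) <= ennreal B ==> C * B * (norm w)\<^sup>2 <= 1
   ==> (\<integral>\<^sup>+z. indicator (pdisk 0 (norm w)) z * negpow \<delta> (norm (p z)) \<partial>lborel) <= ennreal (C * B)"
proof -
 define r0 where "r0 = real CARD('n) * R"
 obtain c0 where c0: "c0 \<ge> 0" "(\<integral>\<^sup>+(x::complex). ennreal (1 / (1 + (norm x)\<^sup>2)\<^sup>2) \<partial>lborel) = ennreal c0"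
  using nn_integral_cauchy_kernel by (rule enn_finite_real)
 obtain Gs where Gs: "Gs \<ge> 0" "(\<integral>\<^sup>+(x::complex^'n). ennreal (exp (- 2 * (norm x)\<^sup>2)) \<partial>lborel) = ennreal Gs"
  using nn_integral_gaussian by (rule enn_finite_real)
 have "emeasure lborel (ball (0::complex) R) < \<infinity>" by (rule emeasure_bounded_finite) simp
 then obtain v where v0: "v \<ge> 0" and v: "emeasure lborel (ball (0::complex) R) = ennreal v" by (rule enn_finite_real)
 have vpos: "v > 0" using emeasure_lborel_open_neq_0[of "ball (0::complex) R"] R v v0 by (cases "v = 0") auto
 have "R / 2 > 0" using R by simp
 from emeasure_pdisk[OF this, where 'n = 'n] obtain V where V0: "V \<ge> 0" and V: "emeasure lborel (pdisk (0::complex^'n) (R / 2)) = ennreal V"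
  by (metis enn_finite_real)
 have Vpos: "V > 0" using emeasure_pdisk(2)[OF \<open>R / 2 > 0\<close>, where 'n = 'n] V V0 by (cases "V = 0") auto
 define G1 where "G1 = exp (2 * R\<^sup>2) * Gs"
 have G1: "G1 \<ge> 0" unfolding G1_def using Gs by simp
 \<comment> \<open>Bounds the integral of kk E by A0 B: the limit is at most c0 (B + G1), the two
   added units make the comparison strict so that a positive t can be picked, B >= 1 absorbs them,
   and v is the area of the dummy disk.\<close>
 define A0 where "A0 = (c0 + 1) * (G1 + 2) / v"
 have A0: "A0 > 0" unfolding A0_def using c0 G1 vpos by (intro divide_pos_pos mult_pos_pos) auto
 define C2 where "C2 = 8 * ((r0 + 1 + R)\<^sup>2 + 3) * A0 + 1"
 have C2: "C2 > 0" unfolding C2_def using A0 by (intro add_nonneg_pos mult_nonneg_nonneg) auto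
 define Qm where "Qm = M\<^sup>2 + real CARD('n) + 1"
 have Qm: "Qm \<ge> 1" unfolding Qm_def by simp
 \<comment> \<open>A lower bound for the weight on \<open>pdisk 0 R\<close>, uniform in N, in
   \<delta> <= d and in all p bounded by M.\<close>
 define c3 where "c3 = exp (- 2 * r0\<^sup>2) * Qm powr (- (d / 2))"
 have c3: "c3 > 0" unfolding c3_def using Qm by simp
 define C4 where "C4 = C2 / (c3 * V)"
 have C4: "C4 > 0" unfolding C4_def using C2 c3 Vpos by simp
 \<comment> \<open>The first summand makes the variation of F at most 1/2: the square of 2 |w| sqrt
   (C4 B) / (R/4) is 64 C4 B |w|^2 / R^2, which has to be at most 1/4. The second is the final
   bound, with 4 from |F| >= 1/2 and the exponential from dividing out the Gaussian.\<close>
 define C where "C = 256 * C4 / R\<^sup>2 + 4 * C2 * exp (2 * r0\<^sup>2)"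
 have Cparts: "256 * C4 / R\<^sup>2 <= C" "4 * C2 * exp (2 * r0\<^sup>2) <= C" unfolding C_def using C2 C4 R by auto
 have C: "C > 0" unfolding C_def using C2 C4 R by (intro add_pos_pos) auto
 have main: "(\<integral>\<^sup>+z. indicator (pdisk 0 (norm w)) z * ennreal (approx_norm2 p k R N z powr (- (\<delta> / 2))) \<partial>lborel) <= ennreal (C * B)"
  if p: "\<And>j. polyfun (%z. p z $ j)" and de: "0 < \<delta>" "\<delta> <= d" and w: "w ~= 0" "4 * norm w <= R"
   and pM: "\<And>z. z \<in> pdisk 0 R ==> norm (p z) <= M" and B: "B \<ge> 1"
   and sl: "(\<integral>\<^sup>+z. indicator (pdisk 0 R) z * negpow \<delta> (norm (p (upd z k w))) \<partial>lborel) <= ennreal B"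
   and small: "C * B * (norm w)\<^sup>2 <= 1"
  for p :: "complex^'n => complex^'j" and \<delta> w B N
 proof -
  have "continuous_on UNIV (%z. \<chi> j. p z $ j)" by (intro continuous_on_vec_lambda polyfun_cont p)
  then have pc: "continuous_on UNIV p" by (simp add: vec_lambda_beta[abs_def] vec_nth_inverse)
  interpret lw: log_sum_weight "approx_q p k R N" "\<delta> / 2" "(1 / real (Suc N))\<^sup>2" by (rule approx_weight[OF p R de(1)])
  interpret pw: psh_weight lw.E lw.ph by (rule lw.psh_weight_E)
  have E: "lw.E x = exp (- 2 * (norm x)\<^sup>2) * approx_norm2 p k R N x powr (- (\<delta> / 2))" for x
   unfolding lw.E_powr lw.Q_def approx_q_sum[OF R] ..
  define S where "S = (\<integral>\<^sup>+z. ennreal (lw.E (upd z k w)) * indicator (ball 0 R) (z $ k) \<partial>lborel)"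
  have S: "S <= ennreal (B + G1)"
   unfolding S_def E G1_def by (rule approx_slice_bound[OF R de(1) sl _ Gs(2,1) pc]) (use B in simp)
  have lim: "(%j. (\<integral>\<^sup>+x. ennreal (1 / real (Suc j) / ((norm (x $ k - w))\<^sup>2 + 1 / real (Suc j))\<^sup>2 * lw.E x) \<partial>lborel) * ennreal v)
   \<longlonglongrightarrow> ennreal c0 * S"
   unfolding S_def v[symmetric] c0(2)[symmetric]
  proof (rule slice_kernel_limit[OF pw.E_cont _ lw.E_le R])
   show "(%j. 1 / real (Suc j)) \<longlonglongrightarrow> 0" using LIMSEQ_inverse_real_of_nat by (simp add: inverse_eq_divide)
  qed (auto intro: less_imp_le[OF pw.E_pos])
  have "ennreal c0 * S <= ennreal c0 * ennreal (B + G1)" by (intro mult_left_mono S) auto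
  also have "... = ennreal (c0 * (B + G1))" using c0 B G1 by (simp add: ennreal_mult)
  also have "... < ennreal ((c0 + 1) * (B + G1 + 1))"
  proof (rule ennreal_lessI)
   show "c0 * (B + G1) < (c0 + 1) * (B + G1 + 1)" using c0 B G1 by (simp add: algebra_simps)
   show "0 < (c0 + 1) * (B + G1 + 1)" using c0 B G1 by (intro mult_pos_pos) auto
  qed
  finally have "\<forall>\<^sub>F j in sequentially. (\<integral>\<^sup>+x. ennreal (1 / real (Suc j) / ((norm (x $ k - w))\<^sup>2 + 1 / real (Suc j))\<^sup>2 * lw.E x) \<partial>lborel) * ennreal v
    < ennreal ((c0 + 1) * (B + G1 + 1))"
   by (rule order_tendstoD(2)[OF lim])
  then obtain j where j: "(\<integral>\<^sup>+x. ennreal (1 / real (Suc j) / ((norm (x $ k - w))\<^sup>2 + 1 / real (Suc j))\<^sup>2 * lw.E x) \<partial>lborel) * ennreal v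
    < ennreal ((c0 + 1) * (B + G1 + 1))"
   by (meson eventually_happens trivial_limit_sequentially)
  \<comment> \<open>One t suffices, and it may depend on p, N and w: the resulting bound on the
    kernel integral involves only B and the fixed constants.\<close>
  define t where "t = 1 / real (Suc j)"
  have t: "0 < t" "t <= 1" unfolding t_def by auto
  interpret tw: twisted_weight lw.E lw.ph k w t using t by unfold_locales
  define A where "A = (\<integral>x. tw.kk x * lw.E x \<partial>lborel)"
  have kE0: "tw.kk x * lw.E x \<ge> 0" for x using tw.kk_pos[of x] pw.E_pos[of x] by simp
  have A0': "A \<ge> 0" unfolding A_def using kE0 by simp
  have "(\<integral>\<^sup>+x. ennreal (tw.kk x * lw.E x) \<partial>lborel) = ennreal A"
   unfolding A_def using kE0 by (intro nn_integral_eq_integral tw.integrable_kkE) auto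
  then have "ennreal A * ennreal v < ennreal ((c0 + 1) * (B + G1 + 1))"
   using j unfolding t_def[symmetric] tw.kk_def tw.sd_def by simp
  then have "ennreal (A * v) < ennreal ((c0 + 1) * (B + G1 + 1))" using A0' v0 by (simp add: ennreal_mult)
  then have "A * v < (c0 + 1) * (B + G1 + 1)" using A0' v0 by (simp add: ennreal_less_iff)
  also have "... <= (c0 + 1) * ((G1 + 2) * B)"
  proof (rule mult_left_mono)
   have "G1 * 1 <= G1 * B" using G1 B by (intro mult_left_mono) auto
   then show "B + G1 + 1 <= (G1 + 2) * B" using B by (simp add: algebra_simps)
  qed (use c0 in simp)
  finally have A: "A <= A0 * B" unfolding A0_def using vpos by (simp add: field_simps)
  obtain F where F1: "ck 1 F" and Fh: "\<And>j y. dzb j F y = 0" and Fw: "\<And>y. y $ k = w ==> F y = 1"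
   and Fb: "(\<integral>\<^sup>+y. indicator (cball 0 r0) y * ennreal ((norm (F y))\<^sup>2 * lw.E y) \<partial>lborel) <= ennreal (8 * ((r0 + 1 + norm w)\<^sup>2 + 3) * A + 1)"
   using tw.extension_from_hyperplane[of 1 r0] unfolding A_def[symmetric] by auto
  have r0: "r0 \<ge> 0" unfolding r0_def using R by simp
  have "8 * ((r0 + 1 + norm w)\<^sup>2 + 3) * A <= 8 * ((r0 + 1 + R)\<^sup>2 + 3) * (A0 * B)"
  proof (rule mult_mono)
   have "norm w <= R" using w norm_ge_zero[of w] by linarith
   then have "(r0 + 1 + norm w)\<^sup>2 <= (r0 + 1 + R)\<^sup>2" using r0 by (intro power_mono) auto
   then show "8 * ((r0 + 1 + norm w)\<^sup>2 + 3) <= 8 * ((r0 + 1 + R)\<^sup>2 + 3)" by simp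
  qed (use A A0' in auto)
  then have "8 * ((r0 + 1 + norm w)\<^sup>2 + 3) * A + 1 <= C2 * B" unfolding C2_def using B by (simp add: distrib_right mult.assoc)
  then have Fb2: "(\<integral>\<^sup>+y. indicator (cball 0 r0) y * ennreal ((norm (F y))\<^sup>2 * lw.E y) \<partial>lborel) <= ennreal (C2 * B)"
   by (intro order_trans[OF Fb] ennreal_leI)
  have Fc: "continuous_on UNIV F" by (rule ck_cont[OF F1])
  have [measurable]: "F \<in> borel_measurable borel" by (rule borel_measurable_continuous_onI[OF Fc])
  have [measurable]: "cball 0 r0 \<in> sets (borel :: (complex^'n) measure)" by simp
  have hol: "(%t. F (upd z k' t)) holomorphic_on UNIV" for z k' by (rule holomorphic_slice[OF F1 Fh])
  have inball: "x \<in> cball 0 r0" if "x \<in> pdisk 0 R" for x :: "complex^'n"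
   using pdisk_subset_cball[of R] R that unfolding r0_def by auto
  have Elow: "c3 <= lw.E x" if x: "x \<in> pdisk 0 R" for x
  proof -
   have "norm x <= r0" using inball[OF x] by simp
   then have "(norm x)\<^sup>2 <= r0\<^sup>2" by (intro power_mono) auto
   then have a: "exp (- 2 * r0\<^sup>2) <= exp (- 2 * (norm x)\<^sup>2)" by simp
   have "Qm powr (- (d / 2)) <= Qm powr (- (\<delta> / 2))" using Qm de by (intro powr_mono) auto
   also have "... <= approx_norm2 p k R N x powr (- (\<delta> / 2))"
    using de approx_norm2_pos[where p = p, OF R, of k N x] approx_norm2_le[where p = p and M = M, OF R x pM[OF x], of k N] unfolding Qm_def by (intro powr_mono2') auto
   finally show ?thesis unfolding E c3_def using a by (intro mult_mono) auto
  qed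
  \<comment> \<open>The mean value inequality for F^2 bounds |F a|^2 directly by the weighted L^2
    norm of F; radius R/2 keeps the polydisk about a inside \<open>pdisk 0 R\<close>.\<close>
  have Fsup: "(norm (F a))\<^sup>2 <= C4 * B" if a: "\<And>i. norm (a $ i) <= R / 2" for a
  proof -
   have "ennreal (norm (F a * F a)) * ennreal V <= (\<integral>\<^sup>+x. indicator (pdisk a (R / 2)) x * ennreal (norm (F x * F x)) \<partial>lborel)"
    unfolding V[symmetric] using R
    by (intro polydisc_mean_value[of "%x. F x * F x"] continuous_intros Fc holomorphic_intros hol) auto
   also have "... <= (\<integral>\<^sup>+x. ennreal (1 / c3) * (indicator (cball 0 r0) x * ennreal ((norm (F x))\<^sup>2 * lw.E x)) \<partial>lborel)"
   proof (rule nn_integral_mono)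
    fix x
    show "indicator (pdisk a (R / 2)) x * ennreal (norm (F x * F x)) <= ennreal (1 / c3) * (indicator (cball 0 r0) x * ennreal ((norm (F x))\<^sup>2 * lw.E x))"
    proof (cases "x \<in> pdisk a (R / 2)")
     case True
     have "norm (x $ i) < R" for i
     proof -
      have "norm (x $ i) <= norm (x $ i - a $ i) + norm (a $ i)" using norm_triangle_ineq[of "x $ i - a $ i" "a $ i"] by simp
      moreover have "norm (x $ i - a $ i) < R / 2" using True by (simp add: pdisk_def)
      ultimately show ?thesis using a[of i] by simp
     qed
     then have x: "x \<in> pdisk 0 R" by (simp add: pdisk_def)
     have "c3 * (norm (F x))\<^sup>2 <= lw.E x * (norm (F x))\<^sup>2" by (intro mult_right_mono Elow x) auto
     then have "norm (F x * F x) <= 1 / c3 * ((norm (F x))\<^sup>2 * lw.E x)"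
      using c3 by (simp add: field_simps norm_mult power2_eq_square)
     then have "ennreal (norm (F x * F x)) <= ennreal (1 / c3 * ((norm (F x))\<^sup>2 * lw.E x))" by (rule ennreal_leI)
     also have "... = ennreal (1 / c3) * ennreal ((norm (F x))\<^sup>2 * lw.E x)"
      using c3 less_imp_le[OF pw.E_pos] by (intro ennreal_mult) auto
     finally show ?thesis using True inball[OF x] by simp
    qed simp
   qed
   also have "... = ennreal (1 / c3) * (\<integral>\<^sup>+x. indicator (cball 0 r0) x * ennreal ((norm (F x))\<^sup>2 * lw.E x) \<partial>lborel)"
    by (rule nn_integral_cmult) measurable
   also have "... <= ennreal (1 / c3) * ennreal (C2 * B)" by (intro mult_left_mono Fb2) auto
   finally have "ennreal (norm (F a * F a) * V) <= ennreal (1 / c3 * (C2 * B))"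
    using c3 C2 B V0 by (simp add: ennreal_mult[symmetric])
   then have "norm (F a * F a) * V <= 1 / c3 * (C2 * B)"
    using c3 C2 B by (subst (asm) ennreal_le_iff) auto
   then show ?thesis unfolding C4_def using c3 Vpos by (simp add: field_simps norm_mult power2_eq_square)
  qed
  have Fhalf: "norm (F z) \<ge> 1 / 2" if z: "z \<in> pdisk 0 (norm w)" for z
  proof -
   define f where "f = (%t. F (upd z k t))"
   have zi: "norm (z $ i) < norm w" for i using z by (simp add: pdisk_def)
   have "norm (f (z $ k) - f w) <= sqrt (C4 * B) / (R / 4) * norm (z $ k - w)"
   proof (rule holomorphic_difference_bound)
    show "f holomorphic_on UNIV" unfolding f_def by (rule hol)
    fix s :: complex assume s: "norm s <= 2 * (R / 4)"
    have "(norm (f s))\<^sup>2 <= C4 * B"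
     unfolding f_def
    proof (rule Fsup)
     fix i
     have "norm (z $ i) <= R / 2" "norm s <= R / 2" using s zi[of i] w norm_ge_zero[of w] by linarith+
     then show "norm (upd z k s $ i) <= R / 2" by (simp add: upd_nth)
    qed
    then show "norm (f s) <= sqrt (C4 * B)" by (rule real_le_rsqrt)
   qed (use R w zi[of k] in linarith)+
   also have "... <= sqrt (C4 * B) / (R / 4) * (2 * norm w)"
    using norm_triangle_ineq4[of "z $ k" w] zi[of k] R C4 B by (intro mult_left_mono) auto
   also have "... <= 1 / 2"
   proof (rule power2_le_imp_le)
    have e: "(sqrt (C4 * B) / (R / 4) * (2 * norm w))\<^sup>2 = 64 * C4 / R\<^sup>2 * B * (norm w)\<^sup>2"
     using C4 B R by (simp add: power_mult_distrib power_divide)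
    have b: "256 * C4 / R\<^sup>2 * B * (norm w)\<^sup>2 <= 1"
    proof (rule order_trans[OF _ small])
     show "256 * C4 / R\<^sup>2 * B * (norm w)\<^sup>2 <= C * B * (norm w)\<^sup>2" using Cparts(1) B by (intro mult_right_mono) auto
    qed
    have q: "(1 / 2 :: real)\<^sup>2 = 1 / 4" by (simp add: power2_eq_square)
    have f: "64 * C4 / R\<^sup>2 * B * (norm w)\<^sup>2 = (256 * C4 / R\<^sup>2 * B * (norm w)\<^sup>2) / 4" by simp
    show "(sqrt (C4 * B) / (R / 4) * (2 * norm w))\<^sup>2 <= (1 / 2)\<^sup>2" unfolding e q f by (rule divide_right_mono[OF b]) simp
   qed simp
   finally have "norm (F z - 1) <= 1 / 2" unfolding f_def using Fw[of "upd z k w"] by simp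
   then show ?thesis using norm_triangle_ineq2[of 1 "1 - F z"] by (simp add: norm_minus_commute)
  qed
  have "(\<integral>\<^sup>+z. indicator (pdisk 0 (norm w)) z * ennreal (approx_norm2 p k R N z powr (- (\<delta> / 2))) \<partial>lborel)
    <= (\<integral>\<^sup>+z. ennreal (4 * exp (2 * r0\<^sup>2)) * (indicator (cball 0 r0) z * ennreal ((norm (F z))\<^sup>2 * lw.E z)) \<partial>lborel)"
  proof (rule nn_integral_mono)
   fix z
   show "indicator (pdisk 0 (norm w)) z * ennreal (approx_norm2 p k R N z powr (- (\<delta> / 2)))
    <= ennreal (4 * exp (2 * r0\<^sup>2)) * (indicator (cball 0 r0) z * ennreal ((norm (F z))\<^sup>2 * lw.E z))"
   proof (cases "z \<in> pdisk 0 (norm w)")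
    case True
    have "norm w <= R" using w norm_ge_zero[of w] by linarith
    then have "z \<in> pdisk 0 R" using True pdisk_mono by blast
    then have zb: "z \<in> cball 0 r0" by (rule inball)
    define y where "y = approx_norm2 p k R N z powr (- (\<delta> / 2))"
    have y0: "y \<ge> 0" unfolding y_def by simp
    have "(norm z)\<^sup>2 <= r0\<^sup>2" using zb by (intro power_mono) auto
    then have "1 <= exp (2 * r0\<^sup>2) * exp (- 2 * (norm z)\<^sup>2)" by (simp add: exp_add[symmetric])
    then have "1 * y <= (exp (2 * r0\<^sup>2) * exp (- 2 * (norm z)\<^sup>2)) * y" using y0 by (rule mult_right_mono)
    then have "y <= exp (2 * r0\<^sup>2) * lw.E z" unfolding E y_def by (simp add: mult.assoc)
    also have "exp (2 * r0\<^sup>2) * lw.E z <= exp (2 * r0\<^sup>2) * (4 * (norm (F z))\<^sup>2 * lw.E z)"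
    proof (rule mult_left_mono)
     have "(1 / 2)\<^sup>2 <= (norm (F z))\<^sup>2" using Fhalf[OF True] by (intro power_mono) auto
     then have "1 <= 4 * (norm (F z))\<^sup>2" by (simp add: power2_eq_square)
     from mult_right_mono[OF this less_imp_le[OF pw.E_pos[of z]]]
     show "lw.E z <= 4 * (norm (F z))\<^sup>2 * lw.E z" by simp
    qed simp
    finally have "y <= 4 * exp (2 * r0\<^sup>2) * ((norm (F z))\<^sup>2 * lw.E z)" by (simp add: mult_ac)
    then have "ennreal y <= ennreal (4 * exp (2 * r0\<^sup>2) * ((norm (F z))\<^sup>2 * lw.E z))" by (rule ennreal_leI)
    also have "... = ennreal (4 * exp (2 * r0\<^sup>2)) * ennreal ((norm (F z))\<^sup>2 * lw.E z)"
     using less_imp_le[OF pw.E_pos] by (intro ennreal_mult) auto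
    finally show ?thesis using True zb by (simp add: y_def)
   qed simp
  qed
  also have "... = ennreal (4 * exp (2 * r0\<^sup>2)) * (\<integral>\<^sup>+z. indicator (cball 0 r0) z * ennreal ((norm (F z))\<^sup>2 * lw.E z) \<partial>lborel)"
   by (rule nn_integral_cmult) measurable
  also have "... <= ennreal (4 * exp (2 * r0\<^sup>2)) * ennreal (C2 * B)" by (intro mult_left_mono Fb2) auto
  also have "... = ennreal (4 * exp (2 * r0\<^sup>2) * (C2 * B))" using C2 B by (intro ennreal_mult[symmetric]) auto
  also have "... <= ennreal (C * B)"
  proof (rule ennreal_leI)
   have "4 * C2 * exp (2 * r0\<^sup>2) * B <= C * B" using Cparts(2) B by (intro mult_right_mono) auto
   then show "4 * exp (2 * r0\<^sup>2) * (C2 * B) <= C * B" by (simp add: mult_ac)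
  qed
  finally show ?thesis .
 qed
 have "(\<integral>\<^sup>+z. indicator (pdisk 0 (norm w)) z * negpow \<delta> (norm (p z)) \<partial>lborel) <= ennreal (C * B)"
  if p: "\<And>j. polyfun (%z. p z $ j)" and de: "0 < \<delta>" "\<delta> <= d" and w: "w ~= 0" "4 * norm w <= R"
   and pM: "\<And>z. z \<in> pdisk 0 R ==> norm (p z) <= M" and B: "B \<ge> 1"
   and sl: "(\<integral>\<^sup>+z. indicator (pdisk 0 R) z * negpow \<delta> (norm (p (upd z k w))) \<partial>lborel) <= ennreal B"
   and small: "C * B * (norm w)\<^sup>2 <= 1"
  for p :: "complex^'n => complex^'j" and \<delta> w B
 proof -
  have "continuous_on UNIV (%z. \<chi> j. p z $ j)" by (intro continuous_on_vec_lambda polyfun_cont p)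
  then have pc: "continuous_on UNIV p" by (simp add: vec_lambda_beta[abs_def] vec_nth_inverse)
  have "continuous_on UNIV (approx_norm2 p k R N)" for N
   unfolding approx_norm2_def[abs_def] using R by (intro continuous_intros pc) auto
  then have am [measurable]: "approx_norm2 p k R N \<in> borel_measurable borel" for N by (rule borel_measurable_continuous_onI)
  have "(\<integral>\<^sup>+z. indicator (pdisk 0 (norm w)) z * negpow \<delta> (norm (p z)) \<partial>lborel)
    <= (\<integral>\<^sup>+z. liminf (%N. indicator (pdisk 0 (norm w)) z * ennreal (approx_norm2 p k R N z powr (- (\<delta> / 2)))) \<partial>lborel)"
  proof (rule nn_integral_mono)
   fix z
   show "indicator (pdisk 0 (norm w)) z * negpow \<delta> (norm (p z))
     <= liminf (%N. indicator (pdisk 0 (norm w)) z * ennreal (approx_norm2 p k R N z powr (- (\<delta> / 2))))"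
   proof (cases "z \<in> pdisk 0 (norm w)")
    case True
    moreover have "norm w <= R" using w norm_ge_zero[of w] by linarith
    ultimately have "z \<in> pdisk 0 R" using pdisk_mono by blast
    from negpow_liminf[OF norm_ge_zero de(1) approx_norm2_pos[OF R] approx_norm2_tendsto[where p = p and k = k, OF R this]]
    show ?thesis using True by simp
   qed simp
  qed
  \<comment> \<open>Fatou in N removes the regularisation: the estimate \<open>main\<close> holds
    with the same constant for every N.\<close>
  also have "... <= liminf (%N. \<integral>\<^sup>+z. indicator (pdisk 0 (norm w)) z * ennreal (approx_norm2 p k R N z powr (- (\<delta> / 2))) \<partial>lborel)"
   by (rule nn_integral_liminf) measurable
  also have "... <= liminf (%N::nat. ennreal (C * B))"
   by (intro Liminf_mono eventuallyI main[OF p de w pM B sl small])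
  also have "... = ennreal (C * B)" by (simp add: Liminf_const)
  finally show ?thesis .
 qed
 with C show thesis by (rule that)
qed

section \<open>Non-integrability of 1/|w|^2, and comparison of exponents\<close>

text \<open>The integrand is scale invariant in the plane, so the disks of radius \<rho> and
  \<rho>/2 carry the same integral; were it finite, the annulus between them would carry
  none.\<close>

lemma inverse_square_not_integrable:
 assumes "\<rho> > 0"
 shows "(\<integral>\<^sup>+w. indicator (ball 0 \<rho>) w * ennreal (1 / (norm (w::complex))\<^sup>2) \<partial>lborel) = \<infinity>"
proof -
 define f where "f = (%r (w::complex). indicator (ball 0 r) w * ennreal (1 / (norm w)\<^sup>2))"
 have [measurable]: "ball 0 r \<in> sets (borel :: complex measure)" for r by simp
 have fm [measurable]: "f r \<in> borel_measurable borel" for r unfolding f_def by measurable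
 define S where "S = ball (0::complex) \<rho> - cball 0 (\<rho> / 2)"
 have So: "open S" unfolding S_def by (intro open_Diff) auto
 have [measurable]: "S \<in> sets borel" using So by simp
 have "of_real (3 * \<rho> / 4) \<in> S" unfolding S_def using assms by (simp add: norm_of_real abs_mult)
 then have S0: "emeasure lborel S ~= 0" using emeasure_lborel_open_neq_0[OF So] by blast
 have half: "(\<integral>\<^sup>+w. f (\<rho> / 2) w \<partial>lborel) = (\<integral>\<^sup>+w. f \<rho> w \<partial>lborel)"
 proof -
  have "(\<integral>\<^sup>+w. f (\<rho> / 2) w \<partial>lborel) = (\<integral>\<^sup>+w. ennreal ((1 / 2) ^ DIM(complex)) * f (\<rho> / 2) (0 + (1 / 2) *\<^sub>R w) \<partial>lborel)"
   by (rule nn_integral_lborel_affine) auto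
  also have "... = (\<integral>\<^sup>+w. f \<rho> w \<partial>lborel)"
  proof (rule nn_integral_cong)
   fix w :: complex
   have "ennreal ((1 / 2) ^ 2) * ennreal (1 / (norm ((1 / 2) *\<^sub>R w))\<^sup>2) = ennreal (1 / (norm w)\<^sup>2)"
    by (subst ennreal_mult[symmetric]) (auto simp: power_mult_distrib power_divide)
   moreover have "indicator (ball 0 (\<rho> / 2)) ((1 / 2) *\<^sub>R w) = (indicator (ball 0 \<rho>) w :: ennreal)" by (auto simp: indicator_def)
   ultimately show "ennreal ((1 / 2) ^ DIM(complex)) * f (\<rho> / 2) (0 + (1 / 2) *\<^sub>R w) = f \<rho> w"
    by (simp add: f_def mult.left_commute)
  qed
  finally show ?thesis .
 qed
 have "(\<integral>\<^sup>+w. f \<rho> w \<partial>lborel) + ennreal (1 / \<rho>\<^sup>2) * emeasure lborel S = (\<integral>\<^sup>+w. f (\<rho> / 2) w + ennreal (1 / \<rho>\<^sup>2) * indicator S w \<partial>lborel)"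
  unfolding half[symmetric] by (subst nn_integral_add) (auto simp: nn_integral_cmult)
 also have "... <= (\<integral>\<^sup>+w. f \<rho> w \<partial>lborel)"
 proof (rule nn_integral_mono)
  fix w :: complex
  show "f (\<rho> / 2) w + ennreal (1 / \<rho>\<^sup>2) * indicator S w <= f \<rho> w"
  proof (cases "w \<in> S")
   case True
   then have w: "norm w < \<rho>" "\<rho> / 2 < norm w" by (auto simp: S_def)
   then have "(norm w)\<^sup>2 <= \<rho>\<^sup>2" by (intro power_mono) auto
   moreover have "(norm w)\<^sup>2 > 0" using w assms by auto
   ultimately have "1 / \<rho>\<^sup>2 <= 1 / (norm w)\<^sup>2" using assms by (intro divide_left_mono) auto
   then show ?thesis using True w by (simp add: f_def ennreal_leI)
  next
   case False
   then show ?thesis using assms by (auto simp: f_def indicator_def)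
  qed
 qed
 finally have le: "(\<integral>\<^sup>+w. f \<rho> w \<partial>lborel) + ennreal (1 / \<rho>\<^sup>2) * emeasure lborel S <= (\<integral>\<^sup>+w. f \<rho> w \<partial>lborel)" .
 have "ennreal (1 / \<rho>\<^sup>2) * emeasure lborel S ~= 0" using S0 assms by auto
 then have "(\<integral>\<^sup>+w. f \<rho> w \<partial>lborel) = \<infinity>"
  using le ennreal_add_left_cancel_le[of "\<integral>\<^sup>+w. f \<rho> w \<partial>lborel" "ennreal (1 / \<rho>\<^sup>2) * emeasure lborel S" 0] by auto
 then show ?thesis by (simp add: f_def)
qed

lemma negpow_le_add:
 assumes "s \<ge> 0" "0 < a" "a <= b" shows "negpow a s <= 1 + negpow b s"
proof (cases "s = 0")
 case False
 then have s: "s > 0" using assms by simp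
 have "s powr (- a) <= 1 + s powr (- b)"
 proof (cases "s \<ge> 1")
  case True
  have "s powr (- a) <= 1 powr (- a)" using True assms by (intro powr_mono2') auto
  then have "s powr (- a) <= 1" by simp
  moreover have "0 <= s powr (- b)" by simp
  ultimately show ?thesis by linarith
 next
  case False
  have "s powr (- a) <= s powr (- b)" using False s assms by (intro powr_mono') auto
  then show ?thesis by simp
 qed
 then have "ennreal (s powr (- a)) <= ennreal (1 + s powr (- b))" by (rule ennreal_leI)
 then show ?thesis using False by (simp add: negpow_def)
qed (simp add: negpow_def)

text \<open>Transfers a bound from t to a nearby s. Where s < \<eta> the surplus exponent \<delta>1
  gains a power of \<eta>; where s >= \<eta> the ratio of t to s is at most 1 + \<epsilon>/\<eta>,
  and raising \<delta> to \<delta>' costs a factor that tends to 1.\<close>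

lemma negpow_truncation:
 assumes s: "s \<ge> 0" and t: "t \<ge> 0" and st: "\<bar>s - t\<bar> <= \<epsilon>" and e: "\<epsilon> \<ge> 0" and eta: "0 < \<eta>" "\<eta> <= 1"
  and de: "0 < \<delta>" "\<delta> <= \<delta>'" "\<delta>' <= (\<delta> + \<delta>1) / 2" "\<delta> <= \<delta>1"
 shows "negpow \<delta>' s <= ennreal (\<eta> powr (- (\<delta>' - \<delta>)) * (1 + \<epsilon> / \<eta>) powr \<delta>) * negpow \<delta> t + ennreal (\<eta> powr ((\<delta>1 - \<delta>) / 2)) * negpow \<delta>1 s"
proof (cases "s < \<eta>")
 case True
 have "negpow \<delta>' s <= ennreal (\<eta> powr ((\<delta>1 - \<delta>) / 2)) * negpow \<delta>1 s"
 proof (cases "s = 0")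
  case False
  then have s0: "s > 0" using s by simp
  have "s powr (- \<delta>') = s powr (\<delta>1 - \<delta>') * s powr (- \<delta>1)" by (simp add: powr_add[symmetric])
  also have "s powr (\<delta>1 - \<delta>') <= \<eta> powr (\<delta>1 - \<delta>')" using True s0 de by (intro powr_mono2) auto
  also have "\<eta> powr (\<delta>1 - \<delta>') <= \<eta> powr ((\<delta>1 - \<delta>) / 2)" using eta de by (intro powr_mono') auto
  finally have "s powr (- \<delta>') <= \<eta> powr ((\<delta>1 - \<delta>) / 2) * s powr (- \<delta>1)" by (simp add: mult_right_mono)
  then have "ennreal (s powr (- \<delta>')) <= ennreal (\<eta> powr ((\<delta>1 - \<delta>) / 2) * s powr (- \<delta>1))" by (rule ennreal_leI)
  then show ?thesis using False by (simp add: negpow_def ennreal_mult)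
 qed (use eta in \<open>simp add: negpow_def ennreal_mult_top\<close>)
 then show ?thesis by (rule add_increasing[OF zero_le])
next
 case False
 then have s0: "s > 0" "\<eta> <= s" using eta by auto
 define K where "K = \<eta> powr (- (\<delta>' - \<delta>)) * (1 + \<epsilon> / \<eta>) powr \<delta>"
 have "1 + \<epsilon> / \<eta> > 0" using e eta by (intro add_pos_nonneg) auto
 then have K: "K > 0" unfolding K_def using eta by simp
 have "negpow \<delta>' s <= ennreal K * negpow \<delta> t"
 proof (cases "t = 0")
  case True
  then show ?thesis using K by (simp add: negpow_def ennreal_mult_top)
 next
  case t0: False
  then have t0: "t > 0" using t by simp
  have "\<epsilon> <= \<epsilon> / \<eta> * s" using e eta s0 mult_left_mono[OF s0(2) e] by (simp add: field_simps)
  then have "t <= (1 + \<epsilon> / \<eta>) * s" using st by (simp add: algebra_simps)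
  moreover have c: "1 + \<epsilon> / \<eta> > 0" using e eta by (simp add: add_pos_nonneg)
  ultimately have "((1 + \<epsilon> / \<eta>) * s) powr (- \<delta>) <= t powr (- \<delta>)" using t0 de by (intro powr_mono2') auto
  then have "(1 + \<epsilon> / \<eta>) powr (- \<delta>) * s powr (- \<delta>) <= t powr (- \<delta>)" using c s0 by (simp add: powr_mult)
  then have "(1 + \<epsilon> / \<eta>) powr \<delta> * ((1 + \<epsilon> / \<eta>) powr (- \<delta>) * s powr (- \<delta>)) <= (1 + \<epsilon> / \<eta>) powr \<delta> * t powr (- \<delta>)"
   by (rule mult_left_mono) simp
  moreover have "(1 + \<epsilon> / \<eta>) powr \<delta> * (1 + \<epsilon> / \<eta>) powr (- \<delta>) = 1" using c by (simp add: powr_add[symmetric])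
  ultimately have b: "s powr (- \<delta>) <= (1 + \<epsilon> / \<eta>) powr \<delta> * t powr (- \<delta>)" by (simp add: mult.assoc[symmetric])
  have "s powr (- \<delta>') = s powr (- (\<delta>' - \<delta>)) * s powr (- \<delta>)" by (simp add: powr_add[symmetric])
  also have "... <= \<eta> powr (- (\<delta>' - \<delta>)) * ((1 + \<epsilon> / \<eta>) powr \<delta> * t powr (- \<delta>))"
   using eta s0 de by (intro mult_mono b powr_mono2') auto
  finally have "s powr (- \<delta>') <= K * t powr (- \<delta>)" by (simp add: K_def mult.assoc)
  then have "ennreal (s powr (- \<delta>')) <= ennreal (K * t powr (- \<delta>))" by (rule ennreal_leI)
  then show ?thesis using K t0 s0 by (simp add: negpow_def ennreal_mult)
 qed
 then show ?thesis unfolding K_def by (rule add_increasing2[OF zero_le])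
qed

text \<open>The order of choices matters: \<eta> is dictated by x, then \<delta>' lies so close to
  \<delta> that the first factor is at most 6/5, then \<epsilon> makes the second exactly 5/4. The
  product is 3/2.\<close>

lemma truncation_parameters:
 assumes de: "0 < \<delta>" "\<delta> < \<delta>1" and x: "x > 0" and d: "d > \<delta>"
 obtains \<eta> \<delta>' \<epsilon> :: real where "0 < \<eta>" "\<eta> <= 1" "\<delta> < \<delta>'" "\<delta>' <= (\<delta> + \<delta>1) / 2" "\<delta>' <= d" "\<epsilon> > 0"
  "\<eta> powr (- (\<delta>' - \<delta>)) * (1 + \<epsilon> / \<eta>) powr \<delta> <= 3 / 2" "\<eta> powr ((\<delta>1 - \<delta>) / 2) <= x"
proof -
 define a where "a = (\<delta>1 - \<delta>) / 2"
 have a: "a > 0" using de by (simp add: a_def)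
 define \<eta> where "\<eta> = min 1 (x powr (1 / a))"
 have eta: "0 < \<eta>" "\<eta> <= 1" using x by (auto simp: \<eta>_def)
 have "\<eta> powr a <= (x powr (1 / a)) powr a" using a eta by (intro powr_mono2) (auto simp: \<eta>_def)
 also have "... = x" using a x by (simp add: powr_powr)
 finally have p1: "\<eta> powr a <= x" .
 define L where "L = - ln \<eta>"
 have L: "L \<ge> 0" using eta by (simp add: L_def)
 \<comment> \<open>h is \<delta>' - \<delta>. The last entry keeps \<eta> powr (-h) below 6/5; L + 1
   avoids a division by 0 when \<eta> = 1.\<close>
 define h where "h = min (min a (d - \<delta>)) (ln (6 / 5) / (L + 1))"
 have h: "h > 0" "h <= a" "h <= d - \<delta>" "h <= ln (6 / 5) / (L + 1)" using a d L by (auto simp: h_def)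
 have "h * L <= ln (6 / 5) / (L + 1) * L" using h L by (intro mult_right_mono) auto
 also have "... <= ln (6 / 5)" using L by (simp add: field_simps)
 finally have "exp (h * L) <= exp (ln (6 / 5))" by (simp only: exp_le_cancel_iff)
 moreover have "\<eta> powr (- h) = exp (h * L)" using eta by (simp add: powr_def L_def)
 moreover have "exp (ln (6 / 5)) = (6 / 5 :: real)" by simp
 ultimately have p2: "\<eta> powr (- h) <= 6 / 5" by (simp only:)
 define \<epsilon> where "\<epsilon> = \<eta> * ((5 / 4) powr (1 / \<delta>) - 1)"
 have "(1::real) < (5 / 4) powr (1 / \<delta>)" using de by simp
 then have e: "\<epsilon> > 0" using eta by (simp add: \<epsilon>_def)
 have "1 + \<epsilon> / \<eta> = (5 / 4) powr (1 / \<delta>)" using eta by (simp add: \<epsilon>_def)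
 then have p3: "(1 + \<epsilon> / \<eta>) powr \<delta> = 5 / 4" using de by (simp add: powr_powr)
 have "\<eta> powr (- (\<delta> + h - \<delta>)) * (1 + \<epsilon> / \<eta>) powr \<delta> <= 6 / 5 * (5 / 4)" unfolding p3 using p2 by (intro mult_right_mono) auto
 then have p4: "\<eta> powr (- (\<delta> + h - \<delta>)) * (1 + \<epsilon> / \<eta>) powr \<delta> <= 3 / 2" by simp
 have "\<delta> + h <= (\<delta> + \<delta>1) / 2" using h(2) by (simp add: a_def field_simps)
 then show thesis using that[of \<eta> "\<delta> + h" \<epsilon>] eta h e p4 p1 by (simp add: a_def)
qed

section \<open>Stability under polynomial perturbation\<close>

text \<open>The number of variables is measured by the set I, so the induction stays within one type
  \<open>complex^'n\<close> and frozen coordinates remain as dummies.\<close>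

definition dep_on :: "'n set => (complex^'n => 'a) => bool" where
 "dep_on I f \<longleftrightarrow> (\<forall>x y. (\<forall>i\<in>I. x $ i = y $ i) \<longrightarrow> f x = f y)"

definition polyvec :: "'n::finite set => (complex^'n => complex^'j::finite) => bool" where
 "polyvec I p \<longleftrightarrow> (\<forall>j. polyfun (%z. p z $ j)) \<and> dep_on I p"

text \<open>The constants may depend on g and the radii but not on p. The reference g is an
  arbitrary function and only its competitors p are polynomials, so the notion passes to slices and
  translates of g.\<close>

definition stable_on :: "'n::finite set => (complex^'n => complex^'j::finite) => real => real => real => bool" where
 "stable_on I g R r \<delta> \<longleftrightarrow> (\<exists>\<epsilon>>0. \<exists>\<delta>'>\<delta>. \<exists>C\<ge>0. \<forall>p. polyvec I p \<longrightarrow> (\<forall>z\<in>pdisk 0 R. norm (p z - g z) <= \<epsilon>) \<longrightarrow>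
   (\<integral>\<^sup>+z. indicator (pdisk 0 r) z * negpow \<delta>' (norm (p z)) \<partial>lborel) <= ennreal C)"

lemma polyvec_cont: "polyvec I p ==> continuous_on S p"
proof -
 assume "polyvec I p"
 then have "continuous_on S (%z. \<chi> j. p z $ j)" unfolding polyvec_def by (intro continuous_on_vec_lambda polyfun_cont) auto
 then show ?thesis by (simp add: vec_lambda_beta[abs_def] vec_nth_inverse)
qed

lemma polyvec_meas: "polyvec I p ==> p \<in> borel_measurable borel"
 by (rule borel_measurable_continuous_onI[OF polyvec_cont])

lemma polyvec_upd:
 assumes "polyvec (insert k I) p" shows "polyvec I (%z. p (upd z k w))"
 using assms polyfun_upd[of "%z. p z $ _" k w] unfolding polyvec_def dep_on_def by (auto simp: upd_nth)

lemma polyvec_shift: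
 assumes "polyvec I p" shows "polyvec I (%z. p (a + z))"
 using assms polyfun_shift[of "%z. p z $ _" a] unfolding polyvec_def dep_on_def by auto

lemma small_slice:
 fixes g :: "complex^'n::finite => complex^'j::finite"
 assumes [measurable]: "g \<in> borel_measurable borel" and R: "R > 0" and rho: "0 < \<rho>" "\<rho> <= R" and c: "c > 0"
  and fin: "(\<integral>\<^sup>+z. indicator (pdisk 0 R) z * negpow \<delta> (norm (g z)) \<partial>lborel) < \<infinity>"
 obtains w where "w ~= 0" "norm w < \<rho>" "(\<integral>\<^sup>+z. indicator (pdisk 0 R) z * negpow \<delta> (norm (g (upd z k w))) \<partial>lborel) <= ennreal (c / (norm w)\<^sup>2)"
proof (rule ccontr)
 note base = that
 assume "\<not> thesis"
 have big: "ennreal (c / (norm w)\<^sup>2) <= (\<integral>\<^sup>+z. indicator (pdisk 0 R) z * negpow \<delta> (norm (g (upd z k w))) \<partial>lborel)" if "w ~= 0" "norm w < \<rho>" for w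
 proof (rule ccontr)
  assume "\<not> ennreal (c / (norm w)\<^sup>2) <= (\<integral>\<^sup>+z. indicator (pdisk 0 R) z * negpow \<delta> (norm (g (upd z k w))) \<partial>lborel)"
  then have "(\<integral>\<^sup>+z. indicator (pdisk 0 R) z * negpow \<delta> (norm (g (upd z k w))) \<partial>lborel) <= ennreal (c / (norm w)\<^sup>2)" by (simp add: not_le less_imp_le)
  from base[OF that this] show False using \<open>\<not> thesis\<close> by blast
 qed
 have [measurable]: "ball 0 \<rho> \<in> sets (borel :: complex measure)" "ball 0 R \<in> sets (borel :: complex measure)" by simp_all
 define f where "f = (%z. indicator (pdisk 0 R) z * negpow \<delta> (norm (g z)))"
 have [measurable]: "f \<in> borel_measurable borel" unfolding f_def by measurable
 \<comment> \<open>The coordinate k of z is a dummy on a slice; b confines it to the disk of radius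
   R, so that \<open>nn_integral_upd\<close> applies with a finite factor.\<close>
 define b where "b = (%w::complex. indicator (ball 0 R) w :: ennreal)"
 have bm [measurable]: "b \<in> borel_measurable borel" unfolding b_def by measurable
 have "\<infinity> = ennreal c * (\<integral>\<^sup>+w. indicator (ball 0 \<rho>) w * ennreal (1 / (norm (w::complex))\<^sup>2) \<partial>lborel)"
  unfolding inverse_square_not_integrable[OF rho(1)] using c by (simp add: ennreal_mult_top)
 also have "... = (\<integral>\<^sup>+w. ennreal c * (indicator (ball 0 \<rho>) w * ennreal (1 / (norm (w::complex))\<^sup>2)) \<partial>lborel)"
  by (rule nn_integral_cmult[symmetric]) measurable
 also have "... <= (\<integral>\<^sup>+w. \<integral>\<^sup>+z. f (upd z k w) * b (z $ k) \<partial>lborel \<partial>lborel)"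
 proof (rule nn_integral_mono)
  fix w :: complex
  show "ennreal c * (indicator (ball 0 \<rho>) w * ennreal (1 / (norm w)\<^sup>2)) <= (\<integral>\<^sup>+z. f (upd z k w) * b (z $ k) \<partial>lborel)"
  proof (cases "w ~= 0 \<and> norm w < \<rho>")
   case True
   have "f (upd z k w) * b (z $ k) = indicator (pdisk 0 R) z * negpow \<delta> (norm (g (upd z k w)))" for z
    using True rho by (auto simp: f_def b_def pdisk_def indicator_def upd_nth split: if_splits)
   moreover have "ennreal c * ennreal (1 / (norm w)\<^sup>2) = ennreal (c / (norm w)\<^sup>2)"
    using c by (subst ennreal_mult[symmetric]) auto
   ultimately show ?thesis using big[of w] True by simp
  next
   case False
   then show ?thesis by (auto simp: indicator_def)
  qed
 qed
 also have "... = (\<integral>\<^sup>+z. \<integral>\<^sup>+w. f (upd z k w) * b (z $ k) \<partial>lborel \<partial>lborel)"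
  by (rule lborel_pair.Fubini') measurable
 also have "... = (\<integral>\<^sup>+z. f z \<partial>lborel) * (\<integral>\<^sup>+w. b w \<partial>lborel)" by (rule nn_integral_upd[symmetric]) measurable
 also have "... < \<infinity>"
 proof -
  have "(\<integral>\<^sup>+w. b w \<partial>lborel) < \<infinity>" unfolding b_def using emeasure_bounded_finite[OF bounded_ball, of "0::complex" R] by simp
  then show ?thesis using fin by (simp add: f_def ennreal_mult_less_top)
 qed
 finally show False by simp
qed

text \<open>The order of the constants carries the argument: \<open>C1\<close> comes from the local
  estimate, then \<kappa> and the slice w, then \<delta>1 and \<open>C5\<close> from the induction
  hypothesis on that slice, and finally the truncation level that makes \<open>C5\<close> harmless.
  The radius of the neighbourhood obtained is |w|.\<close>

lemma stable_local:
 fixes g :: "complex^'n::finite => complex^'j::finite"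
 assumes IH: "\<And>(g :: complex^'n => complex^'j) R r \<delta> M. g \<in> borel_measurable borel ==> dep_on I g ==> (\<And>z. z \<in> pdisk 0 R ==> norm (g z) <= M)
   ==> 0 < r ==> r < R ==> \<delta> > 0 ==> (\<integral>\<^sup>+z. indicator (pdisk 0 R) z * negpow \<delta> (norm (g z)) \<partial>lborel) < \<infinity> ==> stable_on I g R r \<delta>"
  and gm [measurable]: "g \<in> borel_measurable borel" and dep: "dep_on (insert k I) g" and gM: "\<And>z. z \<in> pdisk 0 R ==> norm (g z) <= M"
  and R: "R > 0" and de: "\<delta> > 0" and fin: "(\<integral>\<^sup>+z. indicator (pdisk 0 R) z * negpow \<delta> (norm (g z)) \<partial>lborel) < \<infinity>"
 shows "\<exists>s>0. stable_on (insert k I) g R s \<delta>"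
proof -
 \<comment> \<open>The induction hypothesis controls slices on a smaller polydisk, hence R/2;
   perturbations by at most 1 stay below |M| + 1; \<delta> + 1 is a fixed ceiling for the new
   exponent.\<close>
 have par: "R / 2 > 0" "\<bar>M\<bar> + 1 \<ge> 1" "\<delta> + 1 > 0" using R de by auto
 show ?thesis
 proof (rule local_estimate[where k = k and 'j = 'j, OF par])
 fix C1 :: real assume C1: "C1 > 0" and
  est: "\<And>(p :: complex^'n => complex^'j) \<delta>' w B. (\<And>j. polyfun (%z. p z $ j)) ==> 0 < \<delta>' ==> \<delta>' <= \<delta> + 1 ==> w ~= 0
   ==> 4 * norm w <= R / 2 ==> (\<And>z. z \<in> pdisk 0 (R / 2) ==> norm (p z) <= \<bar>M\<bar> + 1) ==> B \<ge> 1
   ==> (\<integral>\<^sup>+z. indicator (pdisk 0 (R / 2)) z * negpow \<delta>' (norm (p (upd z k w))) \<partial>lborel) <= ennreal B ==> C1 * B * (norm w)\<^sup>2 <= 1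
   ==> (\<integral>\<^sup>+z. indicator (pdisk 0 (norm w)) z * negpow \<delta>' (norm (p z)) \<partial>lborel) <= ennreal (C1 * B)"
 define \<kappa> where "\<kappa> = 1 / C1"
 have kap: "\<kappa> > 0" using C1 by (simp add: \<kappa>_def)
 \<comment> \<open>R/8 ensures 4 |w| <= R/2 for the local estimate; the minimum with 1 and \<kappa>
   ensures |w|^2 <= \<kappa>, that is B >= 1.\<close>
 define \<rho> where "\<rho> = min (R / 8) (min 1 \<kappa>)"
 have rho: "0 < \<rho>" "\<rho> <= R" "\<rho> <= R / 8" "\<rho> <= 1" "\<rho> <= \<kappa>" using R kap by (auto simp: \<rho>_def)
 have kap2: "\<kappa> / 2 > 0" using kap by simp
 obtain w where w: "w ~= 0" "norm w < \<rho>"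
  and wN: "(\<integral>\<^sup>+z. indicator (pdisk 0 R) z * negpow \<delta> (norm (g (upd z k w))) \<partial>lborel) <= ennreal (\<kappa> / 2 / (norm w)\<^sup>2)"
  by (rule small_slice[where k = k, OF gm R rho(1,2) kap2 fin])
 \<comment> \<open>With this B the smallness condition C1 B |w|^2 <= 1 holds with equality, and the
   slice of g itself uses only B/2, leaving the other half for the perturbation.\<close>
 define B where "B = \<kappa> / (norm w)\<^sup>2"
 have w2: "(norm w)\<^sup>2 > 0" using w by simp
 have "(norm w)\<^sup>2 <= norm w * 1" unfolding power2_eq_square using w rho by (intro mult_left_mono) auto
 then have "(norm w)\<^sup>2 <= \<kappa>" using w rho by linarith
 then have B1: "B \<ge> 1" unfolding B_def using w2 by simp
 have CB: "C1 * B * (norm w)\<^sup>2 <= 1" unfolding B_def \<kappa>_def using w2 C1 by simp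
 define gw where "gw = (%z. g (upd z k w))"
 have "(%z. upd z k w) \<in> borel_measurable (borel :: (complex^'n) measure)"
  by (intro borel_measurable_continuous_onI continuous_intros)
 then have gwm [measurable]: "gw \<in> borel_measurable borel" unfolding gw_def by (rule measurable_compose[OF _ gm])
 have updR: "upd z k w \<in> pdisk 0 R" if "z \<in> pdisk 0 R" for z
  using that w rho by (auto simp: pdisk_def upd_nth)
 have "stable_on I gw R (R / 2) \<delta>"
 proof (rule IH[of gw])
  show "dep_on I gw" using dep unfolding gw_def dep_on_def by (auto simp: upd_nth)
  show "norm (gw z) <= M" if "z \<in> pdisk 0 R" for z unfolding gw_def by (rule gM[OF updR[OF that]])
  show "(\<integral>\<^sup>+z. indicator (pdisk 0 R) z * negpow \<delta> (norm (gw z)) \<partial>lborel) < \<infinity>"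
   unfolding gw_def by (rule le_less_trans[OF wN]) simp
 qed (use R de gwm in auto)
 then obtain \<epsilon>1 \<delta>1 C5 where e1: "\<epsilon>1 > 0" and d1: "\<delta>1 > \<delta>" and C5: "C5 \<ge> 0" and
  st: "\<And>p. polyvec I p ==> (\<forall>z\<in>pdisk 0 R. norm (p z - gw z) <= \<epsilon>1) ==> (\<integral>\<^sup>+z. indicator (pdisk 0 (R / 2)) z * negpow \<delta>1 (norm (p z)) \<partial>lborel) <= ennreal C5"
  unfolding stable_on_def by blast
 \<comment> \<open>The budget: 3/2 times B/2 from the unperturbed slice, plus at most B/8 from the
   uncontrolled constant \<open>C5\<close>, stays below B.\<close>
 have par2: "B / (8 * (C5 + 1)) > 0" "\<delta> + 1 > \<delta>" using B1 C5 by auto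
 obtain \<eta> \<delta>' \<epsilon>2 where eta: "0 < \<eta>" "\<eta> <= 1" and d': "\<delta> < \<delta>'" "\<delta>' <= (\<delta> + \<delta>1) / 2" "\<delta>' <= \<delta> + 1"
  and e2: "\<epsilon>2 > 0" and k1: "\<eta> powr (- (\<delta>' - \<delta>)) * (1 + \<epsilon>2 / \<eta>) powr \<delta> <= 3 / 2" and k2: "\<eta> powr ((\<delta>1 - \<delta>) / 2) <= B / (8 * (C5 + 1))"
  by (rule truncation_parameters[OF de d1 par2])
 define \<epsilon> where "\<epsilon> = min (min \<epsilon>1 \<epsilon>2) 1"
 have e: "\<epsilon> > 0" "\<epsilon> <= \<epsilon>1" "\<epsilon> <= \<epsilon>2" "\<epsilon> <= 1" using e1 e2 by (auto simp: \<epsilon>_def)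
 have bound: "(\<integral>\<^sup>+z. indicator (pdisk 0 (norm w)) z * negpow \<delta>' (norm (p z)) \<partial>lborel) <= ennreal (C1 * B)"
  if p: "polyvec (insert k I) p" and close: "\<forall>z\<in>pdisk 0 R. norm (p z - g z) <= \<epsilon>" for p :: "complex^'n => complex^'j"
 proof (rule est)
  show "polyfun (%z. p z $ j)" for j using p by (simp add: polyvec_def)
  show "0 < \<delta>'" "\<delta>' <= \<delta> + 1" "w ~= 0" "B \<ge> 1" "C1 * B * (norm w)\<^sup>2 <= 1" using de d' w B1 CB by auto
  show "4 * norm w <= R / 2" using w rho by linarith
  have sub: "z \<in> pdisk 0 R" if "z \<in> pdisk 0 (R / 2)" for z :: "complex^'n" using that pdisk_mono[of "R / 2" R] R by auto
  show "norm (p z) <= \<bar>M\<bar> + 1" if "z \<in> pdisk 0 (R / 2)" for z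
  proof -
   have "norm (p z - g z) <= \<epsilon>" "norm (g z) <= M" using sub[OF that] close gM by auto
   then show ?thesis using norm_triangle_ineq[of "p z - g z" "g z"] e by simp
  qed
  define q where "q = (%z. p (upd z k w))"
  have q: "polyvec I q" unfolding q_def by (rule polyvec_upd[OF p])
  have [measurable]: "q \<in> borel_measurable borel" by (rule polyvec_meas[OF q])
  have qc: "norm (q z - gw z) <= \<epsilon>" if "z \<in> pdisk 0 R" for z unfolding q_def gw_def using close updR[OF that] by blast
  have q1: "(\<integral>\<^sup>+z. indicator (pdisk 0 (R / 2)) z * negpow \<delta>1 (norm (q z)) \<partial>lborel) <= ennreal C5"
   using qc e by (intro st q) (auto intro: order_trans)
  define a1 where "a1 = \<eta> powr (- (\<delta>' - \<delta>)) * (1 + \<epsilon>2 / \<eta>) powr \<delta>"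
  define a2 where "a2 = \<eta> powr ((\<delta>1 - \<delta>) / 2)"
  have a: "a1 <= 3 / 2" "a2 <= B / (8 * (C5 + 1))" "a2 \<ge> 0" "a1 \<ge> 0" using k1 k2 by (auto simp: a1_def a2_def)
  have "(\<integral>\<^sup>+z. indicator (pdisk 0 (R / 2)) z * negpow \<delta>' (norm (q z)) \<partial>lborel)
    <= (\<integral>\<^sup>+z. ennreal a1 * (indicator (pdisk 0 R) z * negpow \<delta> (norm (gw z))) + ennreal a2 * (indicator (pdisk 0 (R / 2)) z * negpow \<delta>1 (norm (q z))) \<partial>lborel)"
  proof (rule nn_integral_mono)
   fix z
   show "indicator (pdisk 0 (R / 2)) z * negpow \<delta>' (norm (q z))
    <= ennreal a1 * (indicator (pdisk 0 R) z * negpow \<delta> (norm (gw z))) + ennreal a2 * (indicator (pdisk 0 (R / 2)) z * negpow \<delta>1 (norm (q z)))"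
   proof (cases "z \<in> pdisk 0 (R / 2)")
    case True
    have "\<bar>norm (q z) - norm (gw z)\<bar> <= \<epsilon>2" using norm_triangle_ineq3[of "q z" "gw z"] qc[OF sub[OF True]] e by linarith
    then have "negpow \<delta>' (norm (q z)) <= ennreal a1 * negpow \<delta> (norm (gw z)) + ennreal a2 * negpow \<delta>1 (norm (q z))"
     unfolding a1_def a2_def using eta de d' d1 e2 by (intro negpow_truncation) auto
    then show ?thesis using True sub[OF True] by simp
   qed simp
  qed
  also have "... = ennreal a1 * (\<integral>\<^sup>+z. indicator (pdisk 0 R) z * negpow \<delta> (norm (gw z)) \<partial>lborel)
    + ennreal a2 * (\<integral>\<^sup>+z. indicator (pdisk 0 (R / 2)) z * negpow \<delta>1 (norm (q z)) \<partial>lborel)"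
   by (subst nn_integral_add) (auto simp: nn_integral_cmult)
  also have "... <= ennreal (3 / 2) * ennreal (B / 2) + ennreal (B / (8 * (C5 + 1))) * ennreal C5"
  proof (intro add_mono mult_mono q1 ennreal_leI a)
   show "(\<integral>\<^sup>+z. indicator (pdisk 0 R) z * negpow \<delta> (norm (gw z)) \<partial>lborel) <= ennreal (B / 2)"
    using wN by (simp add: gw_def B_def mult.commute)
  qed auto
  also have "... = ennreal (3 / 2 * (B / 2) + B / (8 * (C5 + 1)) * C5)"
   using B1 C5 by (simp only: ennreal_mult[symmetric] ennreal_plus[symmetric] divide_nonneg_nonneg mult_nonneg_nonneg)
  also have "... <= ennreal B"
  proof (rule ennreal_leI)
   have "C5 / (C5 + 1) <= 1" using C5 by (simp add: divide_le_eq_1)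
   then have "B / 8 * (C5 / (C5 + 1)) <= B / 8 * 1" using B1 by (intro mult_left_mono) auto
   moreover have "B / (8 * (C5 + 1)) * C5 = B / 8 * (C5 / (C5 + 1))" by (simp only: times_divide_times_eq) (simp only: times_divide_eq_left)
   ultimately show "3 / 2 * (B / 2) + B / (8 * (C5 + 1)) * C5 <= B" using B1 by linarith
  qed
  finally show "(\<integral>\<^sup>+z. indicator (pdisk 0 (R / 2)) z * negpow \<delta>' (norm (p (upd z k w))) \<partial>lborel) <= ennreal B" by (simp add: q_def)
 qed
 have "stable_on (insert k I) g R (norm w) \<delta>" unfolding stable_on_def using e(1) d'(1) C1 B1 bound
  by (intro exI[of _ \<epsilon>] exI[of _ \<delta>'] exI[of _ "C1 * B"] conjI allI impI) auto
 then show ?thesis using w by (intro exI[of _ "norm w"]) simp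
 qed
qed

text \<open>Compactness of the closed polydisk of radius r. Around each of its points a polydisk of
  radius R - r fits into the large one, so local stability there can use the closeness assumed on
  radius R.\<close>

lemma stable_cover:
 fixes g :: "complex^'n::finite => complex^'j::finite"
 assumes r: "0 < r" "r < R" and de: "\<delta> > 0"
  and loc: "\<And>a. (\<And>i. norm (a $ i) <= r) ==> \<exists>s>0. stable_on I (%z. g (a + z)) (R - r) s \<delta>"
 shows "stable_on I g R r \<delta>"
proof -
 define K where "K = {a :: complex^'n. \<forall>i. norm (a $ i) <= r}"
 have "K = (\<Inter>i\<in>UNIV. {a. norm (a $ i) <= r})" by (auto simp: K_def)
 moreover have "closed {a :: complex^'n. norm (a $ i) <= r}" for i by (intro closed_Collect_le continuous_intros)
 ultimately have "closed K" by (simp add: closed_INT)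
 moreover have "bounded K"
 proof (rule bounded_subset[OF bounded_cball])
  have "K \<subseteq> pdisk 0 (r + 1)"
  proof
   fix x assume "x \<in> K"
   then have "norm (x $ i) <= r" for i by (simp add: K_def)
   then have "norm (x $ i) < r + 1" for i by (rule le_less_trans) simp
   then show "x \<in> pdisk 0 (r + 1)" by (simp add: pdisk_def)
  qed
  also have "... \<subseteq> cball 0 (real CARD('n) * (r + 1))" using r by (intro pdisk_subset_cball) simp
  finally show "K \<subseteq> cball 0 (real CARD('n) * (r + 1))" .
 qed
 ultimately have Kc: "compact K" by (simp add: compact_eq_bounded_closed)
 define P where "P = (%a s \<epsilon> \<delta>' C. \<forall>p. polyvec I p \<longrightarrow> (\<forall>z\<in>pdisk 0 (R - r). norm (p z - g (a + z)) <= \<epsilon>) \<longrightarrow>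
   (\<integral>\<^sup>+z. indicator (pdisk 0 s) z * negpow \<delta>' (norm (p z)) \<partial>lborel) <= ennreal C)"
 have "\<exists>s \<epsilon> \<delta>' C. s > 0 \<and> \<epsilon> > 0 \<and> \<delta>' > \<delta> \<and> C \<ge> 0 \<and> P a s \<epsilon> \<delta>' C" if "a \<in> K" for a
 proof -
  have "norm (a $ i) <= r" for i using that by (simp add: K_def)
  from loc[OF this] obtain s where s: "s > 0" "stable_on I (%z. g (a + z)) (R - r) s \<delta>" by blast
  from s(2) have "\<exists>\<epsilon>>0. \<exists>\<delta>'>\<delta>. \<exists>C\<ge>0. P a s \<epsilon> \<delta>' C" unfolding stable_on_def P_def .
  with s(1) show ?thesis by blast
 qed
 then obtain s \<epsilon> \<delta>' C where s: "\<And>a. a \<in> K ==> s a > 0" and e: "\<And>a. a \<in> K ==> \<epsilon> a > 0" and d': "\<And>a. a \<in> K ==> \<delta>' a > \<delta>"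
  and C: "\<And>a. a \<in> K ==> C a \<ge> 0" and P: "\<And>a. a \<in> K ==> P a (s a) (\<epsilon> a) (\<delta>' a) (C a)"
  by metis
 have b: "(\<integral>\<^sup>+z. indicator (pdisk 0 (s a)) z * negpow (\<delta>' a) (norm (p z)) \<partial>lborel) <= ennreal (C a)"
  if "a \<in> K" "polyvec I p" "\<forall>z\<in>pdisk 0 (R - r). norm (p z - g (a + z)) <= \<epsilon> a" for a p
  using P[OF that(1)] that(2,3) unfolding P_def by blast
 have cov: "K \<subseteq> (\<Union>a\<in>K. pdisk a (s a))" using s by (force simp: pdisk_def)
 obtain A where A: "A \<subseteq> K" "finite A" "K \<subseteq> (\<Union>a\<in>A. pdisk a (s a))"
  by (rule compactE_image[OF Kc open_pdisk cov])
 have "0 \<in> K" using r by (simp add: K_def)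
 then have A0: "A ~= {}" using A by auto
 define ee where "ee = Min (\<epsilon> ` A)"
 \<comment> \<open>A finite minimum of exponents above \<delta> still exceeds \<delta>. Lowering an
   exponent costs an additive 1 in the integrand, which is where the volumes in \<open>CC\<close>
   come from.\<close>
 define dd where "dd = Min (\<delta>' ` A)"
 have ee: "ee > 0" "\<And>a. a \<in> A ==> ee <= \<epsilon> a" unfolding ee_def using A A0 e by (auto simp: Min_gr_iff)
 have dd: "dd > \<delta>" "\<And>a. a \<in> A ==> dd <= \<delta>' a" unfolding dd_def using A A0 d' by (auto simp: Min_gr_iff)
 have "\<forall>a\<in>A. \<exists>v\<ge>0. emeasure lborel (pdisk (0::complex^'n) (s a)) = ennreal v"
 proof
  fix a assume "a \<in> A"
  then have "s a > 0" using s A by auto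
  then obtain v where "v \<ge> 0" "emeasure lborel (pdisk (0::complex^'n) (s a)) = ennreal v"
   using enn_finite_real[OF emeasure_pdisk(1)[where 'n = 'n]] by blast
  then show "\<exists>v\<ge>0. emeasure lborel (pdisk (0::complex^'n) (s a)) = ennreal v" by blast
 qed
 then obtain v where v: "\<And>a. a \<in> A ==> v a \<ge> 0" "\<And>a. a \<in> A ==> emeasure lborel (pdisk (0::complex^'n) (s a)) = ennreal (v a)" by metis
 define CC where "CC = (\<Sum>a\<in>A. v a + C a)"
 have CC: "CC \<ge> 0" unfolding CC_def using v C A by (intro sum_nonneg) auto
 have "(\<integral>\<^sup>+z. indicator (pdisk 0 r) z * negpow dd (norm (p z)) \<partial>lborel) <= ennreal CC"
  if p: "polyvec I p" and close: "\<forall>z\<in>pdisk 0 R. norm (p z - g z) <= ee" for p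
 proof -
  have [measurable]: "p \<in> borel_measurable borel" by (rule polyvec_meas[OF p])
  have piece: "(\<integral>\<^sup>+z. indicator (pdisk a (s a)) z * (1 + negpow (\<delta>' a) (norm (p z))) \<partial>lborel) <= ennreal (v a + C a)" if a: "a \<in> A" for a
  proof -
   have aK: "a \<in> K" using a A by auto
   have pa: "polyvec I (%z. p (a + z))" by (rule polyvec_shift[OF p])
   have [measurable]: "(%z. p (a + z)) \<in> borel_measurable borel" by (rule polyvec_meas[OF pa])
   have "\<forall>z\<in>pdisk 0 (R - r). norm (p (a + z) - g (a + z)) <= \<epsilon> a"
   proof
    fix z :: "complex^'n" assume z: "z \<in> pdisk 0 (R - r)"
    have "norm ((a + z) $ i) < R" for i
    proof -
     have "norm (a $ i + z $ i) <= norm (a $ i) + norm (z $ i)" by (rule norm_triangle_ineq)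
     moreover have "norm (a $ i) <= r" "norm (z $ i) < R - r" using aK z by (auto simp: K_def pdisk_def)
     ultimately show ?thesis by simp
    qed
    then have "a + z \<in> pdisk 0 R" by (simp add: pdisk_def)
    then show "norm (p (a + z) - g (a + z)) <= \<epsilon> a" using close ee(2)[OF a] by force
   qed
   from b[OF aK pa this] have b': "(\<integral>\<^sup>+z. indicator (pdisk 0 (s a)) z * negpow (\<delta>' a) (norm (p (a + z))) \<partial>lborel) <= ennreal (C a)" .
   have "(\<integral>\<^sup>+z. indicator (pdisk a (s a)) z * (1 + negpow (\<delta>' a) (norm (p z))) \<partial>lborel)
     = (\<integral>\<^sup>+z. indicator (pdisk a (s a)) (a + z) * (1 + negpow (\<delta>' a) (norm (p (a + z)))) \<partial>lborel)"
    by (rule nn_integral_lborel_shift[of "%z. indicator (pdisk a (s a)) z * (1 + negpow (\<delta>' a) (norm (p z)))", symmetric]) measurable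
   also have "... = (\<integral>\<^sup>+z. indicator (pdisk 0 (s a)) z + indicator (pdisk 0 (s a)) z * negpow (\<delta>' a) (norm (p (a + z))) \<partial>lborel)"
    by (intro nn_integral_cong) (auto simp: pdisk_def indicator_def)
   also have "... = emeasure lborel (pdisk (0::complex^'n) (s a)) + (\<integral>\<^sup>+z. indicator (pdisk 0 (s a)) z * negpow (\<delta>' a) (norm (p (a + z))) \<partial>lborel)"
    by (subst nn_integral_add) auto
   also have "... <= ennreal (v a) + ennreal (C a)" unfolding v(2)[OF a] by (intro add_left_mono b')
   also have "... = ennreal (v a + C a)" using v(1)[OF a] C[OF aK] by simp
   finally show ?thesis .
  qed
  have "(\<integral>\<^sup>+z. indicator (pdisk 0 r) z * negpow dd (norm (p z)) \<partial>lborel)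
    <= (\<integral>\<^sup>+z. (\<Sum>a\<in>A. indicator (pdisk a (s a)) z * (1 + negpow (\<delta>' a) (norm (p z)))) \<partial>lborel)"
  proof (rule nn_integral_mono)
   fix z
   show "indicator (pdisk 0 r) z * negpow dd (norm (p z)) <= (\<Sum>a\<in>A. indicator (pdisk a (s a)) z * (1 + negpow (\<delta>' a) (norm (p z))))"
   proof (cases "z \<in> pdisk 0 r")
    case True
    then have "z \<in> K" by (auto simp: pdisk_def K_def intro: less_imp_le)
    then obtain a where a: "a \<in> A" "z \<in> pdisk a (s a)" using A by auto
    have "negpow dd (norm (p z)) <= 1 + negpow (\<delta>' a) (norm (p z))"
     using de dd(1) dd(2)[OF a(1)] by (intro negpow_le_add) auto
    also have "... = indicator (pdisk a (s a)) z * (1 + negpow (\<delta>' a) (norm (p z)))" using a by simp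
    also have "... <= (\<Sum>a\<in>A. indicator (pdisk a (s a)) z * (1 + negpow (\<delta>' a) (norm (p z))))"
     using a A by (intro member_le_sum) auto
    finally show ?thesis using True by simp
   qed simp
  qed
  also have "... = (\<Sum>a\<in>A. \<integral>\<^sup>+z. indicator (pdisk a (s a)) z * (1 + negpow (\<delta>' a) (norm (p z))) \<partial>lborel)"
   by (rule nn_integral_sum) measurable
  also have "... <= (\<Sum>a\<in>A. ennreal (v a + C a))" by (intro sum_mono piece)
  also have "... = ennreal CC" unfolding CC_def using v C A by (intro sum_ennreal) auto
  finally show ?thesis .
 qed
 then show ?thesis unfolding stable_on_def using ee(1) dd(1) CC
  by (intro exI[of _ ee] exI[of _ dd] exI[of _ CC] conjI allI impI)
qed

text \<open>Finiteness of the integral forces the constant to be nonzero, so perturbations by half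
  its norm stay away from 0 and every exponent works; \<bar>\<delta>\<bar> + 1 is one that is
  positive and above \<delta>.\<close>

lemma stable_const:
 fixes g :: "complex^'n::finite => complex^'j::finite"
 assumes dep: "dep_on {} g" and r: "0 < r" "r < R"
  and fin: "(\<integral>\<^sup>+z. indicator (pdisk 0 R) z * negpow \<delta> (norm (g z)) \<partial>lborel) < \<infinity>"
 shows "stable_on {} g R r \<delta>"
proof -
 have g: "g z = g 0" for z using dep by (simp add: dep_on_def)
 have R: "R > 0" using r by simp
 have g0: "g 0 ~= 0"
 proof
  assume "g 0 = 0"
  then have "g z = 0" for z using g by simp
  then have "(\<integral>\<^sup>+z. indicator (pdisk 0 R) z * negpow \<delta> (norm (g z)) \<partial>lborel) = (\<integral>\<^sup>+z. \<infinity> * indicator (pdisk (0::complex^'n) R) z \<partial>lborel)"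
   by (intro nn_integral_cong) (simp add: negpow_def mult.commute)
  also have "... = \<infinity>" using emeasure_pdisk(2)[OF R, where 'n = 'n] by (subst nn_integral_cmult_indicator) (auto simp: ennreal_top_mult)
  finally show False using fin by simp
 qed
 define c where "c = norm (g 0) / 2"
 have c: "c > 0" using g0 by (simp add: c_def)
 obtain V where V: "V \<ge> 0" "emeasure lborel (pdisk (0::complex^'n) r) = ennreal V" using emeasure_pdisk(1)[OF r(1), where 'n = 'n] by (rule enn_finite_real)
 have "(\<integral>\<^sup>+z. indicator (pdisk 0 r) z * negpow (\<bar>\<delta>\<bar> + 1) (norm (p z)) \<partial>lborel) <= ennreal (c powr (- (\<bar>\<delta>\<bar> + 1)) * V)"
  if close: "\<forall>z\<in>pdisk 0 R. norm (p z - g z) <= c" for p :: "complex^'n => complex^'j"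
 proof -
  have "(\<integral>\<^sup>+z. indicator (pdisk 0 r) z * negpow (\<bar>\<delta>\<bar> + 1) (norm (p z)) \<partial>lborel) <= (\<integral>\<^sup>+z. ennreal (c powr (- (\<bar>\<delta>\<bar> + 1))) * indicator (pdisk (0::complex^'n) r) z \<partial>lborel)"
  proof (rule nn_integral_mono)
   fix z :: "complex^'n"
   show "indicator (pdisk 0 r) z * negpow (\<bar>\<delta>\<bar> + 1) (norm (p z)) <= ennreal (c powr (- (\<bar>\<delta>\<bar> + 1))) * indicator (pdisk 0 r) z"
   proof (cases "z \<in> pdisk 0 r")
    case True
    then have "z \<in> pdisk 0 R" using pdisk_mono[of r R] r by auto
    then have "norm (p z - g 0) <= c" using close g by metis
    then have pc: "norm (p z) \<ge> c" using norm_triangle_ineq2[of "g 0" "g 0 - p z"] by (simp add: c_def norm_minus_commute)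
    then have "norm (p z) powr (- (\<bar>\<delta>\<bar> + 1)) <= c powr (- (\<bar>\<delta>\<bar> + 1))" using c by (intro powr_mono2') auto
    moreover have "norm (p z) ~= 0" using pc c by auto
    ultimately show ?thesis using True by (simp add: negpow_def ennreal_leI)
   qed simp
  qed
  also have "... = ennreal (c powr (- (\<bar>\<delta>\<bar> + 1)) * V)" using V by (simp add: nn_integral_cmult ennreal_mult)
  finally show ?thesis .
 qed
 then show ?thesis unfolding stable_on_def using c V
  by (intro exI[of _ c] exI[of _ "\<bar>\<delta>\<bar> + 1"] exI[of _ "c powr (- (\<bar>\<delta>\<bar> + 1)) * V"] conjI allI impI) auto
qed

text \<open>The induction step is carried out at every centre a through the translate g (a + z) on
  radius R - r, since boundedness, dependence and finiteness of the integral all survive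
  translation.\<close>

theorem stable:
 fixes g :: "complex^'n::finite => complex^'j::finite"
 assumes "finite I" "g \<in> borel_measurable borel" "dep_on I g" "\<And>z. z \<in> pdisk 0 R ==> norm (g z) <= M" "0 < r" "r < R" "\<delta> > 0"
  "(\<integral>\<^sup>+z. indicator (pdisk 0 R) z * negpow \<delta> (norm (g z)) \<partial>lborel) < \<infinity>"
 shows "stable_on I g R r \<delta>"
 using assms
proof (induction I arbitrary: g R r \<delta> M rule: finite_induct)
 case empty
 then show ?case by (intro stable_const) auto
next
 case (insert k I)
 note [measurable] = insert.prems(1)
 show ?case
 proof (rule stable_cover[OF insert.prems(4-6)])
  fix a :: "complex^'n" assume a: "\<And>i. norm (a $ i) <= r"
  have sub: "a + z \<in> pdisk 0 R" if "z \<in> pdisk 0 (R - r)" for z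
  proof -
   have "norm ((a + z) $ i) < R" for i
   proof -
    have "norm (a $ i + z $ i) <= norm (a $ i) + norm (z $ i)" by (rule norm_triangle_ineq)
    moreover have "norm (z $ i) < R - r" using that by (auto simp: pdisk_def)
    ultimately show ?thesis using a[of i] by simp
   qed
   then show ?thesis by (simp add: pdisk_def)
  qed
  show "\<exists>s>0. stable_on (insert k I) (%z. g (a + z)) (R - r) s \<delta>"
  proof (rule stable_local[where M = M])
   show "stable_on I h R r \<delta>" if "h \<in> borel_measurable borel" "dep_on I h" "\<And>z. z \<in> pdisk 0 R ==> norm (h z) <= M"
    "0 < r" "r < R" "\<delta> > 0" "(\<integral>\<^sup>+z. indicator (pdisk 0 R) z * negpow \<delta> (norm (h z)) \<partial>lborel) < \<infinity>"
    for h :: "complex^'n => complex^'j" and R r \<delta> M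
    by (rule insert.IH[OF that])
   show "(%z. g (a + z)) \<in> borel_measurable borel" by measurable
   show "dep_on (insert k I) (%z. g (a + z))" using insert.prems(2) unfolding dep_on_def by auto
   show "norm (g (a + z)) <= M" if "z \<in> pdisk 0 (R - r)" for z by (rule insert.prems(3)[OF sub[OF that]])
   show "R - r > 0" "\<delta> > 0" using insert.prems by auto
   have "(\<integral>\<^sup>+z. indicator (pdisk 0 (R - r)) z * negpow \<delta> (norm (g (a + z))) \<partial>lborel)
    <= (\<integral>\<^sup>+z. indicator (pdisk 0 R) (a + z) * negpow \<delta> (norm (g (a + z))) \<partial>lborel)"
    using sub by (intro nn_integral_mono mult_right_mono) (auto simp: indicator_def)
   also have "... = (\<integral>\<^sup>+z. indicator (pdisk 0 R) z * negpow \<delta> (norm (g z)) \<partial>lborel)"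
    by (rule nn_integral_lborel_shift[of "%z. indicator (pdisk 0 R) z * negpow \<delta> (norm (g z))"]) measurable
   also have "... < \<infinity>" by (rule insert.prems(7))
   finally show "(\<integral>\<^sup>+z. indicator (pdisk 0 (R - r)) z * negpow \<delta> (norm (g (a + z))) \<partial>lborel) < \<infinity>" .
  qed
 qed
qed

section \<open>Uniform polynomial approximation on closed polydisks\<close>

definition cpd :: "real => (complex^'n::finite) set" where
 "cpd r = {x. \<forall>i. norm (x $ i) <= r}"

lemma compact_cpd: "compact (cpd r :: (complex^'n::finite) set)"
proof -
 have "cpd r = (\<Inter>i\<in>UNIV. {a :: complex^'n. norm (a $ i) <= r})" by (auto simp: cpd_def)
 moreover have "closed {a :: complex^'n. norm (a $ i) <= r}" for i by (intro closed_Collect_le continuous_intros)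
 ultimately have "closed (cpd r :: (complex^'n) set)" by (simp add: closed_INT)
 moreover have "bounded (cpd r :: (complex^'n) set)"
 proof (rule boundedI)
  fix x :: "complex^'n" assume x: "x \<in> cpd r"
  have "norm x <= (\<Sum>i\<in>UNIV. norm (x $ i))" by (simp add: norm_vec_def L2_set_le_sum)
  also have "... <= (\<Sum>i\<in>(UNIV::'n set). r)" using x by (intro sum_mono) (auto simp: cpd_def)
  finally show "norm x <= real CARD('n) * r" by simp
 qed
 ultimately show ?thesis by (simp add: compact_eq_bounded_closed)
qed

lemma pdisk_subset_cpd: "pdisk 0 r \<subseteq> cpd r"
 by (auto simp: pdisk_def cpd_def intro: less_imp_le)

lemma cpd_subset_pdisk: "r < R ==> cpd r \<subseteq> pdisk 0 R"
 by (auto simp: pdisk_def cpd_def intro: le_less_trans)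

definition approxable :: "(complex^'n::finite) set => (complex^'n => complex) => bool" where
 "approxable K u \<longleftrightarrow> (\<forall>\<epsilon>>0. \<exists>p. polyfun p \<and> (\<forall>z\<in>K. norm (p z - u z) <= \<epsilon>))"

lemma approxable_polyfun: "polyfun p ==> approxable K p"
 unfolding approxable_def by (auto intro!: exI[of _ p])

lemma approxable_closed:
 assumes "\<And>\<epsilon>. \<epsilon> > 0 ==> \<exists>v. approxable K v \<and> (\<forall>z\<in>K. norm (v z - u z) <= \<epsilon>)"
 shows "approxable K u"
 unfolding approxable_def
proof (intro allI impI)
 fix \<epsilon> :: real assume "\<epsilon> > 0"
 then have h: "\<epsilon> / 2 > 0" by simp
 from assms[OF h] obtain v where v: "approxable K v" "\<And>z. z \<in> K ==> norm (v z - u z) <= \<epsilon> / 2" by blast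
 from v(1) h obtain p where p: "polyfun p" "\<And>z. z \<in> K ==> norm (p z - v z) <= \<epsilon> / 2" unfolding approxable_def by blast
 have "norm (p z - u z) <= \<epsilon>" if "z \<in> K" for z
  using norm_triangle_ineq[of "p z - v z" "v z - u z"] p(2)[OF that] v(2)[OF that] by simp
 then show "\<exists>p. polyfun p \<and> (\<forall>z\<in>K. norm (p z - u z) <= \<epsilon>)" using p by blast
qed

lemma approxable_add:
 assumes "approxable K u" "approxable K v" shows "approxable K (%z. u z + v z)"
 unfolding approxable_def
proof (intro allI impI)
 fix \<epsilon> :: real assume "\<epsilon> > 0"
 then have h: "\<epsilon> / 2 > 0" by simp
 obtain p where p: "polyfun p" "\<And>z. z \<in> K ==> norm (p z - u z) <= \<epsilon> / 2" using assms(1) h unfolding approxable_def by blast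
 obtain q where q: "polyfun q" "\<And>z. z \<in> K ==> norm (q z - v z) <= \<epsilon> / 2" using assms(2) h unfolding approxable_def by blast
 have "norm (p z + q z - (u z + v z)) <= \<epsilon>" if "z \<in> K" for z
  using norm_triangle_ineq[of "p z - u z" "q z - v z"] p(2)[OF that] q(2)[OF that] by (simp add: algebra_simps)
 then show "\<exists>p. polyfun p \<and> (\<forall>z\<in>K. norm (p z - (u z + v z)) <= \<epsilon>)" using polyfun_add[OF p(1) q(1)] by blast
qed

lemma polyfun_bounded:
 assumes "polyfun p" "compact K" obtains B where "B > 0" "\<And>z. z \<in> K ==> norm (p z) <= B"
proof -
 have "bounded (p ` K)" using assms by (intro compact_imp_bounded compact_continuous_image polyfun_cont)
 then obtain B where "B > 0" "\<forall>y\<in>p ` K. norm y <= B" unfolding bounded_pos by blast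
 then show thesis using that by blast
qed

text \<open>Boundedness of u follows from a single polynomial within distance 1. The approximant q
  of v is chosen first, because the accuracy required of the approximant of u depends on a bound for
  q.\<close>

lemma approxable_mult:
 assumes u: "approxable K u" and v: "approxable K v" and K: "compact K" shows "approxable K (%z. u z * v z)"
 unfolding approxable_def
proof (intro allI impI)
 fix \<epsilon> :: real assume e: "\<epsilon> > 0"
 obtain p0 where p0: "polyfun p0" "\<And>z. z \<in> K ==> norm (p0 z - u z) <= 1" using u unfolding approxable_def by (metis zero_less_one)
 obtain B0 where B0: "B0 > 0" "\<And>z. z \<in> K ==> norm (p0 z) <= B0" using polyfun_bounded[OF p0(1) K] by blast
 have ub: "norm (u z) <= B0 + 1" if "z \<in> K" for z
  using norm_triangle_ineq2[of "u z" "p0 z"] B0(2)[OF that] p0(2)[OF that] by (simp add: norm_minus_commute)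
 have h: "\<epsilon> / (2 * (B0 + 1)) > 0" using e B0 by simp
 obtain q where q: "polyfun q" "\<And>z. z \<in> K ==> norm (q z - v z) <= \<epsilon> / (2 * (B0 + 1))" using v h unfolding approxable_def by blast
 obtain B where B: "B > 0" "\<And>z. z \<in> K ==> norm (q z) <= B" using polyfun_bounded[OF q(1) K] by blast
 have h2: "\<epsilon> / (2 * B) > 0" using e B by simp
 obtain p where p: "polyfun p" "\<And>z. z \<in> K ==> norm (p z - u z) <= \<epsilon> / (2 * B)" using u h2 unfolding approxable_def by blast
 have "norm (p z * q z - u z * v z) <= \<epsilon>" if z: "z \<in> K" for z
 proof -
  have "p z * q z - u z * v z = (p z - u z) * q z + u z * (q z - v z)" by (simp add: algebra_simps)
  also have "norm ... <= norm (p z - u z) * norm (q z) + norm (u z) * norm (q z - v z)"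
   using norm_triangle_ineq[of "(p z - u z) * q z" "u z * (q z - v z)"] by (simp only: norm_mult)
  also have "... <= \<epsilon> / (2 * B) * B + (B0 + 1) * (\<epsilon> / (2 * (B0 + 1)))"
   using p(2)[OF z] q(2)[OF z] B(2)[OF z] ub[OF z] B0 B e by (intro add_mono mult_mono) auto
  also have "... = \<epsilon>" using B B0 by (simp add: field_simps)
  finally show ?thesis .
 qed
 then show "\<exists>p. polyfun p \<and> (\<forall>z\<in>K. norm (p z - u z * v z) <= \<epsilon>)" using polyfun_mult[OF p(1) q(1)] by blast
qed

lemma approxable_sum:
 "(\<And>i. i \<in> A ==> approxable K (f i)) ==> approxable K (%z. \<Sum>i\<in>A. f i z)"
 by (induction A rule: infinite_finite_induct) (auto intro: approxable_add approxable_polyfun polyfun_const)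

text \<open>The Cauchy kernel as a geometric series in z_k/\<xi>, converging uniformly because
  |z_k/\<xi>| <= R/R1 < 1; m is chosen so that the tail q^m/(1 - q) is below \<epsilon>.\<close>

lemma approxable_geometric:
 fixes k :: "'n::finite"
 assumes R: "0 < R" "R < R1" and xi: "norm \<xi> = R1"
 shows "approxable (cpd R) (%z::complex^'n. 1 / (1 - z $ k / \<xi>))"
 unfolding approxable_def
proof (intro allI impI)
 fix \<epsilon> :: real assume e: "\<epsilon> > 0"
 define q where "q = R / R1"
 have q: "0 < q" "q < 1" using R by (auto simp: q_def)
 have "(%m. q ^ m) \<longlonglongrightarrow> 0" using q by (intro LIMSEQ_realpow_zero) auto
 then have "\<forall>\<^sub>F m in sequentially. q ^ m < \<epsilon> * (1 - q)" using e q by (intro order_tendstoD(2)) auto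
 then obtain m where m: "q ^ m < \<epsilon> * (1 - q)" by (meson eventually_happens trivial_limit_sequentially)
 have "polyfun (%z::complex^'n. \<Sum>l<m. ((1 / \<xi>) * z $ k) ^ l)"
  by (intro polyfun_sum polyfun_power polyfun_mult polyfun_const polyfun_nth)
 moreover have "norm ((\<Sum>l<m. ((1 / \<xi>) * z $ k) ^ l) - 1 / (1 - z $ k / \<xi>)) <= \<epsilon>" if z: "z \<in> cpd R" for z :: "complex^'n"
 proof -
  define u where "u = z $ k / \<xi>"
  have u: "norm u <= q" unfolding u_def q_def norm_divide xi using z R by (intro divide_right_mono) (auto simp: cpd_def)
  have u1: "norm (1 - u) \<ge> 1 - q" using norm_triangle_ineq2[of 1 u] u by simp
  then have nz: "1 - u ~= 0" using q by auto
  have "(\<Sum>l<m. u ^ l) * (1 - u) = 1 - u ^ m" using one_diff_power_eq[of u m] by (simp add: mult.commute)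
  then have "(\<Sum>l<m. u ^ l) = (1 - u ^ m) / (1 - u)" using nz by (simp add: eq_divide_eq)
  then have "(\<Sum>l<m. u ^ l) - 1 / (1 - u) = (1 - u ^ m - 1) / (1 - u)" by (simp only: diff_divide_distrib)
  then have "norm ((\<Sum>l<m. u ^ l) - 1 / (1 - u)) = norm u ^ m / norm (1 - u)" by (simp add: norm_divide norm_power)
  also have "... <= q ^ m / (1 - q)" using u u1 q by (intro frac_le power_mono) auto
  also have "... <= \<epsilon>" using m q by (simp add: field_simps)
  finally show ?thesis by (simp add: u_def)
 qed
 ultimately show "\<exists>p. polyfun p \<and> (\<forall>z\<in>cpd R. norm (p z - 1 / (1 - z $ k / \<xi>)) <= \<epsilon>)" by blast
qed

text \<open>Makes a Cauchy integral a finite sum of products of approximable functions, with an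
  error that depends only on the modulus of continuity and is therefore uniform in the remaining
  variables.\<close>

lemma riemann_sum_bound:
 fixes f :: "real => complex"
 assumes f: "continuous_on {0..1} f" and N: "N > 0"
  and d: "\<And>x y. x \<in> {0..1} ==> y \<in> {0..1} ==> \<bar>x - y\<bar> <= 1 / real N ==> norm (f x - f y) <= \<epsilon>"
 shows "norm (integral {0..1} f - (\<Sum>l<N. of_real (1 / real N) * f (real l / real N))) <= \<epsilon>"
proof -
 have sub: "{real l / real N..real (Suc l) / real N} \<subseteq> {0..1}" if "l < N" for l
 proof -
  have "real (Suc l) / real N <= 1" using that by (simp add: divide_le_eq_1)
  then show ?thesis by (intro atLeastatMost_subset_iff[THEN iffD2] disjI2 conjI) auto
 qed
 have comb: "integral {0..real n / real N} f = (\<Sum>l<n. integral {real l / real N..real (Suc l) / real N} f)" if "n <= N" for n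
  using that
 proof (induction n)
  case (Suc n)
  have "real (Suc n) / real N <= 1" using Suc.prems N by (simp add: divide_le_eq_1)
  then have "f integrable_on {0..real (Suc n) / real N}"
   by (intro integrable_continuous_real continuous_on_subset[OF f]) auto
  then have "integral {0..real n / real N} f + integral {real n / real N..real (Suc n) / real N} f = integral {0..real (Suc n) / real N} f"
   by (intro Henstock_Kurzweil_Integration.integral_combine) (auto intro!: divide_right_mono)
  then show ?case using Suc by simp
 qed simp
 have piece: "norm (integral {real l / real N..real (Suc l) / real N} f - of_real (1 / real N) * f (real l / real N)) <= \<epsilon> * (1 / real N)" if l: "l < N" for l
 proof -
  define a where "a = real l / real N"
  define b where "b = real (Suc l) / real N"
  have ba: "b - a = 1 / real N" by (simp add: a_def b_def diff_divide_distrib[symmetric])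
  have "1 / real N > 0" using N by simp
  then have ab: "a <= b" using ba by linarith
  have c: "continuous_on {a..b} f" using sub[OF l] unfolding a_def b_def by (rule continuous_on_subset[OF f])
  have "integral {a..b} (%x. f x - f a) = integral {a..b} f - integral {a..b} (%x. f a)"
   by (intro Henstock_Kurzweil_Integration.integral_diff integrable_continuous_real c continuous_intros)
  also have "integral {a..b} (%x. f a) = of_real (1 / real N) * f a" using ab ba by (simp add: scaleR_conv_of_real)
  finally have "integral {a..b} f - of_real (1 / real N) * f a = integral {a..b} (%x. f x - f a)" by simp
  moreover have "norm (integral {a..b} (%x. f x - f a)) <= \<epsilon> * (b - a)"
  proof (rule integral_bound[OF ab])
   show "continuous_on {a..b} (%x. f x - f a)" by (intro continuous_intros c)
   fix x assume x: "x \<in> {a..b}"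
   have "a \<in> {a..b}" using ab by simp
   then have "x \<in> {0..1}" "a \<in> {0..1}" using sub[OF l] x unfolding a_def b_def by blast+
   moreover have "\<bar>x - a\<bar> <= 1 / real N" using x ba by auto
   ultimately show "norm (f x - f a) <= \<epsilon>" by (rule d)
  qed
  ultimately show ?thesis unfolding ba by (simp add: a_def b_def)
 qed
 have "integral {0..1} f = (\<Sum>l<N. integral {real l / real N..real (Suc l) / real N} f)" using comb[of N] N by simp
 then have "integral {0..1} f - (\<Sum>l<N. of_real (1 / real N) * f (real l / real N))
   = (\<Sum>l<N. integral {real l / real N..real (Suc l) / real N} f - of_real (1 / real N) * f (real l / real N))"
  by (simp only: sum_subtractf)
 also have "norm ... <= (\<Sum>l<N. \<epsilon> * (1 / real N))" by (intro sum_norm_le piece) auto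
 also have "... = \<epsilon>" using N by simp
 finally show ?thesis .
qed

text \<open>Parametrising the circle by [0, 1] cancels 2 pi i, and the factor \<xi>/(\<xi> - t) is
  written as 1/(1 - t/\<xi>) to match the geometric kernel.\<close>

lemma cauchy_formula_unit_interval:
 assumes f: "f holomorphic_on cball 0 R1" and t: "norm t < R1"
 shows "integral {0..1} (%x::real. f (of_real R1 * exp (2 * of_real pi * \<i> * of_real x)) * (1 / (1 - t / (of_real R1 * exp (2 * of_real pi * \<i> * of_real x))))) = f t"
proof -
 define \<xi> where "\<xi> = (%x::real. complex_of_real R1 * exp (2 * of_real pi * \<i> * of_real x))"
 have R1: "R1 > 0" using t norm_ge_zero[of t] by linarith
 have nx: "norm (\<xi> x) = R1" for x using R1 by (simp add: \<xi>_def norm_mult norm_exp_eq_Re)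
 have "((%x. f (\<xi> x) / (\<xi> x - t) * (2 * of_real pi * \<i> * \<xi> x)) has_integral (2 * of_real pi * \<i> * f t)) {0..1::real}"
  using Cauchy_integral_circlepath_simple[OF f, of t] t
  unfolding has_contour_integral vector_derivative_circlepath unfolding circlepath \<xi>_def by (simp add: mult_ac)
 from has_integral_mult_right[OF this, of "inverse (2 * of_real pi * \<i>)"]
 have i: "((%x. inverse (2 * of_real pi * \<i>) * (f (\<xi> x) / (\<xi> x - t) * (2 * of_real pi * \<i> * \<xi> x))) has_integral inverse (2 * of_real pi * \<i>) * (2 * of_real pi * \<i> * f t)) {0..1}" .
 have "inverse (2 * of_real pi * \<i>) * (2 * of_real pi * \<i> * f t) = f t" by (simp add: field_simps)
 with i have "((%x. inverse (2 * of_real pi * \<i>) * (f (\<xi> x) / (\<xi> x - t) * (2 * of_real pi * \<i> * \<xi> x))) has_integral f t) {0..1}"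
  by (simp only:)
 moreover have "inverse (2 * of_real pi * \<i>) * (f (\<xi> x) / (\<xi> x - t) * (2 * of_real pi * \<i> * \<xi> x)) = f (\<xi> x) * (1 / (1 - t / \<xi> x))" for x
 proof -
  have "\<xi> x ~= 0" "\<xi> x - t ~= 0" using nx[of x] R1 t by auto
  then have eq: "1 / (1 - t / \<xi> x) = \<xi> x / (\<xi> x - t)" by (simp add: divide_simps)
  have gen: "inverse k * (a / b * (k * y)) = a * (y / b)" if "k ~= 0" for k a b y :: complex
  proof -
   have "inverse k * (a / b * (k * y)) = (inverse k * k) * (a / b * y)" by (simp only: mult_ac)
   then show ?thesis using that by simp
  qed
  show ?thesis unfolding eq by (rule gen) simp
 qed
 ultimately have "((%x. f (\<xi> x) * (1 / (1 - t / \<xi> x))) has_integral f t) {0..1}" by (simp only:)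
 then show ?thesis unfolding \<xi>_def by (rule integral_unique)
qed

text \<open>Variables are released one at a time, without power series in several variables. By
  Cauchy's formula in the coordinate k the function is an integral of a function with k frozen on a
  circle of radius R1, approximable by induction, times a geometric kernel.\<close>

lemma approxable_holomorphic:
 fixes h :: "complex^'n::finite => complex"
 assumes hc: "continuous_on (pdisk 0 R0) h"
  and hol: "\<And>z k. z \<in> pdisk 0 R0 ==> (%t. h (upd z k t)) holomorphic_on ball 0 R0"
  and R: "0 < R" "R < R1" "R1 < R0"
 shows "approxable (cpd R) h"
proof -
 \<comment> \<open>Coordinates in I are taken from z, the others from a. The induction is over I
   with a arbitrary in the closed polydisk of radius R1, since a itself moves along the circle of
   integration.\<close>
 define mix where "mix = (%I (z::complex^'n) a. (\<chi> i. if i \<in> I then z $ i else a $ i) :: complex^'n)"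
 have mixin: "mix I z a \<in> cpd R1" if "z \<in> cpd R" "a \<in> cpd R1" for I z a
  unfolding cpd_def
 proof (intro CollectI allI)
  fix i
  have "norm (z $ i) <= R" "norm (a $ i) <= R1" using that by (auto simp: cpd_def)
  then show "norm (mix I z a $ i) <= R1" using R by (simp add: mix_def)
 qed
 have "approxable (cpd R) (%z. h (mix I z a))" if "finite I" "a \<in> cpd R1" for I a
  using that
 proof (induction I arbitrary: a rule: finite_induct)
  case empty
  have "(%z. h (mix {} z a)) = (%_. h a)" by (simp add: mix_def vec_eq_iff)
  then show ?case by (simp add: approxable_polyfun polyfun_const)
 next
  case (insert k I)
  define \<xi> where "\<xi> = (%x::real. complex_of_real R1 * exp (2 * of_real pi * \<i> * of_real x))"
  have nx: "norm (\<xi> x) = R1" for x using R by (simp add: \<xi>_def norm_mult norm_exp_eq_Re)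
  define ax where "ax = (%x. upd a k (\<xi> x))"
  have ax: "ax x \<in> cpd R1" for x using insert.prems nx by (auto simp: ax_def cpd_def upd_nth)
  have mixm: "mix I z (ax x) \<in> pdisk 0 R0" if "z \<in> cpd R" for z x
   using mixin[OF that ax] cpd_subset_pdisk[OF R(3)] by blast
  define \<Psi> where "\<Psi> = (%z x. h (mix I z (ax x)) * (1 / (1 - z $ k / \<xi> x)))"
  have xc: "continuous_on S \<xi>" for S unfolding \<xi>_def by (intro continuous_intros)
  have zk: "norm (z $ k) < R1" if "z \<in> cpd R" for z :: "complex^'n"
   using that R by (auto simp: cpd_def intro: le_less_trans)
  have x0: "\<xi> x ~= 0" for x using nx[of x] R by auto
  have nz: "1 - z $ k / \<xi> x ~= 0" if "z \<in> cpd R" for z :: "complex^'n" and x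
  proof -
   have "z $ k ~= \<xi> x" using nx[of x] zk[OF that] by auto
   then show ?thesis using x0[of x] by simp
  qed
  have mixc: "continuous_on S (%p. mix I (fst p) (ax (snd p)))" for S
  proof -
   have xs: "continuous_on S (%p. \<xi> (snd p))" by (rule continuous_on_compose2[OF xc, of _ _ UNIV]) (auto intro!: continuous_intros)
   have "continuous_on S (%p. if i \<in> I then fst p $ i else ax (snd p) $ i)" for i
    using xs by (cases "i \<in> I"; cases "i = k") (auto simp: ax_def upd_nth intro!: continuous_intros)
   then show ?thesis unfolding mix_def by (intro continuous_on_vec_lambda)
  qed
  have Pc: "continuous_on (cpd R \<times> {0..1}) (%p. \<Psi> (fst p) (snd p))"
  proof -
   have 1: "continuous_on (cpd R \<times> {0..1}) (%p. h (mix I (fst p) (ax (snd p))))"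
    by (rule continuous_on_compose2[OF hc mixc]) (use mixm in auto)
   have 2: "continuous_on (cpd R \<times> {0..1}) (%p. \<xi> (snd p))"
    by (rule continuous_on_compose2[OF xc, of _ _ UNIV]) (auto intro!: continuous_intros)
   have 3: "continuous_on (cpd R \<times> {0..1}) (%p. fst p $ k / \<xi> (snd p))"
    using x0 by (intro continuous_on_divide 2 continuous_intros) auto
   show ?thesis unfolding \<Psi>_def
    by (intro continuous_on_mult 1 continuous_on_divide continuous_on_diff 3 continuous_on_const) (use nz in auto)
  qed
  have uc: "uniformly_continuous_on (cpd R \<times> {0..1}) (%p. \<Psi> (fst p) (snd p))"
   by (intro compact_uniformly_continuous Pc compact_Times compact_cpd compact_Icc)
  have formula: "integral {0..1} (\<Psi> z) = h (mix (insert k I) z a)" if z: "z \<in> cpd R" for z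
  proof -
   define f where "f = (%t. h (upd (mix I z a) k t))"
   have "mix I z a \<in> pdisk 0 R0" using mixin[OF z insert.prems] cpd_subset_pdisk[OF R(3)] by blast
   then have "f holomorphic_on ball 0 R0" unfolding f_def by (rule hol)
   then have fh: "f holomorphic_on cball 0 R1" by (rule holomorphic_on_subset) (use R in auto)
   from cauchy_formula_unit_interval[OF fh zk[OF z]]
   have "integral {0..1} (%x. f (\<xi> x) * (1 / (1 - z $ k / \<xi> x))) = f (z $ k)" by (simp add: \<xi>_def)
   moreover have "upd (mix I z a) k (\<xi> x) = mix I z (ax x)" for x using insert.hyps by (auto simp: mix_def ax_def vec_eq_iff upd_nth)
   moreover have "upd (mix I z a) k (z $ k) = mix (insert k I) z a" using insert.hyps by (auto simp: mix_def vec_eq_iff upd_nth)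
   ultimately show ?thesis by (simp add: f_def \<Psi>_def)
  qed
  show ?case
  proof (rule approxable_closed)
   fix \<epsilon> :: real assume e: "\<epsilon> > 0"
   obtain d where d: "d > 0" and dP: "\<And>p q. p \<in> cpd R \<times> {0..1} ==> q \<in> cpd R \<times> {0..1} ==> dist q p < d ==> dist (\<Psi> (fst q) (snd q)) (\<Psi> (fst p) (snd p)) < \<epsilon>"
    using uc e unfolding uniformly_continuous_on_def by metis
   obtain n where n: "inverse (real (Suc n)) < d" using reals_Archimedean[OF d] by blast
   define N where "N = Suc n"
   have N: "N > 0" "1 / real N < d" using n by (auto simp: N_def inverse_eq_divide)
   define v where "v = (%z. \<Sum>l<N. of_real (1 / real N) * \<Psi> z (real l / real N))"
   have "approxable (cpd R) (%z. \<Psi> z x)" for x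
    unfolding \<Psi>_def by (intro approxable_mult compact_cpd insert.IH ax approxable_geometric[OF R(1,2) nx])
   then have "approxable (cpd R) v"
    unfolding v_def by (intro approxable_sum approxable_mult compact_cpd approxable_polyfun[OF polyfun_const])
   moreover have "norm (v z - h (mix (insert k I) z a)) <= \<epsilon>" if z: "z \<in> cpd R" for z
   proof -
    have "norm (integral {0..1} (\<Psi> z) - (\<Sum>l<N. of_real (1 / real N) * \<Psi> z (real l / real N))) <= \<epsilon>"
    proof (rule riemann_sum_bound[OF _ N(1)])
     have "continuous_on {0..1} (%x. \<Psi> (fst (z, x)) (snd (z, x)))"
      by (rule continuous_on_compose2[OF Pc, of _ "%x. (z, x)"]) (use z in \<open>auto intro!: continuous_intros\<close>)
     then show "continuous_on {0..1} (\<Psi> z)" by simp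
     fix x y :: real assume xy: "x \<in> {0..1}" "y \<in> {0..1}" "\<bar>x - y\<bar> <= 1 / real N"
     have "dist (z, x) (z, y) < d" using xy N by (simp add: dist_Pair_Pair dist_real_def)
     from dP[OF _ _ this] z xy show "norm (\<Psi> z x - \<Psi> z y) <= \<epsilon>" by (simp add: dist_norm less_imp_le)
    qed
    then show ?thesis unfolding formula[OF z] v_def by (simp add: norm_minus_commute)
   qed
   ultimately show "\<exists>v. approxable (cpd R) v \<and> (\<forall>z\<in>cpd R. norm (v z - h (mix (insert k I) z a)) <= \<epsilon>)" by blast
  qed
 qed
 from this[of UNIV 0] have "approxable (cpd R) (%z. h (mix UNIV z 0))" using R by (simp add: cpd_def)
 moreover have "mix UNIV z 0 = z" for z by (simp add: mix_def vec_eq_iff)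
 ultimately show ?thesis by simp
qed

section \<open>Semicontinuity, slices of the given functions, truncated integrals\<close>

text \<open>The numbers x m may vanish, so they are raised to at least 1/(m + 1) before
  \<open>negpow_liminf\<close> is applied; this only decreases the negative power.\<close>

lemma negpow_lower_semicontinuous:
 assumes d: "\<delta> > 0" and x: "\<And>m. x m \<ge> 0" "x \<longlonglongrightarrow> s"
 shows "negpow \<delta> s <= liminf (%m. negpow \<delta> (x m))"
proof -
 have "s \<ge> 0" using x by (intro LIMSEQ_le_const) auto
 define y where "y = (%m. (max (x m) (1 / real (Suc m)))\<^sup>2)"
 have l0: "(%m. 1 / real (Suc m)) \<longlonglongrightarrow> 0" using LIMSEQ_inverse_real_of_nat by (simp add: inverse_eq_divide)
 have "(%m. max (x m) (1 / real (Suc m))) \<longlonglongrightarrow> max s 0" by (intro tendsto_max x l0)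
 from tendsto_power[OF this, of 2] have y: "y \<longlonglongrightarrow> s\<^sup>2" unfolding y_def using \<open>s \<ge> 0\<close> by simp
 have pos: "0 < max (x m) (1 / real (Suc m))" for m by (rule less_le_trans[of _ "1 / real (Suc m)"]) auto
 then have y0: "y m > 0" for m unfolding y_def using zero_less_power by blast
 have "negpow \<delta> s <= liminf (%m. ennreal (y m powr (- (\<delta> / 2))))"
  by (rule negpow_liminf[OF \<open>s \<ge> 0\<close> d y0 y])
 also have "... <= liminf (%m. negpow \<delta> (x m))"
 proof (intro Liminf_mono eventuallyI powr_le_negpow x d)
  fix m show "(x m)\<^sup>2 <= y m" unfolding y_def using x(1)[of m] by (intro power_mono) auto
 qed
 finally show ?thesis .
qed

lemma bounded_linear_axis: "bounded_linear (%v::complex. axis k v :: complex^'n::finite)"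
 unfolding linear_conv_bounded_linear[symmetric] by (rule linearI) (auto simp: vec_eq_iff axis_def)

text \<open>(\<open>axis k v\<close>, 0) is \<open>cmul v\<close> of (\<open>axis k 1\<close>, 0),
  so complex linearity of the total derivative gives a complex derivative along the coordinate
  k.\<close>

lemma holomorphic_several_slice:
 fixes F :: "(complex^'n::finite) \<times> complex => complex"
 assumes F: "holomorphic_several F (polydisk r \<times> ball 0 s)" and c: "c \<in> ball 0 s" and R: "\<And>i. R0 <= r i" and z: "z \<in> pdisk 0 R0"
 shows "(%t. F (upd z k t, c)) holomorphic_on ball 0 R0"
 unfolding holomorphic_on_def field_differentiable_def
proof
 fix t :: complex assume t: "t \<in> ball 0 R0"
 have "norm (upd z k t $ i) < r i" for i using z t R[of i] by (auto simp: pdisk_def upd_nth intro: less_le_trans)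
 then have "(upd z k t, c) \<in> polydisk r \<times> ball 0 s" using c by (simp add: polydisk_def)
 then obtain L where L: "(F has_derivative L) (at (upd z k t, c))" "\<And>a v. L (cmul a v) = a * L v"
  using F unfolding holomorphic_several_def by blast
 have "((%t. upd z k 0 + axis k t) has_derivative (%v. axis k v)) (at t)"
  by (auto intro!: derivative_eq_intros bounded_linear.has_derivative[OF bounded_linear_axis])
 moreover have "upd z k 0 + axis k t = upd z k t" for t by (auto simp: vec_eq_iff axis_def upd_nth)
 ultimately have "((%t. upd z k t) has_derivative (%v. axis k v)) (at t)" by simp
 then have u: "((%t. (upd z k t, c)) has_derivative (%v. (axis k v, 0))) (at t)"
  by (intro has_derivative_Pair has_derivative_const)
 have hd: "((%t. F (upd z k t, c)) has_derivative (%v. L (axis k v, 0))) (at t)"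
  by (rule has_derivative_compose[OF u L(1)])
 have lin: "L (axis k v, 0) = L (axis k 1, 0) * v" for v
 proof -
  have "(axis k v, 0) = cmul v (axis k 1, 0 :: complex)" by (auto simp: cmul_def vec_eq_iff axis_def)
  then show ?thesis using L(2)[of v "(axis k 1, 0)"] by (simp add: mult.commute)
 qed
 have eq: "(%v. L (axis k v, 0)) = (*) (L (axis k 1, 0))" by (rule ext) (rule lin)
 have "((%t. F (upd z k t, c)) has_field_derivative L (axis k 1, 0)) (at t)"
  using hd unfolding has_field_derivative_def eq .
 then show "\<exists>f'. ((%t. F (upd z k t, c)) has_field_derivative f') (at t within ball 0 R0)"
  by (intro exI) (rule has_field_derivative_at_within)
qed

lemma approximate_by_polyvec:
 fixes h :: "complex^'n::finite => complex^'j::finite"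
 assumes "\<And>j. approxable K (%z. h z $ j)" "\<epsilon> > 0"
 obtains p where "polyvec UNIV p" "\<And>z. z \<in> K ==> norm (p z - h z) <= \<epsilon>"
proof -
 define e where "e = \<epsilon> / real CARD('j)"
 have "e > 0" using assms(2) by (simp add: e_def)
 then have "\<forall>j. \<exists>p. polyfun p \<and> (\<forall>z\<in>K. norm (p z - h z $ j) <= e)" using assms(1) unfolding approxable_def by blast
 then obtain P where P: "\<And>j. polyfun (P j)" "\<And>j z. z \<in> K ==> norm (P j z - h z $ j) <= e" by metis
 define p where "p = (%z. \<chi> j. P j z)"
 have "polyvec UNIV p" unfolding polyvec_def p_def dep_on_def using P(1) by (auto simp: vec_eq_iff[symmetric])
 moreover have "norm (p z - h z) <= \<epsilon>" if "z \<in> K" for z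
 proof -
  have "norm (p z - h z) <= (\<Sum>j\<in>UNIV. norm ((p z - h z) $ j))" by (simp add: norm_vec_def L2_set_le_sum)
  also have "... <= (\<Sum>j\<in>(UNIV::'j set). e)" using P(2)[OF that] by (intro sum_mono) (simp add: p_def)
  also have "... = \<epsilon>" by (simp add: e_def)
  finally show ?thesis .
 qed
 ultimately show thesis by (rule that)
qed

text \<open>Truncation from below at \<eta> bounds the integrand by \<eta> powr (-\<delta>) on a set
  of finite measure, so separate continuity in c suffices for dominated convergence.\<close>

lemma truncated_integral_continuous:
 fixes g :: "complex^'n::finite => complex => complex^'j::finite"
 assumes m: "\<And>c. c \<in> S ==> continuous_on (pdisk 0 \<rho>) (%z. g z c)" and c: "\<And>z. z \<in> pdisk 0 \<rho> ==> continuous_on S (g z)"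
  and eta: "\<eta> > 0" and de: "\<delta> > 0" and rho: "\<rho> > 0"
 defines "f \<equiv> %c z. indicator (pdisk 0 \<rho>) z * (max (norm (g z c)) \<eta>) powr (- \<delta>)"
 shows "continuous_on S (%c. \<integral>z. f c z \<partial>lborel)" "\<And>c. c \<in> S ==> integrable lborel (f c)"
proof -
 have fm: "f c \<in> borel_measurable borel" if "c \<in> S" for c
 proof -
  have "(%z. if z \<in> pdisk 0 \<rho> then (max (norm (g z c)) \<eta>) powr (- \<delta>) else 0) \<in> borel_measurable borel"
   using eta by (intro borel_measurable_continuous_on_if continuous_intros m that) auto
  moreover have "f c = (%z. if z \<in> pdisk 0 \<rho> then (max (norm (g z c)) \<eta>) powr (- \<delta>) else 0)"
   by (auto simp: f_def fun_eq_iff)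
  ultimately show ?thesis by simp
 qed
 have fb: "norm (f c z) <= \<eta> powr (- \<delta>) * indicator (pdisk 0 \<rho>) z" for c z
  using eta de by (auto simp: f_def indicator_def intro!: powr_mono2')
 have bi: "integrable lborel (%z::complex^'n. \<eta> powr (- \<delta>) * indicator (pdisk 0 \<rho>) z)"
  using emeasure_pdisk(1)[OF rho, where 'n = 'n] by (intro integrable_mult_right integrable_real_indicator) auto
 show "integrable lborel (f c)" if "c \<in> S" for c
  by (rule Bochner_Integration.integrable_bound[OF bi]) (use fm[OF that] fb in \<open>auto intro: order_trans[OF _ abs_ge_self]\<close>)
 show "continuous_on S (%c. \<integral>z. f c z \<partial>lborel)"
  unfolding continuous_on_sequentially comp_def
 proof (intro allI ballI impI, elim conjE)
  fix x a assume a: "a \<in> S" and x: "\<forall>n. x n \<in> S" "x \<longlonglongrightarrow> a"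
  show "(%n. \<integral>z. f (x n) z \<partial>lborel) \<longlonglongrightarrow> (\<integral>z. f a z \<partial>lborel)"
  proof (rule integral_dominated_convergence[OF _ _ bi])
   show "AE z in lborel. (%n. f (x n) z) \<longlonglongrightarrow> f a z"
   proof (rule AE_I2)
    fix z
    show "(%n. f (x n) z) \<longlonglongrightarrow> f a z"
    proof (cases "z \<in> pdisk 0 \<rho>")
     case True
     have "(%n. g z (x n)) \<longlonglongrightarrow> g z a"
      using c[OF True] a x unfolding continuous_on_sequentially comp_def by blast
     then show ?thesis unfolding f_def using eta by (intro tendsto_intros) auto
    qed (simp add: f_def)
   qed
  qed (use fm a x fb in auto)
 qed
qed

text \<open>The truncation error lives where s < \<eta>, and there the surplus exponent turns it
  into a small multiple of the integrand with \<delta>'. After integration the error is uniform in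
  c.\<close>

lemma negpow_truncated_bounds:
 assumes s: "s \<ge> 0" and eta: "0 < \<eta>" and de: "0 < \<delta>" "\<delta> < \<delta>'"
 shows "ennreal ((max s \<eta>) powr (- \<delta>)) <= negpow \<delta> s"
  and "negpow \<delta> s <= ennreal ((max s \<eta>) powr (- \<delta>)) + ennreal (\<eta> powr (\<delta>' - \<delta>)) * negpow \<delta>' s"
proof -
 show "ennreal ((max s \<eta>) powr (- \<delta>)) <= negpow \<delta> s"
 proof (cases "s = 0")
  case False
  then have "(max s \<eta>) powr (- \<delta>) <= s powr (- \<delta>)" using s de by (intro powr_mono2') auto
  then show ?thesis using False by (simp add: negpow_def ennreal_leI)
 qed (simp add: negpow_def)
 show "negpow \<delta> s <= ennreal ((max s \<eta>) powr (- \<delta>)) + ennreal (\<eta> powr (\<delta>' - \<delta>)) * negpow \<delta>' s"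
 proof (cases "s < \<eta>")
  case True
  have "negpow \<delta> s <= ennreal (\<eta> powr (\<delta>' - \<delta>)) * negpow \<delta>' s"
  proof (cases "s = 0")
   case False
   have "s powr (- \<delta>) = s powr (\<delta>' - \<delta>) * s powr (- \<delta>')" by (simp add: powr_add[symmetric])
   also have "... <= \<eta> powr (\<delta>' - \<delta>) * s powr (- \<delta>')"
    using True s de by (intro mult_right_mono powr_mono2) auto
   finally have "ennreal (s powr (- \<delta>)) <= ennreal (\<eta> powr (\<delta>' - \<delta>) * s powr (- \<delta>'))" by (rule ennreal_leI)
   then show ?thesis using False by (simp add: negpow_def ennreal_mult)
  qed (use eta in \<open>simp add: negpow_def ennreal_mult_top\<close>)
  then show ?thesis by (rule add_increasing[OF zero_le])
 next
  case False
  then have "negpow \<delta> s = ennreal ((max s \<eta>) powr (- \<delta>))" using eta by (simp add: negpow_def max_def)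
  then show ?thesis by (simp add: add_increasing2)
 qed
qed

section \<open>Finiteness and continuity of the integral in the parameter\<close>

theorem mainTheorem1:
 fixes g :: "complex^'n::finite \<Rightarrow> complex \<Rightarrow> complex^'j::finite"
  and r :: "'n \<Rightarrow> real" and s :: real and \<delta> :: real
 assumes r_pos: "\<forall>i. r i > 0" and s_pos: "s > 0" and delta_pos: "\<delta> > 0"
  and holo: "\<forall>j. holomorphic_several (\<lambda>p. g (fst p) (snd p) $ j) (polydisk r \<times> ball 0 s)"
  and fin: "(\<integral>\<^sup>+ z \<in> polydisk r. negpow \<delta> (norm (g z 0)) \<partial>lborel) < \<infinity>"
 shows "\<exists>r' s'. (\<forall>i. 0 < r' i \<and> r' i \<le> r i) \<and> 0 < s' \<and> s' \<le> s \<and>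
      (\<forall>c\<in>ball 0 s'. (\<integral>\<^sup>+ z \<in> polydisk r'. negpow \<delta> (norm (g z c)) \<partial>lborel) < \<infinity>) \<and>
      continuous_on (ball 0 s')
       (\<lambda>c. enn2real (\<integral>\<^sup>+ z \<in> polydisk r'. negpow \<delta> (norm (g z c)) \<partial>lborel))"
proof -
 \<comment> \<open>The smallest radius: inside the given polydisk one with equal radii is used, for
   which \<open>pdisk\<close> and the stability theorem are formulated.\<close>
 define R0 where "R0 = Min (range r)"
 have R0: "R0 > 0" "\<And>i. R0 \<le> r i" unfolding R0_def using r_pos by auto
 \<comment> \<open>Half of R0 leaves room for the intermediate radius 3 R0 / 4 of the Cauchy circles
   in the approximation.\<close>
 define R where "R = R0 / 2"
 have R: "0 < R" "R < 3 * R0 / 4" "3 * R0 / 4 < R0" "R < R0" using R0 by (auto simp: R_def)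
 have sub: "pdisk 0 R0 \<subseteq> polydisk r"
  unfolding pdisk_def polydisk_def using R0(2) by (auto intro: less_le_trans)
 have "continuous_on (polydisk r \<times> ball 0 s) (\<lambda>p. g (fst p) (snd p) $ j)" for j
 proof (rule continuous_at_imp_continuous_on, rule ballI)
  fix p :: "(complex^'n) \<times> complex" assume "p \<in> polydisk r \<times> ball 0 s"
  then obtain L where "((\<lambda>p. g (fst p) (snd p) $ j) has_derivative L) (at p)"
   using holo unfolding holomorphic_several_def by blast
  then show "isCont (\<lambda>p. g (fst p) (snd p) $ j) p" by (rule has_derivative_continuous)
 qed
 then have "continuous_on (polydisk r \<times> ball 0 s) (\<lambda>p. \<chi> j. g (fst p) (snd p) $ j)" by (intro continuous_on_vec_lambda)
 then have "continuous_on (polydisk r \<times> ball 0 s) (\<lambda>p. g (fst p) (snd p))" by (simp add: vec_nth_inverse)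
 then have jc: "continuous_on (pdisk 0 R0 \<times> ball 0 s) (\<lambda>p. g (fst p) (snd p))" by (rule continuous_on_subset) (use sub in auto)
 have gc: "continuous_on (pdisk 0 R0) (\<lambda>z. g z c)" if "c \<in> ball 0 s" for c
 proof -
  have "continuous_on (pdisk 0 R0) (\<lambda>z. g (fst (z, c)) (snd (z, c)))"
   by (rule continuous_on_compose2[OF jc, of _ "\<lambda>z. (z, c)"]) (use that in \<open>auto intro!: continuous_intros\<close>)
  then show ?thesis by simp
 qed
 have gz: "continuous_on (ball 0 s) (g z)" if "z \<in> pdisk 0 R0" for z
 proof -
  have "continuous_on (ball 0 s) (\<lambda>c. g (fst (z, c)) (snd (z, c)))"
   by (rule continuous_on_compose2[OF jc, of _ "\<lambda>c. (z, c)"]) (use that in \<open>auto intro!: continuous_intros\<close>)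
  then show ?thesis by simp
 qed
 have cpdR: "cpd R \<subseteq> (pdisk 0 R0 :: (complex^'n) set)" by (rule cpd_subset_pdisk[OF R(4)])
 have appr: "approxable (cpd R) (\<lambda>z. g z c $ j)" if c: "c \<in> ball 0 s" for c j
 proof (rule approxable_holomorphic[OF _ _ R(1-3)])
  show "continuous_on (pdisk 0 R0) (\<lambda>z. g z c $ j)" by (intro continuous_intros gc c)
  show "(\<lambda>t. g (upd z k t) c $ j) holomorphic_on ball 0 R0" if "z \<in> pdisk 0 R0" for z k
   using holomorphic_several_slice[where k = k, OF holo[rule_format, of j] c R0(2) that] by simp
 qed
 have s0: "0 \<in> ball 0 s" using s_pos by simp
 \<comment> \<open>g (z, 0) is arbitrary outside the polydisk; extension by 0 makes it globally
   measurable, which is all the regularity that stability asks of its reference function.\<close>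
 define G where "G = (\<lambda>z. if z \<in> pdisk 0 R then g z 0 else 0)"
 have pR: "pdisk 0 R \<subseteq> (pdisk 0 R0 :: (complex^'n) set)" using pdisk_mono[of R R0] R by simp
 have Gm: "G \<in> borel_measurable borel"
  unfolding G_def by (intro borel_measurable_continuous_on_if sets_pdisk continuous_on_subset[OF gc[OF s0] pR] continuous_on_const)
 have "bounded ((\<lambda>z. g z 0) ` cpd R)"
  by (intro compact_imp_bounded compact_continuous_image continuous_on_subset[OF gc[OF s0] cpdR] compact_cpd)
 then obtain M where M: "\<And>z. z \<in> cpd R \<Longrightarrow> norm (g z 0) \<le> M" unfolding bounded_iff by blast
 have GM: "norm (G z) \<le> M" if "z \<in> pdisk 0 R" for z using that M pdisk_subset_cpd by (auto simp: G_def)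
 have Gfin: "(\<integral>\<^sup>+z. indicator (pdisk 0 R) z * negpow \<delta> (norm (G z)) \<partial>lborel) < \<infinity>"
 proof (rule le_less_trans[OF _ fin], rule nn_integral_mono)
  fix z show "indicator (pdisk 0 R) z * negpow \<delta> (norm (G z)) \<le> negpow \<delta> (norm (g z 0)) * indicator (polydisk r) z"
   using pR sub by (auto simp: G_def indicator_def)
 qed
 have "dep_on UNIV G" by (auto simp: dep_on_def vec_eq_iff[symmetric])
 then have "stable_on UNIV G R (R / 2) \<delta>"
  using Gm GM Gfin R delta_pos by (intro stable[where M = M]) auto
 then obtain \<epsilon> \<delta>' C where e: "\<epsilon> > 0" and d': "\<delta>' > \<delta>" and C: "C \<ge> 0"
  and st: "\<And>p. polyvec UNIV p \<Longrightarrow> \<forall>z\<in>pdisk 0 R. norm (p z - G z) \<le> \<epsilon> \<Longrightarrow>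
   (\<integral>\<^sup>+z. indicator (pdisk 0 (R / 2)) z * negpow \<delta>' (norm (p z)) \<partial>lborel) \<le> ennreal C"
  unfolding stable_on_def by blast
 have d'0: "\<delta>' > 0" using d' delta_pos by simp
 have "uniformly_continuous_on (cpd R \<times> cball 0 (s / 2)) (\<lambda>p. g (fst p) (snd p))"
  using cpdR s_pos by (intro compact_uniformly_continuous continuous_on_subset[OF jc] compact_Times compact_cpd compact_cball) auto
 then obtain d where d: "d > 0" and dg: "\<And>p q. p \<in> cpd R \<times> cball 0 (s / 2) \<Longrightarrow> q \<in> cpd R \<times> cball 0 (s / 2) \<Longrightarrow> dist q p < d
   \<Longrightarrow> dist (g (fst q) (snd q)) (g (fst p) (snd p)) < \<epsilon> / 2"
  using e unfolding uniformly_continuous_on_def by (meson half_gt_zero)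
 \<comment> \<open>Uniform continuity on a compact set puts g (z, c) within \<epsilon>/2 of g (z,
   0); the other half of \<epsilon> is reserved for polynomial approximation.\<close>
 define s' where "s' = min d (s / 2)"
 have s': "0 < s'" "s' \<le> s" "s' \<le> d" "s' \<le> s / 2" using d s_pos by (auto simp: s'_def)
 have inS: "c \<in> ball 0 s" if "c \<in> ball 0 s'" for c :: complex using that s' by auto
 have near: "norm (g z c - g z 0) \<le> \<epsilon> / 2" if c: "c \<in> ball 0 s'" and z: "z \<in> cpd R" for c z
 proof -
  have "dist (z, c) (z, 0) < d" using c s' by (simp add: dist_Pair_Pair)
  from dg[OF _ _ this] z c s' s_pos show ?thesis by (simp add: dist_norm less_imp_le)
 qed
 define rho where "rho = R / 2"
 have rho: "rho > 0" "rho \<le> R" "rho \<le> R0" using R by (auto simp: rho_def)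
 have prho: "pdisk 0 rho \<subseteq> (pdisk 0 R0 :: (complex^'n) set)" "pdisk 0 rho \<subseteq> (cpd R :: (complex^'n) set)"
  using pdisk_mono[OF rho(3)] pdisk_mono[OF rho(2)] pdisk_subset_cpd by blast+
 \<comment> \<open>Polynomials converging uniformly to g (z, c) on the closed polydisk all lie
   within \<epsilon> of G, so the stability bound holds for each of them; lower semicontinuity and
   Fatou pass it to g (z, c), with the same C for every c.\<close>
 have key: "(\<integral>\<^sup>+z. indicator (pdisk 0 rho) z * negpow \<delta>' (norm (g z c)) \<partial>lborel) \<le> ennreal C" if c: "c \<in> ball 0 s'" for c
 proof -
  have "\<exists>p. polyvec UNIV p \<and> (\<forall>z\<in>cpd R. norm (p z - g z c) \<le> min (\<epsilon> / 2) (1 / real (Suc m)))" for m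
  proof -
   have "min (\<epsilon> / 2) (1 / real (Suc m)) > 0" using e by simp
   then show ?thesis
   proof (rule approximate_by_polyvec[OF appr[OF inS[OF c]]])
    fix p assume "polyvec UNIV p" "\<And>z. z \<in> cpd R \<Longrightarrow> norm (p z - g z c) \<le> min (\<epsilon> / 2) (1 / real (Suc m))"
    then show ?thesis by (intro exI[of _ p]) blast
   qed
  qed
  then obtain p where p: "\<And>m. polyvec UNIV (p m)" and pc: "\<And>m z. z \<in> cpd R \<Longrightarrow> norm (p m z - g z c) \<le> min (\<epsilon> / 2) (1 / real (Suc m))" by metis
  have [measurable]: "p m \<in> borel_measurable borel" for m by (rule polyvec_meas[OF p])
  have bnd: "(\<integral>\<^sup>+z. indicator (pdisk 0 rho) z * negpow \<delta>' (norm (p m z)) \<partial>lborel) \<le> ennreal C" for m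
   unfolding rho_def
  proof (rule st[OF p], rule ballI)
   fix z :: "complex^'n" assume z: "z \<in> pdisk 0 R"
   then have zc: "z \<in> cpd R" using pdisk_subset_cpd by blast
   show "norm (p m z - G z) \<le> \<epsilon>"
    using norm_triangle_ineq[of "p m z - g z c" "g z c - g z 0"] near[OF c zc] pc[OF zc, of m] z by (simp add: G_def)
  qed
  have "(\<integral>\<^sup>+z. indicator (pdisk 0 rho) z * negpow \<delta>' (norm (g z c)) \<partial>lborel)
   \<le> (\<integral>\<^sup>+z. liminf (\<lambda>m. indicator (pdisk 0 rho) z * negpow \<delta>' (norm (p m z))) \<partial>lborel)"
  proof (rule nn_integral_mono)
   fix z
   show "indicator (pdisk 0 rho) z * negpow \<delta>' (norm (g z c)) \<le> liminf (\<lambda>m. indicator (pdisk 0 rho) z * negpow \<delta>' (norm (p m z)))"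
   proof (cases "z \<in> pdisk 0 rho")
    case True
    then have zc: "z \<in> cpd R" using prho by blast
    have "(\<lambda>m. p m z - g z c) \<longlonglongrightarrow> 0"
    proof (rule Lim_null_comparison)
     show "\<forall>\<^sub>F m in sequentially. norm (p m z - g z c) \<le> 1 / real (Suc m)"
      using pc[OF zc] by (intro eventuallyI) simp
     show "(\<lambda>m. 1 / real (Suc m)) \<longlonglongrightarrow> 0" using LIMSEQ_inverse_real_of_nat by (simp add: inverse_eq_divide)
    qed
    then have "(\<lambda>m. p m z) \<longlonglongrightarrow> g z c" by (rule LIM_zero_cancel)
    then have "(\<lambda>m. norm (p m z)) \<longlonglongrightarrow> norm (g z c)" by (rule tendsto_norm)
    from negpow_lower_semicontinuous[OF d'0 _ this] show ?thesis using True by simp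
   qed simp
  qed
  also have "\<dots> \<le> liminf (\<lambda>m. \<integral>\<^sup>+z. indicator (pdisk 0 rho) z * negpow \<delta>' (norm (p m z)) \<partial>lborel)"
   by (rule nn_integral_liminf) measurable
  also have "\<dots> \<le> liminf (\<lambda>m::nat. ennreal C)" by (intro Liminf_mono eventuallyI bnd)
  also have "\<dots> = ennreal C" by (simp add: Liminf_const)
  finally show ?thesis .
 qed
 define f where "f = (\<lambda>\<eta> c z. indicator (pdisk 0 rho) z * (max (norm (g z c)) \<eta>) powr (- \<delta>))"
 define J where "J = (\<lambda>c. \<integral>\<^sup>+z. indicator (pdisk 0 rho) z * negpow \<delta> (norm (g z c)) \<partial>lborel)"
 have gcr: "continuous_on (pdisk 0 rho) (\<lambda>z. g z c)" if "c \<in> ball 0 s'" for c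
  by (rule continuous_on_subset[OF gc[OF inS[OF that]] prho(1)])
 have gzr: "continuous_on (ball 0 s') (g z)" if "z \<in> pdisk 0 rho" for z
  by (rule continuous_on_subset[OF gz]) (use that prho s' in auto)
 have fcont: "continuous_on (ball 0 s') (\<lambda>c. \<integral>z. f \<eta> c z \<partial>lborel)" and fint: "\<And>c. c \<in> ball 0 s' \<Longrightarrow> integrable lborel (f \<eta> c)"
  if "\<eta> > 0" for \<eta>
  using truncated_integral_continuous[of "ball 0 s'" rho g \<eta> \<delta>, OF gcr gzr that delta_pos rho(1)] unfolding f_def by blast+
 have bounds: "ennreal (\<integral>z. f \<eta> c z \<partial>lborel) \<le> J c" "J c \<le> ennreal ((\<integral>z. f \<eta> c z \<partial>lborel) + \<eta> powr (\<delta>' - \<delta>) * C)"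
  if c: "c \<in> ball 0 s'" and eta: "\<eta> > 0" for c \<eta>
 proof -
  have f0: "f \<eta> c z \<ge> 0" for z by (simp add: f_def)
  have fe: "(\<integral>\<^sup>+z. ennreal (f \<eta> c z) \<partial>lborel) = ennreal (\<integral>z. f \<eta> c z \<partial>lborel)"
   by (rule nn_integral_eq_integral[OF fint[OF eta c]]) (simp add: f0)
  have fi: "ennreal (f \<eta> c z) = indicator (pdisk 0 rho) z * ennreal ((max (norm (g z c)) \<eta>) powr (- \<delta>))" for z
   by (simp add: f_def indicator_def)
  show "ennreal (\<integral>z. f \<eta> c z \<partial>lborel) \<le> J c"
   unfolding fe[symmetric] J_def fi by (intro nn_integral_mono mult_left_mono negpow_truncated_bounds(1)[OF _ eta delta_pos d']) auto
  have [measurable]: "f \<eta> c \<in> borel_measurable lborel" using fint[OF eta c] by simp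
  \<comment> \<open>A globally measurable version of g (z, c), so that the integral of the majorant
    may be split.\<close>
  define gi where "gi = (\<lambda>z. if z \<in> pdisk 0 rho then g z c else 0)"
  have [measurable]: "gi \<in> borel_measurable borel"
   unfolding gi_def by (intro borel_measurable_continuous_on_if sets_pdisk gcr[OF c] continuous_on_const)
  have gi: "indicator (pdisk 0 rho) z * negpow \<delta>' (norm (g z c)) = indicator (pdisk 0 rho) z * negpow \<delta>' (norm (gi z))" for z
   by (simp add: gi_def indicator_def)
  have "J c \<le> (\<integral>\<^sup>+z. ennreal (f \<eta> c z) + ennreal (\<eta> powr (\<delta>' - \<delta>)) * (indicator (pdisk 0 rho) z * negpow \<delta>' (norm (gi z))) \<partial>lborel)"
   unfolding J_def
  proof (rule nn_integral_mono)
   fix z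
   show "indicator (pdisk 0 rho) z * negpow \<delta> (norm (g z c)) \<le> ennreal (f \<eta> c z) + ennreal (\<eta> powr (\<delta>' - \<delta>)) * (indicator (pdisk 0 rho) z * negpow \<delta>' (norm (gi z)))"
    unfolding gi[symmetric] fi
    using negpow_truncated_bounds(2)[OF norm_ge_zero eta delta_pos d', of "g z c"] by (cases "z \<in> pdisk 0 rho") auto
  qed
  also have "\<dots> = (\<integral>\<^sup>+z. ennreal (f \<eta> c z) \<partial>lborel) + ennreal (\<eta> powr (\<delta>' - \<delta>)) * (\<integral>\<^sup>+z. indicator (pdisk 0 rho) z * negpow \<delta>' (norm (gi z)) \<partial>lborel)"
   by (subst nn_integral_add) (auto simp: nn_integral_cmult)
  also have "\<dots> \<le> ennreal (\<integral>z. f \<eta> c z \<partial>lborel) + ennreal (\<eta> powr (\<delta>' - \<delta>)) * ennreal C"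
   unfolding fe gi[symmetric] by (intro add_left_mono mult_left_mono key c) auto
  also have "\<dots> = ennreal ((\<integral>z. f \<eta> c z \<partial>lborel) + \<eta> powr (\<delta>' - \<delta>) * C)"
   using C f0 by (simp add: ennreal_mult ennreal_plus)
  finally show "J c \<le> ennreal ((\<integral>z. f \<eta> c z \<partial>lborel) + \<eta> powr (\<delta>' - \<delta>) * C)" .
 qed
 have Jfin: "J c < \<infinity>" if "c \<in> ball 0 s'" for c
  using bounds(2)[OF that zero_less_one] by (rule le_less_trans) simp
 have diff: "\<bar>(\<integral>z. f \<eta> c z \<partial>lborel) - enn2real (J c)\<bar> \<le> \<eta> powr (\<delta>' - \<delta>) * C" if c: "c \<in> ball 0 s'" and eta: "\<eta> > 0" for c \<eta>
 proof -
  obtain j where j: "j \<ge> 0" "J c = ennreal j" using Jfin[OF c] by (rule enn_finite_real)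
  have i0: "(\<integral>z. f \<eta> c z \<partial>lborel) \<ge> 0" by (simp add: f_def)
  have x0: "0 \<le> \<eta> powr (\<delta>' - \<delta>) * C" using C by simp
  have "(\<integral>z. f \<eta> c z \<partial>lborel) \<le> j" using bounds(1)[OF c eta] j by simp
  moreover have "j \<le> (\<integral>z. f \<eta> c z \<partial>lborel) + \<eta> powr (\<delta>' - \<delta>) * C"
   using bounds(2)[OF c eta] i0 x0 unfolding j(2) by (subst (asm) ennreal_le_iff) auto
  moreover have "enn2real (J c) = j" using j by simp
  ultimately show ?thesis using x0 by linarith
 qed
 \<comment> \<open>The error \<eta> powr (\<delta>' - \<delta>) C is independent of c, so the limit
   of the continuous truncated integrals is uniform.\<close>
 have "uniform_limit (ball 0 s') (\<lambda>m c. \<integral>z. f (1 / real (Suc m)) c z \<partial>lborel) (\<lambda>c. enn2real (J c)) sequentially"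
 proof (rule uniform_limitI)
  fix x :: real assume x: "x > 0"
  have l: "(\<lambda>m. 1 / real (Suc m)) \<longlonglongrightarrow> 0" using LIMSEQ_inverse_real_of_nat by (simp add: inverse_eq_divide)
  have "(\<lambda>m. (1 / real (Suc m)) powr (\<delta>' - \<delta>)) \<longlonglongrightarrow> 0"
   using tendsto_zero_powrI[OF l tendsto_const, of "\<delta>' - \<delta>"] d' by simp
  from tendsto_mult[OF this tendsto_const[of C]] have "(\<lambda>m. (1 / real (Suc m)) powr (\<delta>' - \<delta>) * C) \<longlonglongrightarrow> 0" by simp
  from order_tendstoD(2)[OF this x]
  show "\<forall>\<^sub>F m in sequentially. \<forall>c\<in>ball 0 s'. dist (\<integral>z. f (1 / real (Suc m)) c z \<partial>lborel) (enn2real (J c)) < x"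
  proof (rule eventually_mono, intro ballI)
   fix m :: nat and c :: complex assume m: "(1 / real (Suc m)) powr (\<delta>' - \<delta>) * C < x" and c: "c \<in> ball 0 s'"
   have "1 / real (Suc m) > 0" by simp
   from diff[OF c this] m show "dist (\<integral>z. f (1 / real (Suc m)) c z \<partial>lborel) (enn2real (J c)) < x"
    unfolding dist_real_def by (rule le_less_trans)
  qed
 qed
 then have Jc: "continuous_on (ball 0 s') (\<lambda>c. enn2real (J c))"
  by (rule uniform_limit_theorem[rotated]) (auto intro!: eventuallyI fcont)
 have JJ: "(\<integral>\<^sup>+ z \<in> polydisk (\<lambda>_. rho). negpow \<delta> (norm (g z c)) \<partial>lborel) = J c" for c
  unfolding J_def by (simp add: polydisk_def pdisk_def mult.commute)
 show ?thesis
  using rho(1) R0 rho(3) s' Jfin Jc by (intro exI[of _ "\<lambda>_. rho"] exI[of _ s']) (auto simp: JJ intro: order_trans)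
qed

end
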